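(* Let $G$ be a symmetry group of a holomorphic, eventually contracting iterated function scheme (IFS), let $V:\phi(D)\to\mathbb{C}$ be a bounded holomorphic $G$-invariant potential, and let $d_V(z)=\det(1-z\mathcal{L}_V)$ be the dynamical zeta function associated to the IFS and $V$. Then the dynamical zeta function admits a factorization $$d_V(z)=\prod_{\chi\in\hat G} d_V^\chi(z),$$ where the reduced zeta functions $d_V^\chi(z)$ can be expressed for sufficiently small $|z|$ by $$d_V^\chi(z)=\exp\left(-\sum_{n>0}\frac{z^n}{n}\frac{d_\chi}{|G|}\sum_{g\in G}\chi(g)\sum_{w\in\mathcal{W}_n^g}V_w(gu_{w,g})\sum_{k\ge 0}\left[(\phi_w\circ g)'(u_{w,g})\right]^k\right),$$ and they extend analytically to $\mathbb{C}$.
   Context: A holomorphic IFS consists of $N$ open disks $D_1,\dots,D_N\subset\mathbb{C}$ with pairwise disjoint closures, an adjacency matrix $A\in\{0,1\}^{N\times N}$ defining the relation $i\rightsquigarrow j$ iff $A_{i,j}=1$, and for each $i\rightsquigarrow j$ a biholomorphic map $\phi_{i,j}:D_i\to\phi_{i,j}(D_i)\Subset D_j$ (image relatively compact in $D_j$), such that $\phi_{i,j}(D_i)\cap\phi_{k,l}(D_k)\ne\emptyset$ iff $(i,j)=(k,l)$. Put $D=\bigcup_i D_i$ and $\phi(D)=\bigcup_{i\rightsquigarrow j}\phi_{i,j}(D_i)$. Words of length $n\ge1$: $\mathcal{W}_n=\{(w_0,\dots,w_n): w_i\rightsquigarrow w_{i+1},\ 0\le i\le n-1\}$. For $w\in\mathcal{W}_n$,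 $w_{0,k}=(w_0,\dots,w_k)$ and $\phi_w=\phi_{w_{n-1},w_n}\circ\cdots\circ\phi_{w_0,w_1}:D_{w_0}\to D_{w_n}$. The IFS is eventually contracting if there are $N_0\in\mathbb{N}$ and $\theta<1$ with $|\phi_w'(u)|\le\theta$ for all $n\ge N_0$, $w\in\mathcal{W}_n$, $u\in D_{w_0}$. A symmetry group of the IFS is a finite group $G$ acting on $D$ by holomorphic maps such that for each $g\in G$ and $i\rightsquigarrow j$ there is a pair $k\rightsquigarrow l$ with $g\phi_{i,j}(u)=\phi_{k,l}(gu)$ for $u\in D_i$. Each $g$ permutes the disks; one writes $gi:=j$ if $g(D_i)=D_j$, so $G$ acts on the symbols $\{1,\dots,N\}$. For $g\in G$ set $\mathcal{W}_n^g=\{w\in\mathcal{W}_n: gw_n=w_0\}$. For $w\in\mathcal{W}_n^g$, $u_{w,g}$ is the unique point with $u_{w,g}=\phi_w(gu_{w,g})$. $\mathcal{B}(D)$ is the Bergman space of holomorphic functions on $D$ lying in $L^2(D)$ (Lebesgue measure). For $V:\phi(D)\to\mathbb{C}$ bounded holomorphic, the transfer operator on $\mathcal{B}(D)$ is $(\mathcal{L}_Vf)(u)=\sum_{j:\,i\rightsquigarrow j}V(\phi_{i,j}(u))f(\phi_{i,j}(u))$ for $u\in D_i$; it is trace class, and $\det(1-z\mathcal{L}_V)$ is the Fredholm determinant. $V$ is $G$-invariant if $V(gu)=V(u)$ for all $g\in G$, $u\in\phi(D)$ (the set $\phi(D)$ is $G$-invariant). For $w\in\mathcal{W}_n$ and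 $u\in D_{w_0}$, $V_w(u)=\prod_{k=1}^nV(\phi_{w_{0,k}}(u))$. $\hat G$ is the set of equivalence classes of irreducible unitary representations of $G$, identified with their characters $\chi$; $d_\chi$ is the dimension. $G$ acts on $\mathcal{B}(D)$ by $(gf)(u)=f(g^{-1}u)$, $P_\chi=\frac{d_\chi}{|G|}\sum_{g\in G}\overline{\chi(g)}\,g$, $B^\chi=P_\chi\mathcal{B}(D)$. For $G$-invariant $V$, $\mathcal{L}_V$ preserves $B^\chi$; $\mathcal{L}_V^\chi:=\mathcal{L}_V|_{B^\chi}$ and $d_V^\chi(z):=\det_{B^\chi}(1-z\mathcal{L}_V^\chi)$. *)

theory Defs
  imports
    "HOL-Complex_Analysis.Complex_Analysis"
    "HOL-Combinatorics.Permutations"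
    "HOL-Algebra.Group_Action"
    "Jordan_Normal_Form.Schur_Decomposition"
begin

text \<open>Frees \<open>\<chi>\<close>, a binder in that syntax, for characters.\<close>

unbundle no vec_syntax

section \<open>Holomorphic iterated function schemes\<close>

text \<open>The symbols \<open>1, \<dots>, N\<close> are the elements of a finite type, and the 0-1 adjacency matrix is
  given by its relation.  Only the values of \<open>branch S i j\<close> on the disk \<open>i\<close> with \<open>adj S i j\<close> matter.\<close>

record 'i ifs =
  centre :: "'i \<Rightarrow> complex"
  radius :: "'i \<Rightarrow> real"
  adj :: "'i \<Rightarrow> 'i \<Rightarrow> bool"
  branch :: "'i \<Rightarrow> 'i \<Rightarrow> complex \<Rightarrow> complex"

definition disk :: "('i, 'b) ifs_scheme \<Rightarrow> 'i \<Rightarrow> complex set" where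
  "disk S i = ball (centre S i) (radius S i)"

definition region :: "('i, 'b) ifs_scheme \<Rightarrow> complex set" where
  "region S = (\<Union>i. disk S i)"

definition branch_image :: "('i, 'b) ifs_scheme \<Rightarrow> complex set" where
  "branch_image S = (\<Union>(i, j) \<in> {(i, j). adj S i j}. branch S i j ` disk S i)"

definition biholomorphic_on_image :: "(complex \<Rightarrow> complex) \<Rightarrow> complex set \<Rightarrow> bool" where
  "biholomorphic_on_image f A \<longleftrightarrow>
     f holomorphic_on A \<and> inj_on f A \<and> inv_into A f holomorphic_on f ` A"

definition holomorphic_ifs :: "('i :: finite, 'b) ifs_scheme \<Rightarrow> bool" where
  "holomorphic_ifs S \<longleftrightarrow>
     (\<forall>i. 0 < radius S i) \<and>
     (\<forall>i j. i \<noteq> j \<longrightarrow> closure (disk S i) \<inter> closure (disk S j) = {}) \<and>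
     (\<forall>i j. adj S i j \<longrightarrow>
        biholomorphic_on_image (branch S i j) (disk S i) \<and>
        compact (closure (branch S i j ` disk S i)) \<and>
        closure (branch S i j ` disk S i) \<subseteq> disk S j) \<and>
     (\<forall>i j k l. adj S i j \<longrightarrow> adj S k l \<longrightarrow>
        (branch S i j ` disk S i \<inter> branch S k l ` disk S k \<noteq> {} \<longleftrightarrow> (i, j) = (k, l)))"

text \<open>A word of length \<open>n\<close> is a list with \<open>n + 1\<close> entries.\<close>

definition words :: "('i, 'b) ifs_scheme \<Rightarrow> nat \<Rightarrow> 'i list set" where
  "words S n = {w. length w = Suc n \<and> (\<forall>k<n. adj S (w ! k) (w ! Suc k))}"

text \<open>The first branch of the word is applied first: \<open>\<phi>\<^bsub>w\<^esub> = \<phi>\<^bsub>w(n-1),w(n)\<^esub> \<circ> \<dots> \<circ> \<phi>\<^bsub>w(0),w(1)\<^esub>\<close>.\<close>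

fun word_map :: "('i, 'b) ifs_scheme \<Rightarrow> 'i list \<Rightarrow> complex \<Rightarrow> complex" where
  "word_map S (i # j # w) = word_map S (j # w) \<circ> branch S i j"
| "word_map S [i] = id"
| "word_map S [] = id"

definition eventually_contracting :: "('i, 'b) ifs_scheme \<Rightarrow> bool" where
  "eventually_contracting S \<longleftrightarrow>
     (\<exists>(N\<^sub>0::nat) (\<theta>::real). \<theta> < 1 \<and>
        (\<forall>n. 1 \<le> n \<longrightarrow> N\<^sub>0 \<le> n \<longrightarrow>
          (\<forall>w \<in> words S n. \<forall>u \<in> disk S (w ! 0). norm (deriv (word_map S w) u) \<le> \<theta>)))"

text \<open>\<open>V\<^bsub>w\<^esub>(u)\<close>, where \<open>take (Suc k) w\<close> is \<open>(w\<^sub>0, \<dots>, w\<^sub>k)\<close>.\<close>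

definition word_weight ::
  "('i, 'b) ifs_scheme \<Rightarrow> (complex \<Rightarrow> complex) \<Rightarrow> 'i list \<Rightarrow> complex \<Rightarrow> complex" where
  "word_weight S V w u = (\<Prod>k = 1..length w - 1. V (word_map S (take (Suc k) w) u))"


section \<open>Symmetry groups\<close>

text \<open>The equivariance identity evaluates \<open>branch S k l\<close> at \<open>act g u\<close>, which is only meaningful
  for \<open>act g u\<close> in the disk \<open>k\<close>; hence the explicit membership condition.\<close>

definition symmetry_group ::
  "('i, 'b) ifs_scheme \<Rightarrow> ('g, 'm) monoid_scheme \<Rightarrow> ('g \<Rightarrow> complex \<Rightarrow> complex) \<Rightarrow> bool" where
  "symmetry_group S G act \<longleftrightarrow>
     finite (carrier G) \<and>
     group_action G (region S) act \<and>
     (\<forall>g \<in> carrier G. act g holomorphic_on region S) \<and>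
     (\<forall>g \<in> carrier G. \<forall>i j. adj S i j \<longrightarrow>
        (\<exists>k l. adj S k l \<and>
          (\<forall>u \<in> disk S i. act g u \<in> disk S k \<and>
             act g (branch S i j u) = branch S k l (act g u))))"

definition invariant_potential ::
  "('i, 'b) ifs_scheme \<Rightarrow> ('g, 'm) monoid_scheme \<Rightarrow> ('g \<Rightarrow> complex \<Rightarrow> complex) \<Rightarrow>
     (complex \<Rightarrow> complex) \<Rightarrow> bool" where
  "invariant_potential S G act V \<longleftrightarrow>
     (\<forall>g \<in> carrier G. \<forall>u \<in> branch_image S. V (act g u) = V u)"

definition symbol_act ::
  "('i, 'b) ifs_scheme \<Rightarrow> ('g \<Rightarrow> complex \<Rightarrow> complex) \<Rightarrow> 'g \<Rightarrow> 'i \<Rightarrow> 'i" where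
  "symbol_act S act g i = (THE j. act g ` disk S i = disk S j)"

definition twisted_words ::
  "('i, 'b) ifs_scheme \<Rightarrow> ('g \<Rightarrow> complex \<Rightarrow> complex) \<Rightarrow> nat \<Rightarrow> 'g \<Rightarrow> 'i list set" where
  "twisted_words S act n g = {w \<in> words S n. symbol_act S act g (w ! n) = w ! 0}"

text \<open>\<open>word_map S w \<circ> act g\<close> maps the disk of the last symbol of \<open>w\<close> to itself, so this is where the
  fixed point \<open>u\<^bsub>w,g\<^esub>\<close> lives.\<close>

definition fixed_point ::
  "('i, 'b) ifs_scheme \<Rightarrow> ('g \<Rightarrow> complex \<Rightarrow> complex) \<Rightarrow> 'i list \<Rightarrow> 'g \<Rightarrow> complex" where
  "fixed_point S act w g = (THE u. u \<in> disk S (last w) \<and> u = word_map S w (act g u))"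


section \<open>Irreducible characters\<close>

definition unitary_rep ::
  "('g, 'm) monoid_scheme \<Rightarrow> nat \<Rightarrow> ('g \<Rightarrow> complex mat) \<Rightarrow> bool" where
  "unitary_rep G d \<rho> \<longleftrightarrow>
     (\<forall>g \<in> carrier G. \<rho> g \<in> carrier_mat d d \<and>
        \<rho> g * mat_adjoint (\<rho> g) = 1\<^sub>m d \<and> mat_adjoint (\<rho> g) * \<rho> g = 1\<^sub>m d) \<and>
     \<rho> \<one>\<^bsub>G\<^esub> = 1\<^sub>m d \<and>
     (\<forall>g \<in> carrier G. \<forall>h \<in> carrier G. \<rho> (g \<otimes>\<^bsub>G\<^esub> h) = \<rho> g * \<rho> h)"

definition irreducible_unitary_rep ::
  "('g, 'm) monoid_scheme \<Rightarrow> nat \<Rightarrow> ('g \<Rightarrow> complex mat) \<Rightarrow> bool" where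
  "irreducible_unitary_rep G d \<rho> \<longleftrightarrow>
     unitary_rep G d \<rho> \<and> 0 < d \<and>
     (\<forall>W. VectorSpace.subspace class_ring W (module_vec TYPE(complex) d) \<longrightarrow>
        (\<forall>g \<in> carrier G. \<forall>v \<in> W. \<rho> g *\<^sub>v v \<in> W) \<longrightarrow>
        W = {0\<^sub>v d} \<or> W = carrier_vec d)"

text \<open>Characters are restricted to the carrier so that equal characters are equal functions.\<close>

definition rep_character ::
  "('g, 'm) monoid_scheme \<Rightarrow> nat \<Rightarrow> ('g \<Rightarrow> complex mat) \<Rightarrow> 'g \<Rightarrow> complex" where
  "rep_character G d \<rho> = (\<lambda>g \<in> carrier G. \<Sum>i<d. \<rho> g $$ (i, i))"

definition irr_characters :: "('g, 'm) monoid_scheme \<Rightarrow> ('g \<Rightarrow> complex) set" where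
  "irr_characters G =
     {\<chi>. \<exists>d \<rho>. irreducible_unitary_rep G d \<rho> \<and> \<chi> = rep_character G d \<rho>}"

definition character_dim :: "('g, 'm) monoid_scheme \<Rightarrow> ('g \<Rightarrow> complex) \<Rightarrow> nat" where
  "character_dim G \<chi> =
     (THE d. \<exists>\<rho>. irreducible_unitary_rep G d \<rho> \<and> \<chi> = rep_character G d \<rho>)"


section \<open>Fredholm determinants\<close>

text \<open>\<open>H\<close> is the carrier of a Hilbert space with inner product \<open>ip\<close>, linear in its first argument.
  An orthonormal basis is a maximal orthonormal set, not necessarily infinite or even nonempty.\<close>

definition orthonormal_basis :: "('a \<Rightarrow> 'a \<Rightarrow> complex) \<Rightarrow> 'a set \<Rightarrow> 'a set \<Rightarrow> bool" where
  "orthonormal_basis ip H E \<longleftrightarrow>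
     E \<subseteq> H \<and>
     (\<forall>e \<in> E. \<forall>e' \<in> E. ip e e' = (if e = e' then 1 else 0)) \<and>
     (\<forall>f \<in> H. (\<forall>e \<in> E. ip f e = 0) \<longrightarrow> ip f f = 0)"

text \<open>The trace of the \<open>k\<close>-th exterior power \<open>\<Lambda>\<^sup>k A\<close> in the orthonormal basis
  \<open>e\<^sub>1 \<and> \<dots> \<and> e\<^sub>k\<close> indexed by the \<open>k\<close>-element subsets \<open>F = {e\<^sub>1, \<dots>, e\<^sub>k}\<close> of \<open>E\<close>: its diagonal
  entries are the determinants of the matrices of the \<open>\<langle>A e\<^sub>a, e\<^sub>b\<rangle>\<close>, written out by the Leibniz
  formula.  For trace class \<open>A\<close> the sum converges absolutely and does not depend on \<open>E\<close>.\<close>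

definition exterior_trace ::
  "('a \<Rightarrow> 'a \<Rightarrow> complex) \<Rightarrow> 'a set \<Rightarrow> ('a \<Rightarrow> 'a) \<Rightarrow> nat \<Rightarrow> complex" where
  "exterior_trace ip E A k =
     (\<Sum>\<^sub>\<infinity>F \<in> {F. F \<subseteq> E \<and> finite F \<and> card F = k}.
        \<Sum>p | p permutes F. of_int (sign p) * (\<Prod>e\<in>F. ip (A e) (p e)))"

text \<open>Grothendieck's definition \<open>det(1 - z A) = \<Sum>k. (-z)^k tr(\<Lambda>\<^sup>k A)\<close> for an operator of trace
  class on \<open>H\<close>.  Only the restriction of \<open>A\<close> to \<open>H\<close> enters.\<close>

definition fredholm_det ::
  "('a \<Rightarrow> 'a \<Rightarrow> complex) \<Rightarrow> 'a set \<Rightarrow> ('a \<Rightarrow> 'a) \<Rightarrow> complex \<Rightarrow> complex" where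
  "fredholm_det ip H A z =
     (let E = (SOME E. orthonormal_basis ip H E) in \<Sum>k. (- z) ^ k * exterior_trace ip E A k)"


section \<open>Bergman space and transfer operator\<close>

text \<open>Functions on \<open>D\<close> are represented by functions on the plane that vanish outside \<open>D\<close>.\<close>

definition bergman_space :: "complex set \<Rightarrow> (complex \<Rightarrow> complex) set" where
  "bergman_space D =
     {f. f holomorphic_on D \<and> set_integrable lborel D (\<lambda>u. (norm (f u))\<^sup>2) \<and> (\<forall>u. u \<notin> D \<longrightarrow> f u = 0)}"

definition bergman_inner ::
  "complex set \<Rightarrow> (complex \<Rightarrow> complex) \<Rightarrow> (complex \<Rightarrow> complex) \<Rightarrow> complex" where
  "bergman_inner D f h = set_lebesgue_integral lborel D (\<lambda>u. f u * cnj (h u))"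

text \<open>The disks being disjoint, at most one \<open>i\<close> contributes at a given \<open>u\<close>, and none outside the
  region.\<close>

definition transfer_op ::
  "('i :: finite, 'b) ifs_scheme \<Rightarrow> (complex \<Rightarrow> complex) \<Rightarrow>
     (complex \<Rightarrow> complex) \<Rightarrow> (complex \<Rightarrow> complex)" where
  "transfer_op S V f u =
     (\<Sum>(i, j) \<in> {(i, j). u \<in> disk S i \<and> adj S i j}. V (branch S i j u) * f (branch S i j u))"

definition function_act ::
  "('i, 'b) ifs_scheme \<Rightarrow> ('g, 'm) monoid_scheme \<Rightarrow> ('g \<Rightarrow> complex \<Rightarrow> complex) \<Rightarrow> 'g \<Rightarrow>
     (complex \<Rightarrow> complex) \<Rightarrow> (complex \<Rightarrow> complex)" where
  "function_act S G act g f u = (if u \<in> region S then f (act (inv\<^bsub>G\<^esub> g) u) else 0)"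

definition isotypic_projection ::
  "('i, 'b) ifs_scheme \<Rightarrow> ('g, 'm) monoid_scheme \<Rightarrow> ('g \<Rightarrow> complex \<Rightarrow> complex) \<Rightarrow>
     ('g \<Rightarrow> complex) \<Rightarrow> (complex \<Rightarrow> complex) \<Rightarrow> (complex \<Rightarrow> complex)" where
  "isotypic_projection S G act \<chi> f u =
     of_nat (character_dim G \<chi>) / of_nat (card (carrier G)) *
       (\<Sum>g\<in>carrier G. cnj (\<chi> g) * function_act S G act g f u)"

definition isotypic_bergman ::
  "('i, 'b) ifs_scheme \<Rightarrow> ('g, 'm) monoid_scheme \<Rightarrow> ('g \<Rightarrow> complex \<Rightarrow> complex) \<Rightarrow>
     ('g \<Rightarrow> complex) \<Rightarrow> (complex \<Rightarrow> complex) set" where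
  "isotypic_bergman S G act \<chi> = isotypic_projection S G act \<chi> ` bergman_space (region S)"

definition dynamical_zeta ::
  "('i :: finite, 'b) ifs_scheme \<Rightarrow> (complex \<Rightarrow> complex) \<Rightarrow> complex \<Rightarrow> complex" where
  "dynamical_zeta S V z =
     fredholm_det (bergman_inner (region S)) (bergman_space (region S)) (transfer_op S V) z"

text \<open>The subspace \<open>B\<^sup>\<chi>\<close> carries the inner product inherited from the Bergman space.\<close>

definition reduced_zeta ::
  "('i :: finite, 'b) ifs_scheme \<Rightarrow> ('g, 'm) monoid_scheme \<Rightarrow> ('g \<Rightarrow> complex \<Rightarrow> complex) \<Rightarrow>
     (complex \<Rightarrow> complex) \<Rightarrow> ('g \<Rightarrow> complex) \<Rightarrow> complex \<Rightarrow> complex" where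
  "reduced_zeta S G act V \<chi> z =
     fredholm_det (bergman_inner (region S)) (isotypic_bergman S G act \<chi>) (transfer_op S V) z"

end

theory Submission
  imports Defs "Jordan_Normal_Form.Spectral_Radius"
begin

text \<open>
  An operator \<open>f \<mapsto> \<Sum>n. l\<^sub>n(f) v\<^sub>n\<close> with sufficiently summable data has, by Cauchy--Binet, the same
  Fredholm determinant as the infinite matrix of the \<open>l\<^sub>a(v\<^sub>b)\<close>; this is an entire function and near
  0 the exponential of minus its trace series.  Taylor expansion around the centre of the target
  disk of each branch is such an expansion of the transfer operator, and averaging the \<open>v\<^sub>n\<close> over
  the group with the weights of \<open>P\<^sub>\<chi>\<close> is one for its restriction to \<open>B\<^sup>\<chi>\<close>.  The averaging is bounded
  on the Bergman space because, by the Schwarz lemma, a symmetry is a Moebius map on each disk.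

  The \<open>n\<close>-th trace is then a sum over group elements \<open>g\<close> and words \<open>w\<close> of length \<open>n\<close> of traces of
  weighted composition operators \<open>f \<mapsto> W \<cdot> (f \<circ> \<psi>)\<close> on a disk, where \<open>\<psi> = \<phi>\<^sub>w \<circ> g\<close> maps the disk into
  a smaller concentric one; such a trace is \<open>W(u) / (1 - \<psi>'(u))\<close> at the fixed point \<open>u\<close> of \<open>\<psi>\<close>.
  Since the irreducible characters \<open>\<chi>\<close> with multiplicities \<open>d\<^sub>\<chi>\<close> add up to the regular one, the
  traces for the \<open>P\<^sub>\<chi>\<close> add up to that of the whole space.  This gives the factorization near 0, and
  the identity theorem extends it to the plane.
\<close>

section \<open>Cauchy--Binet for infinite matrices\<close>

text \<open>The symmetries are Moebius maps on each disk and need not preserve area, so P_\<chi> may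
  be an oblique projection, and the B^\<chi> are not known to be orthogonal to each other. Bases of
  the components therefore cannot simply be joined to a basis of the whole space; the determinants
  are compared through traces, which are linear in the weights of the averaging. A second obstacle
  is that \<open>fredholm_det\<close> works in an unspecified orthonormal basis, in which nothing
  can be computed; Cauchy--Binet trades it for explicit Taylor data. Writing \<xi> and \<eta> for
  bounds on the functionals and vectors of such an expansion, geometric decay makes even the sum of
  sqrt(\<xi>\<eta>) finite, which is more than the exchange of sums needs and is what makes the
  determinant entire. The step from determinants to traces is taken for finite sections, where it is
  a statement about eigenvalues, and is carried over by dominated convergence.\<close>

definition subset_det :: "('a \<Rightarrow> 'a \<Rightarrow> complex) \<Rightarrow> 'a set \<Rightarrow> complex" where
  "subset_det K F = (\<Sum>p | p permutes F. of_int (sign p) * (\<Prod>e\<in>F. K e (p e)))"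

text \<open>Tuples range over a full product set, on which sums of products factor, whereas sums
  over k-element subsets do not. The price is a factor k! and the tuples with repetitions, which
  contribute zero.\<close>

definition tuple_det :: "('a \<Rightarrow> 'a \<Rightarrow> complex) \<Rightarrow> nat \<Rightarrow> (nat \<Rightarrow> 'a) \<Rightarrow> complex" where
  "tuple_det K k x = (\<Sum>p | p permutes {..<k}. of_int (sign p) * (\<Prod>i<k. K (x i) (x (p i))))"

definition ksubsets :: "'a set \<Rightarrow> nat \<Rightarrow> 'a set set" where
  "ksubsets E k = {F. F \<subseteq> E \<and> finite F \<and> card F = k}"

abbreviation tuples :: "'a set \<Rightarrow> nat \<Rightarrow> (nat \<Rightarrow> 'a) set" where
  "tuples E k \<equiv> PiE {..<k} (\<lambda>_. E)"

text \<open>Conjugation by \<open>x\<close> is a sign-preserving bijection between the permutations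
  of the positions and those of \<open>F\<close>.\<close>

lemma subset_det_eq_tuple_det:
  assumes x: "bij_betw x {..<k} F"
  shows "tuple_det K k x = subset_det K F"
proof -
  define y where "y = inv_into {..<k} x"
  have y: "bij_betw y F {..<k}" unfolding y_def by (rule bij_betw_inv_into[OF x])
  have inj: "inj_on x {..<k}" and img: "x ` {..<k} = F" using x by (auto simp: bij_betw_def)
  have injy: "inj_on y F" using y by (auto simp: bij_betw_def)
  have fin: "finite F" using img by auto
  have yx: "y (x i) = i" if "i < k" for i using inj that by (simp add: y_def)
  have xy: "x (y e) = e" if "e \<in> F" for e using that img by (auto simp: yx)
  show ?thesis unfolding tuple_det_def subset_det_def
  proof (rule sum.reindex_bij_witness[where i="map_permutation F y" and j="map_permutation {..<k} x"])
    fix p assume "p \<in> {p. p permutes {..<k}}"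
    hence p: "p permutes {..<k}" by simp
    show "map_permutation F y (map_permutation {..<k} x p) = p"
      by (rule map_permutation_compose_inv[OF x p]) (simp add: yx)
    show "map_permutation {..<k} x p \<in> {p. p permutes F}"
      using map_permutation_permutes[OF x p] by simp
    have "(\<Prod>e\<in>F. K e (map_permutation {..<k} x p e)) = (\<Prod>i<k. K (x i) (map_permutation {..<k} x p (x i)))"
      by (rule prod.reindex_bij_betw[OF x, symmetric])
    also have "\<dots> = (\<Prod>i<k. K (x i) (x (p i)))"
      by (intro prod.cong refl) (use inj p in \<open>simp add: map_permutation_apply\<close>)
    finally show "complex_of_int (sign (map_permutation {..<k} x p)) *
         (\<Prod>e\<in>F. K e (map_permutation {..<k} x p e)) =
         complex_of_int (sign p) * (\<Prod>i<k. K (x i) (x (p i)))"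
      by (simp add: sign_map_permutation[OF inj p])
  next
    fix p assume "p \<in> {p. p permutes F}"
    hence p: "p permutes F" by simp
    show "map_permutation {..<k} x (map_permutation F y p) = p"
      by (rule map_permutation_compose_inv[OF y p]) (simp add: xy)
    show "map_permutation F y p \<in> {p. p permutes {..<k}}"
      using map_permutation_permutes[OF y p] by simp
  qed
qed

text \<open>A repeated entry of the tuple gives a matrix with two equal rows.\<close>

lemma tuple_det_not_inj:
  assumes "\<not> inj_on x {..<k}"
  shows "tuple_det K k x = 0"
proof -
  obtain i j where ij: "i < k" "j < k" "i \<noteq> j" "x i = x j"
    using assms by (auto simp: inj_on_def)
  let ?A = "mat k k (\<lambda>(a, b). K (x a) (x b))"
  have "Determinant.det ?A = 0"
  proof (rule det_identical_rows[of _ k i j])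
    show "?A \<in> carrier_mat k k" by simp
    show "row ?A i = row ?A j" using ij by (auto intro!: eq_vecI)
  qed (use ij in auto)
  moreover have "Determinant.det ?A = tuple_det K k x"
    unfolding tuple_det_def by (subst det_def'[of _ k])
      (auto simp: lessThan_atLeast0 permutes_in_image intro!: sum.cong prod.cong)
  ultimately show ?thesis by simp
qed

lemma card_bijective_tuples:
  assumes "finite F" "card F = k"
  shows "card {x \<in> tuples F k. inj_on x {..<k}} = fact k"
  using card_inj_on_subset_funcset[of "{..<k}" F "{..<k}"] assms
  by (simp add: fact_prod_rev)

lemma injective_tuple_image:
  assumes "x \<in> tuples E k" "inj_on x {..<k}"
  shows "x ` {..<k} \<in> ksubsets E k"
  using assms by (auto simp: ksubsets_def card_image PiE_def)

lemma injective_tuples_Sigma: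
  "{x \<in> tuples E k. inj_on x {..<k}} =
     snd ` (SIGMA F:ksubsets E k. {x \<in> tuples F k. inj_on x {..<k}})" (is "?L = ?R")
proof
  show "?L \<subseteq> ?R"
  proof
    fix x assume x: "x \<in> ?L"
    have "(x ` {..<k}, x) \<in> (SIGMA F:ksubsets E k. {x \<in> tuples F k. inj_on x {..<k}})"
    proof (rule SigmaI)
      show "x ` {..<k} \<in> ksubsets E k" using x by (intro injective_tuple_image) auto
      have "x \<in> tuples (x ` {..<k}) k" using x by (simp add: PiE_iff)
      thus "x \<in> {y \<in> tuples (x ` {..<k}) k. inj_on y {..<k}}" using x by simp
    qed
    thus "x \<in> ?R" by (rule image_eqI[rotated]) (rule snd_conv[symmetric])
  qed
  show "?R \<subseteq> ?L"
  proof
    fix x assume "x \<in> ?R"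
    then obtain q where q: "q \<in> (SIGMA F:ksubsets E k. {x \<in> tuples F k. inj_on x {..<k}})" "x = snd q"
      by (rule imageE)
    define F where "F = fst q"
    have "F \<in> ksubsets E k" "x \<in> tuples F k" "inj_on x {..<k}"
      using q unfolding F_def by (cases q; simp)+
    moreover from this have "F \<subseteq> E" by (simp add: ksubsets_def)
    ultimately have "x \<in> tuples E k" "inj_on x {..<k}"
      by (simp_all add: PiE_iff subset_iff)
    thus "x \<in> ?L" by simp
  qed
qed

lemma injective_tuple_surj:
  assumes "x \<in> tuples F k" "inj_on x {..<k}" "finite F" "card F = k"
  shows "bij_betw x {..<k} F"
proof -
  have "x ` {..<k} \<subseteq> F" using assms by (auto simp: PiE_def Pi_def)
  moreover have "card (x ` {..<k}) = card F" using assms by (simp add: card_image)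
  ultimately show ?thesis using assms card_subset_eq[of F "x ` {..<k}"] by (simp add: bij_betw_def)
qed

text \<open>The injective tuples are fibred over their images. The fibre over a k-element set
  consists of its k! enumerations, and \<open>f\<close> is constant on it, so Fubini for the
  dependent sum produces the factor.\<close>

lemma infsum_tuples_subsets:
  fixes f :: "(nat \<Rightarrow> 'a) \<Rightarrow> complex" and h :: "'a set \<Rightarrow> complex"
  assumes f: "\<And>x. x \<in> tuples E k \<Longrightarrow> inj_on x {..<k} \<Longrightarrow> f x = h (x ` {..<k})"
    and f0: "\<And>x. x \<in> tuples E k \<Longrightarrow> \<not> inj_on x {..<k} \<Longrightarrow> f x = 0"
    and sf: "f summable_on tuples E k"
  shows "h summable_on ksubsets E k"
    and "infsum f (tuples E k) = fact k * infsum h (ksubsets E k)"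
proof -
  let ?J = "\<lambda>F. {x \<in> tuples F k. inj_on x {..<k}}"
  let ?S = "SIGMA F:ksubsets E k. ?J F"
  have inj: "inj_on snd ?S"
  proof (rule inj_onI, clarsimp)
    fix F F' x assume a: "F \<in> ksubsets E k" "F' \<in> ksubsets E k" "x \<in> tuples F k" "x \<in> tuples F' k" "inj_on x {..<k}"
    have "bij_betw x {..<k} F" "bij_betw x {..<k} F'"
      using a by (auto intro!: injective_tuple_surj simp: ksubsets_def)
    thus "F = F'" by (simp add: bij_betw_def)
  qed
  have sJ: "f summable_on ?J E"
    by (rule summable_on_subset_banach[OF sf]) auto
  have sS: "(f \<circ> snd) summable_on ?S"
    using sJ unfolding injective_tuples_Sigma[of k E] by (subst (asm) summable_on_reindex[OF inj])
  have eq: "(f \<circ> snd) (F, x) = h F" if "F \<in> ksubsets E k" "x \<in> ?J F" for F x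
  proof -
    have "bij_betw x {..<k} F" using that by (auto intro!: injective_tuple_surj simp: ksubsets_def)
    hence "x ` {..<k} = F" by (simp add: bij_betw_def)
    moreover have "x \<in> tuples E k"
      using that PiE_mono[of "{..<k}" "\<lambda>_. F" "\<lambda>_. E"] by (auto simp: ksubsets_def)
    ultimately show ?thesis using that f[of x] by simp
  qed
  have sS': "(\<lambda>(F, x). h F) summable_on ?S"
    using sS by (subst summable_on_cong[where g="f \<circ> snd"]) (use eq in auto)
  have card: "infsum (\<lambda>x. h F) (?J F) = fact k * h F" if "F \<in> ksubsets E k" for F
    using that card_bijective_tuples[of F k]
    by (subst infsum_finite) (auto simp: ksubsets_def finite_PiE)
  have "(\<lambda>F. fact k * h F) summable_on ksubsets E k"
    using summable_on_Sigma_banach[OF sS'] by (subst summable_on_cong[OF card[symmetric]])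
  thus "h summable_on ksubsets E k"
    by (subst (asm) summable_on_cmult_right') auto
  have "infsum f (tuples E k) = infsum f (?J E)"
    by (rule infsum_cong_neutral) (use f0 in auto)
  also have "\<dots> = infsum (f \<circ> snd) ?S"
    unfolding injective_tuples_Sigma[of k E] by (rule infsum_reindex[OF inj])
  also have "\<dots> = infsum (\<lambda>(F, x). h F) ?S"
    by (rule infsum_cong) (use eq in auto)
  also have "\<dots> = infsum (\<lambda>F. infsum (\<lambda>x. h F) (?J F)) (ksubsets E k)"
    using infsum_Sigma_banach[OF sS'] by simp
  also have "\<dots> = infsum (\<lambda>F. fact k * h F) (ksubsets E k)"
    by (rule infsum_cong[OF card])
  also have "\<dots> = fact k * infsum h (ksubsets E k)"
    by (rule infsum_cmult_right') 
  finally show "infsum f (tuples E k) = fact k * infsum h (ksubsets E k)" .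
qed

lemma tuple_det_subset_det:
  fixes K :: "'a \<Rightarrow> 'a \<Rightarrow> complex"
  assumes "tuple_det K k summable_on tuples E k"
  shows "subset_det K summable_on ksubsets E k"
    and "infsum (tuple_det K k) (tuples E k) = fact k * infsum (subset_det K) (ksubsets E k)"
proof -
  have eq: "tuple_det K k x = subset_det K (x ` {..<k})" if "inj_on x {..<k}" for x :: "nat \<Rightarrow> 'a"
    by (rule subset_det_eq_tuple_det) (use that in \<open>auto simp: bij_betw_def\<close>)
  show "subset_det K summable_on ksubsets E k"
    and "infsum (tuple_det K k) (tuples E k) = fact k * infsum (subset_det K) (ksubsets E k)"
    using infsum_tuples_subsets[of k E "tuple_det K k" "subset_det K", OF eq tuple_det_not_inj assms] by auto
qed

text \<open>For complex families summability is absolute summability, so the induction over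
  \<open>A\<close> may pass to norms and use Fubini on the product of one factor with the remaining
  ones.\<close>

lemma abs_summable_prod_PiE:
  fixes f :: "'a \<Rightarrow> 'b \<Rightarrow> complex"
  assumes fin: "finite A" and s: "\<And>x. x \<in> A \<Longrightarrow> f x summable_on B x"
  shows "(\<lambda>g. \<Prod>x\<in>A. f x (g x)) summable_on PiE A B"
  using assms
proof (induction A rule: finite_induct)
  case empty show ?case by simp
next
  case (insert x A)
  have pi: "PiE (insert x A) B = (\<lambda>(y, g). g(x := y)) ` (B x \<times> PiE A B)"
    by (simp add: PiE_insert_eq)
  have inj: "inj_on (\<lambda>(y, g). g(x := y)) (B x \<times> PiE A B)"
    using insert.hyps(2) by (rule inj_combinator)
  have IH: "(\<lambda>g. \<Prod>x\<in>A. f x (g x)) summable_on PiE A B" using insert by auto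
  have fx: "f x summable_on B x" using insert by auto
  have nfx: "(\<lambda>y. norm (f x y)) summable_on B x"
    using fx unfolding summable_on_iff_abs_summable_on_complex .
  have nIH: "(\<lambda>g. norm (\<Prod>x\<in>A. f x (g x))) summable_on PiE A B"
    using IH unfolding summable_on_iff_abs_summable_on_complex .
  have "(\<lambda>z. norm (case z of (y, g) \<Rightarrow> f x y * (\<Prod>x\<in>A. f x (g x)))) summable_on (B x \<times> PiE A B)"
  proof (subst Infinite_Sum.abs_summable_on_Sigma_iff, intro conjI ballI)
    fix y assume "y \<in> B x"
    show "(\<lambda>g. norm (case (y, g) of (y, g) \<Rightarrow> f x y * (\<Prod>x\<in>A. f x (g x)))) summable_on PiE A B"
      using nIH unfolding prod.case norm_mult by (rule summable_on_cmult_right)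
  next
    have "(\<lambda>y. norm (f x y) * (\<Sum>\<^sub>\<infinity>g\<in>PiE A B. norm (\<Prod>x\<in>A. f x (g x)))) summable_on B x"
      using nfx by (rule summable_on_cmult_left)
    thus "(\<lambda>y. norm (\<Sum>\<^sub>\<infinity>g\<in>PiE A B. norm (case (y, g) of (y, g) \<Rightarrow> f x y * (\<Prod>x\<in>A. f x (g x))))) summable_on B x"
      unfolding summable_on_iff_abs_summable_on_real[symmetric]
      by (simp add: norm_mult infsum_cmult_right')
  qed
  hence ab: "(\<lambda>(y, g). f x y * (\<Prod>x\<in>A. f x (g x))) summable_on (B x \<times> PiE A B)"
    unfolding summable_on_iff_abs_summable_on_complex .
  have eq: "(\<Prod>z\<in>insert x A. f z ((g(x := y)) z)) = f x y * (\<Prod>z\<in>A. f z (g z))" for y g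
  proof -
    have "(\<Prod>z\<in>A. f z ((g(x := y)) z)) = (\<Prod>z\<in>A. f z (g z))"
      by (rule prod.cong) (use insert.hyps in auto)
    thus ?thesis using insert.hyps by simp
  qed
  show ?case unfolding pi summable_on_reindex[OF inj]
    using ab eq by (simp add: o_def case_prod_unfold del: fun_upd_apply)
qed

lemma summable_on_finite_sum:
  fixes f :: "'a \<Rightarrow> 'b \<Rightarrow> complex"
  assumes "finite A" "\<And>x. x \<in> A \<Longrightarrow> f x summable_on B"
  shows "(\<lambda>y. \<Sum>x\<in>A. f x y) summable_on B"
  using assms by (induction A rule: finite_induct) (auto intro: summable_on_add)

lemma infsum_finite_sum:
  fixes f :: "'a \<Rightarrow> 'b \<Rightarrow> complex"
  assumes "finite A" "\<And>x. x \<in> A \<Longrightarrow> f x summable_on B"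
  shows "infsum (\<lambda>y. \<Sum>x\<in>A. f x y) B = (\<Sum>x\<in>A. infsum (f x) B)"
  using assms
  by (induction A rule: finite_induct) (auto simp: infsum_add summable_on_finite_sum)

lemma sum_norm_mult_le:
  fixes u v :: "'a \<Rightarrow> complex"
  assumes "(\<Sum>e\<in>F. (norm (u e))\<^sup>2) \<le> a\<^sup>2" "(\<Sum>e\<in>F. (norm (v e))\<^sup>2) \<le> b\<^sup>2" "0 \<le> a" "0 \<le> b"
  shows "(\<Sum>e\<in>F. norm (u e * v e)) \<le> a * b"
proof -
  have "(\<Sum>e\<in>F. norm (u e * v e)) = (\<Sum>e\<in>F. \<bar>norm (u e)\<bar> * \<bar>norm (v e)\<bar>)" by (simp add: norm_mult)
  also have "\<dots> \<le> L2_set (\<lambda>e. norm (u e)) F * L2_set (\<lambda>e. norm (v e)) F"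
    by (rule L2_set_mult_ineq)
  also have "\<dots> \<le> a * b"
    unfolding L2_set_def using assms by (intro mult_mono real_le_lsqrt) (auto intro: sum_nonneg)
  finally show ?thesis .
qed

lemma summable_on_mult_square_bounded:
  fixes u v :: "'a \<Rightarrow> complex"
  assumes "\<And>F. finite F \<Longrightarrow> F \<subseteq> E \<Longrightarrow> (\<Sum>e\<in>F. (norm (u e))\<^sup>2) \<le> a\<^sup>2"
    and "\<And>F. finite F \<Longrightarrow> F \<subseteq> E \<Longrightarrow> (\<Sum>e\<in>F. (norm (v e))\<^sup>2) \<le> b\<^sup>2" "0 \<le> a" "0 \<le> b"
  shows "(\<lambda>e. u e * v e) summable_on E" and "(\<Sum>\<^sub>\<infinity>e\<in>E. norm (u e * v e)) \<le> a * b"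
proof -
  have b: "(\<Sum>e\<in>F. norm (u e * v e)) \<le> a * b" if "finite F" "F \<subseteq> E" for F
    using that assms by (intro sum_norm_mult_le) auto
  have "(\<lambda>e. norm (u e * v e)) summable_on E"
    by (rule nonneg_bdd_above_summable_on) (use b in \<open>auto intro!: bdd_aboveI2\<close>)
  thus "(\<lambda>e. u e * v e) summable_on E" "(\<Sum>\<^sub>\<infinity>e\<in>E. norm (u e * v e)) \<le> a * b"
    using b by (auto simp: summable_on_iff_abs_summable_on_complex intro: infsum_le_finite_sums)
qed

text \<open>For a fixed tuple \<open>a\<close> the sum over \<open>x\<close> factors into k sums,
  each bounded by \<xi> times \<eta> through Cauchy--Schwarz. The permutation disappears from the
  product of the \<eta> factors, and what remains is a product of terms \<xi>\<eta>, summable over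
  all \<open>a\<close>.\<close>

lemma cauchy_binet_summable:
  fixes X :: "'a \<Rightarrow> 'b \<Rightarrow> complex" and Y :: "'b \<Rightarrow> 'a \<Rightarrow> complex"
  assumes X: "\<And>\<alpha> F. \<alpha> \<in> I \<Longrightarrow> finite F \<Longrightarrow> F \<subseteq> E \<Longrightarrow> (\<Sum>e\<in>F. (norm (X e \<alpha>))\<^sup>2) \<le> (\<xi> \<alpha>)\<^sup>2"
    and Y: "\<And>\<alpha> F. \<alpha> \<in> I \<Longrightarrow> finite F \<Longrightarrow> F \<subseteq> E \<Longrightarrow> (\<Sum>e\<in>F. (norm (Y \<alpha> e))\<^sup>2) \<le> (\<eta> \<alpha>)\<^sup>2"
    and nn: "\<And>\<alpha>. \<alpha> \<in> I \<Longrightarrow> 0 \<le> \<xi> \<alpha>" "\<And>\<alpha>. \<alpha> \<in> I \<Longrightarrow> 0 \<le> \<eta> \<alpha>"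
    and s: "(\<lambda>\<alpha>. \<xi> \<alpha> * \<eta> \<alpha>) summable_on I"
    and p: "p permutes {..<k}"
  shows "(\<lambda>(a, x). \<Prod>i<k. X (x i) (a i) * Y (a (p i)) (x i)) summable_on (tuples I k \<times> tuples E k)"
proof -
  let ?T = "\<lambda>a x. \<Prod>i<k. X (x i) (a i) * Y (a (p i)) (x i)"
  have aI: "a i \<in> I" "a (p i) \<in> I" if "a \<in> tuples I k" "i < k" for a i
    using that permutes_in_image[OF p, of i] by auto
  have one: "(\<lambda>e. X e (a i) * Y (a (p i)) e) summable_on E"
      "(\<Sum>\<^sub>\<infinity>e\<in>E. norm (X e (a i) * Y (a (p i)) e)) \<le> \<xi> (a i) * \<eta> (a (p i))"
    if "a \<in> tuples I k" "i < k" for a i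
    using summable_on_mult_square_bounded[of E "\<lambda>e. X e (a i)" "\<xi> (a i)" "\<lambda>e. Y (a (p i)) e" "\<eta> (a (p i))"]
      aI[OF that] X Y nn by auto
  have sx: "?T a summable_on tuples E k" if "a \<in> tuples I k" for a
    by (rule abs_summable_prod_PiE[where f="\<lambda>i e. X e (a i) * Y (a (p i)) e"]) (use one that in auto)
  have bound: "(\<Sum>\<^sub>\<infinity>x\<in>tuples E k. norm (?T a x)) \<le> (\<Prod>i<k. \<xi> (a i) * \<eta> (a i))" if a: "a \<in> tuples I k" for a
  proof -
    have "(\<Sum>\<^sub>\<infinity>x\<in>tuples E k. norm (?T a x)) = (\<Sum>\<^sub>\<infinity>x\<in>tuples E k. \<Prod>i<k. norm (X (x i) (a i) * Y (a (p i)) (x i)))"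
      by (simp add: prod_norm)
    also have "\<dots> = (\<Prod>i<k. \<Sum>\<^sub>\<infinity>e\<in>E. norm (X e (a i) * Y (a (p i)) e))"
      by (rule infsum_prod_PiE_abs[where f="\<lambda>i e. norm (X e (a i) * Y (a (p i)) e)"])
         (use one(1)[OF a] in \<open>auto simp: summable_on_iff_abs_summable_on_complex\<close>)
    also have "\<dots> \<le> (\<Prod>i<k. \<xi> (a i) * \<eta> (a (p i)))"
      by (intro prod_mono conjI infsum_nonneg one(2)[OF a]) auto
    also have "\<dots> = (\<Prod>i<k. \<xi> (a i)) * (\<Prod>i<k. \<eta> (a (p i)))" by (simp add: prod.distrib)
    also have "(\<Prod>i<k. \<eta> (a (p i))) = (\<Prod>i<k. \<eta> (a i))"
      using prod.permute[OF p, of "\<lambda>i. \<eta> (a i)"] by (simp add: o_def)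
    finally show ?thesis by (simp add: prod.distrib)
  qed
  have "(\<lambda>a. \<Prod>i<k. complex_of_real (\<xi> (a i) * \<eta> (a i))) summable_on tuples I k"
    by (rule abs_summable_prod_PiE[where f="\<lambda>i \<alpha>. complex_of_real (\<xi> \<alpha> * \<eta> \<alpha>)"])
       (use s in \<open>auto intro: summable_on_of_real simp del: of_real_mult\<close>)
  hence "(\<lambda>a. norm (\<Prod>i<k. complex_of_real (\<xi> (a i) * \<eta> (a i)))) summable_on tuples I k"
    unfolding summable_on_iff_abs_summable_on_complex .
  hence sI: "(\<lambda>a. \<Prod>i<k. \<xi> (a i) * \<eta> (a i)) summable_on tuples I k"
    by (subst summable_on_cong[where g="\<lambda>a. norm (\<Prod>i<k. complex_of_real (\<xi> (a i) * \<eta> (a i)))"])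
       (use nn in \<open>auto simp: prod_norm[symmetric] norm_mult PiE_def Pi_def intro!: prod.cong\<close>)
  have "(\<lambda>z. norm (case z of (a, x) \<Rightarrow> ?T a x)) summable_on (tuples I k \<times> tuples E k)"
  proof (subst Infinite_Sum.abs_summable_on_Sigma_iff, intro conjI ballI)
    fix a assume "a \<in> tuples I k"
    thus "(\<lambda>x. norm (case (a, x) of (a, x) \<Rightarrow> ?T a x)) summable_on tuples E k"
      using sx by (simp add: summable_on_iff_abs_summable_on_complex)
  next
    show "(\<lambda>a. norm (\<Sum>\<^sub>\<infinity>x\<in>tuples E k. norm (case (a, x) of (a, x) \<Rightarrow> ?T a x))) summable_on tuples I k"
      by (rule Infinite_Sum.abs_summable_on_comparison_test'[OF sI])
         (use bound in \<open>auto simp: infsum_nonneg\<close>)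
  qed
  thus ?thesis unfolding summable_on_iff_abs_summable_on_complex .
qed

text \<open>Expanding both determinants over tuples gives the same absolutely convergent double sum.\<close>

theorem cauchy_binet_infsum:
  fixes X :: "'a \<Rightarrow> 'b \<Rightarrow> complex" and Y :: "'b \<Rightarrow> 'a \<Rightarrow> complex"
  assumes X: "\<And>\<alpha> F. \<alpha> \<in> I \<Longrightarrow> finite F \<Longrightarrow> F \<subseteq> E \<Longrightarrow> (\<Sum>e\<in>F. (norm (X e \<alpha>))\<^sup>2) \<le> (\<xi> \<alpha>)\<^sup>2"
    and Y: "\<And>\<alpha> F. \<alpha> \<in> I \<Longrightarrow> finite F \<Longrightarrow> F \<subseteq> E \<Longrightarrow> (\<Sum>e\<in>F. (norm (Y \<alpha> e))\<^sup>2) \<le> (\<eta> \<alpha>)\<^sup>2"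
    and nn: "\<And>\<alpha>. \<alpha> \<in> I \<Longrightarrow> 0 \<le> \<xi> \<alpha>" "\<And>\<alpha>. \<alpha> \<in> I \<Longrightarrow> 0 \<le> \<eta> \<alpha>"
    and s: "(\<lambda>\<alpha>. \<xi> \<alpha> * \<eta> \<alpha>) summable_on I"
    and K: "\<And>e e'. e \<in> E \<Longrightarrow> e' \<in> E \<Longrightarrow> ((\<lambda>\<alpha>. X e \<alpha> * Y \<alpha> e') has_sum K e e') I"
    and M: "\<And>\<alpha> \<beta>. \<alpha> \<in> I \<Longrightarrow> \<beta> \<in> I \<Longrightarrow> ((\<lambda>e. X e \<alpha> * Y \<beta> e) has_sum M \<alpha> \<beta>) E"
  shows "infsum (subset_det K) (ksubsets E k) = infsum (subset_det M) (ksubsets I k)"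
proof -
  let ?T = "\<lambda>p a x. \<Prod>i<k. X (x i) (a i) * Y (a (p i)) (x i)"
  let ?S = "\<lambda>a x. \<Sum>p | p permutes {..<k}. of_int (sign p) * ?T p a x"
  have fin: "finite {p. p permutes {..<k}}" by (simp add: finite_permutations)
  have sT: "(\<lambda>(a, x). ?T p a x) summable_on (tuples I k \<times> tuples E k)" if "p permutes {..<k}" for p
    by (rule cauchy_binet_summable[where \<xi>=\<xi> and \<eta>=\<eta>]) (use assms that in auto)
  have "(\<lambda>z. \<Sum>p | p permutes {..<k}. of_int (sign p) * (case z of (a, x) \<Rightarrow> ?T p a x)) summable_on (tuples I k \<times> tuples E k)"
    by (intro summable_on_finite_sum summable_on_cmult_right sT) (use fin in auto)
  hence sS: "(\<lambda>(a, x). ?S a x) summable_on (tuples I k \<times> tuples E k)"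
    by (simp add: case_prod_unfold)
  hence sS': "(\<lambda>(x, a). ?S a x) summable_on (tuples E k \<times> tuples I k)"
    by (subst summable_on_swap) (simp add: case_prod_unfold)
  have sTx: "(\<lambda>x. ?T p a x) summable_on tuples E k" if "p permutes {..<k}" "a \<in> tuples I k" for p a
    using summable_on_SigmaD1[OF sT[OF that(1)]] that(2) by auto
  have sTa: "(\<lambda>a. ?T p a x) summable_on tuples I k" if "p permutes {..<k}" "x \<in> tuples E k" for p x
  proof -
    have "(\<lambda>(x, a). ?T p a x) summable_on (tuples E k \<times> tuples I k)"
      using sT[OF that(1)] by (subst summable_on_swap) (simp add: case_prod_unfold)
    from summable_on_SigmaD1[OF this] that(2) show ?thesis by auto
  qed
  have dM: "tuple_det M k a = (\<Sum>\<^sub>\<infinity>x\<in>tuples E k. ?S a x)" if a: "a \<in> tuples I k" for a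
  proof -
    have "(\<Prod>i<k. M (a i) (a (p i))) = infsum (?T p a) (tuples E k)" if p: "p permutes {..<k}" for p
    proof -
      have aI: "a i \<in> I" "a (p i) \<in> I" if "i < k" for i
        using that a permutes_in_image[OF p, of i] by auto
      have "(\<Prod>i<k. M (a i) (a (p i))) = (\<Prod>i<k. \<Sum>\<^sub>\<infinity>e\<in>E. X e (a i) * Y (a (p i)) e)"
        by (intro prod.cong refl infsumI[symmetric] M) (use aI in auto)
      also have "\<dots> = infsum (?T p a) (tuples E k)"
        by (rule infsum_prod_PiE_abs[where f="\<lambda>i e. X e (a i) * Y (a (p i)) e", symmetric])
           (auto simp flip: summable_on_iff_abs_summable_on_complex intro!: has_sum_imp_summable[OF M] aI)
      finally show ?thesis .
    qed
    hence "tuple_det M k a = (\<Sum>p | p permutes {..<k}. \<Sum>\<^sub>\<infinity>x\<in>tuples E k. of_int (sign p) * ?T p a x)"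
      unfolding tuple_det_def by (intro sum.cong refl) (simp add: infsum_cmult_right')
    also have "\<dots> = (\<Sum>\<^sub>\<infinity>x\<in>tuples E k. ?S a x)"
      by (rule infsum_finite_sum[OF fin, symmetric]) (use sTx a in \<open>auto intro: summable_on_cmult_right\<close>)
    finally show ?thesis .
  qed
  have dK: "tuple_det K k x = (\<Sum>\<^sub>\<infinity>a\<in>tuples I k. ?S a x)" if x: "x \<in> tuples E k" for x
  proof -
    \<comment> \<open>Expanding \<open>K\<close> puts the same index \<open>a i\<close> into both
      factors and permutes \<open>x\<close>. Reindexing the Y factors moves the permutation from
      \<open>x\<close> to \<open>a\<close>, where it appears inverted; this is harmless because
      inversion permutes the group and keeps the sign.\<close>
    have T: "(\<Prod>i<k. K (x i) (x (p i))) = infsum (\<lambda>a. ?T (inv_into UNIV p) a x) (tuples I k)" if p: "p permutes {..<k}" for p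
    proof -
      have xI: "x i \<in> E" "x (p i) \<in> E" if "i < k" for i
        using that x permutes_in_image[OF p, of i] by auto
      have "(\<Prod>i<k. K (x i) (x (p i))) = (\<Prod>i<k. \<Sum>\<^sub>\<infinity>\<alpha>\<in>I. X (x i) \<alpha> * Y \<alpha> (x (p i)))"
        by (intro prod.cong refl infsumI[symmetric] K) (use xI in auto)
      also have "\<dots> = infsum (\<lambda>a. \<Prod>i<k. X (x i) (a i) * Y (a i) (x (p i))) (tuples I k)"
        by (rule infsum_prod_PiE_abs[where f="\<lambda>i \<alpha>. X (x i) \<alpha> * Y \<alpha> (x (p i))", symmetric])
           (auto simp flip: summable_on_iff_abs_summable_on_complex intro!: has_sum_imp_summable[OF K] xI)
      also have "(\<lambda>a. \<Prod>i<k. X (x i) (a i) * Y (a i) (x (p i))) = (\<lambda>a. ?T (inv_into UNIV p) a x)"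
      proof
        fix a
        have "(\<Prod>i<k. Y (a i) (x (p i))) = (\<Prod>i<k. Y (a (inv_into UNIV p i)) (x i))"
          using prod.permute[OF p, of "\<lambda>i. Y (a (inv_into UNIV p i)) (x i)"] p
          by (simp add: o_def permutes_inverses)
        thus "(\<Prod>i<k. X (x i) (a i) * Y (a i) (x (p i))) = ?T (inv_into UNIV p) a x"
          by (simp add: prod.distrib)
      qed
      finally show ?thesis .
    qed
    have "tuple_det K k x = (\<Sum>p | p permutes {..<k}. of_int (sign p) * infsum (\<lambda>a. ?T (inv_into UNIV p) a x) (tuples I k))"
      unfolding tuple_det_def by (intro sum.cong refl arg_cong2[of _ _ _ _ "(*)"] T) simp
    also have "\<dots> = (\<Sum>p | p permutes {..<k}. of_int (sign (inv_into UNIV p)) * infsum (\<lambda>a. ?T (inv_into UNIV (inv_into UNIV p)) a x) (tuples I k))"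
      by (rule sum_permutations_inverse)
    also have "\<dots> = (\<Sum>p | p permutes {..<k}. \<Sum>\<^sub>\<infinity>a\<in>tuples I k. of_int (sign p) * ?T p a x)"
    proof (intro sum.cong refl)
      fix p assume "p \<in> {p. p permutes {..<k}}"
      hence p: "p permutes {..<k}" by simp
      have pp: "permutation p" using p finite_lessThan permutation_permutes by blast
      show "of_int (sign (inv_into UNIV p)) * infsum (\<lambda>a. ?T (inv_into UNIV (inv_into UNIV p)) a x) (tuples I k)
          = (\<Sum>\<^sub>\<infinity>a\<in>tuples I k. of_int (sign p) * ?T p a x)"
        unfolding sign_inverse[OF pp] permutes_inv_inv[OF p] by (rule infsum_cmult_right'[symmetric])
    qed
    also have "\<dots> = (\<Sum>\<^sub>\<infinity>a\<in>tuples I k. ?S a x)"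
      by (rule infsum_finite_sum[OF fin, symmetric]) (use sTa x in \<open>auto intro: summable_on_cmult_right\<close>)
    finally show ?thesis .
  qed
  have sK: "tuple_det K k summable_on tuples E k"
    using summable_on_Sigma_banach[OF sS'] by (subst summable_on_cong[OF dK])
  have sM: "tuple_det M k summable_on tuples I k"
    using summable_on_Sigma_banach[OF sS] by (subst summable_on_cong[OF dM])
  have "fact k * infsum (subset_det K) (ksubsets E k) = infsum (tuple_det K k) (tuples E k)"
    using tuple_det_subset_det(2)[OF sK] by simp
  also have "\<dots> = (\<Sum>\<^sub>\<infinity>x\<in>tuples E k. \<Sum>\<^sub>\<infinity>a\<in>tuples I k. ?S a x)" by (rule infsum_cong[OF dK])
  also have "\<dots> = (\<Sum>\<^sub>\<infinity>a\<in>tuples I k. \<Sum>\<^sub>\<infinity>x\<in>tuples E k. ?S a x)" by (rule infsum_swap_banach[OF sS'])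
  also have "\<dots> = infsum (tuple_det M k) (tuples I k)" by (rule infsum_cong[OF dM, symmetric])
  also have "\<dots> = fact k * infsum (subset_det M) (ksubsets I k)"
    by (rule tuple_det_subset_det(2)[OF sM])
  finally have "fact k * infsum (subset_det K) (ksubsets E k) = fact k * infsum (subset_det M) (ksubsets I k)" .
  moreover have "(fact k :: complex) \<noteq> 0" by simp
  ultimately show ?thesis using mult_left_cancel by blast
qed

section \<open>Determinants and traces of infinite matrices\<close>

definition subset_det_sum :: "('a \<Rightarrow> 'a \<Rightarrow> complex) \<Rightarrow> 'a set \<Rightarrow> nat \<Rightarrow> complex" where
  "subset_det_sum K E k = infsum (subset_det K) (ksubsets E k)"

definition kernel_det :: "(nat \<Rightarrow> nat \<Rightarrow> complex) \<Rightarrow> complex \<Rightarrow> complex" where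
  "kernel_det M z = (\<Sum>k. (- z) ^ k * subset_det_sum M UNIV k)"

text \<open>\<open>kernel_pow M n\<close> is the matrix power \<open>M\<^bsup>n+1\<^esup>\<close>, and \<open>kernel_trace M n\<close> its trace.\<close>

fun kernel_pow :: "(nat \<Rightarrow> nat \<Rightarrow> complex) \<Rightarrow> nat \<Rightarrow> nat \<Rightarrow> nat \<Rightarrow> complex" where
  "kernel_pow M 0 a b = M a b"
| "kernel_pow M (Suc n) a b = (\<Sum>c. M a c * kernel_pow M n c b)"

definition kernel_trace :: "(nat \<Rightarrow> nat \<Rightarrow> complex) \<Rightarrow> nat \<Rightarrow> complex" where
  "kernel_trace M n = (\<Sum>a. kernel_pow M n a a)"

text \<open>The finite section is padded with zeros and so remains an infinite matrix: bounds on
  \<open>M\<close> hold for all sections with the same constants, as the limits N to infinity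
  require.\<close>

definition truncate :: "nat \<Rightarrow> (nat \<Rightarrow> nat \<Rightarrow> complex) \<Rightarrow> nat \<Rightarrow> nat \<Rightarrow> complex" where
  "truncate N M a b = (if a < N \<and> b < N then M a b else 0)"

text \<open>Every factor in the Leibniz formula is an entry of -zM plus an entry of the identity. If
  \<open>F\<close> collects the rows where the first summand is chosen, only permutations fixing all
  points outside \<open>F\<close> survive, and they form the minor of \<open>F\<close>.\<close>

lemma det_one_minus_smult:
  "Determinant.det (mat N N (\<lambda>(i, j). (if i = j then 1 else 0) - z * M i j)) =
     (\<Sum>F\<in>Pow {..<N}. (- z) ^ card F * subset_det M F)" (is "Determinant.det ?A = _")
proof -
  let ?d = "\<lambda>i j. if i = j then 1 else (0::complex)"
  have *: "(\<Sum>p | p permutes {..<N}. of_int (sign p) * ((\<Prod>i\<in>F. - z * M i (p i)) * (\<Prod>i\<in>{..<N} - F. ?d i (p i)))) =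
      (- z) ^ card F * subset_det M F" if F: "F \<subseteq> {..<N}" for F
  proof -
    have sub: "{p. p permutes F} \<subseteq> {p. p permutes {..<N}}"
      using F by (auto intro: permutes_subset)
    have z: "(\<Prod>i\<in>{..<N} - F. ?d i (p i)) = 0" if "p permutes {..<N}" "\<not> p permutes F" for p
    proof (rule ccontr)
      assume "(\<Prod>i\<in>{..<N} - F. ?d i (p i)) \<noteq> 0"
      hence fixed: "p i = i" if "i \<in> {..<N} - F" for i using that by (auto split: if_splits)
      have "p permutes F"
        by (rule permutes_superset[OF that(1)]) (use fixed in auto)
      thus False using that by simp
    qed
    have o: "(\<Prod>i\<in>{..<N} - F. ?d i (p i)) = 1" if "p permutes F" for p
      by (rule prod.neutral) (use permutes_not_in[OF that] in auto)
    have "(\<Sum>p | p permutes {..<N}. of_int (sign p) * ((\<Prod>i\<in>F. - z * M i (p i)) * (\<Prod>i\<in>{..<N} - F. ?d i (p i)))) =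
      (\<Sum>p | p permutes F. of_int (sign p) * ((\<Prod>i\<in>F. - z * M i (p i)) * (\<Prod>i\<in>{..<N} - F. ?d i (p i))))"
      by (rule sum.mono_neutral_right[OF _ sub]) (use z in \<open>auto simp: finite_permutations\<close>)
    also have "\<dots> = (\<Sum>p | p permutes F. (- z) ^ card F * (of_int (sign p) * (\<Prod>i\<in>F. M i (p i))))"
      by (intro sum.cong refl) (simp only: o mem_Collect_eq prod.distrib prod_constant mult_1_right mult_1_left mult_ac)
    finally show ?thesis by (simp add: subset_det_def sum_distrib_left)
  qed
  have "Determinant.det ?A = (\<Sum>p | p permutes {..<N}. of_int (sign p) * (\<Prod>i\<in>{..<N}. - z * M i (p i) + ?d i (p i)))"
    by (subst det_def'[of _ N])
      (auto simp: lessThan_atLeast0 permutes_in_image intro!: sum.cong prod.cong)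
  also have "\<dots> = (\<Sum>p | p permutes {..<N}. \<Sum>F\<in>Pow {..<N}. of_int (sign p) * ((\<Prod>i\<in>F. - z * M i (p i)) * (\<Prod>i\<in>{..<N} - F. ?d i (p i))))"
    by (simp only: prod_add[OF finite_lessThan] sum_distrib_left)
  also have "\<dots> = (\<Sum>F\<in>Pow {..<N}. \<Sum>p | p permutes {..<N}. of_int (sign p) * ((\<Prod>i\<in>F. - z * M i (p i)) * (\<Prod>i\<in>{..<N} - F. ?d i (p i))))"
    by (rule sum.swap)
  also have "\<dots> = (\<Sum>F\<in>Pow {..<N}. (- z) ^ card F * subset_det M F)"
    by (intro sum.cong refl *) auto
  finally show ?thesis .
qed

lemma trace_mult_commute:
  fixes A B :: "complex mat"
  assumes "A \<in> carrier_mat n n" "B \<in> carrier_mat n n"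
  shows "(\<Sum>i<n. (A * B) $$ (i, i)) = (\<Sum>i<n. (B * A) $$ (i, i))"
proof -
  have "(\<Sum>i<n. (A * B) $$ (i, i)) = (\<Sum>i<n. \<Sum>j<n. A $$ (i, j) * B $$ (j, i))"
    using assms by (intro sum.cong refl) (auto simp: scalar_prod_def lessThan_atLeast0)
  also have "\<dots> = (\<Sum>j<n. \<Sum>i<n. A $$ (i, j) * B $$ (j, i))" by (rule sum.swap)
  also have "\<dots> = (\<Sum>i<n. (B * A) $$ (i, i))"
    using assms by (intro sum.cong refl) (auto simp: scalar_prod_def lessThan_atLeast0 mult.commute)
  finally show ?thesis .
qed

text \<open>The exponent is shifted as in \<open>kernel_pow\<close>: the value at \<open>n\<close>
  is the power A^(n+1).\<close>

primrec mat_iterate :: "complex mat \<Rightarrow> nat \<Rightarrow> complex mat" where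
  "mat_iterate A 0 = A"
| "mat_iterate A (Suc n) = A * mat_iterate A n"

lemma mat_iterate_carrier: "A \<in> carrier_mat N N \<Longrightarrow> mat_iterate A n \<in> carrier_mat N N"
  by (induction n) auto

lemma mat_iterate_similar:
  assumes "similar_mat_wit A B P Q" "A \<in> carrier_mat N N"
  shows "mat_iterate A n = P * mat_iterate B n * Q"
proof (induction n)
  case 0 show ?case using similar_mat_witD2[OF assms(2,1)] by simp
next
  case (Suc n)
  note * = similar_mat_witD2[OF assms(2,1)]
  have R: "mat_iterate B n \<in> carrier_mat N N" using * by (simp add: mat_iterate_carrier)
  have QP: "Q * (P * X) = X" if "X \<in> carrier_mat N N" for X
    using * that by (simp add: assoc_mult_mat[of Q N N P N X N, symmetric])
  have "mat_iterate A (Suc n) = (P * B * Q) * (P * mat_iterate B n * Q)"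
    using Suc *(3) by simp
  also have "\<dots> = P * mat_iterate B (Suc n) * Q"
    using * R QP[of "mat_iterate B n * Q"] by (simp add: assoc_mult_mat[of _ N N _ N _ N])
  finally show ?case .
qed

lemma mat_iterate_upper_triangular:
  assumes "upper_triangular B" "B \<in> carrier_mat N N"
  shows "upper_triangular (mat_iterate B n) \<and> (\<forall>i<N. mat_iterate B n $$ (i, i) = B $$ (i, i) ^ Suc n)"
proof (induction n)
  case 0 show ?case using assms by simp
next
  case (Suc n)
  let ?R = "mat_iterate B n"
  have R: "?R \<in> carrier_mat N N" using assms by (simp add: mat_iterate_carrier)
  have e: "(B * ?R) $$ (i, j) = (\<Sum>k<N. B $$ (i, k) * ?R $$ (k, j))" if "i < N" "j < N" for i j
    using that assms R by (auto simp: scalar_prod_def lessThan_atLeast0)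
  have B0: "B $$ (i, j) = 0" if "j < i" "i < N" for i j using assms that by (auto simp: upper_triangular_def)
  have R0: "?R $$ (i, j) = 0" if "j < i" "i < N" for i j using Suc R that by (auto simp: upper_triangular_def)
  have "(B * ?R) $$ (i, j) = 0" if "j < i" "i < N" for i j
  proof -
    have "(B * ?R) $$ (i, j) = (\<Sum>k<N. B $$ (i, k) * ?R $$ (k, j))" using that by (intro e) auto
    also have "\<dots> = 0"
    proof (rule sum.neutral, safe)
      fix k assume "k < N"
      show "B $$ (i, k) * ?R $$ (k, j) = 0"
        by (cases "k < i") (use that \<open>k < N\<close> B0 R0 in auto)
    qed
    finally show ?thesis .
  qed
  moreover have "(B * ?R) $$ (i, i) = B $$ (i, i) ^ Suc (Suc n)" if "i < N" for i
  proof -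
    have "(B * ?R) $$ (i, i) = (\<Sum>k<N. B $$ (i, k) * ?R $$ (k, i))" using that by (intro e) auto
    also have "\<dots> = (\<Sum>k<N. if k = i then B $$ (i, i) * ?R $$ (i, i) else 0)"
    proof (intro sum.cong refl)
      fix k assume "k \<in> {..<N}"
      thus "B $$ (i, k) * ?R $$ (k, i) = (if k = i then B $$ (i, i) * ?R $$ (i, i) else 0)"
        by (cases k i rule: linorder_cases) (use that B0 R0 in auto)
    qed
    also have "\<dots> = B $$ (i, i) * ?R $$ (i, i)" using that by simp
    finally show ?thesis using Suc that by simp
  qed
  ultimately show ?case using assms R by (auto simp: upper_triangular_def)
qed

text \<open>After Schur triangularization both the determinant and the traces of all powers are read
  off from one and the same list of diagonal entries, the eigenvalues with multiplicity.\<close>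

lemma spectrum_det_trace:
  fixes A :: "complex mat"
  assumes A: "A \<in> carrier_mat N N"
  obtains ev where "\<And>i. i < N \<Longrightarrow> eigenvalue A (ev i)"
    "\<And>z. Determinant.det (1\<^sub>m N - z \<cdot>\<^sub>m A) = (\<Prod>i<N. 1 - z * ev i)"
    "\<And>n. (\<Sum>i<N. mat_iterate A n $$ (i, i)) = (\<Sum>i<N. ev i ^ Suc n)"
proof -
  obtain as where as: "char_poly A = (\<Prod>a\<leftarrow>as. [:- a, 1:])"
    using char_poly_factorized[OF A] by blast
  from schur_decomposition_exists[OF A as]
  obtain B where B: "B \<in> carrier_mat N N" "upper_triangular B" "similar_mat A B" by blast
  then obtain P Q where wit: "similar_mat_wit A B P Q" by (auto simp: similar_mat_def)
  note * = similar_mat_witD2[OF A wit]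
  define ev where "ev i = B $$ (i, i)" for i
  have "eigenvalue A (ev i)" if "i < N" for i
  proof -
    have "char_poly A = (\<Prod>a\<leftarrow>diag_mat B. [:- a, 1:])"
      using char_poly_similar[OF B(3)] char_poly_upper_triangular[OF B(1,2)] by simp
    hence "poly (char_poly A) (ev i) = (\<Prod>a\<leftarrow>diag_mat B. ev i - a)"
      by (simp add: poly_prod_list o_def)
    also have "\<dots> = 0"
      using that B by (auto simp: prod_list_zero_iff ev_def diag_mat_def)
    finally show ?thesis by (simp add: eigenvalue_root_char_poly[OF A])
  qed
  moreover have "Determinant.det (1\<^sub>m N - z \<cdot>\<^sub>m A) = (\<Prod>i<N. 1 - z * ev i)" for z
  proof -
    let ?C = "1\<^sub>m N - z \<cdot>\<^sub>m B"
    have C: "?C \<in> carrier_mat N N" using B by auto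
    have "P * ?C * Q = (P * 1\<^sub>m N - P * (z \<cdot>\<^sub>m B)) * Q"
      using * by (subst mult_minus_distrib_mat[of _ N N _ N]) auto
    also have "\<dots> = P * 1\<^sub>m N * Q - P * (z \<cdot>\<^sub>m B) * Q"
      using * by (subst minus_mult_distrib_mat[of _ N N _ _ N]) auto
    also have "P * (z \<cdot>\<^sub>m B) * Q = z \<cdot>\<^sub>m A"
      using * by (simp add: mult_smult_distrib[of _ N N _ N] mult_smult_assoc_mat[of _ N N _ N])
    also have "P * 1\<^sub>m N * Q = 1\<^sub>m N" using * by simp
    finally have "similar_mat_wit (1\<^sub>m N - z \<cdot>\<^sub>m A) ?C P Q"
      using * C by (intro similar_mat_witI[of _ _ N]) auto
    hence "Determinant.det (1\<^sub>m N - z \<cdot>\<^sub>m A) = Determinant.det ?C"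
      by (intro det_similar) (auto simp: similar_mat_def)
    also have "\<dots> = prod_list (diag_mat ?C)"
      using B by (intro det_upper_triangular[OF _ C]) (auto simp: upper_triangular_def)
    also have "\<dots> = (\<Prod>i<N. 1 - z * ev i)"
      using B by (auto simp: prod_list_diag_prod ev_def lessThan_atLeast0 intro!: prod.cong)
    finally show ?thesis .
  qed
  moreover have "(\<Sum>i<N. mat_iterate A n $$ (i, i)) = (\<Sum>i<N. ev i ^ Suc n)" for n
  proof -
    let ?R = "mat_iterate B n"
    have R: "?R \<in> carrier_mat N N" using B by (simp add: mat_iterate_carrier)
    have "(\<Sum>i<N. mat_iterate A n $$ (i, i)) = (\<Sum>i<N. (P * ?R * Q) $$ (i, i))"
      by (simp add: mat_iterate_similar[OF wit A])
    also have "\<dots> = (\<Sum>i<N. (Q * (P * ?R)) $$ (i, i))"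
      by (rule trace_mult_commute) (use * R in auto)
    also have "Q * (P * ?R) = ?R"
      using * R by (simp add: assoc_mult_mat[of Q N N P N ?R N, symmetric])
    also have "(\<Sum>i<N. ?R $$ (i, i)) = (\<Sum>i<N. ev i ^ Suc n)"
      using mat_iterate_upper_triangular[OF B(2,1)] by (auto simp: ev_def)
    finally show ?thesis .
  qed
  ultimately show ?thesis by (rule that)
qed

text \<open>Summing the eigenvector equation with the weights \<xi> gives a weighted norm
  \<open>S\<close> with |e| S at most (sum of \<eta>\<xi>) S. If \<open>S\<close> vanishes, the rows
  of the equation show that e v = 0, hence e = 0. The resulting bound does not depend on the size of
  the matrix once the full sum is finite.\<close>

lemma eigenvalue_bound:
  fixes A :: "complex mat"
  assumes A: "A \<in> carrier_mat N N" and ev: "eigenvalue A e"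
    and b: "\<And>i j. i < N \<Longrightarrow> j < N \<Longrightarrow> norm (A $$ (i, j)) \<le> \<eta> i * \<xi> j"
    and nn: "\<And>i. 0 \<le> \<eta> i" "\<And>i. 0 \<le> \<xi> i"
  shows "norm e \<le> (\<Sum>i<N. \<eta> i * \<xi> i)"
proof -
  obtain v where v: "v \<in> carrier_vec N" "v \<noteq> 0\<^sub>v N" "A *\<^sub>v v = e \<cdot>\<^sub>v v"
    using ev A by (auto simp: eigenvalue_def eigenvector_def)
  define S where "S = (\<Sum>i<N. \<xi> i * norm (vec_index v i))"
  have S: "0 \<le> S" unfolding S_def by (intro sum_nonneg mult_nonneg_nonneg nn) auto
  have vi: "norm e * norm (vec_index v i) \<le> \<eta> i * S" if "i < N" for i
  proof -
    have "e * vec_index v i = vec_index (A *\<^sub>v v) i" using v that by simp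
    also have "\<dots> = (\<Sum>j<N. A $$ (i, j) * vec_index v j)"
      using v(1) that A by (auto simp: scalar_prod_def lessThan_atLeast0)
    also have "norm \<dots> \<le> (\<Sum>j<N. \<eta> i * \<xi> j * norm (vec_index v j))"
      by (rule sum_norm_le) (use b that in \<open>auto simp: norm_mult intro!: mult_right_mono\<close>)
    finally show ?thesis by (simp add: S_def norm_mult sum_distrib_left mult.assoc)
  qed
  have "norm e * S = (\<Sum>i<N. \<xi> i * (norm e * norm (vec_index v i)))"
    by (simp add: S_def sum_distrib_left mult_ac)
  also have "\<dots> \<le> (\<Sum>i<N. \<xi> i * (\<eta> i * S))"
    by (intro sum_mono mult_left_mono vi nn) auto
  finally have le: "norm e * S \<le> (\<Sum>i<N. \<eta> i * \<xi> i) * S" by (simp add: sum_distrib_left sum_distrib_right mult_ac)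
  show ?thesis
  proof (cases "S = 0")
    case False thus ?thesis using le S by simp
  next
    case True
    obtain i where "i < N" "vec_index v i \<noteq> 0" using v(1,2) by (metis eq_vecI carrier_vecD index_zero_vec)
    hence "norm e = 0" using vi[of i] True by (simp add: mult_le_0_iff)
    thus ?thesis using nn by (auto intro: sum_nonneg)
  qed
qed

lemma prod_one_minus_exp:
  fixes ev :: "nat \<Rightarrow> complex"
  assumes "\<And>i. i < N \<Longrightarrow> norm (z * ev i) < 1"
  shows "\<exists>s. (\<lambda>n. z ^ Suc n / of_nat (Suc n) * (\<Sum>i<N. ev i ^ Suc n)) sums s \<and> (\<Prod>i<N. 1 - z * ev i) = exp (- s)"
proof -
  have 1: "(\<lambda>n. (z * ev i) ^ Suc n / of_nat (Suc n)) sums (- Ln (1 - z * ev i))" if "i < N" for i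
  proof -
    have "(\<lambda>n. (-1) ^ Suc n / of_nat n * (- (z * ev i)) ^ n) sums Ln (1 + - (z * ev i))"
      by (rule Ln_series) (use assms that in simp)
    hence "(\<lambda>n. (-1) ^ Suc (Suc n) / of_nat (Suc n) * (- (z * ev i)) ^ Suc n) sums Ln (1 + - (z * ev i))"
      by (subst sums_Suc_iff) simp
    moreover have eq: "(-1) ^ Suc (Suc n) / of_nat (Suc n) * (- (z * ev i)) ^ Suc n = - ((z * ev i) ^ Suc n / of_nat (Suc n))" for n
    proof -
      have "(-1) ^ Suc n * (- (z * ev i)) ^ Suc n = (z * ev i) ^ Suc n"
        by (simp only: power_mult_distrib[symmetric]) simp
      thus ?thesis by simp
    qed
    ultimately have "(\<lambda>n. - ((z * ev i) ^ Suc n / of_nat (Suc n))) sums Ln (1 - z * ev i)"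
      by (simp only: eq) simp
    from sums_minus[OF this] show ?thesis by simp
  qed
  have ne: "1 - z * ev i \<noteq> 0" if "i < N" for i using assms[OF that] by auto
  have a: "(\<lambda>n. \<Sum>i<N. (z * ev i) ^ Suc n / of_nat (Suc n)) sums (\<Sum>i<N. - Ln (1 - z * ev i))"
    by (intro sums_sum 1) auto
  have eq: "(\<lambda>n. \<Sum>i<N. (z * ev i) ^ Suc n / of_nat (Suc n)) =
      (\<lambda>n. z ^ Suc n / of_nat (Suc n) * (\<Sum>i<N. ev i ^ Suc n))"
    by (auto simp: fun_eq_iff sum_distrib_left power_mult_distrib mult_ac)
  moreover have "(\<Prod>i<N. 1 - z * ev i) = exp (- (\<Sum>i<N. - Ln (1 - z * ev i)))"
    using ne by (simp add: exp_sum sum_negf)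
  ultimately show ?thesis using a unfolding eq by blast
qed

section \<open>Finite sections of an infinite matrix\<close>

lemma kernel_pow_truncate:
  "mat_iterate (mat N N (\<lambda>(i, j). M i j)) n \<in> carrier_mat N N"
  "i < N \<Longrightarrow> j < N \<Longrightarrow> mat_iterate (mat N N (\<lambda>(i, j). M i j)) n $$ (i, j) = kernel_pow (truncate N M) n i j"
proof -
  let ?A = "mat N N (\<lambda>(i, j). M i j)"
  show R: "mat_iterate ?A n \<in> carrier_mat N N" for n by (rule mat_iterate_carrier) simp
  show "mat_iterate ?A n $$ (i, j) = kernel_pow (truncate N M) n i j" if "i < N" "j < N" for i j
    using that
  proof (induction n arbitrary: i j)
    case 0 thus ?case by (simp add: truncate_def)
  next
    case (Suc n)
    have "mat_iterate ?A (Suc n) $$ (i, j) = (\<Sum>c<N. M i c * mat_iterate ?A n $$ (c, j))"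
      using Suc R[of n] by (auto simp: scalar_prod_def lessThan_atLeast0 intro!: sum.cong)
    also have "\<dots> = (\<Sum>c<N. truncate N M i c * kernel_pow (truncate N M) n c j)"
    proof (intro sum.cong refl)
      fix c assume "c \<in> {..<N}"
      moreover from this have "truncate N M i c = M i c" using Suc.prems by (simp add: truncate_def)
      ultimately show "M i c * mat_iterate ?A n $$ (c, j) = truncate N M i c * kernel_pow (truncate N M) n c j"
        using Suc by simp
    qed
    also have "\<dots> = (\<Sum>c. truncate N M i c * kernel_pow (truncate N M) n c j)"
      by (rule suminf_finite[symmetric]) (auto simp: truncate_def)
    finally show ?case by simp
  qed
qed

lemma kernel_pow_truncate_outside: "N \<le> i \<Longrightarrow> kernel_pow (truncate N M) n i j = 0"
  by (cases n) (auto simp: truncate_def)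

lemma kernel_trace_truncate:
  "kernel_trace (truncate N M) n = (\<Sum>i<N. mat_iterate (mat N N (\<lambda>(i, j). M i j)) n $$ (i, i))"
proof -
  have "kernel_trace (truncate N M) n = (\<Sum>i<N. kernel_pow (truncate N M) n i i)"
    unfolding kernel_trace_def by (rule suminf_finite) (auto simp: kernel_pow_truncate_outside)
  thus ?thesis by (simp add: kernel_pow_truncate)
qed

lemma subset_det_truncate:
  assumes "finite F"
  shows "subset_det (truncate N M) F = (if F \<subseteq> {..<N} then subset_det M F else 0)"
proof (cases "F \<subseteq> {..<N}")
  case True
  have "(\<Prod>e\<in>F. truncate N M e (p e)) = (\<Prod>e\<in>F. M e (p e))" if "p permutes F" for p
  proof (intro prod.cong refl)
    fix e assume "e \<in> F"
    moreover from this have "p e \<in> F" using permutes_in_image[OF that] by simp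
    ultimately show "truncate N M e (p e) = M e (p e)" using True by (auto simp: truncate_def)
  qed
  thus ?thesis using True by (simp add: subset_det_def)
next
  case False
  then obtain e where e: "e \<in> F" "\<not> e < N" by auto
  have "(\<Prod>e\<in>F. truncate N M e (p e)) = 0" for p
    by (rule prod_zero[OF assms]) (use e in \<open>auto simp: truncate_def\<close>)
  thus ?thesis using False by (simp add: subset_det_def)
qed

lemma subset_det_sum_truncate:
  "subset_det_sum (truncate N M) UNIV k = (\<Sum>F | F \<subseteq> {..<N} \<and> card F = k. subset_det M F)"
proof -
  have fin: "finite {F. F \<subseteq> {..<N} \<and> card F = k}"
    by (rule finite_subset[of _ "Pow {..<N}"]) auto
  have "subset_det_sum (truncate N M) UNIV k = infsum (subset_det M) {F. F \<subseteq> {..<N} \<and> card F = k}"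
    unfolding subset_det_sum_def
    by (rule infsum_cong_neutral)
       (auto simp: ksubsets_def subset_det_truncate intro: finite_subset[of _ "{..<N}"])
  thus ?thesis using fin by simp
qed

lemma kernel_det_truncate:
  "kernel_det (truncate N M) z = Determinant.det (1\<^sub>m N - z \<cdot>\<^sub>m mat N N (\<lambda>(i, j). M i j))"
proof -
  have "kernel_det (truncate N M) z = (\<Sum>k\<le>N. (- z) ^ k * subset_det_sum (truncate N M) UNIV k)"
    unfolding kernel_det_def
  proof (rule suminf_finite)
    fix k assume "k \<notin> {..N}"
    hence e: "{F. F \<subseteq> {..<N} \<and> card F = k} = {}"
      using card_mono[of "{..<N}"] by fastforce
    show "(- z) ^ k * subset_det_sum (truncate N M) UNIV k = 0"
      by (simp only: subset_det_sum_truncate e sum.empty mult_zero_right)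
  qed auto
  also have "\<dots> = (\<Sum>k\<le>N. \<Sum>F | F \<in> Pow {..<N} \<and> card F = k. (- z) ^ card F * subset_det M F)"
    by (simp add: subset_det_sum_truncate sum_distrib_left)
  also have "\<dots> = (\<Sum>F\<in>Pow {..<N}. (- z) ^ card F * subset_det M F)"
    by (rule sum.group) (use card_mono[of "{..<N}"] in \<open>auto\<close>)
  also have "\<dots> = Determinant.det (mat N N (\<lambda>(i, j). (if i = j then 1 else 0) - z * M i j))"
    by (rule det_one_minus_smult[symmetric])
  also have "mat N N (\<lambda>(i, j). (if i = j then 1 else 0) - z * M i j) = 1\<^sub>m N - z \<cdot>\<^sub>m mat N N (\<lambda>(i, j). M i j)"
    by (rule eq_matI) auto
  finally show ?thesis .
qed

text \<open>The majorant \<eta>(a) \<xi>(b) has rank one: in a product along a permutation its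
  factors regroup into diagonal ones, and in a matrix product it reproduces itself up to the factor
  \<open>diag_sum\<close>. Thus minors, powers and traces are all controlled by the numbers
  \<eta>(a) \<xi>(a).\<close>

locale bounded_kernel =
  fixes \<eta> \<xi> :: "nat \<Rightarrow> real"
  assumes nonneg: "0 \<le> \<eta> a" "0 \<le> \<xi> a"
    and sqrt_summable: "summable (\<lambda>a. sqrt (\<eta> a * \<xi> a))"
begin

definition bounded_by :: "(nat \<Rightarrow> nat \<Rightarrow> complex) \<Rightarrow> bool" where
  "bounded_by M \<longleftrightarrow> (\<forall>a b. norm (M a b) \<le> \<eta> a * \<xi> b)"

definition sqrt_sum :: real where "sqrt_sum = (\<Sum>a. sqrt (\<eta> a * \<xi> a))"
definition diag_sum :: real where "diag_sum = (\<Sum>a. \<eta> a * \<xi> a)"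

lemma diag_summable: "summable (\<lambda>a. \<eta> a * \<xi> a)"
proof (rule summable_comparison_test)
  have "norm (\<eta> a * \<xi> a) \<le> sqrt_sum * sqrt (\<eta> a * \<xi> a)" for a
  proof -
    have "sqrt (\<eta> a * \<xi> a) \<le> sqrt_sum"
      using sum_le_suminf[OF sqrt_summable, of "{a}"] by (simp add: sqrt_sum_def nonneg)
    hence "sqrt (\<eta> a * \<xi> a) * sqrt (\<eta> a * \<xi> a) \<le> sqrt_sum * sqrt (\<eta> a * \<xi> a)"
      by (intro mult_right_mono) (auto simp: nonneg)
    thus ?thesis by (simp add: nonneg)
  qed
  thus "\<exists>N. \<forall>n\<ge>N. norm (\<eta> n * \<xi> n) \<le> sqrt_sum * sqrt (\<eta> n * \<xi> n)" by blast
  show "summable (\<lambda>n. sqrt_sum * sqrt (\<eta> n * \<xi> n))" by (intro summable_mult sqrt_summable)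
qed

lemma diag_sum_nonneg: "0 \<le> diag_sum"
  unfolding diag_sum_def by (intro suminf_nonneg diag_summable) (simp add: nonneg)

lemma bounded_by_truncate: "bounded_by M \<Longrightarrow> bounded_by (truncate N M)"
  by (auto simp: bounded_by_def truncate_def nonneg)

lemma subset_det_bound:
  assumes "bounded_by M" "finite F"
  shows "norm (subset_det M F) \<le> fact (card F) * (\<Prod>e\<in>F. \<eta> e * \<xi> e)"
proof -
  have "norm (of_int (sign p) * (\<Prod>e\<in>F. M e (p e))) \<le> (\<Prod>e\<in>F. \<eta> e * \<xi> e)" if p: "p permutes F" for p
  proof -
    have "norm (of_int (sign p) * (\<Prod>e\<in>F. M e (p e))) = (\<Prod>e\<in>F. norm (M e (p e)))"
      by (simp add: norm_mult prod_norm sign_def)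
    also have "\<dots> \<le> (\<Prod>e\<in>F. \<eta> e * \<xi> (p e))"
      using assms by (intro prod_mono) (auto simp: bounded_by_def)
    also have "\<dots> = (\<Prod>e\<in>F. \<eta> e * \<xi> e)"
      using prod.permute[OF p, of \<xi>] by (simp add: prod.distrib o_def)
    finally show ?thesis .
  qed
  hence "norm (subset_det M F) \<le> (\<Sum>p | p permutes F. \<Prod>e\<in>F. \<eta> e * \<xi> e)"
    unfolding subset_det_def by (intro sum_norm_le) auto
  also have "\<dots> = fact (card F) * (\<Prod>e\<in>F. \<eta> e * \<xi> e)"
    using card_permutations[OF refl assms(2)] by simp
  finally show ?thesis .
qed

text \<open>The sum over all k-tuples is the k-th power of \<open>sqrt_sum\<close>. The injective
  ones contribute at most as much and count every subset k! times. The detour through complex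
  numbers is only there to apply \<open>infsum_tuples_subsets\<close>.\<close>

lemma sum_prod_ksubsets:
  "(\<lambda>F. \<Prod>e\<in>F. sqrt (\<eta> e * \<xi> e)) summable_on ksubsets UNIV k"
  "(\<Sum>\<^sub>\<infinity>F\<in>ksubsets UNIV k. \<Prod>e\<in>F. sqrt (\<eta> e * \<xi> e)) \<le> sqrt_sum ^ k / fact k"
proof -
  let ?t = "\<lambda>e. complex_of_real (sqrt (\<eta> e * \<xi> e))"
  let ?w = "\<lambda>F. \<Prod>e\<in>F. sqrt (\<eta> e * \<xi> e)"
  let ?f = "\<lambda>x. if inj_on x {..<k} then \<Prod>i<k. ?t (x i) else 0"
  have t: "?t summable_on UNIV"
    by (intro summable_on_of_real summable_nonneg_imp_summable_on sqrt_summable) (simp add: nonneg)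
  have it: "infsum ?t UNIV = of_real sqrt_sum"
  proof (rule infsumI)
    have "((\<lambda>e. sqrt (\<eta> e * \<xi> e)) has_sum sqrt_sum) UNIV"
      unfolding sqrt_sum_def
      by (rule sums_nonneg_imp_has_sum) (auto simp: nonneg intro: summable_sums sqrt_summable)
    thus "(?t has_sum complex_of_real sqrt_sum) UNIV" by (rule has_sum_of_real)
  qed
  have P: "(\<lambda>x. \<Prod>i<k. ?t (x i)) summable_on tuples UNIV k"
    by (rule abs_summable_prod_PiE[where f="\<lambda>i. ?t"]) (use t in auto)
  have iP: "(\<Sum>\<^sub>\<infinity>x\<in>tuples UNIV k. \<Prod>i<k. ?t (x i)) = of_real sqrt_sum ^ k"
    by (subst infsum_prod_PiE[where f="\<lambda>i. ?t"]) (use t P in \<open>auto simp: it\<close>)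
  have nP: "(\<lambda>x. norm (\<Prod>i<k. ?t (x i))) summable_on tuples UNIV k"
    using P unfolding summable_on_iff_abs_summable_on_complex .
  have "(\<lambda>x. norm (?f x)) summable_on tuples UNIV k"
    by (rule Infinite_Sum.abs_summable_on_comparison_test'[OF nP]) auto
  hence f: "?f summable_on tuples UNIV k" unfolding summable_on_iff_abs_summable_on_complex .
  have fh: "?f x = complex_of_real (?w (x ` {..<k}))" if "x \<in> tuples UNIV k" "inj_on x {..<k}" for x
    using that by (simp add: prod.reindex)
  have f0: "?f x = 0" if "x \<in> tuples UNIV k" "\<not> inj_on x {..<k}" for x
    using that by simp
  have *: "(\<lambda>F. complex_of_real (?w F)) summable_on ksubsets UNIV k"
      "infsum ?f (tuples UNIV k) = fact k * infsum (\<lambda>F. complex_of_real (?w F)) (ksubsets UNIV k)"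
    by (rule infsum_tuples_subsets[of k UNIV ?f "\<lambda>F. complex_of_real (?w F)"]; fact fh f0 f)+
  show s: "?w summable_on ksubsets UNIV k"
    using summable_on_Re[OF *(1)] by (simp only: Re_complex_of_real)
  have "infsum (\<lambda>F. complex_of_real (?w F)) (ksubsets UNIV k) = of_real (infsum ?w (ksubsets UNIV k))"
    by (rule infsumI[OF has_sum_of_real[OF has_sum_infsum[OF s]]])
  hence "fact k * complex_of_real (infsum ?w (ksubsets UNIV k)) = infsum ?f (tuples UNIV k)"
    using *(2) by (simp only:)
  hence "fact k * infsum ?w (ksubsets UNIV k) = norm (infsum ?f (tuples UNIV k))"
  proof -
    assume a: "fact k * complex_of_real (infsum ?w (ksubsets UNIV k)) = infsum ?f (tuples UNIV k)"
    have "0 \<le> infsum ?w (ksubsets UNIV k)" by (intro infsum_nonneg prod_nonneg) (auto simp: nonneg)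
    thus ?thesis unfolding a[symmetric] by (simp add: norm_mult)
  qed
  also have "\<dots> \<le> (\<Sum>\<^sub>\<infinity>x\<in>tuples UNIV k. norm (\<Prod>i<k. ?t (x i)))"
    by (rule norm_infsum_le[OF has_sum_infsum[OF f] has_sum_infsum[OF nP]]) auto
  also have "\<dots> = norm (\<Sum>\<^sub>\<infinity>x\<in>tuples UNIV k. \<Prod>i<k. ?t (x i))"
  proof -
    have eq: "(\<Prod>i<k. ?t (x i)) = complex_of_real (norm (\<Prod>i<k. ?t (x i)))" for x
      by (simp add: prod_norm[symmetric] nonneg abs_of_nonneg)
    have "(\<Sum>\<^sub>\<infinity>x\<in>tuples UNIV k. \<Prod>i<k. ?t (x i)) = complex_of_real (\<Sum>\<^sub>\<infinity>x\<in>tuples UNIV k. norm (\<Prod>i<k. ?t (x i)))"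
      by (subst eq) (rule infsumI[OF has_sum_of_real[OF has_sum_infsum[OF nP]]])
    moreover have "0 \<le> (\<Sum>\<^sub>\<infinity>x\<in>tuples UNIV k. norm (\<Prod>i<k. ?t (x i)))" by (rule infsum_nonneg) auto
    ultimately show ?thesis by simp
  qed
  also have "\<dots> = sqrt_sum ^ k"
    unfolding iP by (simp add: norm_power sqrt_sum_def suminf_nonneg[OF sqrt_summable] nonneg)
  finally show "infsum ?w (ksubsets UNIV k) \<le> sqrt_sum ^ k / fact k"
    by (simp add: field_simps)
qed

text \<open>The square root buys a second factor \<open>1 / k!\<close>, which beats the \<open>k!\<close> terms of the Leibniz
  formula.\<close>

lemma subset_det_summable:
  assumes "bounded_by M"
  shows "subset_det M summable_on ksubsets UNIV k"
    and "norm (subset_det_sum M UNIV k) \<le> (sqrt_sum\<^sup>2) ^ k / fact k"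
proof -
  let ?w = "\<lambda>F. \<Prod>e\<in>F. sqrt (\<eta> e * \<xi> e)"
  let ?W = "infsum ?w (ksubsets UNIV k)"
  have wnn: "0 \<le> ?w F" for F by (intro prod_nonneg) (auto simp: nonneg)
  have w: "?w F \<le> ?W" if "F \<in> ksubsets UNIV k" for F
    using finite_sum_le_infsum[OF sum_prod_ksubsets(1), of "{F}" k] that wnn by simp
  have b: "norm (subset_det M F) \<le> fact k * ?W * ?w F" if F: "F \<in> ksubsets UNIV k" for F
  proof -
    have "norm (subset_det M F) \<le> fact k * (\<Prod>e\<in>F. \<eta> e * \<xi> e)"
      using subset_det_bound[OF assms, of F] F by (auto simp: ksubsets_def)
    \<comment> \<open>One of the two equal factors is replaced by the whole sum \<open>?W\<close>,
      the other is kept for the summation over \<open>F\<close>; each of them is eventually worth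
      \<open>1 / fact k\<close>.\<close>
    also have "(\<Prod>e\<in>F. \<eta> e * \<xi> e) = ?w F * ?w F"
      unfolding prod.distrib[symmetric] by (intro prod.cong refl) (simp add: nonneg)
    also have "fact k * (?w F * ?w F) \<le> fact k * (?W * ?w F)"
      by (intro mult_left_mono mult_right_mono w F wnn) auto
    finally show ?thesis by (simp add: mult.assoc)
  qed
  have s: "(\<lambda>F. fact k * ?W * ?w F) summable_on ksubsets UNIV k"
    by (intro summable_on_cmult_right sum_prod_ksubsets)
  have "(\<lambda>F. norm (subset_det M F)) summable_on ksubsets UNIV k"
    by (rule Infinite_Sum.abs_summable_on_comparison_test'[OF s]) (use b in auto)
  thus sd: "subset_det M summable_on ksubsets UNIV k" by (simp add: summable_on_iff_abs_summable_on_complex)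
  have "norm (subset_det_sum M UNIV k) \<le> infsum (\<lambda>F. fact k * ?W * ?w F) (ksubsets UNIV k)"
    unfolding subset_det_sum_def
    by (rule norm_infsum_le[OF has_sum_infsum[OF sd] has_sum_infsum[OF s]]) (use b in auto)
  also have "\<dots> = fact k * (?W * ?W)" by (simp add: infsum_cmult_right')
  also have "\<dots> \<le> fact k * ((sqrt_sum ^ k / fact k) * (sqrt_sum ^ k / fact k))"
  proof -
    have "0 \<le> ?W" by (intro infsum_nonneg wnn)
    thus ?thesis using sum_prod_ksubsets(2)[of k] by (intro mult_left_mono mult_mono) auto
  qed
  also have "\<dots> = (sqrt_sum\<^sup>2) ^ k / fact k"
    by (simp add: power2_eq_square power_mult_distrib)
  finally show "norm (subset_det_sum M UNIV k) \<le> (sqrt_sum\<^sup>2) ^ k / fact k" .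
qed

lemma kernel_det_term_bound:
  assumes "bounded_by M"
  shows "norm ((- z) ^ k * subset_det_sum M UNIV k) \<le> (norm z * sqrt_sum\<^sup>2) ^ k / fact k"
proof -
  have "norm ((- z) ^ k * subset_det_sum M UNIV k) = norm z ^ k * norm (subset_det_sum M UNIV k)"
    by (simp add: norm_mult norm_power)
  also have "\<dots> \<le> norm z ^ k * ((sqrt_sum\<^sup>2) ^ k / fact k)"
    by (intro mult_left_mono subset_det_summable assms) auto
  finally show ?thesis by (simp add: power_mult_distrib)
qed

lemma kernel_det_entire:
  assumes "bounded_by M"
  shows "kernel_det M holomorphic_on UNIV"
proof -
  have sums: "(\<lambda>k. ((-1) ^ k * subset_det_sum M UNIV k) * (z - 0) ^ k) sums kernel_det M z" for z
  proof -
    have "summable (\<lambda>k. (- z) ^ k * subset_det_sum M UNIV k)"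
      by (rule summable_comparison_test'[OF summable_exp[of "norm z * sqrt_sum\<^sup>2"], where N=0])
         (use kernel_det_term_bound[OF assms] in \<open>simp add: divide_inverse mult.commute\<close>)
    from summable_sums[OF this] show ?thesis
      by (simp add: kernel_det_def power_minus[of z] mult_ac)
  qed
  have "kernel_det M holomorphic_on ball 0 r" for r
    by (rule power_series_holomorphic) (rule sums)
  hence "kernel_det M field_differentiable at z" for z
    using holomorphic_on_imp_differentiable_at[of "kernel_det M" "ball 0 (norm z + 1)" z] by simp
  thus ?thesis unfolding holomorphic_on_def using field_differentiable_at_within by blast
qed

text \<open>The k-element subsets of \<open>{..<N}\<close> form a sequence of finite index sets that
  eventually contains any given finite family, so convergence along the net of finite subsets
  restricts to it.\<close>

lemma subset_det_sum_truncate_tendsto: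
  assumes "bounded_by M"
  shows "(\<lambda>N. subset_det_sum (truncate N M) UNIV k) \<longlonglongrightarrow> subset_det_sum M UNIV k"
proof -
  let ?A = "\<lambda>N. {F. F \<subseteq> {..<N::nat} \<and> card F = k}"
  have fl: "filterlim ?A (finite_subsets_at_top (ksubsets UNIV k)) sequentially"
    unfolding filterlim_finite_subsets_at_top
  proof (intro allI impI)
    fix X :: "nat set set" assume X: "finite X \<and> X \<subseteq> ksubsets UNIV k"
    have "finite (\<Union>X)" using X by (auto simp: ksubsets_def)
    then obtain m where m: "\<Union>X \<subseteq> {..<m}" using finite_nat_iff_bounded by blast
    show "\<forall>\<^sub>F N in sequentially. finite (?A N) \<and> X \<subseteq> ?A N \<and> ?A N \<subseteq> ksubsets UNIV k"
      using eventually_ge_at_top[of m]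
    proof eventually_elim
      case (elim N)
      have "finite (?A N)" by (rule finite_subset[of _ "Pow {..<N}"]) auto
      moreover have "X \<subseteq> ?A N"
      proof
        fix F assume "F \<in> X"
        moreover from this have "F \<subseteq> {..<N}" using m elim by fastforce
        ultimately show "F \<in> ?A N" using X by (auto simp: ksubsets_def)
      qed
      moreover have "?A N \<subseteq> ksubsets UNIV k"
        by (auto simp: ksubsets_def intro: finite_subset[of _ "{..<N}"])
      ultimately show ?case by blast
    qed
  qed
  have "(sum (subset_det M) \<longlongrightarrow> subset_det_sum M UNIV k) (finite_subsets_at_top (ksubsets UNIV k))"
    using has_sum_infsum[OF subset_det_summable(1)[OF assms]]
    unfolding has_sum_def subset_det_sum_def .
  from filterlim_compose[OF this fl] show ?thesis by (simp add: subset_det_sum_truncate)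
qed

text \<open>Dominated convergence for series; the majorant from \<open>kernel_det_term_bound\<close>
  is the same for all sections, since truncation preserves \<open>bounded_by\<close>.\<close>

lemma kernel_det_truncate_tendsto:
  assumes "bounded_by M"
  shows "(\<lambda>N. kernel_det (truncate N M) z) \<longlonglongrightarrow> kernel_det M z"
proof -
  have "((\<lambda>N. \<Sum>k. (- z) ^ k * subset_det_sum (truncate N M) UNIV k) \<longlonglongrightarrow> (\<Sum>k. (- z) ^ k * subset_det_sum M UNIV k))"
  proof (rule tannerys_theorem[THEN conjunct2, THEN conjunct2])
    show "(\<lambda>N. (- z) ^ k * subset_det_sum (truncate N M) UNIV k) \<longlonglongrightarrow> (- z) ^ k * subset_det_sum M UNIV k" for k
      by (intro tendsto_intros subset_det_sum_truncate_tendsto assms)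
    show "summable (\<lambda>k. (norm z * sqrt_sum\<^sup>2) ^ k / fact k)"
      using summable_exp[of "norm z * sqrt_sum\<^sup>2"] by (simp add: divide_inverse mult.commute)
    show "\<forall>\<^sub>F (k, N) in sequentially \<times>\<^sub>F sequentially.
        norm ((- z) ^ k * subset_det_sum (truncate N M) UNIV k) \<le> (norm z * sqrt_sum\<^sup>2) ^ k / fact k"
      using kernel_det_term_bound[OF bounded_by_truncate[OF assms]]
      by (intro always_eventually) auto
  qed simp
  thus ?thesis by (simp add: kernel_det_def)
qed

text \<open>The first estimate follows by induction, each matrix product contributing one factor
  \<open>diag_sum\<close>. The second is its inductive step kept for later: a majorant summable in
  \<open>c\<close>, under which the powers of the finite sections converge.\<close>

lemma kernel_pow_bound:
  assumes "bounded_by M"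
  shows "norm (kernel_pow M n a b) \<le> \<eta> a * \<xi> b * diag_sum ^ n"
    and "norm (M a c * kernel_pow M n c b) \<le> \<eta> a * \<xi> b * diag_sum ^ n * (\<eta> c * \<xi> c)"
proof -
  have step: "norm (M a c * kernel_pow M n c b) \<le> \<eta> a * \<xi> b * diag_sum ^ n * (\<eta> c * \<xi> c)"
    if "norm (kernel_pow M n c b) \<le> \<eta> c * \<xi> b * diag_sum ^ n" for n a b c
  proof -
    have "norm (M a c * kernel_pow M n c b) \<le> (\<eta> a * \<xi> c) * (\<eta> c * \<xi> b * diag_sum ^ n)"
      unfolding norm_mult using assms that by (intro mult_mono) (auto simp: bounded_by_def nonneg)
    thus ?thesis by (simp add: mult_ac)
  qed
  show pow: "norm (kernel_pow M n a b) \<le> \<eta> a * \<xi> b * diag_sum ^ n" for n a b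
  proof (induction n arbitrary: a b)
    case 0 thus ?case using assms by (simp add: bounded_by_def)
  next
    case (Suc n)
    have s: "summable (\<lambda>c. \<eta> a * \<xi> b * diag_sum ^ n * (\<eta> c * \<xi> c))"
      by (intro summable_mult diag_summable)
    have "norm (kernel_pow M (Suc n) a b) \<le> (\<Sum>c. \<eta> a * \<xi> b * diag_sum ^ n * (\<eta> c * \<xi> c))"
      unfolding kernel_pow.simps by (rule norm_suminf_le[OF step[OF Suc] s])
    also have "\<dots> = \<eta> a * \<xi> b * diag_sum ^ Suc n"
      by (subst suminf_mult[OF diag_summable]) (simp add: diag_sum_def)
    finally show ?case .
  qed
  show "norm (M a c * kernel_pow M n c b) \<le> \<eta> a * \<xi> b * diag_sum ^ n * (\<eta> c * \<xi> c)"
    by (rule step[OF pow])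
qed

lemma kernel_pow_truncate_tendsto:
  assumes "bounded_by M"
  shows "(\<lambda>N. kernel_pow (truncate N M) n a b) \<longlonglongrightarrow> kernel_pow M n a b"
proof (induction n arbitrary: a b)
  have M: "(\<lambda>N. truncate N M a b) \<longlonglongrightarrow> M a b" for a b
    by (rule tendsto_eventually, rule eventually_mono[OF eventually_gt_at_top[of "max a b"]])
       (auto simp: truncate_def)
  case 0 show ?case using M by simp
  case (Suc n)
  have "(\<lambda>N. \<Sum>c. truncate N M a c * kernel_pow (truncate N M) n c b) \<longlonglongrightarrow> (\<Sum>c. M a c * kernel_pow M n c b)"
  proof (rule tannerys_theorem[THEN conjunct2, THEN conjunct2])
    show "(\<lambda>N. truncate N M a c * kernel_pow (truncate N M) n c b) \<longlonglongrightarrow> M a c * kernel_pow M n c b" for c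
      by (intro tendsto_intros Suc M)
    show "summable (\<lambda>c. \<eta> a * \<xi> b * diag_sum ^ n * (\<eta> c * \<xi> c))"
      by (intro summable_mult diag_summable)
    show "\<forall>\<^sub>F (c, N) in sequentially \<times>\<^sub>F sequentially. norm (truncate N M a c * kernel_pow (truncate N M) n c b)
        \<le> \<eta> a * \<xi> b * diag_sum ^ n * (\<eta> c * \<xi> c)"
      using kernel_pow_bound(2)[OF bounded_by_truncate[OF assms]]
      by (intro always_eventually) auto
  qed simp
  thus ?case by simp
qed

lemma kernel_trace_bound:
  assumes "bounded_by M"
  shows "summable (\<lambda>a. kernel_pow M n a a)" and "norm (kernel_trace M n) \<le> diag_sum ^ Suc n"
proof -
  have s: "summable (\<lambda>a. \<eta> a * \<xi> a * diag_sum ^ n)" by (intro summable_mult2 diag_summable)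
  show "summable (\<lambda>a. kernel_pow M n a a)"
    by (rule summable_comparison_test'[OF s, where N=0]) (use kernel_pow_bound[OF assms] in auto)
  have "norm (kernel_trace M n) \<le> (\<Sum>a. \<eta> a * \<xi> a * diag_sum ^ n)"
    unfolding kernel_trace_def by (rule norm_suminf_le[OF kernel_pow_bound(1)[OF assms] s])
  also have "\<dots> = diag_sum ^ Suc n" by (subst suminf_mult2[OF diag_summable, symmetric]) (simp add: diag_sum_def)
  finally show "norm (kernel_trace M n) \<le> diag_sum ^ Suc n" .
qed

lemma kernel_trace_truncate_tendsto:
  assumes "bounded_by M"
  shows "(\<lambda>N. kernel_trace (truncate N M) n) \<longlonglongrightarrow> kernel_trace M n"
  unfolding kernel_trace_def
proof (rule tannerys_theorem[THEN conjunct2, THEN conjunct2])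
  show "(\<lambda>N. kernel_pow (truncate N M) n a a) \<longlonglongrightarrow> kernel_pow M n a a" for a
    by (rule kernel_pow_truncate_tendsto[OF assms])
  show "summable (\<lambda>a. \<eta> a * \<xi> a * diag_sum ^ n)" by (intro summable_mult2 diag_summable)
  show "\<forall>\<^sub>F (a, N) in sequentially \<times>\<^sub>F sequentially. norm (kernel_pow (truncate N M) n a a)
        \<le> \<eta> a * \<xi> a * diag_sum ^ n"
    using kernel_pow_bound(1)[OF bounded_by_truncate[OF assms]]
    by (intro always_eventually) auto
qed simp

text \<open>For a finite section the identity is the logarithm series summed over the eigenvalues.
  These are bounded by \<open>diag_sum\<close> uniformly in N, so a single condition on
  \<open>z\<close> serves all sections, and the series of traces has a common geometric majorant for
  the limit.\<close>

theorem kernel_det_exp_trace: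
  assumes M: "bounded_by M" and z: "norm z * diag_sum < 1"
  shows "\<exists>s. (\<lambda>n. z ^ Suc n / of_nat (Suc n) * kernel_trace M n) sums s \<and> kernel_det M z = exp (- s)"
proof -
  let ?g = "\<lambda>M n. z ^ Suc n / of_nat (Suc n) * kernel_trace M n"
  let ?b = "\<lambda>n. (norm z * diag_sum) ^ Suc n"
  have bound: "norm (?g M n) \<le> ?b n" if "bounded_by M" for M n
  proof -
    have "norm (?g M n) = norm z ^ Suc n / real (Suc n) * norm (kernel_trace M n)"
      by (simp only: norm_mult norm_divide norm_power norm_of_nat)
    also have "\<dots> \<le> norm z ^ Suc n / 1 * diag_sum ^ Suc n"
      by (intro mult_mono divide_left_mono kernel_trace_bound that) (auto simp: diag_sum_nonneg)
    finally show ?thesis by (simp add: power_mult_distrib mult_ac)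
  qed
  have sb: "summable ?b"
    using z diag_sum_nonneg by (subst summable_Suc_iff) (intro summable_geometric, simp)
  have lim: "(\<lambda>N. \<Sum>n. ?g (truncate N M) n) \<longlonglongrightarrow> (\<Sum>n. ?g M n)"
  proof (rule tannerys_theorem[THEN conjunct2, THEN conjunct2])
    show "(\<lambda>N. ?g (truncate N M) n) \<longlonglongrightarrow> ?g M n" for n
      by (intro tendsto_mult tendsto_const kernel_trace_truncate_tendsto M)
    show "\<forall>\<^sub>F (n, N) in sequentially \<times>\<^sub>F sequentially. norm (?g (truncate N M) n) \<le> ?b n"
      using bound[OF bounded_by_truncate[OF M]] by (intro always_eventually) auto
  qed (use sb in auto)
  have fin: "kernel_det (truncate N M) z = exp (- (\<Sum>n. ?g (truncate N M) n))" for N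
  proof -
    let ?A = "mat N N (\<lambda>(i, j). M i j)"
    obtain ev where ev: "\<And>i. i < N \<Longrightarrow> eigenvalue ?A (ev i)"
      "\<And>z. Determinant.det (1\<^sub>m N - z \<cdot>\<^sub>m ?A) = (\<Prod>i<N. 1 - z * ev i)"
      "\<And>n. (\<Sum>i<N. mat_iterate ?A n $$ (i, i)) = (\<Sum>i<N. ev i ^ Suc n)"
      using spectrum_det_trace[of ?A N] by auto
    have "norm (z * ev i) < 1" if "i < N" for i
    proof -
      have "norm (ev i) \<le> (\<Sum>i<N. \<eta> i * \<xi> i)"
        by (rule eigenvalue_bound[OF _ ev(1)[OF that]]) (use M nonneg in \<open>auto simp: bounded_by_def\<close>)
      also have "\<dots> \<le> diag_sum"
        unfolding diag_sum_def by (intro sum_le_suminf diag_summable) (auto simp: nonneg)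
      finally have "norm (z * ev i) \<le> norm z * diag_sum" by (simp add: norm_mult mult_left_mono)
      thus ?thesis using z by simp
    qed
    hence "\<exists>s. (\<lambda>n. z ^ Suc n / of_nat (Suc n) * (\<Sum>i<N. ev i ^ Suc n)) sums s \<and> (\<Prod>i<N. 1 - z * ev i) = exp (- s)"
      by (rule prod_one_minus_exp)
    then obtain s where s: "(\<lambda>n. z ^ Suc n / of_nat (Suc n) * (\<Sum>i<N. ev i ^ Suc n)) sums s"
        "(\<Prod>i<N. 1 - z * ev i) = exp (- s)"
      by blast
    have "kernel_trace (truncate N M) n = (\<Sum>i<N. ev i ^ Suc n)" for n
      by (subst kernel_trace_truncate) (rule ev(3))
    hence "(\<Sum>n. ?g (truncate N M) n) = s" using sums_unique[OF s(1)] by presburger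
    moreover have "kernel_det (truncate N M) z = exp (- s)"
      by (simp only: kernel_det_truncate ev(2) s(2))
    ultimately show ?thesis by (simp only:)
  qed
  have "(\<lambda>N. kernel_det (truncate N M) z) \<longlonglongrightarrow> exp (- (\<Sum>n. ?g M n))"
    unfolding fin by (intro tendsto_exp tendsto_minus lim)
  hence "kernel_det M z = exp (- (\<Sum>n. ?g M n))"
    using LIMSEQ_unique kernel_det_truncate_tendsto[OF M] by blast
  moreover have "summable (?g M)"
    by (rule summable_comparison_test'[OF sb, where N=0]) (use bound[OF M] in auto)
  ultimately show ?thesis using summable_sums by blast
qed

end

section \<open>Fredholm determinants of nuclear operators\<close>

text \<open>The spaces in question are subspaces of one function type, so completeness is phrased
  through \<open>ip\<close> of differences rather than by a type class. Positivity is kept in the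
  weak form that matches the conclusion \<open>ip f f = 0\<close> in
  \<open>orthonormal_basis\<close>.\<close>

locale function_hilbert =
  fixes H :: "('x \<Rightarrow> complex) set" and ip :: "('x \<Rightarrow> complex) \<Rightarrow> ('x \<Rightarrow> complex) \<Rightarrow> complex"
  assumes zero_mem: "(\<lambda>u. 0) \<in> H"
    and add_mem: "f \<in> H \<Longrightarrow> g \<in> H \<Longrightarrow> (\<lambda>u. f u + g u) \<in> H"
    and scale_mem: "f \<in> H \<Longrightarrow> (\<lambda>u. c * f u) \<in> H"
    and ip_add: "f \<in> H \<Longrightarrow> g \<in> H \<Longrightarrow> h \<in> H \<Longrightarrow> ip (\<lambda>u. f u + g u) h = ip f h + ip g h"
    and ip_scale: "f \<in> H \<Longrightarrow> h \<in> H \<Longrightarrow> ip (\<lambda>u. c * f u) h = c * ip f h"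
    and ip_sym: "f \<in> H \<Longrightarrow> h \<in> H \<Longrightarrow> ip h f = cnj (ip f h)"
    and ip_pos: "f \<in> H \<Longrightarrow> 0 \<le> Re (ip f f)"
    and complete: "(\<And>n. fs n \<in> H) \<Longrightarrow>
      (\<And>e. 0 < e \<Longrightarrow> \<exists>N. \<forall>m\<ge>N. \<forall>n\<ge>N. Re (ip (\<lambda>u. fs m u - fs n u) (\<lambda>u. fs m u - fs n u)) < e) \<Longrightarrow>
      \<exists>h\<in>H. (\<lambda>n. Re (ip (\<lambda>u. fs n u - h u) (\<lambda>u. fs n u - h u))) \<longlonglongrightarrow> 0"
begin

definition nsq :: "('x \<Rightarrow> complex) \<Rightarrow> real" where "nsq f = Re (ip f f)"

definition orthonormal :: "('x \<Rightarrow> complex) set \<Rightarrow> bool" where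
  "orthonormal E \<longleftrightarrow> E \<subseteq> H \<and> (\<forall>e\<in>E. \<forall>e'\<in>E. ip e e' = (if e = e' then 1 else 0))"

definition partial_expansion :: "('x \<Rightarrow> complex) \<Rightarrow> ('x \<Rightarrow> complex) set \<Rightarrow> 'x \<Rightarrow> complex" where
  "partial_expansion v F = (\<lambda>u. \<Sum>e\<in>F. ip v e * e u)"

definition bounded_functional :: "(('x \<Rightarrow> complex) \<Rightarrow> complex) \<Rightarrow> real \<Rightarrow> bool" where
  "bounded_functional l C \<longleftrightarrow> 0 \<le> C \<and>
     (\<forall>f\<in>H. \<forall>g\<in>H. l (\<lambda>u. f u + g u) = l f + l g) \<and>
     (\<forall>f\<in>H. \<forall>c. l (\<lambda>u. c * f u) = c * l f) \<and> (\<forall>f\<in>H. norm (l f) \<le> C * sqrt (nsq f))"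

lemma diff_mem: "f \<in> H \<Longrightarrow> g \<in> H \<Longrightarrow> (\<lambda>u. f u - g u) \<in> H"
  using add_mem[of f "\<lambda>u. (-1) * g u"] scale_mem[of g "-1"] by simp

lemma sum_mem:
  assumes "finite F" "\<And>e. e \<in> F \<Longrightarrow> f e \<in> H"
  shows "(\<lambda>u. \<Sum>e\<in>F. c e * f e u) \<in> H"
  using assms
proof (induction F rule: finite_induct)
  case empty show ?case by (simp add: zero_mem)
next
  case (insert x F)
  have "(\<lambda>u. c x * f x u + (\<Sum>e\<in>F. c e * f e u)) \<in> H"
    using insert by (intro add_mem[of "\<lambda>u. c x * f x u"] scale_mem) auto
  thus ?case using insert by simp
qed

lemma ip_zero: "h \<in> H \<Longrightarrow> ip (\<lambda>u. 0) h = 0"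
  using ip_scale[of "\<lambda>u. 0" h 0] zero_mem by simp

lemma ip_sum:
  assumes "finite F" "\<And>e. e \<in> F \<Longrightarrow> f e \<in> H" "h \<in> H"
  shows "ip (\<lambda>u. \<Sum>e\<in>F. c e * f e u) h = (\<Sum>e\<in>F. c e * ip (f e) h)"
  using assms by (induction F rule: finite_induct) (auto simp: ip_zero ip_add ip_scale sum_mem scale_mem)

lemma ip_diff: "f \<in> H \<Longrightarrow> g \<in> H \<Longrightarrow> h \<in> H \<Longrightarrow> ip (\<lambda>u. f u - g u) h = ip f h - ip g h"
  using ip_add[of f "\<lambda>u. (-1) * g u" h] scale_mem[of g "-1"] ip_scale[of g h "-1"] by simp

lemma ip_add2: "f \<in> H \<Longrightarrow> g \<in> H \<Longrightarrow> h \<in> H \<Longrightarrow> ip h (\<lambda>u. f u + g u) = ip h f + ip h g"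
  by (subst (1 2 3) ip_sym) (auto simp: ip_add add_mem)

lemma ip_scale2: "f \<in> H \<Longrightarrow> h \<in> H \<Longrightarrow> ip h (\<lambda>u. c * f u) = cnj c * ip h f"
  by (subst (1 2) ip_sym) (auto simp: ip_scale scale_mem)

lemma ip_diff2: "f \<in> H \<Longrightarrow> g \<in> H \<Longrightarrow> h \<in> H \<Longrightarrow> ip h (\<lambda>u. f u - g u) = ip h f - ip h g"
  using ip_add2[of f "\<lambda>u. (-1) * g u" h] scale_mem[of g "-1"] ip_scale2[of g h "-1"] by simp

lemma ip_self: "f \<in> H \<Longrightarrow> ip f f = of_real (nsq f)"
  using ip_sym[of f f] by (simp add: nsq_def complex_eq_iff)

lemma nsq_nonneg: "f \<in> H \<Longrightarrow> 0 \<le> nsq f"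
  by (simp add: nsq_def ip_pos)

lemma nsq_scale:
  assumes "f \<in> H"
  shows "nsq (\<lambda>u. c * f u) = (norm c)\<^sup>2 * nsq f"
proof -
  have "ip (\<lambda>u. c * f u) (\<lambda>u. c * f u) = c * (cnj c * ip f f)"
    using assms by (simp only: ip_scale[OF assms scale_mem[OF assms]] ip_scale2)
  also have "\<dots> = of_real ((norm c)\<^sup>2) * of_real (nsq f)"
    unfolding complex_norm_square ip_self[OF assms] by (simp only: mult.assoc)
  finally show ?thesis unfolding nsq_def by (simp only: of_real_mult[symmetric] Re_complex_of_real)
qed

text \<open>From the parallelogram law. With squared norms this takes the place of the triangle
  inequality.\<close>

lemma nsq_add_le:
  assumes "f \<in> H" "g \<in> H"
  shows "nsq (\<lambda>u. f u + g u) \<le> 2 * nsq f + 2 * nsq g"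
proof -
  have "nsq (\<lambda>u. f u + g u) + nsq (\<lambda>u. f u - g u) = 2 * nsq f + 2 * nsq g"
    using assms by (simp add: nsq_def ip_add ip_add2 ip_diff ip_diff2 add_mem diff_mem)
  moreover have "0 \<le> nsq (\<lambda>u. f u - g u)" using assms by (intro nsq_nonneg diff_mem)
  ultimately show ?thesis by simp
qed

lemma orthonormal_mem: "orthonormal E \<Longrightarrow> e \<in> E \<Longrightarrow> e \<in> H"
  by (auto simp: orthonormal_def)

lemma orthonormal_ip: "orthonormal E \<Longrightarrow> e \<in> E \<Longrightarrow> e' \<in> E \<Longrightarrow> ip e e' = (if e = e' then 1 else 0)"
  by (auto simp: orthonormal_def)

lemma orthonormal_nsq: "orthonormal E \<Longrightarrow> e \<in> E \<Longrightarrow> nsq e = 1"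
  by (simp add: orthonormal_ip nsq_def)

lemma expansion_mem: "orthonormal E \<Longrightarrow> finite F \<Longrightarrow> F \<subseteq> E \<Longrightarrow> partial_expansion v F \<in> H"
  unfolding partial_expansion_def by (intro sum_mem) (auto dest: orthonormal_mem)

lemma ip_combination:
  assumes "orthonormal E" "finite F" "F \<subseteq> E" "e \<in> E"
  shows "ip (\<lambda>u. \<Sum>e\<in>F. c e * e u) e = (if e \<in> F then c e else 0)"
proof -
  have "ip (\<lambda>u. \<Sum>e\<in>F. c e * e u) e = (\<Sum>e'\<in>F. c e' * ip e' e)"
    using assms by (intro ip_sum) (auto dest: orthonormal_mem)
  also have "\<dots> = (\<Sum>e'\<in>F. if e' = e then c e' else 0)"
    using assms by (intro sum.cong refl) (auto simp: orthonormal_ip)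
  finally show ?thesis using assms by simp
qed

lemma nsq_combination:
  assumes "orthonormal E" "finite F" "F \<subseteq> E"
  shows "nsq (\<lambda>u. \<Sum>e\<in>F. c e * e u) = (\<Sum>e\<in>F. (norm (c e))\<^sup>2)"
proof -
  let ?S = "\<lambda>u. \<Sum>e\<in>F. c e * e u"
  have FH: "e \<in> H" if "e \<in> F" for e using assms that by (auto dest: orthonormal_mem)
  have S: "?S \<in> H" using FH assms by (intro sum_mem) auto
  have "ip ?S ?S = (\<Sum>e\<in>F. c e * ip e ?S)" by (rule ip_sum) (use FH S assms in auto)
  also have "\<dots> = (\<Sum>e\<in>F. of_real ((norm (c e))\<^sup>2))"
  proof (intro sum.cong refl)
    fix e assume e: "e \<in> F"
    have "ip e ?S = cnj (ip ?S e)" by (rule ip_sym) (use S FH e in auto)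
    also have "ip ?S e = c e" using ip_combination[OF assms, of e c] e assms by auto
    finally show "c e * ip e ?S = of_real ((norm (c e))\<^sup>2)" by (simp add: complex_norm_square del: of_real_power)
  qed
  finally show ?thesis unfolding nsq_def by (simp del: of_real_power)
qed

lemma nsq_residual:
  assumes "orthonormal E" "finite F" "F \<subseteq> E" "v \<in> H"
  shows "nsq (\<lambda>u. v u - partial_expansion v F u) = nsq v - (\<Sum>e\<in>F. (norm (ip v e))\<^sup>2)"
proof -
  let ?S = "partial_expansion v F"
  have S: "?S \<in> H" by (rule expansion_mem) fact+
  have FH: "e \<in> H" if "e \<in> F" for e using assms that by (auto dest: orthonormal_mem)
  have SS: "nsq ?S = (\<Sum>e\<in>F. (norm (ip v e))\<^sup>2)"
    unfolding partial_expansion_def by (rule nsq_combination) fact+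
  have "ip ?S v = (\<Sum>e\<in>F. ip v e * ip e v)"
    unfolding partial_expansion_def by (rule ip_sum) (use FH assms in auto)
  also have "\<dots> = (\<Sum>e\<in>F. of_real ((norm (ip v e))\<^sup>2))"
    using FH assms by (intro sum.cong refl) (subst ip_sym[of v], auto simp: complex_norm_square simp del: of_real_power)
  finally have Sv: "ip ?S v = of_real (nsq ?S)" by (simp only: SS of_real_sum)
  hence vS: "ip v ?S = of_real (nsq ?S)" using ip_sym[of ?S v] S assms by simp
  have d: "(\<lambda>u. v u - ?S u) \<in> H" by (rule diff_mem[OF assms(4) S])
  have "ip (\<lambda>u. v u - ?S u) (\<lambda>u. v u - ?S u) = ip v v - ip v ?S - (ip ?S v - ip ?S ?S)"
    unfolding ip_diff[OF assms(4) S d] ip_diff2[OF assms(4) S assms(4)] ip_diff2[OF assms(4) S S] ..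
  also have "\<dots> = of_real (nsq v - nsq ?S)"
    unfolding Sv vS ip_self[OF S] ip_self[OF assms(4)] by simp
  finally show ?thesis unfolding SS[symmetric] by (subst nsq_def) (simp only: Re_complex_of_real)
qed

lemma bessel:
  assumes "orthonormal E" "finite F" "F \<subseteq> E" "v \<in> H"
  shows "(\<Sum>e\<in>F. (norm (ip v e))\<^sup>2) \<le> nsq v"
  using nsq_residual[OF assms] nsq_nonneg[OF diff_mem[OF assms(4) expansion_mem[OF assms(1-3), of v]]] by simp

lemma ip_unit_le:
  assumes "orthonormal E" "e \<in> E" "v \<in> H"
  shows "(norm (ip v e))\<^sup>2 \<le> nsq v"
  using bessel[OF assms(1), of "{e}" v] assms by simp

lemma functional_add: "bounded_functional l C \<Longrightarrow> f \<in> H \<Longrightarrow> g \<in> H \<Longrightarrow> l (\<lambda>u. f u + g u) = l f + l g"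
  and functional_scale: "bounded_functional l C \<Longrightarrow> f \<in> H \<Longrightarrow> l (\<lambda>u. c * f u) = c * l f"
  and functional_bound: "bounded_functional l C \<Longrightarrow> f \<in> H \<Longrightarrow> norm (l f) \<le> C * sqrt (nsq f)"
  by (simp_all add: bounded_functional_def)

lemma functional_sum:
  assumes "bounded_functional l C" "finite F" "\<And>e. e \<in> F \<Longrightarrow> f e \<in> H"
  shows "l (\<lambda>u. \<Sum>e\<in>F. c e * f e u) = (\<Sum>e\<in>F. c e * l (f e))"
  using assms(2,3)
proof (induction F rule: finite_induct)
  case empty
  show ?case using functional_scale[OF assms(1) zero_mem, of 0] by simp
next
  case (insert x F)
  have "l (\<lambda>u. c x * f x u + (\<Sum>e\<in>F. c e * f e u)) = l (\<lambda>u. c x * f x u) + l (\<lambda>u. \<Sum>e\<in>F. c e * f e u)"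
    using insert by (intro functional_add[OF assms(1)] scale_mem sum_mem) auto
  moreover have "l (\<lambda>u. c x * f x u) = c x * l (f x)"
    using insert by (intro functional_scale[OF assms(1)]) auto
  ultimately show ?case using insert by simp
qed

lemma functional_diff:
  assumes "bounded_functional l C" "f \<in> H" "g \<in> H"
  shows "l (\<lambda>u. f u - g u) = l f - l g"
  using functional_add[OF assms(1,2) scale_mem[OF assms(3), of "-1"]] functional_scale[OF assms(1,3), of "-1"]
  by simp

text \<open>The dual of Bessel's inequality, obtained without a representing vector: the functional
  is tested on the combination of the \<open>e\<close> with coefficients \<open>cnj (l e)\<close>,
  where its value and the squared norm are both the sum \<open>?s\<close>, so \<open>?s\<close> is
  at most \<open>C * sqrt ?s\<close>.\<close>

lemma functional_square_sum:
  assumes l: "bounded_functional l C" and E: "orthonormal E" "finite F" "F \<subseteq> E"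
  shows "(\<Sum>e\<in>F. (norm (l e))\<^sup>2) \<le> C\<^sup>2"
proof -
  let ?s = "\<Sum>e\<in>F. (norm (l e))\<^sup>2"
  let ?S = "\<lambda>u. \<Sum>e\<in>F. cnj (l e) * e u"
  have FH: "e \<in> H" if "e \<in> F" for e using E that by (auto dest: orthonormal_mem)
  have S: "?S \<in> H" using FH E by (intro sum_mem) auto
  have s0: "0 \<le> ?s" by (intro sum_nonneg) auto
  have "l ?S = (\<Sum>e\<in>F. cnj (l e) * l e)" by (rule functional_sum[OF l]) (use E FH in auto)
  also have "\<dots> = of_real ?s" by (simp add: complex_norm_square mult.commute del: of_real_power)
  finally have "norm (l ?S) = norm (complex_of_real ?s)" by (simp only:)
  hence "?s = norm (l ?S)" using s0 by (simp only: norm_of_real abs_of_nonneg)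
  also have "\<dots> \<le> C * sqrt (nsq ?S)" by (rule functional_bound[OF l S])
  also have "nsq ?S = ?s" by (subst nsq_combination[OF E]) simp
  finally have "?s * ?s \<le> (C * sqrt ?s) * (C * sqrt ?s)" using s0 by (intro mult_mono) auto
  also have "\<dots> = C\<^sup>2 * ?s" using s0 by (simp add: power2_eq_square)
  finally have "?s * ?s \<le> C\<^sup>2 * ?s" .
  show ?thesis
  proof (cases "?s = 0")
    case False
    hence "0 < ?s" using s0 by simp
    thus ?thesis using \<open>?s * ?s \<le> C\<^sup>2 * ?s\<close> by (rule mult_right_le_imp_le[rotated])
  qed simp
qed

text \<open>This gives meaning to the choice operator in \<open>fredholm_det\<close>. For an
  orthonormal set that is maximal under inclusion, a vector orthogonal to it and of nonzero norm
  could be normalized and adjoined.\<close>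

lemma orthonormal_basis_exists: "\<exists>E. orthonormal_basis ip H E"
proof -
  have "\<exists>E\<in>{E. orthonormal E}. \<forall>X\<in>{E. orthonormal E}. E \<subseteq> X \<longrightarrow> X = E"
  proof (rule subset_Zorn')
    fix \<C> assume C: "subset.chain {E. orthonormal E} \<C>"
    show "\<Union>\<C> \<in> {E. orthonormal E}"
    proof (cases "\<C> = {}")
      case True thus ?thesis by (simp add: orthonormal_def)
    next
      case False
      have on: "orthonormal X" if "X \<in> \<C>" for X using C that by (auto simp: subset.chain_def)
      have "ip e e' = (if e = e' then 1 else 0)" if "e \<in> X" "X \<in> \<C>" "e' \<in> Y" "Y \<in> \<C>" for e e' X Y
      proof -
        have "X \<subseteq> Y \<or> Y \<subseteq> X" using C that by (auto simp: subset.chain_def)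
        thus ?thesis using that on orthonormal_ip by (metis subsetD)
      qed
      moreover have "\<Union>\<C> \<subseteq> H" using on unfolding orthonormal_def by blast
      ultimately show ?thesis unfolding orthonormal_def by blast
    qed
  qed
  then obtain E where E: "orthonormal E" "\<And>X. orthonormal X \<Longrightarrow> E \<subseteq> X \<Longrightarrow> X = E" by blast
  have "ip f f = 0" if f: "f \<in> H" "\<forall>e\<in>E. ip f e = 0" for f
  proof (rule ccontr)
    assume "ip f f \<noteq> 0"
    hence pos: "0 < nsq f" using nsq_nonneg[OF f(1)] ip_self[OF f(1)] by (cases "nsq f = 0") auto
    define g where "g = (\<lambda>u. complex_of_real (1 / sqrt (nsq f)) * f u)"
    have g: "g \<in> H" unfolding g_def by (rule scale_mem[OF f(1)])
    have "nsq g = 1" unfolding g_def using pos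
      by (subst nsq_scale[OF f(1)]) (simp add: norm_divide power_divide)
    hence gg: "ip g g = 1" using ip_self[OF g] by simp
    have ge: "ip g e = 0" if "e \<in> E" for e
      unfolding g_def ip_scale[OF f(1) orthonormal_mem[OF E(1) that]] using f(2) that by simp
    have eg: "ip e g = 0" if "e \<in> E" for e
      using ip_sym[OF g orthonormal_mem[OF E(1) that]] ge[OF that] by simp
    have "g \<notin> E" using ge[of g] gg by auto
    have "orthonormal (insert g E)"
      using E(1) g gg ge eg \<open>g \<notin> E\<close> unfolding orthonormal_def by auto
    from E(2)[OF this] \<open>g \<notin> E\<close> show False by auto
  qed
  hence "orthonormal_basis ip H E"
    using E(1) by (auto simp: orthonormal_basis_def orthonormal_def)
  thus ?thesis by blast
qed

lemma basis_orthonormal: "orthonormal_basis ip H E \<Longrightarrow> orthonormal E"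
  by (auto simp: orthonormal_basis_def orthonormal_def)

lemma expansion_diff:
  assumes "F \<subseteq> F'" "finite F'"
  shows "(\<lambda>u. partial_expansion v F' u - partial_expansion v F u) = (\<lambda>u. \<Sum>e\<in>F' - F. ip v e * e u)"
  unfolding partial_expansion_def using assms by (auto simp: sum_diff)

text \<open>The basis may have any cardinality, so a sequence of finite sets is chosen whose Bessel
  sums approach their supremum. The partial expansions along it are Cauchy; the difference between
  \<open>v\<close> and their limit is orthogonal to the whole basis and hence has norm zero. Larger
  finite sets only decrease the residual.\<close>

lemma parseval:
  assumes E: "orthonormal_basis ip H E" and v: "v \<in> H" and \<epsilon>: "0 < \<epsilon>"
  shows "\<exists>F0. finite F0 \<and> F0 \<subseteq> E \<and>
    (\<forall>F. finite F \<and> F0 \<subseteq> F \<and> F \<subseteq> E \<longrightarrow> nsq (\<lambda>u. v u - partial_expansion v F u) < \<epsilon>)"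
proof -
  note on = basis_orthonormal[OF E]
  define b where "b F = (\<Sum>e\<in>F. (norm (ip v e))\<^sup>2)" for F
  let ?FS = "{F. finite F \<and> F \<subseteq> E}"
  define \<sigma> where "\<sigma> = Sup (b ` ?FS)"
  have bdd: "bdd_above (b ` ?FS)"
    by (rule bdd_aboveI2[of _ _ "nsq v"]) (use bessel[OF on _ _ v] in \<open>auto simp: b_def\<close>)
  have b_le: "b F \<le> \<sigma>" if "finite F" "F \<subseteq> E" for F
    unfolding \<sigma>_def by (rule cSUP_upper[OF _ bdd]) (use that in auto)
  have b_mono: "b F \<le> b F'" if "F \<subseteq> F'" "finite F'" for F F'
    unfolding b_def using that by (intro sum_mono2) auto
  have "\<exists>G. finite G \<and> G \<subseteq> E \<and> \<sigma> - 1 / real (Suc n) < b G" for n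
  proof -
    have "\<exists>y\<in>b ` ?FS. \<sigma> - 1 / real (Suc n) < y"
      unfolding \<sigma>_def by (subst less_cSup_iff[symmetric]) (use bdd in auto)
    thus ?thesis by auto
  qed
  then obtain G where G: "\<And>n. finite (G n)" "\<And>n. G n \<subseteq> E" "\<And>n. \<sigma> - 1 / real (Suc n) < b (G n)" by metis
  define Fs where "Fs n = (\<Union>k\<le>n. G k)" for n
  have Fs: "finite (Fs n)" "Fs n \<subseteq> E" for n using G by (auto simp: Fs_def)
  have Fs_mono: "Fs m \<subseteq> Fs n" if "m \<le> n" for m n using that by (force simp: Fs_def)
  have b_Fs: "\<sigma> - 1 / real (Suc n) < b (Fs n)" for n
  proof -
    have "b (G n) \<le> b (Fs n)" by (rule b_mono) (use Fs in \<open>auto simp: Fs_def\<close>)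
    thus ?thesis using G(3)[of n] by linarith
  qed
  define S where "S n = partial_expansion v (Fs n)" for n
  have S: "S n \<in> H" for n unfolding S_def by (rule expansion_mem[OF on Fs])
  have Sdiff: "nsq (\<lambda>u. S m u - S n u) < 1 / real (Suc n)" if "n \<le> m" for m n
  proof -
    have "nsq (\<lambda>u. S m u - S n u) = b (Fs m - Fs n)"
      unfolding S_def expansion_diff[OF Fs_mono[OF that] Fs(1)] b_def
      by (rule nsq_combination[OF on]) (use Fs in auto)
    also have "\<dots> = b (Fs m) - b (Fs n)"
      unfolding b_def by (rule sum_diff[OF Fs(1) Fs_mono[OF that]])
    also have "\<dots> < 1 / real (Suc n)" using b_Fs[of n] b_le[OF Fs, of m] by linarith
    finally show ?thesis .
  qed
  have sym: "nsq (\<lambda>u. f u - g u) = nsq (\<lambda>u. g u - f u)" if "f \<in> H" "g \<in> H" for f g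
    using nsq_scale[of "\<lambda>u. g u - f u" "-1"] diff_mem[of g f] that by simp
  have "\<exists>w\<in>H. (\<lambda>n. nsq (\<lambda>u. S n u - w u)) \<longlonglongrightarrow> 0"
    unfolding nsq_def
  proof (rule complete[OF S])
    fix e :: real assume "0 < e"
    then obtain N where N: "1 / real (Suc N) < e" using nat_approx_posE by metis
    have "nsq (\<lambda>u. S m u - S n u) < e" if "N \<le> m" "N \<le> n" for m n
    proof -
      have le: "1 / real (Suc k) < e" if "N \<le> k" for k
      proof -
        have "1 / real (Suc k) \<le> 1 / real (Suc N)" using that by (intro divide_left_mono) auto
        thus ?thesis using N by linarith
      qed
      show ?thesis
      proof (cases "n \<le> m")
        case True thus ?thesis using Sdiff[OF True] le[OF that(2)] by linarith
      next
        case False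
        hence "nsq (\<lambda>u. S n u - S m u) < e" using Sdiff[of m n] le[OF that(1)] by simp
        thus ?thesis using sym[OF S S] by metis
      qed
    qed
    thus "\<exists>N. \<forall>m\<ge>N. \<forall>n\<ge>N. Re (ip (\<lambda>u. S m u - S n u) (\<lambda>u. S m u - S n u)) < e"
      unfolding nsq_def by blast
  qed
  then obtain w where w: "w \<in> H" "(\<lambda>n. nsq (\<lambda>u. S n u - w u)) \<longlonglongrightarrow> 0" by blast
  let ?r = "\<lambda>u. v u - w u"
  have r: "?r \<in> H" by (rule diff_mem[OF v w(1)])
  have inv0: "(\<lambda>n. 1 / real (Suc n)) \<longlonglongrightarrow> 0" using LIMSEQ_inverse_real_of_nat by (simp add: inverse_eq_divide)
  have "ip ?r e = 0" if e: "e \<in> E" for e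
  proof -
    have "(norm (ip ?r e))\<^sup>2 \<le> 2 * (1 / real (Suc n)) + 2 * nsq (\<lambda>u. S n u - w u)" for n
    proof -
      have eH: "e \<in> H" by (rule orthonormal_mem[OF on e])
      have "ip ?r e = ip (\<lambda>u. v u - S n u) e + ip (\<lambda>u. S n u - w u) e"
        using v w S eH by (simp add: ip_diff)
      hence "norm (ip ?r e) \<le> norm (ip (\<lambda>u. v u - S n u) e) + norm (ip (\<lambda>u. S n u - w u) e)"
        by (metis norm_triangle_ineq)
      hence "(norm (ip ?r e))\<^sup>2 \<le> (norm (ip (\<lambda>u. v u - S n u) e) + norm (ip (\<lambda>u. S n u - w u) e))\<^sup>2"
        by (intro power_mono) auto
      also have "\<dots> \<le> 2 * (norm (ip (\<lambda>u. v u - S n u) e))\<^sup>2 + 2 * (norm (ip (\<lambda>u. S n u - w u) e))\<^sup>2"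
        using sum_squares_bound[of "norm (ip (\<lambda>u. v u - S n u) e)" "norm (ip (\<lambda>u. S n u - w u) e)"]
        by (simp add: power2_sum)
      also have "(norm (ip (\<lambda>u. S n u - w u) e))\<^sup>2 \<le> nsq (\<lambda>u. S n u - w u)"
        by (rule ip_unit_le[OF on e]) (intro diff_mem S w)
      also have "(norm (ip (\<lambda>u. v u - S n u) e))\<^sup>2 \<le> 1 / real (Suc n)"
      proof -
        have "ip (\<lambda>u. v u - S n u) e = ip v e - ip (S n) e" using v S eH by (simp add: ip_diff)
        also have "ip (S n) e = (if e \<in> Fs n then ip v e else 0)"
          unfolding S_def partial_expansion_def by (rule ip_combination[OF on Fs e])
        finally have *: "ip (\<lambda>u. v u - S n u) e = (if e \<in> Fs n then 0 else ip v e)" by simp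
        show ?thesis
        proof (cases "e \<in> Fs n")
          case False
          \<comment> \<open>Adjoining \<open>e\<close> raises the Bessel sum of \<open>Fs n\<close>
            by the squared coefficient, but that sum is already within 1/(n+1) of its
            supremum.\<close>
          have "(norm (ip v e))\<^sup>2 + b (Fs n) = b (insert e (Fs n))" using False Fs by (simp add: b_def)
          also have "\<dots> \<le> \<sigma>" by (rule b_le) (use Fs e in auto)
          finally show ?thesis using * False b_Fs[of n] by simp
        qed (use * in simp)
      qed
      finally show ?thesis by linarith
    qed
    moreover have "(\<lambda>n. 2 * (1 / real (Suc n)) + 2 * nsq (\<lambda>u. S n u - w u)) \<longlonglongrightarrow> 2 * 0 + 2 * 0"
      by (intro tendsto_intros inv0 w(2))
    ultimately have "(norm (ip ?r e))\<^sup>2 \<le> 2 * 0 + 2 * 0"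
      by (intro LIMSEQ_le_const) auto
    thus ?thesis by simp
  qed
  hence "ip ?r ?r = 0" using E r by (auto simp: orthonormal_basis_def)
  hence r0: "nsq ?r = 0" by (simp add: nsq_def)
  have "(\<lambda>n. nsq (\<lambda>u. v u - S n u)) \<longlonglongrightarrow> 0"
  proof (rule tendsto_sandwich)
    show "\<forall>\<^sub>F n in sequentially. 0 \<le> nsq (\<lambda>u. v u - S n u)"
      by (intro always_eventually allI nsq_nonneg diff_mem v S)
    have "nsq (\<lambda>u. v u - S n u) \<le> 2 * nsq (\<lambda>u. S n u - w u)" for n
      using nsq_add_le[OF r diff_mem[OF w(1) S[of n]]] r0 sym[OF S w(1), of n] by simp
    thus "\<forall>\<^sub>F n in sequentially. nsq (\<lambda>u. v u - S n u) \<le> 2 * nsq (\<lambda>u. S n u - w u)"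
      by (intro always_eventually) auto
    show "(\<lambda>n. 2 * nsq (\<lambda>u. S n u - w u)) \<longlonglongrightarrow> 0" using tendsto_mult_right_zero[OF w(2)] .
  qed auto
  hence "eventually (\<lambda>n. nsq (\<lambda>u. v u - S n u) < \<epsilon>) sequentially"
    using \<epsilon> by (rule order_tendstoD)
  then obtain n where n: "nsq (\<lambda>u. v u - S n u) < \<epsilon>" by (auto simp: eventually_sequentially)
  show ?thesis
  proof (intro exI[of _ "Fs n"] conjI allI impI Fs)
    fix F assume F: "finite F \<and> Fs n \<subseteq> F \<and> F \<subseteq> E"
    have "nsq (\<lambda>u. v u - partial_expansion v F u) = nsq v - b F"
      unfolding b_def by (rule nsq_residual[OF on _ _ v]) (use F in auto)
    also have "\<dots> \<le> nsq v - b (Fs n)" using b_mono[of "Fs n" F] F by simp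
    also have "\<dots> = nsq (\<lambda>u. v u - S n u)"
      unfolding b_def S_def by (rule nsq_residual[OF on Fs v, symmetric])
    finally show "nsq (\<lambda>u. v u - partial_expansion v F u) < \<epsilon>" using n by linarith
  qed
qed

text \<open>The partial expansions converge to \<open>v\<close> in norm along the finite subsets of
  the basis, and a bounded functional carries this over to numbers.\<close>

lemma functional_has_sum:
  assumes E: "orthonormal_basis ip H E" and v: "v \<in> H" and l: "bounded_functional l C"
  shows "((\<lambda>e. l e * ip v e) has_sum l v) E"
  unfolding has_sum_def tendsto_iff
proof (intro allI impI)
  note on = basis_orthonormal[OF E]
  fix \<epsilon> :: real assume \<epsilon>: "0 < \<epsilon>"
  have C: "0 \<le> C" using l by (auto simp: bounded_functional_def)
  \<comment> \<open>The bound \<open>C\<close> may be zero, hence the division by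
    \<open>C + 1\<close>.\<close>
  define \<delta> where "\<delta> = (\<epsilon> / (C + 1))\<^sup>2"
  have "0 < \<delta>" using \<epsilon> C by (simp add: \<delta>_def)
  then obtain F0 where F0': "finite F0 \<and> F0 \<subseteq> E \<and>
      (\<forall>F. finite F \<and> F0 \<subseteq> F \<and> F \<subseteq> E \<longrightarrow> nsq (\<lambda>u. v u - partial_expansion v F u) < \<delta>)"
    by (rule exE[OF parseval[OF E v]])
  hence F0: "finite F0" "F0 \<subseteq> E" by simp_all
  show "\<forall>\<^sub>F F in finite_subsets_at_top E. dist (\<Sum>e\<in>F. l e * ip v e) (l v) < \<epsilon>"
    unfolding eventually_finite_subsets_at_top
  proof (intro exI[of _ F0] conjI allI impI F0(1,2))
    fix F assume F: "finite F \<and> F0 \<subseteq> F \<and> F \<subseteq> E"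
    let ?d = "\<lambda>u. v u - partial_expansion v F u"
    have d\<delta>: "nsq ?d < \<delta>" using F0' F by simp
    have P: "partial_expansion v F \<in> H" by (rule expansion_mem[OF on]) (use F in auto)
    have d: "?d \<in> H" by (rule diff_mem[OF v P])
    have "l (partial_expansion v F) = (\<Sum>e\<in>F. ip v e * l e)"
      unfolding partial_expansion_def by (rule functional_sum[OF l]) (use F orthonormal_mem[OF on] in auto)
    hence "dist (\<Sum>e\<in>F. l e * ip v e) (l v) = norm (l ?d)"
      using functional_diff[OF l v P] by (simp add: dist_norm norm_minus_commute mult.commute)
    also have "\<dots> \<le> C * sqrt (nsq ?d)" by (rule functional_bound[OF l d])
    also have "\<dots> \<le> C * sqrt \<delta>"
      using d\<delta> C by (intro mult_left_mono real_sqrt_le_mono) simp_all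
    also have "sqrt \<delta> = \<epsilon> / (C + 1)" using C \<epsilon> by (simp add: \<delta>_def)
    also have "C * (\<epsilon> / (C + 1)) < \<epsilon>" using C \<epsilon> by (simp add: field_simps)
    finally show "dist (\<Sum>e\<in>F. l e * ip v e) (l v) < \<epsilon>" .
  qed
qed

text \<open>For a nuclear operator \<open>A f = \<Sum>n. l\<^sub>n(f) v\<^sub>n\<close>, whatever orthonormal basis the definition
  of the determinant selects, Cauchy--Binet moves the exterior traces to the matrix \<open>l\<^sub>a(v\<^sub>b)\<close>.\<close>

theorem fredholm_det_nuclear:
  fixes A :: "('x \<Rightarrow> complex) \<Rightarrow> 'x \<Rightarrow> complex"
  assumes v: "\<And>n. v n \<in> H" "\<And>n. nsq (v n) \<le> (\<eta> n)\<^sup>2" "\<And>n. 0 \<le> \<eta> n"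
    and l: "\<And>n. bounded_functional (l n) (\<xi> n)"
    and s: "summable (\<lambda>n. \<xi> n * \<eta> n)"
    and A: "\<And>f. f \<in> H \<Longrightarrow> A f \<in> H"
    and Alim: "\<And>f. f \<in> H \<Longrightarrow> (\<lambda>N. nsq (\<lambda>u. A f u - (\<Sum>n<N. l n f * v n u))) \<longlonglongrightarrow> 0"
  shows "fredholm_det ip H A z = kernel_det (\<lambda>a b. l a (v b)) z"
proof -
  define E where "E = (SOME E. orthonormal_basis ip H E)"
  have E: "orthonormal_basis ip H E" unfolding E_def by (rule someI_ex[OF orthonormal_basis_exists])
  note on = basis_orthonormal[OF E]
  have \<xi>: "0 \<le> \<xi> n" for n using l[of n] by (simp add: bounded_functional_def)
  have EH: "e \<in> H" if "e \<in> E" for e using orthonormal_mem[OF on that] .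
  have Y1: "norm (ip (v n) e) \<le> \<eta> n" if "e \<in> E" for n e
    using ip_unit_le[OF on that v(1)[of n]] v(2)[of n] v(3)[of n] by (meson order_trans power2_le_imp_le)
  have X1: "norm (l n e) \<le> \<xi> n" if "e \<in> E" for n e
  proof -
    have "norm (l n e) \<le> \<xi> n * sqrt (nsq e)" by (rule functional_bound[OF l EH[OF that]])
    thus ?thesis using orthonormal_nsq[OF on that] by simp
  qed
  have K: "((\<lambda>n. l n e * ip (v n) e') has_sum ip (A e) e') UNIV" if e: "e \<in> E" "e' \<in> E" for e e'
  proof (rule norm_summable_imp_has_sum)
    show "summable (\<lambda>n. norm (l n e * ip (v n) e'))"
      by (rule summable_comparison_test'[OF s, where N=0])
         (use X1[OF e(1)] Y1[OF e(2)] \<xi> in \<open>auto simp: norm_mult intro!: mult_mono\<close>)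
    show "(\<lambda>n. l n e * ip (v n) e') sums ip (A e) e'"
      unfolding sums_def
    proof (rule LIM_zero_cancel, rule Lim_null_comparison)
      let ?S = "\<lambda>N u. \<Sum>n<N. l n e * v n u"
      let ?q = "\<lambda>N. nsq (\<lambda>u. A e u - ?S N u)"
      have "norm ((\<Sum>n<N. l n e * ip (v n) e') - ip (A e) e') \<le> sqrt (?q N)" for N
      proof -
        have S: "?S N \<in> H" using v(1) by (intro sum_mem) auto
        have "(\<Sum>n<N. l n e * ip (v n) e') = ip (?S N) e'"
          using v(1) EH[OF e(2)] by (intro ip_sum[symmetric]) auto
        hence "norm ((\<Sum>n<N. l n e * ip (v n) e') - ip (A e) e') = norm (ip (\<lambda>u. A e u - ?S N u) e')"
          using ip_diff[OF A[OF EH[OF e(1)]] S EH[OF e(2)]] by (simp add: norm_minus_commute)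
        also have "\<dots> \<le> sqrt (?q N)"
          by (rule real_le_rsqrt, rule ip_unit_le[OF on e(2)]) (intro diff_mem A EH e S)
        finally show ?thesis .
      qed
      thus "\<forall>\<^sub>F N in sequentially. norm ((\<Sum>n<N. l n e * ip (v n) e') - ip (A e) e') \<le> sqrt (?q N)"
        by (intro always_eventually) auto
      show "(\<lambda>N. sqrt (?q N)) \<longlonglongrightarrow> 0"
        using tendsto_real_sqrt[OF Alim[OF EH[OF e(1)]]] by simp
    qed
  qed
  have "infsum (subset_det (\<lambda>e e'. ip (A e) e')) (ksubsets E k) = infsum (subset_det (\<lambda>a b. l a (v b))) (ksubsets UNIV k)" for k
  \<comment> \<open>The two arrays can be contracted in two ways: over \<open>n\<close> they give
    the matrix of \<open>A\<close> in the basis \<open>E\<close>, over \<open>E\<close> they give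
    the matrix of the numbers \<open>l a (v b)\<close>.\<close>
  proof (rule cauchy_binet_infsum[where X="\<lambda>e n. l n e" and Y="\<lambda>n e. ip (v n) e" and \<xi>=\<xi> and \<eta>=\<eta>])
    fix n F assume F: "finite F" "F \<subseteq> E"
    show "(\<Sum>e\<in>F. (norm (l n e))\<^sup>2) \<le> (\<xi> n)\<^sup>2" by (rule functional_square_sum[OF l on F])
    show "(\<Sum>e\<in>F. (norm (ip (v n) e))\<^sup>2) \<le> (\<eta> n)\<^sup>2"
      using bessel[OF on F v(1)] v(2) order_trans by blast
  next
    show "(\<lambda>\<alpha>. \<xi> \<alpha> * \<eta> \<alpha>) summable_on UNIV"
      by (rule summable_nonneg_imp_summable_on[OF s]) (simp add: \<xi> v)
    show "((\<lambda>e. l \<alpha> e * ip (v \<beta>) e) has_sum l \<alpha> (v \<beta>)) E" for \<alpha> \<beta>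
      by (rule functional_has_sum[OF E v(1) l])
  qed (use K \<xi> v in auto)
  hence "exterior_trace ip E A k = subset_det_sum (\<lambda>a b. l a (v b)) UNIV k" for k
    unfolding exterior_trace_def subset_det_sum_def subset_det_def ksubsets_def by simp
  thus ?thesis
    unfolding fredholm_det_def kernel_det_def E_def[symmetric] Let_def by simp
qed

end

section \<open>Area under biholomorphic maps\<close>

text \<open>The change of variables estimate concerns differentiable maps of real coordinate space,
  so area in the complex plane is transported to pairs of real coordinates and back.\<close>

definition cart_complex :: "(real, 2) Finite_Cartesian_Product.vec \<Rightarrow> complex" where
  "cart_complex x = Complex (vec_nth x 1) (vec_nth x 2)"

definition complex_cart :: "complex \<Rightarrow> (real, 2) Finite_Cartesian_Product.vec" where
  "complex_cart z = vector [Re z, Im z]"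

lemma complex_cart_nth [simp]: "vec_nth (complex_cart z) 1 = Re z" "vec_nth (complex_cart z) 2 = Im z"
  by (simp_all add: complex_cart_def)

lemma cart_complex_sel [simp]: "Re (cart_complex x) = vec_nth x 1" "Im (cart_complex x) = vec_nth x 2"
  by (simp_all add: cart_complex_def)

lemma cart_complex_inverse [simp]: "cart_complex (complex_cart z) = z" "complex_cart (cart_complex x) = x"
  by (simp_all add: complex_eq_iff Finite_Cartesian_Product.vec_eq_iff forall_2)

lemma linear_cart_complex: "linear cart_complex" "linear complex_cart"
  by (auto intro!: linearI simp: complex_eq_iff Finite_Cartesian_Product.vec_eq_iff forall_2)

lemma bounded_linear_cart_complex: "bounded_linear cart_complex" "bounded_linear complex_cart"
  using linear_cart_complex by (simp_all add: linear_conv_bounded_linear)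

lemma measurable_cart_complex [measurable]:
  "cart_complex \<in> borel_measurable borel" "complex_cart \<in> borel_measurable borel"
  using bounded_linear_cart_complex
  by (auto intro!: borel_measurable_continuous_onI linear_continuous_on)

lemma lborel_complex_eq_distr: "lborel = distr lborel borel cart_complex"
proof (rule lborel_eqI)
  fix l u :: complex assume le: "\<And>b. b \<in> Basis \<Longrightarrow> l \<bullet> b \<le> u \<bullet> b"
  have lu: "Re l \<le> Re u" "Im l \<le> Im u"
    using le[of 1] le[of \<i>] by (simp_all add: Basis_complex_def)
  have v: "cart_complex -` box l u = box (complex_cart l) (complex_cart u)"
    by (auto simp: in_box_complex_iff mem_box_cart forall_2)
  have "emeasure (distr lborel borel cart_complex) (box l u) = emeasure lborel (box (complex_cart l) (complex_cart u))"
    by (subst emeasure_distr) (auto simp: v)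
  also have "\<dots> = (\<Prod>b\<in>Basis. (complex_cart u - complex_cart l) \<bullet> b)"
    by (rule emeasure_lborel_box) (use lu in \<open>auto simp: Basis_vec_def inner_axis UNIV_2\<close>)
  also have "(\<Prod>b\<in>Basis. (complex_cart u - complex_cart l) \<bullet> b) = (Re u - Re l) * (Im u - Im l)"
    by (simp add: Basis_vec_def inner_axis axis_eq_axis prod.UNION_disjoint UNIV_2)
  also have "\<dots> = (\<Prod>b\<in>Basis. (u - l) \<bullet> b)"
    by (simp add: Basis_complex_def)
  finally show "emeasure (distr lborel borel cart_complex) (box l u) = (\<Prod>b\<in>Basis. (u - l) \<bullet> b)" .
qed simp

lemma vimage_cart_complex: "cart_complex -` A = complex_cart ` A"
proof
  show "cart_complex -` A \<subseteq> complex_cart ` A"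
    by (metis cart_complex_inverse(2) image_eqI subsetI vimage_eq)
qed auto

lemma emeasure_complex_cart:
  assumes "A \<in> sets borel"
  shows "emeasure lborel A = emeasure lborel (complex_cart ` A)" "complex_cart ` A \<in> sets borel"
proof -
  show "emeasure lborel A = emeasure lborel (complex_cart ` A)"
    using assms by (subst lborel_complex_eq_distr, subst emeasure_distr) (auto simp: vimage_cart_complex)
  show "complex_cart ` A \<in> sets borel"
    using measurable_sets_borel[OF measurable_cart_complex(1) assms] by (simp add: vimage_cart_complex)
qed

text \<open>The Cauchy--Riemann equations in disguise: the Jacobian determinant of a holomorphic map
  is the squared modulus of its derivative.\<close>

lemma det_matrix_complex_mult:
  "Determinants.det (matrix (\<lambda>x. complex_cart (d * cart_complex x))) = (norm d)\<^sup>2"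
  by (simp add: det_2 matrix_def axis_def complex_norm power2_eq_square cmod_def)

lemma emeasure_holomorphic_image_le:
  assumes S: "open S" and h: "h holomorphic_on S" and L: "\<And>z. z \<in> S \<Longrightarrow> norm (deriv h z) \<le> L" "0 < L"
    and A: "A \<in> sets borel" "A \<subseteq> S" "h ` A \<in> sets borel"
  shows "emeasure lborel (h ` A) \<le> ennreal (L\<^sup>2) * emeasure lborel A"
proof (cases "emeasure lborel A = \<infinity>")
  \<comment> \<open>As \<open>L\<close> is positive, the right-hand side is infinite here; the
    estimate by the Jacobian concerns sets of finite measure.\<close>
  case True
  thus ?thesis using L(2) by (simp add: ennreal_mult_top)
next
  case False
  let ?B = "complex_cart ` A"
  let ?g = "\<lambda>x. complex_cart (h (cart_complex x))"
  let ?g' = "\<lambda>x y. complex_cart (deriv h (cart_complex x) * cart_complex y)"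
  have B: "?B \<in> sets borel" by (rule emeasure_complex_cart(2)[OF A(1)])
  have Bl: "?B \<in> lmeasurable"
    using False B emeasure_complex_cart(1)[OF A(1)]
    by (intro fmeasurableI) (auto simp: less_top)
  have gB: "?g ` ?B = complex_cart ` (h ` A)" by (auto simp: image_image)
  have inS: "cart_complex x \<in> S" if "x \<in> ?B" for x using that A(2) by auto
  have der: "(?g has_derivative ?g' x) (at x within ?B)" if "x \<in> ?B" for x
  proof -
    have "(h has_derivative (*) (deriv h (cart_complex x))) (at (cart_complex x))"
      using holomorphic_derivI[OF h S inS[OF that]] by (simp add: has_field_derivative_def)
    moreover have "(cart_complex has_derivative cart_complex) (at x within ?B)"
      by (rule bounded_linear_imp_has_derivative[OF bounded_linear_cart_complex(1)])
    ultimately have "((\<lambda>x. h (cart_complex x)) has_derivative (\<lambda>y. deriv h (cart_complex x) * cart_complex y)) (at x within ?B)"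
      by (rule has_derivative_compose[rotated])
    thus ?thesis by (rule bounded_linear.has_derivative[OF bounded_linear_cart_complex(2)])
  qed
  have cont: "continuous_on ?B (\<lambda>x. (norm (deriv h (cart_complex x)))\<^sup>2)"
  proof -
    have "continuous_on S (deriv h)"
      using holomorphic_deriv[OF h S] by (rule holomorphic_on_imp_continuous_on)
    moreover have "continuous_on ?B cart_complex"
      by (rule linear_continuous_on[OF bounded_linear_cart_complex(1)])
    ultimately have "continuous_on ?B (\<lambda>x. deriv h (cart_complex x))"
      by (rule continuous_on_compose2) (use inS in auto)
    thus ?thesis by (intro continuous_intros)
  qed
  have bnd: "(norm (deriv h (cart_complex x)))\<^sup>2 \<le> L\<^sup>2" if "x \<in> ?B" for x
    using L(1)[OF inS[OF that]] by (intro power_mono) auto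
  have int: "(\<lambda>x. (norm (deriv h (cart_complex x)))\<^sup>2) integrable_on ?B"
  proof (rule measurable_bounded_by_integrable_imp_integrable)
    show "(\<lambda>x. (norm (deriv h (cart_complex x)))\<^sup>2) \<in> borel_measurable (lebesgue_on ?B)"
      using Bl by (intro continuous_imp_measurable_on_sets_lebesgue cont) auto
    show "(\<lambda>_. L\<^sup>2) integrable_on ?B" using Bl by (rule integrable_on_const)
  qed (use bnd Bl in auto)
  have *: "?g ` ?B \<in> lmeasurable" "measure lebesgue (?g ` ?B) \<le> L\<^sup>2 * measure lebesgue ?B"
    using measurable_bounded_differentiable_image[OF Bl der, of "L\<^sup>2"]
      measure_bounded_differentiable_image[OF Bl der, of "L\<^sup>2"] int bnd
    by (simp_all only: det_matrix_complex_mult abs_power2)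
  have "emeasure lborel (h ` A) = emeasure lborel (?g ` ?B)"
    unfolding gB by (rule emeasure_complex_cart(1)[OF A(3)])
  also have "\<dots> = emeasure lebesgue (?g ` ?B)"
    unfolding gB using emeasure_complex_cart(2)[OF A(3)] by simp
  also have "\<dots> = ennreal (measure lebesgue (?g ` ?B))"
    using *(1) by (simp add: emeasure_eq_measure2)
  also have "\<dots> \<le> ennreal (L\<^sup>2 * measure lebesgue ?B)" by (rule ennreal_leI[OF *(2)])
  also have "\<dots> = ennreal (L\<^sup>2) * emeasure lebesgue ?B"
    using Bl by (simp add: ennreal_mult emeasure_eq_measure2)
  also have "emeasure lebesgue ?B = emeasure lborel A"
    using B emeasure_complex_cart(1)[OF A(1)] by simp
  finally show ?thesis .
qed

text \<open>Stated as an inequality of measures: the image of area on \<open>T\<close> under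
  \<open>k\<close> is at most L^2 times area on \<open>S\<close>, because preimages under
  \<open>k\<close> are images under \<open>h\<close>. This settles all integrands \<open>F\<close>
  at once.\<close>

lemma nn_integral_biholomorphic_le:
  assumes S: "open S" and T: "open T" and h: "h holomorphic_on S" and k: "continuous_on T k"
    and L: "\<And>z. z \<in> S \<Longrightarrow> norm (deriv h z) \<le> L" "0 < L"
    and hS: "\<And>z. z \<in> S \<Longrightarrow> h z \<in> T \<and> k (h z) = z" and kT: "\<And>z. z \<in> T \<Longrightarrow> k z \<in> S \<and> h (k z) = z"
    and F: "F \<in> borel_measurable borel"
  shows "(\<integral>\<^sup>+z\<in>T. F (k z) \<partial>lborel) \<le> ennreal (L\<^sup>2) * (\<integral>\<^sup>+z\<in>S. F z \<partial>lborel)"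
proof -
  let ?R = "restrict_space lborel T"
  let ?M = "distr ?R borel k"
  let ?N = "density lborel (\<lambda>z. ennreal (L\<^sup>2) * indicator S z)"
  have km: "k \<in> borel_measurable ?R"
    using borel_measurable_continuous_on_restrict[OF k] T
    by (simp add: measurable_def space_restrict_space sets_restrict_space)
  have [measurable]: "S \<in> sets borel" "T \<in> sets borel" using S T by auto
  have le: "?M \<le> ?N"
  proof (subst le_measure, simp, intro ballI)
    fix A assume "A \<in> sets ?M"
    hence A: "A \<in> sets borel" by simp
    have eq: "k -` A \<inter> T = h ` (A \<inter> S)"
    proof (intro equalityI subsetI)
      fix z assume z: "z \<in> k -` A \<inter> T"
      hence "h (k z) = z" "k z \<in> A \<inter> S" using kT[of z] by simp_all
      thus "z \<in> h ` (A \<inter> S)" by (metis image_eqI)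
    next
      fix z assume "z \<in> h ` (A \<inter> S)"
      then obtain x where "x \<in> A \<inter> S" "z = h x" by (rule imageE)
      thus "z \<in> k -` A \<inter> T" using hS[of x] by simp
    qed
    have "k -` A \<inter> space ?R \<in> sets ?R" using km A by (auto dest: measurable_sets)
    hence hA: "h ` (A \<inter> S) \<in> sets borel"
      by (auto simp: eq[symmetric] space_restrict_space sets_restrict_space_iff)
    have "emeasure ?M A = emeasure ?R (k -` A \<inter> space ?R)" using A km by (intro emeasure_distr) auto
    also have "\<dots> = emeasure lborel (h ` (A \<inter> S))"
      using hA hS by (subst emeasure_restrict_space) (auto simp: space_restrict_space eq)
    also have "\<dots> \<le> ennreal (L\<^sup>2) * emeasure lborel (A \<inter> S)"
      by (rule emeasure_holomorphic_image_le[OF S h L]) (use A hA in auto)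
    also have "\<dots> = (\<integral>\<^sup>+z. ennreal (L\<^sup>2) * indicator (A \<inter> S) z \<partial>lborel)"
      using A by (subst nn_integral_cmult) auto
    also have "\<dots> = emeasure ?N A"
      using A by (subst emeasure_density) (auto intro!: nn_integral_cong simp: indicator_def)
    finally show "emeasure ?M A \<le> emeasure ?N A" .
  qed
  have "(\<integral>\<^sup>+z\<in>T. F (k z) \<partial>lborel) = (\<integral>\<^sup>+z. F (k z) \<partial>?R)"
    by (subst nn_integral_restrict_space) auto
  also have "\<dots> = (\<integral>\<^sup>+z. F z \<partial>?M)" using km F by (subst nn_integral_distr) auto
  also have "\<dots> \<le> (\<integral>\<^sup>+z. F z \<partial>?N)" by (rule nn_integral_mono_measure[OF _ le]) simp
  also have "\<dots> = (\<integral>\<^sup>+z. ennreal (L\<^sup>2) * (F z * indicator S z) \<partial>lborel)"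
    using F by (subst nn_integral_density) (auto intro!: nn_integral_cong simp: mult_ac)
  also have "\<dots> = ennreal (L\<^sup>2) * (\<integral>\<^sup>+z\<in>S. F z \<partial>lborel)"
    using F by (subst nn_integral_cmult) auto
  finally show ?thesis .
qed

text \<open>The estimate \<open>nn_integral_biholomorphic_le\<close> has constant 1 for a rotation
  and for its inverse, so the two inequalities combine to an equality.\<close>

lemma lborel_rotation:
  assumes w: "norm w = 1"
  shows "distr lborel borel (\<lambda>z. w * z) = (lborel :: complex measure)"
proof (rule measure_eqI)
  fix A assume "A \<in> sets (distr lborel borel (\<lambda>z. w * z))"
  hence A: "A \<in> sets borel" by simp
  have w0: "w \<noteq> 0" using w by auto
  have le: "(\<integral>\<^sup>+z. F (v * z) \<partial>lborel) \<le> (\<integral>\<^sup>+z. F z \<partial>lborel)"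
    if v: "norm v = 1" and F: "F \<in> borel_measurable borel" for v and F :: "complex \<Rightarrow> ennreal"
  proof -
    have v0: "v \<noteq> 0" using v by auto
    have d: "deriv (\<lambda>z. z / v) z = 1 / v" for z
      by (rule DERIV_imp_deriv) (auto intro!: derivative_eq_intros simp: v0)
    show ?thesis
      using nn_integral_biholomorphic_le[of UNIV UNIV "\<lambda>z. z / v" "\<lambda>z. v * z" 1 F] F v v0
      by (simp add: d norm_divide holomorphic_intros continuous_intros)
  qed
  have e: "emeasure (distr lborel borel (\<lambda>z. w * z)) A = (\<integral>\<^sup>+z. indicator A (w * z) \<partial>lborel)"
  proof -
    have "emeasure (distr lborel borel (\<lambda>z. w * z)) A = emeasure lborel ((\<lambda>z. w * z) -` A)"
      using A by (subst emeasure_distr) auto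
    also have "\<dots> = (\<integral>\<^sup>+z. indicator ((\<lambda>z. w * z) -` A) z \<partial>lborel)"
      using measurable_sets_borel[of "\<lambda>z. w * z" borel A] A by (subst nn_integral_indicator) auto
    finally show ?thesis by (simp add: indicator_vimage[abs_def] o_def)
  qed
  have "(\<integral>\<^sup>+z. indicator A (w * z) \<partial>lborel) \<le> (\<integral>\<^sup>+z. indicator A z \<partial>lborel)"
    by (rule le[OF w]) (use A in auto)
  moreover have "(\<integral>\<^sup>+z. indicator A (w * (inverse w * z)) \<partial>lborel) \<le> (\<integral>\<^sup>+z. indicator A (w * z) \<partial>lborel)"
    by (rule le[of "inverse w"]) (use A w in \<open>auto simp: norm_inverse\<close>)
  ultimately show "emeasure (distr lborel borel (\<lambda>z. w * z)) A = emeasure lborel A"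
    unfolding e using A w0 by (simp add: mult.assoc[symmetric])
qed simp

section \<open>Bergman spaces\<close>

text \<open>Rotation by an n-th root of -1 preserves the ball and the area but changes the sign of
  the integrand.\<close>

lemma set_integral_power_ball:
  assumes "0 < n"
  shows "(\<integral>w\<in>ball 0 r. w ^ n \<partial>lborel) = (0 :: complex)"
proof -
  define \<omega> where "\<omega> = cis (pi / real n)"
  define F where "F = (\<lambda>w::complex. indicator (ball 0 r) w *\<^sub>R w ^ n)"
  have \<omega>1: "norm \<omega> = 1" by (simp add: \<omega>_def)
  have "\<omega> ^ n = cis (real n * (pi / real n))" unfolding \<omega>_def by (rule Complex.DeMoivre)
  also have "real n * (pi / real n) = pi" using assms by simp
  finally have "\<omega> ^ n = -1" by simp
  note \<omega> = \<omega>1 this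
  have F: "F \<in> borel_measurable borel" unfolding F_def by (intro borel_measurable_continuous_on_indicator continuous_intros) auto
  have "integral\<^sup>L lborel F = integral\<^sup>L (distr lborel borel (\<lambda>w. \<omega> * w)) F"
    by (simp only: lborel_rotation[OF \<omega>(1)])
  also have "\<dots> = integral\<^sup>L lborel (\<lambda>w. F (\<omega> * w))"
    using F by (intro integral_distr) auto
  also have "(\<lambda>w. F (\<omega> * w)) = (\<lambda>w. - F w)"
    using \<omega> by (auto simp: F_def fun_eq_iff indicator_def norm_mult power_mult_distrib)
  finally have "integral\<^sup>L lborel F = 0" by simp
  thus ?thesis by (simp add: set_lebesgue_integral_def F_def)
qed

text \<open>The power series around the centre is integrated termwise; every term except the
  constant one vanishes by \<open>set_integral_power_ball\<close>.\<close>

lemma area_mean_value: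
  fixes f :: "complex \<Rightarrow> complex"
  assumes f: "f holomorphic_on ball c R" and r: "0 < r" "r < R"
  shows "(\<integral>z\<in>ball c r. f z \<partial>lborel) = f c * measure lborel (ball c r)"
proof -
  define a where "a n = (deriv ^^ n) f c / fact n" for n
  define B where "B = (ball 0 r :: complex set)"
  have emB: "emeasure lborel B < \<infinity>" unfolding B_def by (rule emeasure_bounded_finite) simp
  have ps: "(\<lambda>n. a n * w ^ n) sums f (c + w)" if "w \<in> ball 0 R" for w
    using holomorphic_power_series[OF f, of "c + w"] that by (simp add: a_def dist_norm)
  \<comment> \<open>Convergence at the larger radius \<open>r'\<close> yields absolute convergence
    at \<open>r\<close>, hence the constant majorant \<open>M\<close> on the smaller ball.\<close>
  obtain r' where r': "r < r'" "r' < R" using dense r(2) by blast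
  have "summable (\<lambda>n. norm (a n * of_real r ^ n))"
    by (rule powser_insidea[OF sums_summable[OF ps[of "of_real r'"]]]) (use r r' in auto)
  hence sm: "summable (\<lambda>n. norm (a n) * r ^ n)" using r by (simp add: norm_mult norm_power)
  define M where "M = (\<Sum>n. norm (a n) * r ^ n)"
  let ?s = "\<lambda>N w. indicator B w *\<^sub>R (\<Sum>n<N. a n * w ^ n)"
  have int_pow: "integrable lborel (\<lambda>w. indicator B w *\<^sub>R w ^ n)" for n
  proof (rule Bochner_Integration.integrable_bound)
    show "integrable lborel (\<lambda>w. indicator B w *\<^sub>R (r ^ n))"
      using emB by (intro integrable_scaleR_left integrable_real_indicator) (auto simp: B_def)
    show "AE w in lborel. norm (indicator B w *\<^sub>R w ^ n) \<le> norm (indicator B w *\<^sub>R r ^ n)"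
      using r by (intro always_eventually) (auto simp: indicator_def B_def norm_power intro!: power_mono)
  qed (auto simp: B_def intro!: borel_measurable_continuous_on_indicator continuous_intros)
  have intB: "integrable lborel (\<lambda>w. indicator B w *\<^sub>R M)"
    using emB by (intro integrable_scaleR_left integrable_real_indicator) (auto simp: B_def)
  have meas_f: "(\<lambda>z. indicator (ball c r) z *\<^sub>R f z) \<in> borel_measurable borel"
  proof (rule borel_measurable_continuous_on_indicator)
    show "continuous_on (ball c r) f"
      by (rule continuous_on_subset[OF holomorphic_on_imp_continuous_on[OF f] subset_ball]) (use r in simp)
  qed simp
  have lim: "(\<lambda>N. integral\<^sup>L lborel (?s N)) \<longlonglongrightarrow> integral\<^sup>L lborel (\<lambda>w. indicator B w *\<^sub>R f (c + w))"
  proof (rule integral_dominated_convergence[where w="\<lambda>w. indicator B w *\<^sub>R M"])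
    have "(\<lambda>w. indicator (ball c r) (c + w) *\<^sub>R f (c + w)) \<in> borel_measurable borel"
      by (rule measurable_compose[OF _ meas_f]) simp
    moreover have "indicator (ball c r) (c + w) = (indicator B w :: real)" for w
      by (simp add: indicator_def B_def dist_norm)
    ultimately show "(\<lambda>w. indicator B w *\<^sub>R f (c + w)) \<in> borel_measurable lborel" by simp
    show "?s N \<in> borel_measurable lborel" for N
      by (auto simp: B_def intro!: borel_measurable_continuous_on_indicator continuous_intros)
    show "AE w in lborel. (\<lambda>N. ?s N w) \<longlonglongrightarrow> indicator B w *\<^sub>R f (c + w)"
    proof (intro always_eventually allI)
      fix w show "(\<lambda>N. ?s N w) \<longlonglongrightarrow> indicator B w *\<^sub>R f (c + w)"
        using ps[of w] r by (cases "w \<in> B") (auto simp: B_def sums_def)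
    qed
    show "AE w in lborel. norm (?s N w) \<le> indicator B w *\<^sub>R M" for N
    proof (intro always_eventually allI)
      fix w show "norm (?s N w) \<le> indicator B w *\<^sub>R M"
      proof (cases "w \<in> B")
        case True
        have "norm (\<Sum>n<N. a n * w ^ n) \<le> (\<Sum>n<N. norm (a n) * r ^ n)"
          using True by (intro sum_norm_le) (auto simp: norm_mult norm_power B_def intro!: mult_left_mono power_mono)
        also have "\<dots> \<le> M" unfolding M_def using r by (intro sum_le_suminf sm) auto
        finally show ?thesis using True by simp
      qed simp
    qed
  qed (rule intB)
  \<comment> \<open>Partial sums with at least one term contain the constant coefficient, so the
    value is the same for all of them; the empty sum is avoided by the shift.\<close>
  have const: "integral\<^sup>L lborel (?s (Suc N)) = f c * measure lborel (ball c r)" for N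
  proof -
    have "?s (Suc N) = (\<lambda>w. \<Sum>n<Suc N. a n * (indicator B w *\<^sub>R w ^ n))"
      by (simp only: scaleR_sum_right mult_scaleR_right)
    hence "integral\<^sup>L lborel (?s (Suc N)) = (\<Sum>n<Suc N. integral\<^sup>L lborel (\<lambda>w. a n * (indicator B w *\<^sub>R w ^ n)))"
      by (simp only:) (rule Bochner_Integration.integral_sum, intro integrable_mult_right int_pow)
    also have "\<dots> = (\<Sum>n<Suc N. a n * integral\<^sup>L lborel (\<lambda>w. indicator B w *\<^sub>R w ^ n))"
      by (simp only: integral_mult_right_zero)
    also have "\<dots> = (\<Sum>n<Suc N. if n = 0 then f c * measure lborel (ball c r) else 0)"
    proof (intro sum.cong refl)
      fix n assume "n \<in> {..<Suc N}"
      have "measure lborel (ball (0::complex) r) = measure lborel (ball c r)"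
        using content_ball[of r "0::complex"] content_ball[of r c] r by simp
      hence "integral\<^sup>L lborel (\<lambda>w. indicator B w *\<^sub>R (w::complex) ^ n) = (if n = 0 then measure lborel (ball c r) else 0)"
        using set_integral_power_ball[of n r] emB
        by (auto simp: set_lebesgue_integral_def B_def scaleR_conv_of_real)
      thus "a n * integral\<^sup>L lborel (\<lambda>w. indicator B w *\<^sub>R w ^ n) = (if n = 0 then f c * measure lborel (ball c r) else 0)"
        by (simp add: a_def)
    qed
    also have "\<dots> = f c * measure lborel (ball c r)" by (subst sum.delta) auto
    finally show ?thesis .
  qed
  have "(\<lambda>N::nat. f c * measure lborel (ball c r)) \<longlonglongrightarrow> integral\<^sup>L lborel (\<lambda>w. indicator B w *\<^sub>R f (c + w))"
    using LIMSEQ_Suc[OF lim] unfolding const .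
  hence "integral\<^sup>L lborel (\<lambda>w. indicator B w *\<^sub>R f (c + w)) = f c * measure lborel (ball c r)"
    by (simp only: LIMSEQ_const_iff)
  moreover have "(\<integral>z\<in>ball c r. f z \<partial>lborel) = integral\<^sup>L (distr lborel borel ((+) c)) (\<lambda>z. indicator (ball c r) z *\<^sub>R f z)"
    by (simp only: lborel_distr_plus set_lebesgue_integral_def)
  moreover have "\<dots> = integral\<^sup>L lborel (\<lambda>w. indicator (ball c r) (c + w) *\<^sub>R f (c + w))"
    using meas_f by (intro integral_distr) auto
  moreover have "indicator (ball c r) (c + w) = (indicator B w :: real)" for w
    by (simp add: indicator_def B_def dist_norm)
  ultimately show ?thesis by simp
qed

section \<open>Norm, point evaluation and completeness\<close>

definition square_norm :: "complex set \<Rightarrow> (complex \<Rightarrow> complex) \<Rightarrow> real" where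
  "square_norm D f = (\<integral>z\<in>D. (norm (f z))\<^sup>2 \<partial>lborel)"

lemma bergman_inner_self: "bergman_inner D f f = of_real (square_norm D f)"
  unfolding bergman_inner_def square_norm_def set_integral_complex_of_real[symmetric]
  by (simp only: complex_norm_square)

lemma square_norm_nonneg: "0 \<le> square_norm D f"
  unfolding square_norm_def set_lebesgue_integral_def by (rule integral_nonneg_AE) auto

lemma bergman_spaceD:
  assumes "f \<in> bergman_space D"
  shows "f holomorphic_on D" "set_integrable lborel D (\<lambda>u. (norm (f u))\<^sup>2)" "\<And>u. u \<notin> D \<Longrightarrow> f u = 0"
  using assms by (auto simp: bergman_space_def)

lemma set_borel_measurable_continuous:
  assumes "open D" "continuous_on D (f :: complex \<Rightarrow> 'a :: {real_normed_vector, second_countable_topology})"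
  shows "set_borel_measurable lborel D f"
  using assms unfolding set_borel_measurable_def
  by (auto intro!: borel_measurable_continuous_on_indicator)

lemma set_integrable_square_bound:
  assumes D: "open D" and f: "f \<in> bergman_space D" and g: "g \<in> bergman_space D"
    and k: "continuous_on D k" and b: "\<And>z. z \<in> D \<Longrightarrow> norm (k z) \<le> C * ((norm (f z))\<^sup>2 + (norm (g z))\<^sup>2)"
  shows "set_integrable lborel D (k :: complex \<Rightarrow> 'a :: {banach, second_countable_topology})"
proof (rule set_integrable_bound)
  show "set_integrable lborel D (\<lambda>z. C * ((norm (f z))\<^sup>2 + (norm (g z))\<^sup>2))"
    using bergman_spaceD(2)[OF f] bergman_spaceD(2)[OF g]
    by (intro set_integrable_mult_right set_integral_add) auto
  show "set_borel_measurable lborel D k" by (rule set_borel_measurable_continuous[OF D k])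
  show "AE x in lborel. x \<in> D \<longrightarrow> norm (k x) \<le> norm (C * ((norm (f x))\<^sup>2 + (norm (g x))\<^sup>2))"
    using b by (intro always_eventually) (metis abs_ge_self order_trans real_norm_def)
qed

lemma norm_add_square_le: "(norm (a + b))\<^sup>2 \<le> 2 * ((norm a)\<^sup>2 + (norm (b :: complex))\<^sup>2)"
proof -
  have "(norm (a + b))\<^sup>2 \<le> (norm a + norm b)\<^sup>2" by (intro power_mono norm_triangle_ineq) auto
  also have "\<dots> \<le> 2 * ((norm a)\<^sup>2 + (norm b)\<^sup>2)"
    using sum_squares_bound[of "norm a" "norm b"] by (simp add: power2_sum)
  finally show ?thesis .
qed

lemma bergman_cont: "f \<in> bergman_space D \<Longrightarrow> continuous_on D f"
  using bergman_spaceD(1) holomorphic_on_imp_continuous_on by blast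

lemma bergman_space_add:
  assumes "open D" "f \<in> bergman_space D" "g \<in> bergman_space D"
  shows "(\<lambda>z. f z + g z) \<in> bergman_space D"
proof -
  have "set_integrable lborel D (\<lambda>z. (norm (f z + g z))\<^sup>2)"
    by (rule set_integrable_square_bound[OF assms, where C=2])
       (use assms bergman_cont norm_add_square_le in \<open>auto intro!: continuous_intros\<close>)
  thus ?thesis using assms bergman_spaceD[OF assms(2)] bergman_spaceD[OF assms(3)]
    by (auto simp: bergman_space_def intro: holomorphic_on_add)
qed

lemma bergman_space_scale:
  assumes "f \<in> bergman_space D"
  shows "(\<lambda>z. c * f z) \<in> bergman_space D"
  using bergman_spaceD[OF assms]
  by (auto simp: bergman_space_def norm_mult power_mult_distrib intro!: holomorphic_intros)

lemma bergman_space_zero: "(\<lambda>z. 0) \<in> bergman_space D"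
  by (simp add: bergman_space_def set_integrable_def)

lemma bergman_space_diff:
  assumes "open D" "f \<in> bergman_space D" "g \<in> bergman_space D"
  shows "(\<lambda>z. f z - g z) \<in> bergman_space D"
  using bergman_space_add[OF assms(1,2) bergman_space_scale[OF assms(3), of "-1"]] by simp

lemma bergman_inner_integrable:
  assumes "open D" "f \<in> bergman_space D" "g \<in> bergman_space D"
  shows "set_integrable lborel D (\<lambda>z. f z * cnj (g z))"
proof (rule set_integrable_square_bound[OF assms, where C=1])
  fix z
  show "norm (f z * cnj (g z)) \<le> 1 * ((norm (f z))\<^sup>2 + (norm (g z))\<^sup>2)"
  proof -
    have "0 \<le> norm (f z) * norm (g z)" by simp
    hence "norm (f z) * norm (g z) \<le> 2 * norm (f z) * norm (g z)" by simp
    also have "\<dots> \<le> (norm (f z))\<^sup>2 + (norm (g z))\<^sup>2" by (rule sum_squares_bound)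
    finally show ?thesis by (simp only: norm_mult complex_mod_cnj mult_1_left)
  qed
qed (use assms bergman_cont in \<open>auto intro!: continuous_intros\<close>)

text \<open>The mean value property is applied to the square of \<open>f\<close>, which leads
  directly to the integral of |f|^2 and spares Cauchy--Schwarz. Measuring the ball around 0 makes
  the constant independent of the point.\<close>

lemma bergman_point_bound:
  assumes D: "open D" and f: "f \<in> bergman_space D" and b: "ball c R \<subseteq> D" and r: "0 < r" "r < R"
  shows "(norm (f c))\<^sup>2 * measure lborel (ball (0::complex) r) \<le> square_norm D f"
proof -
  have sub: "ball c r \<subseteq> D" using b r by auto
  have h2: "(\<lambda>z. (f z)\<^sup>2) holomorphic_on ball c R"
    using bergman_spaceD(1)[OF f] b by (intro holomorphic_intros) (rule holomorphic_on_subset)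
  have int: "set_integrable lborel (ball c r) (\<lambda>z. (norm (f z))\<^sup>2)"
    using set_integrable_subset[OF bergman_spaceD(2)[OF f] _ sub] by simp
  have int2: "set_integrable lborel (ball c r) (\<lambda>z. (f z)\<^sup>2)"
  proof (rule set_integrable_bound[OF int])
    show "set_borel_measurable lborel (ball c r) (\<lambda>z. (f z)\<^sup>2)"
      using bergman_cont[OF f] sub
      by (intro set_borel_measurable_continuous continuous_intros) (auto intro: continuous_on_subset)
  qed (auto simp: norm_power)
  have "measure lborel (ball (0::complex) r) = measure lborel (ball c r)"
    using content_ball[of r "0::complex"] content_ball[of r c] r by simp
  hence "(norm (f c))\<^sup>2 * measure lborel (ball (0::complex) r) = norm ((f c)\<^sup>2 * measure lborel (ball c r))"
    by (simp add: norm_mult norm_power)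
  also have "\<dots> = norm (\<integral>z\<in>ball c r. (f z)\<^sup>2 \<partial>lborel)"
    by (subst area_mean_value[OF h2 r]) simp
  also have "\<dots> \<le> (\<integral>z\<in>ball c r. norm ((f z)\<^sup>2) \<partial>lborel)"
    using int2 unfolding set_lebesgue_integral_def set_integrable_def
    by (intro order_trans[OF integral_norm_bound]) simp
  also have "\<dots> = (\<integral>z\<in>ball c r. (norm (f z))\<^sup>2 \<partial>lborel)" by (simp add: norm_power)
  also have "\<dots> \<le> square_norm D f"
    unfolding square_norm_def set_lebesgue_integral_def
    using int bergman_spaceD(2)[OF f] sub unfolding set_integrable_def
    by (intro integral_mono) (auto simp: indicator_def)
  finally show ?thesis .
qed

lemma measure_ball_pos: "0 < r \<Longrightarrow> 0 < measure lborel (ball (0::complex) r)"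
  by (simp add: content_ball_pos)

text \<open>Fatou's lemma. It is used for differences \<open>fs n - fs m\<close> with m tending to
  infinity, where it shows both that the limit is square integrable and how far it is from
  \<open>fs n\<close>.\<close>

lemma bergman_fatou:
  assumes D: "open D" and fs: "\<And>n. fs n \<in> bergman_space D" and g: "g holomorphic_on D" "\<And>z. z \<notin> D \<Longrightarrow> g z = 0"
    and lim: "\<And>z. z \<in> D \<Longrightarrow> (\<lambda>n. fs n z) \<longlonglongrightarrow> g z"
    and b: "\<And>n. N \<le> n \<Longrightarrow> square_norm D (fs n) \<le> e"
  shows "g \<in> bergman_space D \<and> square_norm D g \<le> e"
proof -
  let ?F = "\<lambda>f z. indicator D z *\<^sub>R (norm (f z))\<^sup>2"
  have m: "?F f \<in> borel_measurable lborel" if "continuous_on D f" for f :: "complex \<Rightarrow> complex"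
    using set_borel_measurable_continuous[OF D continuous_on_power[OF continuous_on_norm[OF that]], of 2]
    unfolding set_borel_measurable_def .
  have mf: "?F (fs n) \<in> borel_measurable lborel" for n by (rule m[OF bergman_cont[OF fs]])
  have mg: "?F g \<in> borel_measurable lborel" by (rule m[OF holomorphic_on_imp_continuous_on[OF g(1)]])
  have int: "integrable lborel (?F (fs n))" for n
    using bergman_spaceD(2)[OF fs] by (simp add: set_integrable_def)
  have e: "(\<integral>\<^sup>+z. ennreal (?F (fs n) z) \<partial>lborel) \<le> ennreal e" if "N \<le> n" for n
  proof -
    have "(\<integral>\<^sup>+z. ennreal (?F (fs n) z) \<partial>lborel) = ennreal (square_norm D (fs n))"
      unfolding square_norm_def set_lebesgue_integral_def
      by (rule nn_integral_eq_integral[OF int]) auto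
    thus ?thesis using b[OF that] by (simp add: ennreal_leI)
  qed
  have e0: "0 \<le> e" using b[of N] square_norm_nonneg[of D "fs N"] by simp
  have "ennreal (?F g z) = liminf (\<lambda>n. ennreal (?F (fs n) z))" for z
  proof -
    have "(\<lambda>n. ?F (fs n) z) \<longlonglongrightarrow> ?F g z"
      using lim[of z] by (cases "z \<in> D") (auto intro!: tendsto_intros)
    hence "(\<lambda>n. ennreal (?F (fs n) z)) \<longlonglongrightarrow> ennreal (?F g z)" by (rule tendsto_ennrealI)
    thus ?thesis by (rule lim_imp_Liminf[OF trivial_limit_sequentially, symmetric])
  qed
  hence "(\<integral>\<^sup>+z. ennreal (?F g z) \<partial>lborel) = (\<integral>\<^sup>+z. liminf (\<lambda>n. ennreal (?F (fs n) z)) \<partial>lborel)" by simp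
  also have "\<dots> \<le> liminf (\<lambda>n. \<integral>\<^sup>+z. ennreal (?F (fs n) z) \<partial>lborel)"
    using mf by (intro nn_integral_liminf) auto
  also have "\<dots> \<le> ennreal e"
  proof (rule Liminf_le)
    show "\<forall>\<^sub>F n in sequentially. (\<integral>\<^sup>+z. ennreal (?F (fs n) z) \<partial>lborel) \<le> ennreal e"
      using eventually_ge_at_top[of N] by eventually_elim (rule e)
  qed simp
  finally have le: "(\<integral>\<^sup>+z. ennreal (?F g z) \<partial>lborel) \<le> ennreal e" .
  have ig: "integrable lborel (?F g)"
    by (rule integrableI_nonneg[OF mg]) (use le in \<open>auto simp: less_top[symmetric] top_unique\<close>)
  have "ennreal (square_norm D g) = (\<integral>\<^sup>+z. ennreal (?F g z) \<partial>lborel)"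
    unfolding square_norm_def set_lebesgue_integral_def
    by (rule nn_integral_eq_integral[OF ig, symmetric]) auto
  hence "ennreal (square_norm D g) \<le> ennreal e" using le by (simp only:)
  hence "square_norm D g \<le> e" by (simp only: ennreal_le_iff[OF e0])
  thus ?thesis using ig g by (auto simp: bergman_space_def set_integrable_def)
qed

text \<open>The point bound turns a Cauchy sequence in norm into a locally uniform one, whose limit
  is holomorphic; Fatou then gives convergence in norm. The pointwise convergence is recorded as
  well, since closedness of the isotypic subspaces is checked with it.\<close>

lemma bergman_complete:
  fixes fs :: "nat \<Rightarrow> complex \<Rightarrow> complex"
  assumes D: "open D" and fs: "\<And>n. fs n \<in> bergman_space D"
    and cauchy: "\<And>e. 0 < e \<Longrightarrow> \<exists>N. \<forall>m\<ge>N. \<forall>n\<ge>N. square_norm D (\<lambda>u. fs m u - fs n u) < e"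
  shows "\<exists>g\<in>bergman_space D. (\<lambda>n. square_norm D (\<lambda>u. fs n u - g u)) \<longlonglongrightarrow> 0 \<and> (\<forall>z. (\<lambda>n. fs n z) \<longlonglongrightarrow> g z)"
proof -
  define g where "g z = (if z \<in> D then lim (\<lambda>n. fs n z) else 0)" for z
  have unif: "\<exists>d>0. cball c d \<subseteq> D \<and> uniform_limit (cball c d) fs g sequentially" if "c \<in> D" for c
  proof -
    obtain R where R: "0 < R" "ball c R \<subseteq> D" by (rule openE[OF D \<open>c \<in> D\<close>])
    \<comment> \<open>With a third of the radius, every point of the closed ball of radius
      \<open>d\<close> is the centre of a ball of radius \<open>2 * d\<close> inside
      \<open>D\<close>, as the point bound at radius \<open>d\<close> requires.\<close>
    define d where "d = R / 3"
    have "cball c d \<subseteq> ball c R" using R(1) by (auto simp: d_def)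
    hence d: "0 < d" "cball c d \<subseteq> D" using R by (simp add: d_def, blast)
    define \<kappa> where "\<kappa> = measure lborel (ball (0::complex) d)"
    have \<kappa>: "0 < \<kappa>" unfolding \<kappa>_def by (rule measure_ball_pos[OF d(1)])
    have "uniformly_Cauchy_on (cball c d) fs"
      unfolding uniformly_Cauchy_on_def
    proof (intro allI impI)
      fix e :: real assume e: "0 < e"
      hence "0 < e\<^sup>2 * \<kappa>" using \<kappa> by simp
      from cauchy[OF this] obtain N where N: "\<forall>m\<ge>N. \<forall>n\<ge>N. square_norm D (\<lambda>u. fs m u - fs n u) < e\<^sup>2 * \<kappa>" ..
      have "dist (fs m x) (fs n x) < e" if x: "x \<in> cball c d" and mn: "N \<le> m" "N \<le> n" for x m n
      proof -
        have "ball x (2 * d) \<subseteq> ball c R"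
        proof
          fix y assume "y \<in> ball x (2 * d)"
          hence "dist c y < d + 2 * d" using x dist_triangle[of c y x] by (simp add: dist_commute)
          thus "y \<in> ball c R" by (simp add: d_def)
        qed
        hence sub: "ball x (2 * d) \<subseteq> D" using R by blast
        have "(norm (fs m x - fs n x))\<^sup>2 * \<kappa> \<le> square_norm D (\<lambda>u. fs m u - fs n u)"
          unfolding \<kappa>_def by (rule bergman_point_bound[OF D bergman_space_diff[OF D fs fs] sub d(1)]) (use d in auto)
        also have "\<dots> < e\<^sup>2 * \<kappa>" using N mn by blast
        finally have "(norm (fs m x - fs n x))\<^sup>2 < e\<^sup>2" using \<kappa> by simp
        thus ?thesis using e by (simp add: dist_norm power2_less_imp_less)
      qed
      thus "\<exists>M. \<forall>x\<in>cball c d. \<forall>m\<ge>M. \<forall>n\<ge>M. dist (fs m x) (fs n x) < e" by blast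
    qed
    hence "uniform_limit (cball c d) fs (\<lambda>x. lim (\<lambda>n. fs n x)) sequentially"
      by (simp add: Cauchy_uniformly_convergent uniformly_convergent_uniform_limit_iff[symmetric])
    hence "uniform_limit (cball c d) fs g sequentially"
      by (rule uniform_limit_cong'[THEN iffD1, rotated 2]) (use d(2) in \<open>auto simp: g_def\<close>)
    thus ?thesis using d by blast
  qed
  have g: "g holomorphic_on D"
    by (rule holomorphic_uniform_sequence[OF D _ unif]) (rule bergman_spaceD(1)[OF fs])
  have lim: "(\<lambda>n. fs n z) \<longlonglongrightarrow> g z" for z
  proof (cases "z \<in> D")
    case True
    from unif[OF this] obtain d where "0 < d" "uniform_limit (cball z d) fs g sequentially" by blast
    thus ?thesis by (intro tendsto_uniform_limitI) auto
  next
    case False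
    thus ?thesis using bergman_spaceD(3)[OF fs False] by (simp add: g_def)
  qed
  have small: "\<exists>N. \<forall>n\<ge>N. (\<lambda>u. fs n u - g u) \<in> bergman_space D \<and> square_norm D (\<lambda>u. fs n u - g u) \<le> e" if "0 < e" for e
  proof -
    obtain N where N: "\<forall>m\<ge>N. \<forall>n\<ge>N. square_norm D (\<lambda>u. fs m u - fs n u) < e" using cauchy[OF \<open>0 < e\<close>] ..
    have "(\<lambda>u. fs n u - g u) \<in> bergman_space D \<and> square_norm D (\<lambda>u. fs n u - g u) \<le> e" if n: "N \<le> n" for n
    proof (rule bergman_fatou[OF D, where fs="\<lambda>m u. fs n u - fs m u" and N=N])
      show "(\<lambda>u. fs n u - fs m u) \<in> bergman_space D" for m by (rule bergman_space_diff[OF D fs fs])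
      show "(\<lambda>u. fs n u - g u) holomorphic_on D"
        by (intro holomorphic_on_diff g bergman_spaceD(1)[OF fs])
      show "fs n z - g z = 0" if "z \<notin> D" for z using bergman_spaceD(3)[OF fs that] that by (simp add: g_def)
      show "(\<lambda>m. fs n z - fs m z) \<longlonglongrightarrow> fs n z - g z" for z by (intro tendsto_intros lim)
      show "square_norm D (\<lambda>u. fs n u - fs m u) \<le> e" if "N \<le> m" for m
        using N n that by (simp add: less_imp_le)
    qed
    thus ?thesis by blast
  qed
  obtain N1 where N1: "(\<lambda>u. fs N1 u - g u) \<in> bergman_space D" using small[of 1] by auto
  have "(\<lambda>u. fs N1 u - (fs N1 u - g u)) \<in> bergman_space D" by (rule bergman_space_diff[OF D fs N1])
  hence gB: "g \<in> bergman_space D" by simp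
  have "(\<lambda>n. square_norm D (\<lambda>u. fs n u - g u)) \<longlonglongrightarrow> 0"
    unfolding LIMSEQ_def
  proof (intro allI impI)
    fix e :: real assume "0 < e"
    then obtain N where "\<forall>n\<ge>N. square_norm D (\<lambda>u. fs n u - g u) \<le> e / 2" using small[of "e / 2"] by auto
    hence "\<forall>n\<ge>N. dist (square_norm D (\<lambda>u. fs n u - g u)) 0 < e"
      using square_norm_nonneg[of D] \<open>0 < e\<close> by (auto simp: dist_norm intro: le_less_trans)
    thus "\<exists>N. \<forall>n\<ge>N. dist (square_norm D (\<lambda>u. fs n u - g u)) 0 < e" by blast
  qed
  thus ?thesis using gB lim by blast
qed

text \<open>Closedness is demanded for pointwise limits because the intended subspaces are fixed
  spaces of averaging operators, and these are finite sums of point evaluations.\<close>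

lemma bergman_subspace_hilbert:
  assumes D: "open D" and H: "H \<subseteq> bergman_space D" "(\<lambda>u. 0) \<in> H"
    "\<And>f g. f \<in> H \<Longrightarrow> g \<in> H \<Longrightarrow> (\<lambda>u. f u + g u) \<in> H" "\<And>f c. f \<in> H \<Longrightarrow> (\<lambda>u. c * f u) \<in> H"
    and cl: "\<And>fs g. (\<And>n. fs n \<in> H) \<Longrightarrow> g \<in> bergman_space D \<Longrightarrow> (\<And>z. (\<lambda>n. fs n z) \<longlonglongrightarrow> g z) \<Longrightarrow> g \<in> H"
  shows "function_hilbert H (bergman_inner D)"
proof
  show "(\<lambda>u. 0) \<in> H" by fact
  show "(\<lambda>u. f u + g u) \<in> H" if "f \<in> H" "g \<in> H" for f g using H(3) that .
  show "(\<lambda>u. c * f u) \<in> H" if "f \<in> H" for f c using H(4) that .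
  show "bergman_inner D (\<lambda>u. f u + g u) h = bergman_inner D f h + bergman_inner D g h"
    if "f \<in> H" "g \<in> H" "h \<in> H" for f g h
    unfolding bergman_inner_def distrib_right
    by (rule set_integral_add(2)) (use that H(1) D in \<open>auto intro!: bergman_inner_integrable\<close>)
  show "bergman_inner D (\<lambda>u. c * f u) h = c * bergman_inner D f h" for f h c
    unfolding bergman_inner_def mult.assoc by (rule set_integral_mult_right)
  show "bergman_inner D h f = cnj (bergman_inner D f h)" for f h
    unfolding bergman_inner_def set_lebesgue_integral_def
    by (simp only: Bochner_Integration.integral_cnj[symmetric] complex_cnj_scaleR complex_cnj_mult complex_cnj_cnj mult.commute)
  show "0 \<le> Re (bergman_inner D f f)" for f by (simp add: bergman_inner_self square_norm_nonneg)
  fix fs :: "nat \<Rightarrow> complex \<Rightarrow> complex" assume fs: "\<And>n. fs n \<in> H"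
    and "\<And>e. 0 < e \<Longrightarrow> \<exists>N. \<forall>m\<ge>N. \<forall>n\<ge>N. Re (bergman_inner D (\<lambda>u. fs m u - fs n u) (\<lambda>u. fs m u - fs n u)) < e"
  hence c: "\<exists>N. \<forall>m\<ge>N. \<forall>n\<ge>N. square_norm D (\<lambda>u. fs m u - fs n u) < e" if "0 < e" for e
    using that by (simp only: bergman_inner_self Re_complex_of_real)
  have fB: "fs n \<in> bergman_space D" for n using fs H(1) by blast
  obtain g where g: "g \<in> bergman_space D" "(\<lambda>n. square_norm D (\<lambda>u. fs n u - g u)) \<longlonglongrightarrow> 0" "\<And>z. (\<lambda>n. fs n z) \<longlonglongrightarrow> g z"
    using bergman_complete[OF D fB c] by blast
  have "g \<in> H" by (rule cl[OF fs g(1,3)])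
  thus "\<exists>h\<in>H. (\<lambda>n. Re (bergman_inner D (\<lambda>u. fs n u - h u) (\<lambda>u. fs n u - h u))) \<longlonglongrightarrow> 0"
    using g(2) by (simp only: bergman_inner_self Re_complex_of_real) blast
qed

lemma bounded_bergman:
  assumes D: "open D" "emeasure lborel D < \<infinity>" and v: "v holomorphic_on D" "\<And>z. z \<notin> D \<Longrightarrow> v z = 0"
    and b: "\<And>z. z \<in> D \<Longrightarrow> norm (v z) \<le> b"
  shows "v \<in> bergman_space D" and "square_norm D v \<le> b\<^sup>2 * measure lborel D"
proof -
  have ib: "set_integrable lborel D (\<lambda>_. b\<^sup>2)"
    unfolding set_integrable_def using D by (intro integrable_scaleR_left integrable_real_indicator) auto
  have b2: "(norm (v z))\<^sup>2 \<le> b\<^sup>2" if "z \<in> D" for z using b[OF that] by (intro power_mono) auto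
  have iv: "set_integrable lborel D (\<lambda>z. (norm (v z))\<^sup>2)"
  proof (rule set_integrable_bound[OF ib])
    show "set_borel_measurable lborel D (\<lambda>z. (norm (v z))\<^sup>2)"
      using holomorphic_on_imp_continuous_on[OF v(1)] D(1)
      by (intro set_borel_measurable_continuous continuous_intros)
  qed (use b2 in auto)
  thus "v \<in> bergman_space D" using v by (auto simp: bergman_space_def)
  have "square_norm D v \<le> (\<integral>z\<in>D. b\<^sup>2 \<partial>lborel)"
    unfolding square_norm_def by (rule set_integral_mono[OF iv ib]) (use b2 in auto)
  also have "\<dots> = b\<^sup>2 * measure lborel D"
    using D by (simp add: set_lebesgue_integral_def mult.commute)
  finally show "square_norm D v \<le> b\<^sup>2 * measure lborel D" .
qed

section \<open>Weighted composition operators on a disk\<close>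

definition taylor_coeff :: "complex \<Rightarrow> nat \<Rightarrow> (complex \<Rightarrow> complex) \<Rightarrow> complex" where
  "taylor_coeff c m f = (deriv ^^ m) f c / fact m"

text \<open>Brouwer's theorem on the smaller closed disk gives a fixed point \<open>u\<close>.
  Conjugation by a biholomorphism to the unit disk moves it to 0, and the Schwarz lemma gives the
  derivative bound and uniqueness unless the conjugate is a rotation. A rotation would be
  surjective, while \<open>\<psi>\<close> misses points near the boundary.\<close>

lemma disk_self_map:
  assumes h: "\<psi> holomorphic_on ball c r" and r: "0 < r" "\<rho> < r"
    and im: "\<And>u. u \<in> ball c r \<Longrightarrow> \<psi> u \<in> cball c \<rho>"
  obtains u where "u \<in> ball c r" "\<psi> u = u" "norm (deriv \<psi> u) < 1"
    "\<And>v. v \<in> ball c r \<Longrightarrow> \<psi> v = v \<Longrightarrow> v = u"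
proof -
  have sub: "cball c \<rho> \<subseteq> ball c r" using r by auto
  have "\<psi> c \<in> cball c \<rho>" using im[of c] r by simp
  hence "dist c (\<psi> c) \<le> \<rho>" by simp
  hence \<rho>0: "0 \<le> \<rho>" using zero_le_dist[of c "\<psi> c"] by linarith
  have cont: "continuous_on (cball c \<rho>) \<psi>"
    using holomorphic_on_imp_continuous_on[OF h] sub by (rule continuous_on_subset)
  obtain u where u: "u \<in> cball c \<rho>" "\<psi> u = u"
  proof (rule brouwer[of "cball c \<rho>" \<psi>])
    show "\<psi> \<in> cball c \<rho> \<rightarrow> cball c \<rho>" using im sub by blast
  qed (use cont \<rho>0 in auto)
  have ub: "u \<in> ball c r" using u sub by blast
  define a where "a = (u - c) / of_real r"
  have rc: "complex_of_real r \<noteq> 0" using r by simp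
  have a: "a \<in> ball 0 1" using ub r by (simp add: a_def norm_divide dist_norm norm_minus_commute)
  obtain f g where fg: "f a = 0" "f holomorphic_on ball 0 1" "f ` ball 0 1 \<subseteq> ball 0 1"
    "g holomorphic_on ball 0 1" "g ` ball 0 1 \<subseteq> ball 0 1"
    "\<And>z. z \<in> ball 0 1 \<Longrightarrow> f (g z) = z" "\<And>z. z \<in> ball 0 1 \<Longrightarrow> g (f z) = z"
    by (rule ball_biholomorphism_exists[OF a], rule that; assumption)
  define F where "F = (\<lambda>z. f ((z - c) / of_real r))"
  define \<Gamma> where "\<Gamma> = (\<lambda>w. c + of_real r * g w)"
  have sc: "(z - c) / of_real r \<in> ball 0 1" if "z \<in> ball c r" for z
    using that r by (simp add: norm_divide dist_norm norm_minus_commute)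
  have Fb: "F z \<in> ball 0 1" if "z \<in> ball c r" for z
    using sc[OF that] fg(3) unfolding F_def by blast
  have \<Gamma>b: "\<Gamma> w \<in> ball c r" if "w \<in> ball 0 1" for w
  proof -
    have "norm (g w) < 1" using fg(5) that by (auto simp: image_subset_iff)
    thus ?thesis using r by (simp add: \<Gamma>_def dist_norm norm_mult)
  qed
  have F\<Gamma>: "F (\<Gamma> w) = w" if "w \<in> ball 0 1" for w
    using fg(6)[OF that] rc by (simp add: F_def \<Gamma>_def)
  have \<Gamma>F: "\<Gamma> (F z) = z" if "z \<in> ball c r" for z
    using fg(7)[OF sc[OF that]] rc by (simp add: F_def \<Gamma>_def)
  have Fu: "F u = 0" using fg(1) by (simp add: F_def a_def)
  have \<Gamma>0: "\<Gamma> 0 = u" using \<Gamma>F[OF ub] Fu by simp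
  have hF: "F holomorphic_on ball c r"
  proof -
    have "(f \<circ> (\<lambda>z. (z - c) / of_real r)) holomorphic_on ball c r"
      by (rule holomorphic_on_compose_gen[OF _ fg(2)]) (use rc sc in \<open>auto intro!: holomorphic_intros\<close>)
    thus ?thesis by (simp add: F_def o_def)
  qed
  have h\<Gamma>: "\<Gamma> holomorphic_on ball 0 1" unfolding \<Gamma>_def by (intro holomorphic_intros fg(4))
  define h where "h = (\<lambda>w. F (\<psi> (\<Gamma> w)))"
  have \<psi>b: "\<psi> z \<in> ball c r" if "z \<in> ball c r" for z using im[OF that] sub by blast
  have hh: "h holomorphic_on ball 0 1"
  proof -
    have "(\<psi> \<circ> \<Gamma>) holomorphic_on ball 0 1"
      by (rule holomorphic_on_compose_gen[OF h\<Gamma> h]) (use \<Gamma>b in blast)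
    hence "(F \<circ> (\<psi> \<circ> \<Gamma>)) holomorphic_on ball 0 1"
      by (rule holomorphic_on_compose_gen[OF _ hF]) (use \<Gamma>b \<psi>b in auto)
    thus ?thesis by (simp add: h_def o_def)
  qed
  have h0: "h 0 = 0" by (simp add: h_def \<Gamma>0 u(2) Fu)
  have h1: "norm (h z) < 1" if "norm z < 1" for z
    using Fb[OF \<psi>b[OF \<Gamma>b]] that by (simp add: h_def)
  have d: "deriv h 0 = deriv \<psi> u"
  proof -
    have b0: "(0::complex) \<in> ball 0 1" by simp
    have D\<Gamma>: "(\<Gamma> has_field_derivative deriv \<Gamma> 0) (at 0)"
      by (rule holomorphic_derivI[OF h\<Gamma> open_ball b0])
    have D\<psi>: "(\<psi> has_field_derivative deriv \<psi> u) (at (\<Gamma> 0))"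
      unfolding \<Gamma>0 by (rule holomorphic_derivI[OF h open_ball ub])
    have DF: "(F has_field_derivative deriv F u) (at u)"
      by (rule holomorphic_derivI[OF hF open_ball ub])
    have D1: "((\<lambda>w. \<psi> (\<Gamma> w)) has_field_derivative deriv \<psi> u * deriv \<Gamma> 0) (at 0)"
      by (rule DERIV_chain2[OF D\<psi> D\<Gamma>])
    have "(h has_field_derivative deriv F u * (deriv \<psi> u * deriv \<Gamma> 0)) (at 0)"
      unfolding h_def by (rule DERIV_chain2[OF _ D1]) (simp add: \<Gamma>0 u(2) DF)
    moreover have "((\<lambda>w. F (\<Gamma> w)) has_field_derivative deriv F u * deriv \<Gamma> 0) (at 0)"
      by (rule DERIV_chain2[OF _ D\<Gamma>]) (simp add: \<Gamma>0 DF)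
    moreover have "((\<lambda>w. F (\<Gamma> w)) has_field_derivative 1) (at 0)"
      by (rule has_field_derivative_transform_within_open[OF DERIV_ident open_ball b0]) (simp add: F\<Gamma>)
    ultimately have "deriv F u * deriv \<Gamma> 0 = 1" "deriv h 0 = deriv F u * (deriv \<psi> u * deriv \<Gamma> 0)"
      by (auto dest: DERIV_unique intro: DERIV_imp_deriv)
    thus ?thesis by (simp add: mult.left_commute)
  qed
  have norot: "\<not> (\<exists>\<alpha>. (\<forall>z. norm z < 1 \<longrightarrow> h z = \<alpha> * z) \<and> norm \<alpha> = 1)"
  proof
    assume "\<exists>\<alpha>. (\<forall>z. norm z < 1 \<longrightarrow> h z = \<alpha> * z) \<and> norm \<alpha> = 1"
    then obtain \<alpha> where \<alpha>: "\<And>z. norm z < 1 \<Longrightarrow> h z = \<alpha> * z" "norm \<alpha> = 1" by blast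
    \<comment> \<open>A point halfway between the radii \<open>\<rho>\<close> and \<open>r\<close>:
      it lies in the disk but outside the image of \<open>\<psi>\<close>.\<close>
    define y where "y = c + of_real ((\<rho> + r) / 2)"
    have dy: "dist c y = (\<rho> + r) / 2" using \<rho>0 r by (simp add: y_def dist_norm del: of_real_divide of_real_add)
    have y: "y \<in> ball c r" using dy r by simp
    have Fy: "norm (F y / \<alpha>) < 1" using Fb[OF y] \<alpha>(2) by (simp add: norm_divide)
    have "h (F y / \<alpha>) = F y" using \<alpha>(1)[OF Fy] \<alpha>(2) by auto
    hence "\<Gamma> (F (\<psi> (\<Gamma> (F y / \<alpha>)))) = \<Gamma> (F y)" by (simp add: h_def)
    hence "\<psi> (\<Gamma> (F y / \<alpha>)) = y"
      using \<Gamma>F[OF y] \<Gamma>F[OF \<psi>b[OF \<Gamma>b]] Fy by simp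
    moreover have "\<psi> (\<Gamma> (F y / \<alpha>)) \<in> cball c \<rho>" by (rule im[OF \<Gamma>b]) (use Fy in simp)
    ultimately show False using dy r by simp
  qed
  note S = Schwarz_Lemma'[OF hh h0 h1]
  have d1: "norm (deriv \<psi> u) < 1"
    using S norot unfolding d by (metis order_le_less)
  have uniq: "v = u" if v: "v \<in> ball c r" "\<psi> v = v" for v
  proof (rule ccontr)
    assume "v \<noteq> u"
    have "h (F v) = F v" using \<Gamma>F[OF v(1)] v(2) by (simp add: h_def)
    moreover have "F v \<noteq> 0" using \<Gamma>F[OF v(1)] \<Gamma>0 \<open>v \<noteq> u\<close> by auto
    moreover have "norm (F v) < 1" using Fb[OF v(1)] by simp
    ultimately have "\<exists>z. norm z < 1 \<and> z \<noteq> 0 \<and> norm (h z) = norm z" by metis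
    thus False using S norot by simp
  qed
  show ?thesis by (rule that[OF ub u(2) d1 uniq])
qed

text \<open>Summing the Cauchy integrals for the coefficients is a geometric series with sum
  \<open>\<integral> W(u) / (u - \<psi>(u)) du\<close>, whose integrand has a single simple pole.\<close>

lemma weighted_composition_trace:
  assumes h: "\<psi> holomorphic_on ball c r" and r: "0 < r" "\<rho> < r"
    and im: "\<And>u. u \<in> ball c r \<Longrightarrow> \<psi> u \<in> cball c \<rho>"
    and W: "W holomorphic_on ball c r" and u: "u \<in> ball c r" "\<psi> u = u"
  shows "(\<lambda>m. taylor_coeff c m (\<lambda>z. W z * (\<psi> z - c) ^ m)) sums (W u / (1 - deriv \<psi> u))"
proof -
  obtain u' where u': "u' \<in> ball c r" "\<psi> u' = u'" "norm (deriv \<psi> u') < 1"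
    "\<And>v. v \<in> ball c r \<Longrightarrow> \<psi> v = v \<Longrightarrow> v = u'"
    by (rule disk_self_map[OF h r im], assumption, rule that; assumption)
  have uu: "u = u'" using u'(4)[OF u] .
  have d1: "norm (deriv \<psi> u) < 1" using u'(3) uu by simp
  have uniq: "v = u" if "v \<in> ball c r" "\<psi> v = v" for v using u'(4)[OF that] uu by simp
  have "\<psi> c \<in> cball c \<rho>" using im[of c] r by simp
  hence "dist c (\<psi> c) \<le> \<rho>" by simp
  hence \<rho>0: "0 \<le> \<rho>" using zero_le_dist[of c "\<psi> c"] by linarith
  \<comment> \<open>On a circle of radius strictly between \<open>\<rho>\<close> and
    \<open>r\<close> the quotient of \<open>\<psi> z - c\<close> by \<open>z - c\<close> has modulus
    at most \<rho>/s < 1, so the geometric series converges uniformly there.\<close>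
  define s where "s = (\<rho> + r) / 2"
  have s: "\<rho> < s" "s < r" "0 < s" using r \<rho>0 by (auto simp: s_def)
  have cb: "cball c s \<subseteq> ball c r" using s by auto
  define q where "q z = (if z = u then 1 - deriv \<psi> u else (z - \<psi> z) / (z - u))" for z
  have Dg: "((\<lambda>z. z - \<psi> z) has_field_derivative 1 - deriv \<psi> u) (at u)"
    by (intro derivative_intros holomorphic_derivI[OF h open_ball u(1)])
  have hq: "q holomorphic_on ball c r"
  proof (rule pole_theorem_open_0[of "\<lambda>z. z - \<psi> z" _ u])
    show "(\<lambda>z. z - \<psi> z) holomorphic_on ball c r" by (intro holomorphic_intros h)
    show "q u = deriv (\<lambda>z. z - \<psi> z) u" using DERIV_imp_deriv[OF Dg] by (simp add: q_def)
  qed (use u(2) in \<open>auto simp: q_def\<close>)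
  have q0: "q z \<noteq> 0" if "z \<in> ball c r" for z
  proof (cases "z = u")
    case True thus ?thesis using d1 by (auto simp: q_def)
  next
    case False
    hence "\<psi> z \<noteq> z" using uniq[OF that] by blast
    thus ?thesis using False by (simp add: q_def)
  qed
  define k where "k z = W z / q z" for z
  have hk: "k holomorphic_on ball c r" unfolding k_def by (intro holomorphic_intros W hq q0)
  have us: "norm (u - c) < s"
    using im[OF u(1)] u(2) s by (simp add: dist_norm norm_minus_commute)
  have ki: "((\<lambda>z. k z / (z - u)) has_contour_integral (2 * of_real pi * \<i> * k u)) (circlepath c s)"
    by (rule Cauchy_integral_circlepath_simple[OF holomorphic_on_subset[OF hk cb] us])
  define F where "F m z = W z * (\<psi> z - c) ^ m / (z - c) ^ Suc m" for m z
  have ci: "(F m has_contour_integral (2 * of_real pi * \<i> * taylor_coeff c m (\<lambda>z. W z * (\<psi> z - c) ^ m))) (circlepath c s)" for m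
  proof -
    have hm: "(\<lambda>z. W z * (\<psi> z - c) ^ m) holomorphic_on ball c r" by (intro holomorphic_intros W h)
    have "((\<lambda>z. W z * (\<psi> z - c) ^ m / (z - c) ^ Suc m) has_contour_integral
        ((2 * pi * \<i>) / (fact m) * (deriv ^^ m) (\<lambda>z. W z * (\<psi> z - c) ^ m) c)) (circlepath c s)"
    proof (rule Cauchy_has_contour_integral_higher_derivative_circlepath)
      show "continuous_on (cball c s) (\<lambda>z. W z * (\<psi> z - c) ^ m)"
        by (rule holomorphic_on_imp_continuous_on[OF holomorphic_on_subset[OF hm cb]])
      show "(\<lambda>z. W z * (\<psi> z - c) ^ m) holomorphic_on ball c s"
        by (rule holomorphic_on_subset[OF hm]) (use s in auto)
    qed (use s in simp)
    thus ?thesis by (simp add: F_def[abs_def] taylor_coeff_def)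
  qed
  have sph: "z \<in> ball c r" "norm (z - c) = s" "z - c \<noteq> 0" "norm (\<psi> z - c) \<le> \<rho>" if "z \<in> sphere c s" for z
  proof -
    show b: "z \<in> ball c r" and n: "norm (z - c) = s" using that s by (auto simp: dist_norm norm_minus_commute)
    show "z - c \<noteq> 0" using n s by auto
    show "norm (\<psi> z - c) \<le> \<rho>" using im[OF b] by (simp add: dist_norm norm_minus_commute)
  qed
  have "compact (W ` sphere c s)"
    by (intro compact_continuous_image continuous_on_subset[OF holomorphic_on_imp_continuous_on[OF W]])
       (use sph in auto)
  then obtain B where B: "\<And>z. z \<in> sphere c s \<Longrightarrow> norm (W z) \<le> B"
    using compact_imp_bounded bounded_iff by (metis imageI)
  have ul: "uniform_limit (sphere c s) (\<lambda>N z. \<Sum>m<N. F m z) (\<lambda>z. \<Sum>m. F m z) sequentially"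
  proof (rule Weierstrass_m_test)
    fix m z assume z: "z \<in> sphere c s"
    have B0: "0 \<le> B" using B[OF z] norm_ge_zero[of "W z"] by linarith
    have "norm (F m z) = norm (W z) * norm (\<psi> z - c) ^ m / s ^ Suc m"
      by (simp only: F_def norm_mult norm_divide norm_power sph(2)[OF z])
    also have "\<dots> \<le> B * \<rho> ^ m / s ^ Suc m"
      using s B0 B[OF z] sph(4)[OF z] by (intro divide_right_mono mult_mono power_mono) auto
    also have "\<dots> = B / s * (\<rho> / s) ^ m" by (simp add: power_divide)
    finally show "norm (F m z) \<le> B / s * (\<rho> / s) ^ m" .
  next
    show "summable (\<lambda>m. B / s * (\<rho> / s) ^ m)"
      using s \<rho>0 by (intro summable_mult summable_geometric) simp
  qed
  have Fsum: "(\<Sum>m. F m z) = k z / (z - u)" if z: "z \<in> sphere c s" for z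
  proof -
    have x1: "norm ((\<psi> z - c) / (z - c)) < 1"
      using sph[OF z] s by (simp add: norm_divide)
    have "(\<lambda>m. W z / (z - c) * ((\<psi> z - c) / (z - c)) ^ m) sums (W z / (z - c) * (1 / (1 - (\<psi> z - c) / (z - c))))"
      by (intro sums_mult geometric_sums x1)
    moreover have "W z / (z - c) * ((\<psi> z - c) / (z - c)) ^ m = F m z" for m
      by (simp add: F_def power_divide)
    ultimately have 1: "(\<Sum>m. F m z) = W z / (z - c) * (1 / (1 - (\<psi> z - c) / (z - c)))"
      by (simp add: sums_iff)
    have "1 - (\<psi> z - c) / (z - c) = (z - \<psi> z) / (z - c)" using sph(3)[OF z] by (simp add: field_simps)
    hence 2: "(\<Sum>m. F m z) = W z / (z - \<psi> z)" using 1 sph(3)[OF z] by simp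
    have "z \<noteq> u" using us sph(2)[OF z] by auto
    thus ?thesis unfolding 2 k_def q_def by simp
  qed
  have ul': "uniform_limit (sphere c s) (\<lambda>N z. \<Sum>m<N. F m z) (\<lambda>z. k z / (z - u)) sequentially"
    by (rule uniform_limit_cong'[THEN iffD1, OF _ _ ul]) (use Fsum in auto)
  have cN: "((\<lambda>z. \<Sum>m<N. F m z) has_contour_integral
      (\<Sum>m<N. 2 * of_real pi * \<i> * taylor_coeff c m (\<lambda>z. W z * (\<psi> z - c) ^ m))) (circlepath c s)" for N
    by (intro has_contour_integral_sum ci) auto
  have "(\<lambda>N. contour_integral (circlepath c s) (\<lambda>z. \<Sum>m<N. F m z)) \<longlonglongrightarrow> contour_integral (circlepath c s) (\<lambda>z. k z / (z - u))"
    by (rule contour_integral_uniform_limit_circlepath(2)[OF _ ul' _ s(3)])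
       (use has_contour_integral_integrable[OF cN] in simp_all)
  hence "(\<lambda>N. \<Sum>m<N. 2 * of_real pi * \<i> * taylor_coeff c m (\<lambda>z. W z * (\<psi> z - c) ^ m)) \<longlonglongrightarrow> 2 * of_real pi * \<i> * k u"
    by (simp only: contour_integral_unique[OF cN] contour_integral_unique[OF ki])
  hence "(\<lambda>m. 2 * of_real pi * \<i> * taylor_coeff c m (\<lambda>z. W z * (\<psi> z - c) ^ m)) sums (2 * of_real pi * \<i> * k u)"
    unfolding sums_def .
  hence "(\<lambda>m. taylor_coeff c m (\<lambda>z. W z * (\<psi> z - c) ^ m)) sums k u"
    by (subst (asm) sums_mult_iff) auto
  thus ?thesis by (simp add: k_def q_def)
qed

section \<open>Taylor coefficients as linear functionals\<close>

lemma taylor_coeff_bound: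
  assumes "f holomorphic_on ball c R" "0 < s" "s < R" "\<And>z. dist c z = s \<Longrightarrow> norm (f z) \<le> B"
  shows "norm (taylor_coeff c m f) \<le> B / s ^ m"
proof -
  have "norm ((deriv ^^ m) f c) \<le> fact m * B / s ^ m"
  proof (rule Cauchy_inequality)
    show "f holomorphic_on ball c s" by (rule holomorphic_on_subset[OF assms(1)]) (use assms in auto)
    show "continuous_on (cball c s) f"
      by (rule continuous_on_subset[OF holomorphic_on_imp_continuous_on[OF assms(1)]]) (use assms in auto)
  qed (use assms in \<open>auto simp: dist_norm\<close>)
  thus ?thesis by (simp add: taylor_coeff_def norm_divide field_simps)
qed

lemma taylor_coeff_add:
  assumes "f holomorphic_on S" "g holomorphic_on S" "open S" "c \<in> S"
  shows "taylor_coeff c m (\<lambda>z. f z + g z) = taylor_coeff c m f + taylor_coeff c m g"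
  unfolding taylor_coeff_def higher_deriv_add[OF assms] by (rule add_divide_distrib)

lemma taylor_coeff_scale:
  assumes "f holomorphic_on S" "open S" "c \<in> S"
  shows "taylor_coeff c m (\<lambda>z. a * f z) = a * taylor_coeff c m f"
  unfolding taylor_coeff_def higher_deriv_cmult[OF assms(1,3,2)] by simp

lemma taylor_coeff_cong:
  assumes "f holomorphic_on S" "g holomorphic_on S" "open S" "c \<in> S" "\<And>z. z \<in> S \<Longrightarrow> f z = g z"
  shows "taylor_coeff c m f = taylor_coeff c m g"
proof -
  have "(deriv ^^ m) f c = (deriv ^^ m) g c"
    by (rule higher_deriv_transform_within_open[OF assms(1-4)]) (rule assms(5))
  thus ?thesis by (simp only: taylor_coeff_def)
qed

lemma taylor_coeff_sum:
  assumes "finite A" "\<And>x. x \<in> A \<Longrightarrow> f x holomorphic_on S" "open S" "c \<in> S"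
  shows "taylor_coeff c m (\<lambda>z. \<Sum>x\<in>A. f x z) = (\<Sum>x\<in>A. taylor_coeff c m (f x))"
  using assms(1,2)
proof (induction A rule: finite_induct)
  case empty
  show ?case using taylor_coeff_scale[of "\<lambda>_. 0" UNIV c m 0] by simp
next
  case (insert x A)
  have "taylor_coeff c m (\<lambda>z. f x z + (\<Sum>x\<in>A. f x z)) = taylor_coeff c m (f x) + taylor_coeff c m (\<lambda>z. \<Sum>x\<in>A. f x z)"
    by (rule taylor_coeff_add[OF _ _ assms(3,4)]) (use insert in \<open>auto intro!: holomorphic_intros\<close>)
  thus ?case using insert by simp
qed

lemma taylor_series:
  assumes "f holomorphic_on ball c R" "w \<in> ball c R"
  shows "(\<lambda>m. taylor_coeff c m f * (w - c) ^ m) sums f w"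
  using holomorphic_power_series[OF assms] by (simp add: taylor_coeff_def)

section \<open>Irreducible characters\<close>

lemma vec_subspace_iff:
  "VectorSpace.subspace class_ring W (module_vec TYPE(complex) d) \<longleftrightarrow>
     W \<subseteq> carrier_vec d \<and> 0\<^sub>v d \<in> W \<and> (\<forall>v\<in>W. \<forall>w\<in>W. v + w \<in> W) \<and> (\<forall>c. \<forall>v\<in>W. c \<cdot>\<^sub>v v \<in> W)"
proof -
  have vs: "vectorspace class_ring (module_vec TYPE(complex) d)" by (rule vec_vs)
  have "VectorSpace.subspace class_ring W (module_vec TYPE(complex) d) \<longleftrightarrow> submodule class_ring W (module_vec TYPE(complex) d)"
    using vs by (simp add: VectorSpace.subspace_def)
  also have "\<dots> \<longleftrightarrow> W \<subseteq> carrier_vec d \<and> 0\<^sub>v d \<in> W \<and> (\<forall>v\<in>W. \<forall>w\<in>W. v + w \<in> W) \<and> (\<forall>c. \<forall>v\<in>W. c \<cdot>\<^sub>v v \<in> W)"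
    using vec_module[where 'a=complex and n=d] by (auto simp: submodule_def module_vec_simps)
  finally show ?thesis .
qed

lemma mat_adjoint_dim [simp]: "dim_row (mat_adjoint A) = dim_col A" "dim_col (mat_adjoint A) = dim_row A"
  by (simp_all add: mat_adjoint_def)

lemma mat_adjoint_carrier [simp]: "A \<in> carrier_mat n m \<Longrightarrow> mat_adjoint A \<in> carrier_mat m n"
  by (auto intro!: carrier_matI)

lemma mat_adjoint_index:
  fixes A :: "complex mat"
  assumes "i < dim_col A" "j < dim_row A"
  shows "mat_adjoint A $$ (i, j) = cnj (A $$ (j, i))"
  using assms by (simp add: mat_adjoint_def mat_of_rows_index)

lemma mat_adjoint_mult:
  fixes A B :: "complex mat"
  assumes "A \<in> carrier_mat n m" "B \<in> carrier_mat m k"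
  shows "mat_adjoint (A * B) = mat_adjoint B * mat_adjoint A"
proof (rule eq_matI)
  fix i j assume "i < dim_row (mat_adjoint B * mat_adjoint A)" "j < dim_col (mat_adjoint B * mat_adjoint A)"
  hence ij: "i < k" "j < n" using assms by auto
  have "mat_adjoint (A * B) $$ (i, j) = cnj (\<Sum>a<m. A $$ (j, a) * B $$ (a, i))"
    using assms ij by (subst mat_adjoint_index) (auto simp: scalar_prod_def lessThan_atLeast0)
  also have "\<dots> = (\<Sum>a<m. mat_adjoint B $$ (i, a) * mat_adjoint A $$ (a, j))"
    using assms ij by (auto simp: mat_adjoint_index intro!: sum.cong)
  also have "\<dots> = (mat_adjoint B * mat_adjoint A) $$ (i, j)"
    using assms ij by (auto simp: scalar_prod_def lessThan_atLeast0)
  finally show "mat_adjoint (A * B) $$ (i, j) = (mat_adjoint B * mat_adjoint A) $$ (i, j)" .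
qed (use assms in auto)

lemma mat_adjoint_adjoint: "mat_adjoint (mat_adjoint A) = (A :: complex mat)"
  by (rule eq_matI) (auto simp: mat_adjoint_index)

lemma mult_index_sum:
  assumes "A \<in> carrier_mat n m" "B \<in> carrier_mat m k" "i < n" "j < k"
  shows "(A * B) $$ (i, j) = (\<Sum>a<m. A $$ (i, a) * B $$ (a, j))"
  using assms by (auto simp: scalar_prod_def lessThan_atLeast0)

lemma mult_vec_index_sum:
  assumes "A \<in> carrier_mat n m" "v \<in> carrier_vec m" "i < n"
  shows "vec_index (A *\<^sub>v v) i = (\<Sum>a<m. A $$ (i, a) * vec_index v a)"
  using assms by (auto simp: scalar_prod_def lessThan_atLeast0)

lemma mult_unit_vec_index:
  assumes "A \<in> carrier_mat n m" "i < n" "j < m"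
  shows "vec_index (A *\<^sub>v unit_vec m j) i = (A $$ (i, j) :: complex)"
proof -
  have "vec_index (A *\<^sub>v unit_vec m j) i = (\<Sum>a<m. A $$ (i, a) * (if a = j then 1 else 0))"
    using assms by (subst mult_vec_index_sum) (auto simp: unit_vec_def intro!: sum.cong)
  also have "\<dots> = (\<Sum>a<m. if a = j then A $$ (i, a) else 0)" by (intro sum.cong) auto
  finally show ?thesis using assms by simp
qed

lemma mat_eq_mult_vecI:
  fixes A B :: "complex mat"
  assumes "A \<in> carrier_mat n m" "B \<in> carrier_mat n m" "\<And>v. v \<in> carrier_vec m \<Longrightarrow> A *\<^sub>v v = B *\<^sub>v v"
  shows "A = B"
proof (rule eq_matI)
  fix i j assume "i < dim_row B" "j < dim_col B"
  hence ij: "i < n" "j < m" using assms by auto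
  have "A *\<^sub>v unit_vec m j = B *\<^sub>v unit_vec m j" by (rule assms(3)) simp
  thus "A $$ (i, j) = B $$ (i, j)"
    using mult_unit_vec_index[OF assms(1) ij] mult_unit_vec_index[OF assms(2) ij] by simp
qed (use assms in auto)

definition mtr :: "complex mat \<Rightarrow> complex" where "mtr A = (\<Sum>i<dim_row A. A $$ (i, i))"

lemma mtr_comm:
  assumes "A \<in> carrier_mat n m" "B \<in> carrier_mat m n"
  shows "mtr (A * B) = mtr (B * A)"
proof -
  have "mtr (A * B) = (\<Sum>i<n. \<Sum>a<m. A $$ (i, a) * B $$ (a, i))"
    using assms by (auto simp: mtr_def mult_index_sum simp del: index_mult_mat(1) intro!: sum.cong)
  also have "\<dots> = (\<Sum>a<m. \<Sum>i<n. A $$ (i, a) * B $$ (a, i))" by (rule sum.swap)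
  also have "\<dots> = mtr (B * A)"
    using assms by (auto simp: mtr_def mult_index_sum mult.commute simp del: index_mult_mat(1) intro!: sum.cong)
  finally show ?thesis .
qed

section \<open>Schur's lemma and orthogonality of matrix coefficients\<close>

lemma unitary_repD:
  assumes "unitary_rep G d \<rho>"
  shows "g \<in> carrier G \<Longrightarrow> \<rho> g \<in> carrier_mat d d"
    "g \<in> carrier G \<Longrightarrow> \<rho> g * mat_adjoint (\<rho> g) = 1\<^sub>m d"
    "g \<in> carrier G \<Longrightarrow> mat_adjoint (\<rho> g) * \<rho> g = 1\<^sub>m d"
    "\<rho> \<one>\<^bsub>G\<^esub> = 1\<^sub>m d"
    "g \<in> carrier G \<Longrightarrow> h \<in> carrier G \<Longrightarrow> \<rho> (g \<otimes>\<^bsub>G\<^esub> h) = \<rho> g * \<rho> h"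
  using assms by (auto simp: unitary_rep_def)

lemma unitary_rep_inv:
  assumes G: "group G" and \<rho>: "unitary_rep G d \<rho>" and g: "g \<in> carrier G"
  shows "\<rho> (inv\<^bsub>G\<^esub> g) = mat_adjoint (\<rho> g)"
proof -
  interpret group G by (rule G)
  note R = unitary_repD[OF \<rho>]
  have "\<rho> (inv\<^bsub>G\<^esub> g) * \<rho> g = 1\<^sub>m d" using R(5)[of "inv\<^bsub>G\<^esub> g" g] g R(4) by simp
  hence "\<rho> (inv\<^bsub>G\<^esub> g) * \<rho> g * mat_adjoint (\<rho> g) = mat_adjoint (\<rho> g)"
    using R(1)[OF g] by simp
  thus ?thesis
    using R(1)[of "inv\<^bsub>G\<^esub> g"] R(1,2)[OF g] g
    by (simp add: assoc_mult_mat[of _ d d _ d _ d])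
qed

lemma irreducible_unitary_repD:
  assumes "irreducible_unitary_rep G d \<rho>"
  shows "unitary_rep G d \<rho>" "0 < d"
    "VectorSpace.subspace class_ring W (module_vec TYPE(complex) d) \<Longrightarrow>
      (\<And>g v. g \<in> carrier G \<Longrightarrow> v \<in> W \<Longrightarrow> \<rho> g *\<^sub>v v \<in> W) \<Longrightarrow> W = {0\<^sub>v d} \<or> W = carrier_vec d"
  using assms by (simp_all add: irreducible_unitary_rep_def)

text \<open>The kernel \<open>K\<close> and the image \<open>M\<close> of \<open>T\<close> are
  invariant, so for nonzero \<open>T\<close> irreducibility leaves only the trivial kernel and the
  full image. The inverse is assembled column by column from preimages of the unit vectors.\<close>

lemma schur_intertwiner:
  assumes \<rho>: "irreducible_unitary_rep G d \<rho>" and \<rho>': "irreducible_unitary_rep G d' \<rho>'"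
    and T: "T \<in> carrier_mat d d'" and com: "\<And>g. g \<in> carrier G \<Longrightarrow> \<rho> g * T = T * \<rho>' g"
  shows "T = 0\<^sub>m d d' \<or> (\<exists>S\<in>carrier_mat d' d. T * S = 1\<^sub>m d \<and> S * T = 1\<^sub>m d')"
proof (cases "T = 0\<^sub>m d d'")
  case False
  have R: "\<rho> g \<in> carrier_mat d d" "\<rho>' g \<in> carrier_mat d' d'" if "g \<in> carrier G" for g
    by (rule unitary_repD(1)[OF irreducible_unitary_repD(1)[OF \<rho>] that])
       (rule unitary_repD(1)[OF irreducible_unitary_repD(1)[OF \<rho>'] that])
  note irr = irreducible_unitary_repD(3)[OF \<rho>] and irr' = irreducible_unitary_repD(3)[OF \<rho>']
  have comv: "\<rho> g *\<^sub>v (T *\<^sub>v v) = T *\<^sub>v (\<rho>' g *\<^sub>v v)" if "g \<in> carrier G" "v \<in> carrier_vec d'" for g v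
    using assoc_mult_mat_vec[OF R(1)[OF that(1)] T that(2)] assoc_mult_mat_vec[OF T R(2)[OF that(1)] that(2)]
      com[OF that(1)] by simp
  have T0: "T = 0\<^sub>m d d'" if "\<And>v. v \<in> carrier_vec d' \<Longrightarrow> T *\<^sub>v v = 0\<^sub>v d"
    by (rule mat_eq_mult_vecI[OF T]) (use that in auto)
  define K where "K = {v \<in> carrier_vec d'. T *\<^sub>v v = 0\<^sub>v d}"
  have "K = {0\<^sub>v d'} \<or> K = carrier_vec d'"
  proof (rule irr')
    show "VectorSpace.subspace class_ring K (module_vec TYPE(complex) d')"
      unfolding vec_subspace_iff
    proof (intro conjI ballI allI)
      show "K \<subseteq> carrier_vec d'" by (auto simp: K_def)
      show "0\<^sub>v d' \<in> K" using T by (auto simp: K_def)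
      show "v + w \<in> K" if "v \<in> K" "w \<in> K" for v w
        using that mult_add_distrib_mat_vec[OF T, of v w] by (simp add: K_def)
      show "c \<cdot>\<^sub>v v \<in> K" if "v \<in> K" for c v
      proof -
        have "c \<cdot>\<^sub>v 0\<^sub>v d = (0\<^sub>v d :: complex vec)" by (rule eq_vecI) auto
        thus ?thesis using that mult_mat_vec[OF T, of v c] by (simp add: K_def)
      qed
    qed
    show "\<rho>' g *\<^sub>v v \<in> K" if "g \<in> carrier G" "v \<in> K" for g v
    proof -
      have v: "v \<in> carrier_vec d'" "T *\<^sub>v v = 0\<^sub>v d" using that by (auto simp: K_def)
      have "T *\<^sub>v (\<rho>' g *\<^sub>v v) = \<rho> g *\<^sub>v 0\<^sub>v d" using comv[OF that(1) v(1)] v(2) by simp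
      also have "\<dots> = 0\<^sub>v d" using R(1)[OF that(1)] by (intro eq_vecI) (auto simp: scalar_prod_def)
      finally show ?thesis using mult_mat_vec_carrier[OF R(2)[OF that(1)] v(1)] by (simp add: K_def)
    qed
  qed
  moreover have "K \<noteq> carrier_vec d'"
  proof
    assume K: "K = carrier_vec d'"
    have "T *\<^sub>v v = 0\<^sub>v d" if "v \<in> carrier_vec d'" for v 
    proof -
      have "v \<in> K" using that by (simp only: K)
      thus ?thesis by (simp add: K_def)
    qed
    thus False using T0 False by blast
  qed
  ultimately have K: "K = {0\<^sub>v d'}" by blast
  define M where "M = (\<lambda>v. T *\<^sub>v v) ` carrier_vec d'"
  have "M = {0\<^sub>v d} \<or> M = carrier_vec d"
  proof (rule irr)
    show "VectorSpace.subspace class_ring M (module_vec TYPE(complex) d)"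
      unfolding vec_subspace_iff
    proof (intro conjI ballI allI)
      show "M \<subseteq> carrier_vec d" using T by (auto simp: M_def)
      have "T *\<^sub>v 0\<^sub>v d' = 0\<^sub>v d" using T by (intro eq_vecI) (auto simp: scalar_prod_def)
      thus "0\<^sub>v d \<in> M" unfolding M_def by (metis image_eqI zero_carrier_vec)
      show "v + w \<in> M" if vw: "v \<in> M" "w \<in> M" for v w
      proof -
        obtain x y where x: "x \<in> carrier_vec d'" "v = T *\<^sub>v x" and y: "y \<in> carrier_vec d'" "w = T *\<^sub>v y"
          using vw by (auto simp: M_def)
        have "v + w = T *\<^sub>v (x + y)" using mult_add_distrib_mat_vec[OF T x(1) y(1)] x y by simp
        thus ?thesis unfolding M_def using x y by (intro image_eqI[of _ _ "x + y"]) auto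
      qed
      show "c \<cdot>\<^sub>v v \<in> M" if v: "v \<in> M" for c v
      proof -
        obtain x where x: "x \<in> carrier_vec d'" "v = T *\<^sub>v x" using v by (auto simp: M_def)
        have "c \<cdot>\<^sub>v v = T *\<^sub>v (c \<cdot>\<^sub>v x)" using mult_mat_vec[OF T x(1)] x by simp
        thus ?thesis unfolding M_def using x by (intro image_eqI[of _ _ "c \<cdot>\<^sub>v x"]) auto
      qed
    qed
    show "\<rho> g *\<^sub>v v \<in> M" if g: "g \<in> carrier G" and v: "v \<in> M" for g v
    proof -
      obtain x where x: "x \<in> carrier_vec d'" "v = T *\<^sub>v x" using v by (auto simp: M_def)
      show ?thesis unfolding x(2) comv[OF g x(1)] M_def
        by (rule imageI) (rule mult_mat_vec_carrier[OF R(2)[OF g] x(1)])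
    qed
  qed
  moreover have "M \<noteq> {0\<^sub>v d}"
  proof
    assume M: "M = {0\<^sub>v d}"
    have "T *\<^sub>v v = 0\<^sub>v d" if "v \<in> carrier_vec d'" for v
    proof -
      have "T *\<^sub>v v \<in> M" unfolding M_def by (rule imageI[OF that])
      thus ?thesis by (simp only: M singleton_iff)
    qed
    thus False using T0 False by blast
  qed
  ultimately have M: "M = carrier_vec d" by blast
  have "\<exists>x. x \<in> carrier_vec d' \<and> T *\<^sub>v x = unit_vec d j" for j
  proof -
    have "unit_vec d j \<in> M" by (simp only: M unit_vec_carrier)
    then obtain x where "unit_vec d j = T *\<^sub>v x" "x \<in> carrier_vec d'" unfolding M_def by (rule imageE)
    thus ?thesis by (intro exI[of _ x]) simp
  qed
  then obtain s where s: "\<And>j. s j \<in> carrier_vec d'" "\<And>j. T *\<^sub>v s j = unit_vec d j" by metis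
  define S where "S = mat d' d (\<lambda>(i, j). vec_index (s j) i)"
  have S: "S \<in> carrier_mat d' d" by (simp add: S_def)
  have TS: "T * S = 1\<^sub>m d"
  proof (rule eq_matI)
    fix i j assume "i < dim_row (1\<^sub>m d :: complex mat)" "j < dim_col (1\<^sub>m d :: complex mat)"
    hence ij: "i < d" "j < d" by auto
    have "(T * S) $$ (i, j) = (\<Sum>a<d'. T $$ (i, a) * vec_index (s j) a)"
      using ij by (subst mult_index_sum[OF T S]) (auto simp: S_def intro!: sum.cong)
    also have "\<dots> = vec_index (T *\<^sub>v s j) i" by (rule mult_vec_index_sum[OF T s(1) ij(1), symmetric])
    finally show "(T * S) $$ (i, j) = 1\<^sub>m d $$ (i, j)" using s(2) ij by simp
  qed (use T S in auto)
  have ST: "S * T = 1\<^sub>m d'"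
  proof (rule mat_eq_mult_vecI)
    fix v :: "complex vec" assume v: "v \<in> carrier_vec d'"
    let ?w = "S *\<^sub>v (T *\<^sub>v v)"
    have Tv: "T *\<^sub>v v \<in> carrier_vec d" by (rule mult_mat_vec_carrier[OF T v])
    have w: "?w \<in> carrier_vec d'" by (rule mult_mat_vec_carrier[OF S Tv])
    have "T *\<^sub>v ?w = T *\<^sub>v v"
      using assoc_mult_mat_vec[OF T S Tv] TS Tv by simp
    hence "T *\<^sub>v (?w - v) = 0\<^sub>v d"
      using mult_minus_distrib_mat_vec[OF T w v] Tv by simp
    hence "?w - v \<in> K" using w v by (simp add: K_def)
    hence "?w - v = 0\<^sub>v d'" using K by simp
    hence "?w = v" using w v
    proof -
      assume e: "?w - v = 0\<^sub>v d'"
      show "?w = v"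
      proof (rule eq_vecI)
        fix i assume "i < dim_vec v"
        hence i: "i < d'" using v by simp
        have "vec_index (?w - v) i = vec_index ?w i - vec_index v i" using i v by simp
        thus "vec_index ?w i = vec_index v i" using e i by simp
      qed (use w v S in simp)
    qed
    thus "(S * T) *\<^sub>v v = 1\<^sub>m d' *\<^sub>v v" using assoc_mult_mat_vec[OF S T v] v by simp
  qed (use S T in auto)
  show ?thesis using S TS ST by blast
qed simp


lemma group_sum_translate:
  assumes "group G" "h \<in> carrier G"
  shows "(\<Sum>g\<in>carrier G. F (h \<otimes>\<^bsub>G\<^esub> g)) = (\<Sum>g\<in>carrier G. F g)"
proof -
  interpret group G by fact
  show ?thesis
    by (rule sum.reindex_bij_witness[where i="\<lambda>g. inv\<^bsub>G\<^esub> h \<otimes>\<^bsub>G\<^esub> g" and j="\<lambda>g. h \<otimes>\<^bsub>G\<^esub> g"])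
       (use assms(2) in \<open>auto simp: m_assoc[symmetric]\<close>)
qed

text \<open>For fixed \<open>k\<close> and \<open>l\<close> these are the entries, in
  \<open>i\<close> and \<open>j\<close>, of the sum over g of \<rho>(g) E \<rho>'(g)*, where E is
  the matrix unit at position (k, l). Such averages are intertwiners.\<close>

definition coeff_pairing ::
  "('g, 'm) monoid_scheme \<Rightarrow> ('g \<Rightarrow> complex mat) \<Rightarrow> ('g \<Rightarrow> complex mat) \<Rightarrow> nat \<Rightarrow> nat \<Rightarrow> nat \<Rightarrow> nat \<Rightarrow> complex" where
  "coeff_pairing G \<rho> \<rho>' i k j l = (\<Sum>g\<in>carrier G. \<rho> g $$ (i, k) * cnj (\<rho>' g $$ (j, l)))"

lemma coeff_pairing_intertwines:
  assumes G: "group G" and \<rho>: "unitary_rep G d \<rho>" and \<rho>': "unitary_rep G d' \<rho>'" and kl: "k < d" "l < d'"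
    and h: "h \<in> carrier G"
  defines "T \<equiv> mat d d' (\<lambda>(i, j). coeff_pairing G \<rho> \<rho>' i k j l)"
  shows "\<rho> h * T = T * \<rho>' h"
proof (rule eq_matI)
  interpret group G by (rule G)
  note R = unitary_repD[OF \<rho>] and R' = unitary_repD[OF \<rho>']
  have T: "T \<in> carrier_mat d d'" by (simp add: T_def)
  fix i j assume "i < dim_row (T * \<rho>' h)" "j < dim_col (T * \<rho>' h)"
  hence ij: "i < d" "j < d'" using T R'(1)[OF h] by auto
  have "(\<rho> h * T) $$ (i, j) = (\<Sum>a<d. \<rho> h $$ (i, a) * coeff_pairing G \<rho> \<rho>' a k j l)"
    by (subst mult_index_sum[OF R(1)[OF h] T ij], rule sum.cong[OF refl]) (use ij in \<open>simp add: T_def\<close>)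
  also have "\<dots> = (\<Sum>g\<in>carrier G. (\<Sum>a<d. \<rho> h $$ (i, a) * \<rho> g $$ (a, k)) * cnj (\<rho>' g $$ (j, l)))"
    unfolding coeff_pairing_def sum_distrib_left sum_distrib_right
    by (subst sum.swap) (simp only: mult.assoc)
  also have "\<dots> = (\<Sum>g\<in>carrier G. \<rho> (h \<otimes>\<^bsub>G\<^esub> g) $$ (i, k) * cnj (\<rho>' g $$ (j, l)))"
  proof (intro sum.cong refl)
    fix g assume g: "g \<in> carrier G"
    show "(\<Sum>a<d. \<rho> h $$ (i, a) * \<rho> g $$ (a, k)) * cnj (\<rho>' g $$ (j, l)) = \<rho> (h \<otimes>\<^bsub>G\<^esub> g) $$ (i, k) * cnj (\<rho>' g $$ (j, l))"
      unfolding R(5)[OF h g] by (subst mult_index_sum[OF R(1)[OF h] R(1)[OF g] ij(1) kl(1)]) (rule refl)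
  qed
  \<comment> \<open>The argument of the second factor is rewritten as h^-1 (h g), so that the
    summand depends only on h g and the sum can be translated.\<close>
  also have "\<dots> = (\<Sum>g\<in>carrier G. \<rho> (h \<otimes>\<^bsub>G\<^esub> g) $$ (i, k) * cnj (\<rho>' (inv\<^bsub>G\<^esub> h \<otimes>\<^bsub>G\<^esub> (h \<otimes>\<^bsub>G\<^esub> g)) $$ (j, l)))"
    by (intro sum.cong refl) (use h in \<open>simp add: m_assoc[symmetric]\<close>)
  also have "\<dots> = (\<Sum>g\<in>carrier G. \<rho> g $$ (i, k) * cnj (\<rho>' (inv\<^bsub>G\<^esub> h \<otimes>\<^bsub>G\<^esub> g) $$ (j, l)))"
    by (rule group_sum_translate[OF G h, of "\<lambda>g. \<rho> g $$ (i, k) * cnj (\<rho>' (inv\<^bsub>G\<^esub> h \<otimes>\<^bsub>G\<^esub> g) $$ (j, l))"])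
  also have "\<dots> = (\<Sum>g\<in>carrier G. \<rho> g $$ (i, k) * (\<Sum>b<d'. cnj (\<rho>' g $$ (b, l)) * \<rho>' h $$ (b, j)))"
  proof (intro sum.cong refl)
    fix g assume g: "g \<in> carrier G"
    have "\<rho>' (inv\<^bsub>G\<^esub> h \<otimes>\<^bsub>G\<^esub> g) $$ (j, l) = (mat_adjoint (\<rho>' h) * \<rho>' g) $$ (j, l)"
      using R'(5)[OF inv_closed[OF h] g] unitary_rep_inv[OF G \<rho>' h] by simp
    also have "\<dots> = (\<Sum>b<d'. cnj (\<rho>' h $$ (b, j)) * \<rho>' g $$ (b, l))"
      by (subst mult_index_sum[OF mat_adjoint_carrier[OF R'(1)[OF h]] R'(1)[OF g] ij(2) kl(2)], rule sum.cong[OF refl])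
         (use R'(1)[OF h] ij in \<open>simp add: mat_adjoint_index\<close>)
    finally show "\<rho> g $$ (i, k) * cnj (\<rho>' (inv\<^bsub>G\<^esub> h \<otimes>\<^bsub>G\<^esub> g) $$ (j, l)) =
        \<rho> g $$ (i, k) * (\<Sum>b<d'. cnj (\<rho>' g $$ (b, l)) * \<rho>' h $$ (b, j))"
      by (simp add: mult.commute)
  qed
  also have "\<dots> = (\<Sum>b<d'. coeff_pairing G \<rho> \<rho>' i k b l * \<rho>' h $$ (b, j))"
    unfolding coeff_pairing_def sum_distrib_left sum_distrib_right
    by (subst sum.swap) (simp only: mult.assoc)
  also have "\<dots> = (T * \<rho>' h) $$ (i, j)"
    by (subst mult_index_sum[OF T R'(1)[OF h] ij], rule sum.cong[OF refl]) (use ij in \<open>simp add: T_def\<close>)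
  finally show "(\<rho> h * T) $$ (i, j) = (T * \<rho>' h) $$ (i, j)" .
qed (use unitary_repD(1)[OF \<rho> h] unitary_repD(1)[OF \<rho>' h] in \<open>auto simp: T_def\<close>)

text \<open>A nonzero intertwiner would be invertible and conjugate one representation into the
  other, so their traces would agree.\<close>

lemma schur_orthogonality_distinct:
  assumes G: "group G" and \<rho>: "irreducible_unitary_rep G d \<rho>" and \<rho>': "irreducible_unitary_rep G d' \<rho>'"
    and ne: "rep_character G d \<rho> \<noteq> rep_character G d' \<rho>'" and ijkl: "i < d" "k < d" "j < d'" "l < d'"
  shows "coeff_pairing G \<rho> \<rho>' i k j l = 0"
proof -
  note u = irreducible_unitary_repD(1)[OF \<rho>] and u' = irreducible_unitary_repD(1)[OF \<rho>']
  define T where "T = mat d d' (\<lambda>(i, j). coeff_pairing G \<rho> \<rho>' i k j l)"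
  have T: "T \<in> carrier_mat d d'" by (simp add: T_def)
  have com: "\<rho> h * T = T * \<rho>' h" if "h \<in> carrier G" for h
    unfolding T_def by (rule coeff_pairing_intertwines[OF G u u' ijkl(2,4) that])
  have "T = 0\<^sub>m d d'"
  proof (rule ccontr)
    assume "T \<noteq> 0\<^sub>m d d'"
    then obtain S where S: "S \<in> carrier_mat d' d" "T * S = 1\<^sub>m d" "S * T = 1\<^sub>m d'"
      using schur_intertwiner[OF \<rho> \<rho>' T com] by blast
    have "mtr (\<rho> g) = mtr (\<rho>' g)" if g: "g \<in> carrier G" for g
    proof -
      note r = unitary_repD(1)[OF u g] and r' = unitary_repD(1)[OF u' g]
      have "mtr (\<rho> g) = mtr (\<rho> g * (T * S))" using r S by simp
      also have "\<rho> g * (T * S) = T * (\<rho>' g * S)"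
        unfolding assoc_mult_mat[OF r T S(1), symmetric] com[OF g] by (rule assoc_mult_mat[OF T r' S(1)])
      also have "mtr \<dots> = mtr (\<rho>' g * S * T)" using T S r' by (intro mtr_comm) auto
      also have "\<rho>' g * S * T = \<rho>' g" using T S r' by (simp add: assoc_mult_mat[of "\<rho>' g" d' d' S d T d'])
      finally show ?thesis .
    qed
    hence "(\<Sum>i<d. \<rho> g $$ (i, i)) = (\<Sum>i<d'. \<rho>' g $$ (i, i))" if g: "g \<in> carrier G" for g
      using carrier_matD(1)[OF unitary_repD(1)[OF u g]] carrier_matD(1)[OF unitary_repD(1)[OF u' g]] g
      unfolding mtr_def by metis
    hence "rep_character G d \<rho> = rep_character G d' \<rho>'"
      unfolding rep_character_def by (intro restrict_ext)
    thus False using ne by simp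
  qed
  moreover have "T $$ (i, j) = coeff_pairing G \<rho> \<rho>' i k j l" using ijkl by (simp add: T_def)
  ultimately show ?thesis using ijkl by simp
qed

text \<open>Subtracting an eigenvalue \<open>lam\<close> from the intertwiner leaves one that is not
  invertible, hence zero, so the pairing is the scalar matrix \<open>lam\<close>. Its trace is
  computed from unitarity: each group element contributes 1 if k = l and 0 otherwise, so d times
  \<open>lam\<close> is |G| or 0.\<close>

lemma schur_orthogonality_same:
  assumes G: "group G" and fin: "finite (carrier G)" and \<rho>: "irreducible_unitary_rep G d \<rho>"
    and ijkl: "i < d" "k < d" "j < d" "l < d"
  shows "coeff_pairing G \<rho> \<rho> i k j l = (if i = j \<and> k = l then of_nat (card (carrier G)) / of_nat d else 0)"
proof -
  note u = irreducible_unitary_repD(1)[OF \<rho>] and d0 = irreducible_unitary_repD(2)[OF \<rho>]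
  define T where "T = mat d d (\<lambda>(i, j). coeff_pairing G \<rho> \<rho> i k j l)"
  have T: "T \<in> carrier_mat d d" by (simp add: T_def)
  obtain lam where lam: "eigenvalue T lam"
    using spectrum_non_empty[OF T d0] by (auto simp: spectrum_def)
  define T' where "T' = T - lam \<cdot>\<^sub>m 1\<^sub>m d"
  have T': "T' \<in> carrier_mat d d"
    unfolding T'_def by (intro minus_carrier_mat smult_carrier_mat one_carrier_mat)
  have com: "\<rho> h * T' = T' * \<rho> h" if h: "h \<in> carrier G" for h
  proof -
    note r = unitary_repD(1)[OF u h]
    have "\<rho> h * T = T * \<rho> h"
      unfolding T_def by (rule coeff_pairing_intertwines[OF G u u ijkl(2,4) h])
    moreover have "\<rho> h * (lam \<cdot>\<^sub>m 1\<^sub>m d) = lam \<cdot>\<^sub>m \<rho> h" "(lam \<cdot>\<^sub>m 1\<^sub>m d) * \<rho> h = lam \<cdot>\<^sub>m \<rho> h"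
      using r mult_smult_distrib[OF r one_carrier_mat, of lam] mult_smult_assoc_mat[OF one_carrier_mat r, of lam] by simp_all
    ultimately show ?thesis
      unfolding T'_def using T r by (simp add: mult_minus_distrib_mat[of _ d d _ d] minus_mult_distrib_mat[of _ d d _ _ d])
  qed
  obtain v where v: "v \<in> carrier_vec d" "v \<noteq> 0\<^sub>v d" "T *\<^sub>v v = lam \<cdot>\<^sub>v v"
    using lam T by (auto simp: eigenvalue_def eigenvector_def)
  have T'v: "T' *\<^sub>v v = 0\<^sub>v d"
  proof (rule eq_vecI)
    fix a assume "a < dim_vec (0\<^sub>v d :: complex vec)"
    hence a: "a < d" by simp
    have "vec_index (T' *\<^sub>v v) a = (\<Sum>b<d. T $$ (a, b) * vec_index v b) - (\<Sum>b<d. (if a = b then lam else 0) * vec_index v b)"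
      unfolding sum_subtractf[symmetric]
      by (subst mult_vec_index_sum[OF T' v(1) a], rule sum.cong[OF refl])
         (use a T in \<open>simp add: T'_def algebra_simps\<close>)
    also have "(\<Sum>b<d. T $$ (a, b) * vec_index v b) = vec_index (T *\<^sub>v v) a"
      by (rule mult_vec_index_sum[OF T v(1) a, symmetric])
    also have "(\<Sum>b<d. (if a = b then lam else 0) * vec_index v b) = (\<Sum>b<d. if a = b then lam * vec_index v b else 0)"
      by (intro sum.cong) auto
    also have "\<dots> = lam * vec_index v a" using a by simp
    finally show "vec_index (T' *\<^sub>v v) a = vec_index (0\<^sub>v d) a" using v a by simp
  qed (use T' in simp)
  have "T' = 0\<^sub>m d d"
  proof (rule ccontr)
    assume "T' \<noteq> 0\<^sub>m d d"
    then obtain S where S: "S \<in> carrier_mat d d" "S * T' = 1\<^sub>m d"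
      using schur_intertwiner[OF \<rho> \<rho> T' com] by blast
    have "v = (S * T') *\<^sub>v v" using S v by simp
    also have "\<dots> = S *\<^sub>v 0\<^sub>v d" using assoc_mult_mat_vec[OF S(1) T' v(1)] T'v by simp
    also have "\<dots> = 0\<^sub>v d" using S by (intro eq_vecI) (auto simp: scalar_prod_def)
    finally show False using v by simp
  qed
  hence scal: "coeff_pairing G \<rho> \<rho> a k b l = (if a = b then lam else 0)" if "a < d" "b < d" for a b
  proof -
    assume "T' = 0\<^sub>m d d"
    hence "T' $$ (a, b) = 0" using that by simp
    thus ?thesis using that T unfolding T'_def T_def by (auto split: if_splits)
  qed
  have "(\<Sum>a<d. coeff_pairing G \<rho> \<rho> a k a l) = (\<Sum>g\<in>carrier G. \<Sum>a<d. cnj (\<rho> g $$ (a, l)) * \<rho> g $$ (a, k))"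
    unfolding coeff_pairing_def by (subst sum.swap) (simp only: mult.commute)
  also have "\<dots> = (\<Sum>g\<in>carrier G. if k = l then 1 else 0)"
  proof (intro sum.cong refl)
    fix g assume g: "g \<in> carrier G"
    note r = unitary_repD(1)[OF u g]
    have "(\<Sum>a<d. cnj (\<rho> g $$ (a, l)) * \<rho> g $$ (a, k)) = (mat_adjoint (\<rho> g) * \<rho> g) $$ (l, k)"
      by (subst mult_index_sum[OF mat_adjoint_carrier[OF r] r ijkl(4,2)], rule sum.cong[OF refl])
         (use r ijkl in \<open>simp add: mat_adjoint_index\<close>)
    also have "\<dots> = (if k = l then 1 else 0)" using unitary_repD(3)[OF u g] ijkl by auto
    finally show "(\<Sum>a<d. cnj (\<rho> g $$ (a, l)) * \<rho> g $$ (a, k)) = (if k = l then 1 else 0)" .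
  qed
  finally have "of_nat d * lam = (if k = l then of_nat (card (carrier G)) else 0)" by (simp add: scal)
  thus ?thesis using scal[OF ijkl(1,3)] d0 by (auto simp: field_simps)
qed

section \<open>Characters, their degrees and convolution\<close>

lemma rep_character_one:
  assumes "group G" "irreducible_unitary_rep G d \<rho>"
  shows "rep_character G d \<rho> \<one>\<^bsub>G\<^esub> = of_nat d"
proof -
  interpret group G by fact
  show ?thesis
    using unitary_repD(4)[OF irreducible_unitary_repD(1)[OF assms(2)]] by (simp add: rep_character_def)
qed

text \<open>The value of a character at the unit element is its degree, so the description in
  \<open>character_dim\<close> is determined by the character alone.\<close>

lemma character_dim_eq:
  assumes "group G" "irreducible_unitary_rep G d \<rho>"
  shows "character_dim G (rep_character G d \<rho>) = d"
  unfolding character_dim_def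
proof (rule the_equality)
  show "\<exists>\<rho>'. irreducible_unitary_rep G d \<rho>' \<and> rep_character G d \<rho> = rep_character G d \<rho>'" using assms(2) by blast
  fix e assume "\<exists>\<rho>'. irreducible_unitary_rep G e \<rho>' \<and> rep_character G d \<rho> = rep_character G e \<rho>'"
  then obtain \<rho>' where r: "irreducible_unitary_rep G e \<rho>'" "rep_character G d \<rho> = rep_character G e \<rho>'" by blast
  hence "(of_nat d :: complex) = of_nat e"
    using rep_character_one[OF assms] rep_character_one[OF assms(1) r(1)] by simp
  thus "e = d" by simp
qed

lemma irr_characterE:
  assumes "group G" "\<chi> \<in> irr_characters G"
  obtains \<rho> where "irreducible_unitary_rep G (character_dim G \<chi>) \<rho>" "\<chi> = rep_character G (character_dim G \<chi>) \<rho>"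
proof -
  obtain d \<rho> where r: "irreducible_unitary_rep G d \<rho>" "\<chi> = rep_character G d \<rho>"
    using assms(2) by (auto simp: irr_characters_def)
  have "character_dim G \<chi> = d" unfolding r(2) by (rule character_dim_eq[OF assms(1) r(1)])
  thus ?thesis using r that by blast
qed

lemma rep_character_eval: "g \<in> carrier G \<Longrightarrow> rep_character G d \<rho> g = (\<Sum>i<d. \<rho> g $$ (i, i))"
  by (simp add: rep_character_def)

lemma character_orthogonality:
  assumes G: "group G" and fin: "finite (carrier G)" and \<chi>: "\<chi> \<in> irr_characters G" and \<psi>: "\<psi> \<in> irr_characters G"
  shows "(\<Sum>g\<in>carrier G. \<chi> g * cnj (\<psi> g)) = (if \<chi> = \<psi> then of_nat (card (carrier G)) else 0)"
proof -
  obtain \<rho> where \<rho>: "irreducible_unitary_rep G (character_dim G \<chi>) \<rho>" "\<chi> = rep_character G (character_dim G \<chi>) \<rho>"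
    by (rule irr_characterE[OF G \<chi>])
  obtain \<rho>' where \<rho>': "irreducible_unitary_rep G (character_dim G \<psi>) \<rho>'" "\<psi> = rep_character G (character_dim G \<psi>) \<rho>'"
    by (rule irr_characterE[OF G \<psi>])
  let ?d = "character_dim G \<chi>" and ?e = "character_dim G \<psi>"
  have ev: "\<chi> g = (\<Sum>i<?d. \<rho> g $$ (i, i))" "\<psi> g = (\<Sum>i<?e. \<rho>' g $$ (i, i))" if "g \<in> carrier G" for g
    by (subst \<rho>(2), rule rep_character_eval[OF that], subst \<rho>'(2), rule rep_character_eval[OF that])
  have exp: "(\<Sum>g\<in>carrier G. \<chi> g * cnj (\<psi> g)) = (\<Sum>i<?d. \<Sum>j<?e. coeff_pairing G \<rho> \<rho>' i i j j)"
  proof -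
    have "(\<Sum>g\<in>carrier G. \<chi> g * cnj (\<psi> g)) = (\<Sum>g\<in>carrier G. \<Sum>i<?d. \<Sum>j<?e. \<rho> g $$ (i, i) * cnj (\<rho>' g $$ (j, j)))"
      by (intro sum.cong refl) (simp add: ev sum_product)
    also have "\<dots> = (\<Sum>i<?d. \<Sum>g\<in>carrier G. \<Sum>j<?e. \<rho> g $$ (i, i) * cnj (\<rho>' g $$ (j, j)))" by (rule sum.swap)
    also have "\<dots> = (\<Sum>i<?d. \<Sum>j<?e. coeff_pairing G \<rho> \<rho>' i i j j)"
      unfolding coeff_pairing_def by (intro sum.cong refl sum.swap)
    finally show ?thesis .
  qed
  show ?thesis
  proof (cases "\<chi> = \<psi>")
    case False
    hence "rep_character G ?d \<rho> \<noteq> rep_character G ?e \<rho>'" using \<rho>(2) \<rho>'(2) by argo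
    hence "coeff_pairing G \<rho> \<rho>' i i j j = 0" if "i < ?d" "j < ?e" for i j
      by (rule schur_orthogonality_distinct[OF G \<rho>(1) \<rho>'(1)]) (use that in auto)
    thus ?thesis unfolding exp using False by simp
  next
    case True
    have "(\<Sum>g\<in>carrier G. \<chi> g * cnj (\<psi> g)) = (\<Sum>g\<in>carrier G. \<chi> g * cnj (\<chi> g))" using True by simp
    also have "\<dots> = (\<Sum>i<?d. \<Sum>j<?d. coeff_pairing G \<rho> \<rho> i i j j)"
    proof -
      have "(\<Sum>g\<in>carrier G. \<chi> g * cnj (\<chi> g)) = (\<Sum>g\<in>carrier G. \<Sum>i<?d. \<Sum>j<?d. \<rho> g $$ (i, i) * cnj (\<rho> g $$ (j, j)))"
        by (intro sum.cong refl) (simp add: ev(1) sum_product)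
      also have "\<dots> = (\<Sum>i<?d. \<Sum>g\<in>carrier G. \<Sum>j<?d. \<rho> g $$ (i, i) * cnj (\<rho> g $$ (j, j)))" by (rule sum.swap)
      also have "\<dots> = (\<Sum>i<?d. \<Sum>j<?d. coeff_pairing G \<rho> \<rho> i i j j)"
        unfolding coeff_pairing_def by (intro sum.cong refl sum.swap)
      finally show ?thesis .
    qed
    also have "\<dots> = (\<Sum>i<?d. \<Sum>j<?d. if i = j then of_nat (card (carrier G)) / of_nat ?d else 0)"
      by (intro sum.cong refl) (simp add: schur_orthogonality_same[OF G fin \<rho>(1)])
    also have "\<dots> = of_nat (card (carrier G))"
      using irreducible_unitary_repD(2)[OF \<rho>(1)] by simp
    finally show ?thesis using True by simp
  qed
qed

lemma character_inv:
  assumes G: "group G" and \<chi>: "\<chi> \<in> irr_characters G" and g: "g \<in> carrier G"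
  shows "\<chi> (inv\<^bsub>G\<^esub> g) = cnj (\<chi> g)"
proof -
  interpret group G by (rule G)
  obtain \<rho> where \<rho>: "irreducible_unitary_rep G (character_dim G \<chi>) \<rho>" "\<chi> = rep_character G (character_dim G \<chi>) \<rho>"
    by (rule irr_characterE[OF G \<chi>])
  note u = irreducible_unitary_repD(1)[OF \<rho>(1)]
  have "\<chi> (inv\<^bsub>G\<^esub> g) = (\<Sum>i<character_dim G \<chi>. \<rho> (inv\<^bsub>G\<^esub> g) $$ (i, i))"
    by (subst \<rho>(2), rule rep_character_eval[OF inv_closed[OF g]])
  also have "\<dots> = (\<Sum>i<character_dim G \<chi>. cnj (\<rho> g $$ (i, i)))"
    using unitary_repD(1)[OF u g] by (intro sum.cong refl) (simp add: unitary_rep_inv[OF G u g] mat_adjoint_index)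
  also have "\<dots> = cnj (\<Sum>i<character_dim G \<chi>. \<rho> g $$ (i, i))" by simp
  also have "(\<Sum>i<character_dim G \<chi>. \<rho> g $$ (i, i)) = \<chi> g"
    by (subst (2) \<rho>(2), rule rep_character_eval[OF g, symmetric])
  finally show ?thesis .
qed

text \<open>By unitarity \<chi>(h^-1 g) is a sum of products of coefficients of g with conjugate
  coefficients of h, to which orthogonality applies. This is what makes the normalized characters
  idempotents of the group algebra.\<close>

lemma character_convolution:
  assumes G: "group G" and fin: "finite (carrier G)" and \<chi>: "\<chi> \<in> irr_characters G" and g: "g \<in> carrier G"
  shows "(\<Sum>h\<in>carrier G. \<chi> h * \<chi> (inv\<^bsub>G\<^esub> h \<otimes>\<^bsub>G\<^esub> g)) =
    of_nat (card (carrier G)) / of_nat (character_dim G \<chi>) * \<chi> g"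
proof -
  interpret group G by (rule G)
  obtain \<rho> where \<rho>: "irreducible_unitary_rep G (character_dim G \<chi>) \<rho>" "\<chi> = rep_character G (character_dim G \<chi>) \<rho>"
    by (rule irr_characterE[OF G \<chi>])
  let ?d = "character_dim G \<chi>"
  let ?c = "of_nat (card (carrier G)) / of_nat ?d :: complex"
  note u = irreducible_unitary_repD(1)[OF \<rho>(1)]
  have ev: "\<chi> g = (\<Sum>i<?d. \<rho> g $$ (i, i))" if "g \<in> carrier G" for g
    by (subst \<rho>(2), rule rep_character_eval[OF that])
  have prod: "\<chi> (inv\<^bsub>G\<^esub> h \<otimes>\<^bsub>G\<^esub> g) = (\<Sum>j<?d. \<Sum>k<?d. cnj (\<rho> h $$ (k, j)) * \<rho> g $$ (k, j))" if h: "h \<in> carrier G" for h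
  proof -
    note rh = unitary_repD(1)[OF u h] and rg = unitary_repD(1)[OF u g]
    have "\<rho> (inv\<^bsub>G\<^esub> h \<otimes>\<^bsub>G\<^esub> g) = mat_adjoint (\<rho> h) * \<rho> g"
      using unitary_repD(5)[OF u inv_closed[OF h] g] unitary_rep_inv[OF G u h] by simp
    hence "\<chi> (inv\<^bsub>G\<^esub> h \<otimes>\<^bsub>G\<^esub> g) = (\<Sum>j<?d. (mat_adjoint (\<rho> h) * \<rho> g) $$ (j, j))"
      using ev[OF m_closed[OF inv_closed[OF h] g]] by simp
    also have "\<dots> = (\<Sum>j<?d. \<Sum>k<?d. mat_adjoint (\<rho> h) $$ (j, k) * \<rho> g $$ (k, j))"
      by (intro sum.cong refl mult_index_sum[OF mat_adjoint_carrier[OF rh] rg]) auto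
    also have "\<dots> = (\<Sum>j<?d. \<Sum>k<?d. cnj (\<rho> h $$ (k, j)) * \<rho> g $$ (k, j))"
      using rh by (intro sum.cong refl) (simp add: mat_adjoint_index)
    finally show ?thesis .
  qed
  have "(\<Sum>h\<in>carrier G. \<chi> h * \<chi> (inv\<^bsub>G\<^esub> h \<otimes>\<^bsub>G\<^esub> g)) =
      (\<Sum>h\<in>carrier G. \<Sum>i<?d. \<Sum>j<?d. \<Sum>k<?d. \<rho> h $$ (i, i) * cnj (\<rho> h $$ (k, j)) * \<rho> g $$ (k, j))"
    by (intro sum.cong refl) (simp only: ev prod sum_product, simp only: sum_distrib_left mult.assoc)
  also have "\<dots> = (\<Sum>i<?d. \<Sum>h\<in>carrier G. \<Sum>j<?d. \<Sum>k<?d. \<rho> h $$ (i, i) * cnj (\<rho> h $$ (k, j)) * \<rho> g $$ (k, j))"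
    by (rule sum.swap)
  also have "\<dots> = (\<Sum>i<?d. \<Sum>j<?d. \<Sum>h\<in>carrier G. \<Sum>k<?d. \<rho> h $$ (i, i) * cnj (\<rho> h $$ (k, j)) * \<rho> g $$ (k, j))"
    by (intro sum.cong refl sum.swap)
  also have "\<dots> = (\<Sum>i<?d. \<Sum>j<?d. \<Sum>k<?d. \<Sum>h\<in>carrier G. \<rho> h $$ (i, i) * cnj (\<rho> h $$ (k, j)) * \<rho> g $$ (k, j))"
    by (intro sum.cong refl sum.swap)
  also have "\<dots> = (\<Sum>i<?d. \<Sum>j<?d. \<Sum>k<?d. coeff_pairing G \<rho> \<rho> i i k j * \<rho> g $$ (k, j))"
    by (simp only: coeff_pairing_def sum_distrib_right)
  also have "\<dots> = (\<Sum>i<?d. \<Sum>j<?d. \<Sum>k<?d. if k = i then (if j = i then ?c * \<rho> g $$ (i, i) else 0) else 0)"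
    by (intro sum.cong refl) (auto simp: schur_orthogonality_same[OF G fin \<rho>(1)])
  also have "\<dots> = (\<Sum>i<?d. ?c * \<rho> g $$ (i, i))" by simp
  finally show ?thesis by (simp add: ev[OF g] sum_distrib_left)
qed

section \<open>Orthonormal families and complete reducibility\<close>

definition lin_closed :: "nat \<Rightarrow> complex vec set \<Rightarrow> bool" where
  "lin_closed n W \<longleftrightarrow> W \<subseteq> carrier_vec n \<and> 0\<^sub>v n \<in> W \<and> (\<forall>v\<in>W. \<forall>w\<in>W. v + w \<in> W) \<and> (\<forall>c. \<forall>v\<in>W. c \<cdot>\<^sub>v v \<in> W)"

text \<open>The columns of \<open>B\<close> are an orthonormal family in \<open>W\<close>. Subspaces
  are described by such matrices because the restriction of a representation to an invariant
  subspace is then again a matrix representation, namely the compression by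
  \<open>B\<close>.\<close>

definition isometry_into :: "nat \<Rightarrow> nat \<Rightarrow> complex mat \<Rightarrow> complex vec set \<Rightarrow> bool" where
  "isometry_into n m B W \<longleftrightarrow> B \<in> carrier_mat n m \<and> mat_adjoint B * B = 1\<^sub>m m \<and>
     (\<forall>c\<in>carrier_vec m. B *\<^sub>v c \<in> W)"

lemma mtr_mult_adjoint:
  assumes "A \<in> carrier_mat n m"
  shows "mtr (A * mat_adjoint A) = of_real (\<Sum>i<n. \<Sum>j<m. (norm (A $$ (i, j)))\<^sup>2)"
proof -
  have "mtr (A * mat_adjoint A) = (\<Sum>i<n. (A * mat_adjoint A) $$ (i, i))"
    using assms by (simp add: mtr_def)
  also have "\<dots> = (\<Sum>i<n. \<Sum>j<m. A $$ (i, j) * mat_adjoint A $$ (j, i))"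
    by (intro sum.cong refl mult_index_sum[OF assms mat_adjoint_carrier[OF assms]]) auto
  also have "\<dots> = (\<Sum>i<n. \<Sum>j<m. of_real ((norm (A $$ (i, j)))\<^sup>2))"
    using assms by (intro sum.cong refl) (simp only: mat_adjoint_index carrier_matD lessThan_iff complex_norm_square)
  finally show ?thesis by (simp only: of_real_sum)
qed

lemma mtr_one [simp]: "mtr (1\<^sub>m n) = of_nat n"
  by (simp add: mtr_def)

lemma mtr_minus:
  assumes "A \<in> carrier_mat n n" "B \<in> carrier_mat n n"
  shows "mtr (A - B) = mtr A - mtr B"
  using assms by (simp add: mtr_def sum_subtractf)

lemma mtr_add:
  assumes "A \<in> carrier_mat n n" "B \<in> carrier_mat n n"
  shows "mtr (A + B) = mtr A + mtr B"
  using assms by (simp add: mtr_def sum.distrib)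

lemma mat_adjoint_minus_one:
  fixes A :: "complex mat"
  assumes "A \<in> carrier_mat n n"
  shows "mat_adjoint (1\<^sub>m n - A) = 1\<^sub>m n - mat_adjoint A"
proof (rule eq_matI)
  fix i j assume "i < dim_row (1\<^sub>m n - mat_adjoint A)" "j < dim_col (1\<^sub>m n - mat_adjoint A)"
  hence ij: "i < n" "j < n" using carrier_matD[OF assms] by simp_all
  have "mat_adjoint (1\<^sub>m n - A) $$ (i, j) = cnj ((1\<^sub>m n - A) $$ (j, i))"
    by (rule mat_adjoint_index) (use ij carrier_matD[OF assms] in simp_all)
  also have "\<dots> = (if i = j then 1 else 0) - cnj (A $$ (j, i))" using ij carrier_matD[OF assms] by simp
  also have "cnj (A $$ (j, i)) = mat_adjoint A $$ (i, j)"
    by (rule mat_adjoint_index[symmetric]) (use ij carrier_matD[OF assms] in simp_all)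
  finally show "mat_adjoint (1\<^sub>m n - A) $$ (i, j) = (1\<^sub>m n - mat_adjoint A) $$ (i, j)"
    using ij carrier_matD[OF assms] by simp
qed (use carrier_matD[OF assms] in simp_all)

text \<open>With Q the complementary projection to B B*, the number n - m is the trace of Q = Q Q*,
  which is a sum of squared moduli.\<close>

lemma isometry_dim_le:
  assumes "isometry_into n m B W"
  shows "m \<le> n"
proof -
  have B: "B \<in> carrier_mat n m" and BB: "mat_adjoint B * B = 1\<^sub>m m"
    using assms by (auto simp: isometry_into_def)
  note Ba = mat_adjoint_carrier[OF B]
  define P where "P = B * mat_adjoint B"
  have P: "P \<in> carrier_mat n n" using B Ba by (simp add: P_def)
  have Pa: "mat_adjoint P = P" unfolding P_def mat_adjoint_mult[OF B Ba] mat_adjoint_adjoint ..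
  have PP: "P * P = P"
  proof -
    have "P * P = B * (mat_adjoint B * (B * mat_adjoint B))"
      unfolding P_def by (rule assoc_mult_mat[OF B Ba mult_carrier_mat[OF B Ba]])
    also have "mat_adjoint B * (B * mat_adjoint B) = mat_adjoint B"
      unfolding assoc_mult_mat[OF Ba B Ba, symmetric] BB by (rule left_mult_one_mat[OF Ba])
    finally show ?thesis by (simp only: P_def)
  qed
  define Q where "Q = 1\<^sub>m n - P"
  have Q: "Q \<in> carrier_mat n n" unfolding Q_def using P by (intro minus_carrier_mat)
  have "Q * mat_adjoint Q = Q * Q" by (simp only: Q_def mat_adjoint_minus_one[OF P] Pa)
  also have "Q * Q = (1\<^sub>m n - P) * 1\<^sub>m n - (1\<^sub>m n - P) * P"
    unfolding Q_def by (rule mult_minus_distrib_mat[OF _ one_carrier_mat P]) (use P in \<open>intro minus_carrier_mat\<close>)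
  also have "(1\<^sub>m n - P) * P = 1\<^sub>m n * P - P * P"
    by (rule minus_mult_distrib_mat[OF one_carrier_mat P P])
  also have "1\<^sub>m n * P - P * P = 0\<^sub>m n n" unfolding PP using P by simp
  also have "(1\<^sub>m n - P) * 1\<^sub>m n - 0\<^sub>m n n = Q"
    using Q unfolding Q_def[symmetric] by (intro eq_matI) auto
  finally have QQ: "Q * mat_adjoint Q = Q" .
  have "mtr Q = of_nat n - mtr P" unfolding Q_def mtr_minus[OF one_carrier_mat P] by simp
  also have "mtr P = mtr (mat_adjoint B * B)" unfolding P_def by (rule mtr_comm[OF B Ba])
  also have "\<dots> = of_nat m" by (simp add: BB)
  finally have "of_nat n - of_nat m = mtr (Q * mat_adjoint Q)" by (simp add: QQ)
  also have "\<dots> = of_real (\<Sum>i<n. \<Sum>j<n. (norm (Q $$ (i, j)))\<^sup>2)" by (rule mtr_mult_adjoint[OF Q])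
  finally have "complex_of_real (real n - real m) = of_real (\<Sum>i<n. \<Sum>j<n. (norm (Q $$ (i, j)))\<^sup>2)" by simp
  hence "real n - real m = (\<Sum>i<n. \<Sum>j<n. (norm (Q $$ (i, j)))\<^sup>2)" by (simp only: of_real_eq_iff)
  also have "\<dots> \<ge> 0" by (intro sum_nonneg) auto
  finally show ?thesis by simp
qed

lemma lin_closed_minus:
  assumes "lin_closed n W" "v \<in> W" "w \<in> W"
  shows "v - w \<in> W"
proof -
  have "(-1) \<cdot>\<^sub>v w \<in> W" "v \<in> carrier_vec n" "w \<in> carrier_vec n" using assms by (auto simp: lin_closed_def)
  hence "v + (-1) \<cdot>\<^sub>v w \<in> W" using assms by (simp add: lin_closed_def)
  moreover have "v + (-1) \<cdot>\<^sub>v w = v - w"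
    using \<open>v \<in> carrier_vec n\<close> \<open>w \<in> carrier_vec n\<close> by (intro eq_vecI) auto
  ultimately show ?thesis by simp
qed

text \<open>A Gram--Schmidt step: the vector \<open>r\<close>, orthogonal to all columns, is
  normalized by \<open>t\<close> and appended as a new column.\<close>

lemma isometry_extend:
  assumes B: "isometry_into n m B W" and W: "lin_closed n W" and r: "r \<in> W" "mat_adjoint B *\<^sub>v r = 0\<^sub>v m" "r \<noteq> 0\<^sub>v n"
  shows "\<exists>B'. isometry_into n (Suc m) B' W"
proof -
  have Bc: "B \<in> carrier_mat n m" and BB: "mat_adjoint B * B = 1\<^sub>m m" and BW: "\<And>c. c \<in> carrier_vec m \<Longrightarrow> B *\<^sub>v c \<in> W"
    using B by (auto simp: isometry_into_def)
  note Ba = mat_adjoint_carrier[OF Bc]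
  have rc: "r \<in> carrier_vec n" using r(1) W by (auto simp: lin_closed_def)
  define N where "N = (\<Sum>a<n. (norm (vec_index r a))\<^sup>2)"
  have "0 < N"
  proof -
    obtain a where a: "a < n" "vec_index r a \<noteq> 0"
      using r(3) rc by (metis carrier_vecD eq_vecI index_zero_vec)
    have "0 < (norm (vec_index r a))\<^sup>2" using a by simp
    also have "\<dots> \<le> N" unfolding N_def by (rule member_le_sum) (use a in auto)
    finally show ?thesis .
  qed
  define t where "t = complex_of_real (1 / sqrt N)"
  have t: "cnj t * t * of_real N = 1"
  proof -
    have "cnj t * t * of_real N = of_real (1 / sqrt N * (1 / sqrt N) * N)"
      by (simp only: t_def complex_cnj_complex_of_real of_real_mult)
    also have "1 / sqrt N * (1 / sqrt N) * N = 1" using \<open>0 < N\<close> by simp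
    finally show ?thesis by simp
  qed
  define B' where "B' = mat n (Suc m) (\<lambda>(a, j). if j < m then B $$ (a, j) else t * vec_index r a)"
  have B': "B' \<in> carrier_mat n (Suc m)" by (simp add: B'_def)
  note B'a = mat_adjoint_carrier[OF B']
  have e1: "B' $$ (a, j) = B $$ (a, j)" if "a < n" "j < m" for a j using that by (simp add: B'_def)
  have e2: "B' $$ (a, m) = t * vec_index r a" if "a < n" for a using that by (simp add: B'_def)
  have orth: "(\<Sum>a<n. cnj (B $$ (a, j)) * vec_index r a) = 0" if "j < m" for j
  proof -
    have "(\<Sum>a<n. cnj (B $$ (a, j)) * vec_index r a) = vec_index (mat_adjoint B *\<^sub>v r) j"
      by (subst mult_vec_index_sum[OF Ba rc that], rule sum.cong[OF refl]) (use Bc that in \<open>simp add: mat_adjoint_index\<close>)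
    thus ?thesis using r(2) that by simp
  qed
  have orth': "(\<Sum>a<n. cnj (vec_index r a) * B $$ (a, j)) = 0" if "j < m" for j
  proof -
    have "(\<Sum>a<n. cnj (vec_index r a) * B $$ (a, j)) = cnj (\<Sum>a<n. cnj (B $$ (a, j)) * vec_index r a)"
      by (simp add: mult.commute)
    thus ?thesis by (simp only: orth[OF that] complex_cnj_zero)
  qed
  have bb: "(\<Sum>a<n. cnj (B $$ (a, i)) * B $$ (a, j)) = (if i = j then 1 else 0)" if "i < m" "j < m" for i j
  proof -
    have "(\<Sum>a<n. cnj (B $$ (a, i)) * B $$ (a, j)) = (mat_adjoint B * B) $$ (i, j)"
      by (subst mult_index_sum[OF Ba Bc that], rule sum.cong[OF refl]) (use Bc that in \<open>simp add: mat_adjoint_index\<close>)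
    thus ?thesis using BB that by simp
  qed
  have "mat_adjoint B' * B' = 1\<^sub>m (Suc m)"
  proof (rule eq_matI)
    fix i j assume "i < dim_row (1\<^sub>m (Suc m) :: complex mat)" "j < dim_col (1\<^sub>m (Suc m) :: complex mat)"
    hence ij: "i < Suc m" "j < Suc m" by auto
    have ex: "(mat_adjoint B' * B') $$ (i, j) = (\<Sum>a<n. cnj (B' $$ (a, i)) * B' $$ (a, j))"
      by (subst mult_index_sum[OF B'a B' ij], rule sum.cong[OF refl]) (use B' ij in \<open>simp add: mat_adjoint_index\<close>)
    consider "i < m" "j < m" | "i < m" "j = m" | "i = m" "j < m" | "i = m" "j = m" using ij by linarith
    thus "(mat_adjoint B' * B') $$ (i, j) = 1\<^sub>m (Suc m) $$ (i, j)"
    proof cases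
      case 1
      have "(\<Sum>a<n. cnj (B' $$ (a, i)) * B' $$ (a, j)) = (\<Sum>a<n. cnj (B $$ (a, i)) * B $$ (a, j))"
        by (intro sum.cong refl) (use 1 in \<open>simp add: e1\<close>)
      thus ?thesis using ex bb[OF 1] ij by simp
    next
      case 2
      have "(\<Sum>a<n. cnj (B' $$ (a, i)) * B' $$ (a, j)) = t * (\<Sum>a<n. cnj (B $$ (a, i)) * vec_index r a)"
        unfolding sum_distrib_left by (intro sum.cong refl) (use 2 in \<open>simp add: e1 e2\<close>)
      thus ?thesis using ex orth[OF 2(1)] 2 ij by simp
    next
      case 3
      have "(\<Sum>a<n. cnj (B' $$ (a, i)) * B' $$ (a, j)) = cnj t * (\<Sum>a<n. cnj (vec_index r a) * B $$ (a, j))"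
        unfolding sum_distrib_left by (intro sum.cong refl) (use 3 in \<open>simp add: e1 e2\<close>)
      thus ?thesis using ex orth'[OF 3(2)] 3 ij by simp
    next
      case 4
      have "(\<Sum>a<n. cnj (B' $$ (a, i)) * B' $$ (a, j)) = (\<Sum>a<n. cnj t * t * of_real ((norm (vec_index r a))\<^sup>2))"
        by (intro sum.cong refl) (use 4 in \<open>simp add: e2 complex_norm_square del: of_real_power\<close>)
      also have "\<dots> = cnj t * t * of_real N" by (simp only: N_def of_real_sum sum_distrib_left)
      finally show ?thesis using ex t 4 ij by simp
    qed
  qed (use B' in auto)
  moreover have "B' *\<^sub>v c \<in> W" if c: "c \<in> carrier_vec (Suc m)" for c
  proof -
    define c' where "c' = vec m (vec_index c)"
    have c': "c' \<in> carrier_vec m" by (simp add: c'_def)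
    have "B' *\<^sub>v c = B *\<^sub>v c' + (vec_index c m * t) \<cdot>\<^sub>v r"
    proof (rule eq_vecI)
      fix a assume "a < dim_vec (B *\<^sub>v c' + (vec_index c m * t) \<cdot>\<^sub>v r)"
      hence a: "a < n" using rc by simp
      have "vec_index (B' *\<^sub>v c) a = (\<Sum>j<Suc m. B' $$ (a, j) * vec_index c j)"
        by (rule mult_vec_index_sum[OF B' c a])
      also have "\<dots> = (\<Sum>j<m. B $$ (a, j) * vec_index c' j) + t * vec_index r a * vec_index c m"
        using a by (simp add: e1 e2 c'_def)
      also have "(\<Sum>j<m. B $$ (a, j) * vec_index c' j) = vec_index (B *\<^sub>v c') a"
        by (rule mult_vec_index_sum[OF Bc c' a, symmetric])
      finally show "vec_index (B' *\<^sub>v c) a = vec_index (B *\<^sub>v c' + (vec_index c m * t) \<cdot>\<^sub>v r) a"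
        using a rc Bc by simp
    qed (use B' rc in simp)
    moreover have "B *\<^sub>v c' \<in> W" by (rule BW[OF c'])
    moreover have "(vec_index c m * t) \<cdot>\<^sub>v r \<in> W" using W r(1) by (simp add: lin_closed_def)
    ultimately show ?thesis using W by (simp add: lin_closed_def)
  qed
  ultimately show ?thesis using B' unfolding isometry_into_def by blast
qed

text \<open>The number of columns is taken maximal, which is possible by
  \<open>isometry_dim_le\<close>. If B B* v differed from v for some v in \<open>W\<close>, the
  residual would be a further orthogonal vector in \<open>W\<close>.\<close>

lemma isometry_onto:
  assumes W: "lin_closed n W"
  shows "\<exists>m B. isometry_into n m B W \<and> (\<forall>v\<in>W. B *\<^sub>v (mat_adjoint B *\<^sub>v v) = v)"
proof -
  let ?P = "\<lambda>m. \<exists>B. isometry_into n m B W"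
  have "isometry_into n 0 (mat n 0 (\<lambda>_. 0)) W"
  proof -
    have "mat n 0 (\<lambda>_. 0) *\<^sub>v c = 0\<^sub>v n" if "c \<in> carrier_vec 0" for c :: "complex vec"
      using that by (intro eq_vecI) (auto simp: scalar_prod_def)
    moreover have "mat_adjoint (mat n 0 (\<lambda>_. 0)) * mat n 0 (\<lambda>_. 0) = (1\<^sub>m 0 :: complex mat)"
      by (rule eq_matI) auto
    ultimately show ?thesis using W by (auto simp: isometry_into_def lin_closed_def)
  qed
  hence ex: "?P 0" by blast
  have bd: "\<And>y. ?P y \<Longrightarrow> y \<le> n" using isometry_dim_le by blast
  define m where "m = (GREATEST m. ?P m)"
  have Pm: "?P m" unfolding m_def by (rule GreatestI_nat[of ?P 0 n]) (use ex bd in blast)+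
  have max: "k \<le> m" if "?P k" for k unfolding m_def by (rule Greatest_le_nat[of ?P k n]) (use that bd in blast)+
  obtain B where B: "isometry_into n m B W" using Pm by blast
  have Bc: "B \<in> carrier_mat n m" and BB: "mat_adjoint B * B = 1\<^sub>m m" and BW: "\<And>c. c \<in> carrier_vec m \<Longrightarrow> B *\<^sub>v c \<in> W"
    using B by (auto simp: isometry_into_def)
  note Ba = mat_adjoint_carrier[OF Bc]
  have "B *\<^sub>v (mat_adjoint B *\<^sub>v v) = v" if v: "v \<in> W" for v
  proof (rule ccontr)
    assume ne: "B *\<^sub>v (mat_adjoint B *\<^sub>v v) \<noteq> v"
    have vc: "v \<in> carrier_vec n" using v W by (auto simp: lin_closed_def)
    have c: "mat_adjoint B *\<^sub>v v \<in> carrier_vec m" by (rule mult_mat_vec_carrier[OF Ba vc])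
    let ?w = "B *\<^sub>v (mat_adjoint B *\<^sub>v v)"
    have w: "?w \<in> carrier_vec n" by (rule mult_mat_vec_carrier[OF Bc c])
    have rW: "v - ?w \<in> W" by (rule lin_closed_minus[OF W v BW[OF c]])
    have "mat_adjoint B *\<^sub>v ?w = (mat_adjoint B * B) *\<^sub>v (mat_adjoint B *\<^sub>v v)"
      by (rule assoc_mult_mat_vec[OF Ba Bc c, symmetric])
    also have "\<dots> = mat_adjoint B *\<^sub>v v" using c by (simp add: BB)
    finally have "mat_adjoint B *\<^sub>v (v - ?w) = 0\<^sub>v m"
      using mult_minus_distrib_mat_vec[OF Ba vc w] c by simp
    moreover have "v - ?w \<noteq> 0\<^sub>v n"
    proof
      assume z: "v - ?w = 0\<^sub>v n"
      have "?w = v"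
      proof (rule eq_vecI)
        fix i assume "i < dim_vec v"
        hence i: "i < n" using vc by simp
        have "vec_index (v - ?w) i = vec_index v i - vec_index ?w i"
          by (rule index_minus_vec(1)) (simp only: carrier_vecD[OF w] i)
        thus "vec_index ?w i = vec_index v i" using z i by simp
      qed (simp only: carrier_vecD[OF w] carrier_vecD[OF vc])
      thus False using ne by simp
    qed
    ultimately have "?P (Suc m)" by (rule isometry_extend[OF B W rW])
    thus False using max[of "Suc m"] by simp
  qed
  thus ?thesis using B by blast
qed

text \<open>The hypothesis \<open>inv\<close> says that the range of \<open>B\<close> is invariant:
  B B* may be inserted or deleted after \<sigma>(g) B, and so the compression is multiplicative. Its
  adjoint is the compression at the inverse element, which gives unitarity.\<close>

lemma compress_unitary_rep:
  assumes G: "group G" and \<sigma>: "unitary_rep G n \<sigma>" and B: "B \<in> carrier_mat n m" "mat_adjoint B * B = 1\<^sub>m m"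
    and inv: "\<And>g. g \<in> carrier G \<Longrightarrow> B * (mat_adjoint B * (\<sigma> g * B)) = \<sigma> g * B"
  shows "unitary_rep G m (\<lambda>g. mat_adjoint B * (\<sigma> g * B))"
proof -
  interpret group G by (rule G)
  note S = unitary_repD[OF \<sigma>]
  note Ba = mat_adjoint_carrier[OF B(1)]
  let ?t = "\<lambda>g. mat_adjoint B * (\<sigma> g * B)"
  have SB: "\<sigma> g * B \<in> carrier_mat n m" if "g \<in> carrier G" for g by (rule mult_carrier_mat[OF S(1)[OF that] B(1)])
  have t: "?t g \<in> carrier_mat m m" if "g \<in> carrier G" for g by (rule mult_carrier_mat[OF Ba SB[OF that]])
  have mult: "?t (g \<otimes>\<^bsub>G\<^esub> h) = ?t g * ?t h" if g: "g \<in> carrier G" and h: "h \<in> carrier G" for g h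
  proof -
    have "?t g * ?t h = mat_adjoint B * ((\<sigma> g * B) * ?t h)" by (rule assoc_mult_mat[OF Ba SB[OF g] t[OF h]])
    also have "(\<sigma> g * B) * ?t h = \<sigma> g * (B * ?t h)" by (rule assoc_mult_mat[OF S(1)[OF g] B(1) t[OF h]])
    also have "B * ?t h = \<sigma> h * B" by (rule inv[OF h])
    also have "\<sigma> g * (\<sigma> h * B) = \<sigma> (g \<otimes>\<^bsub>G\<^esub> h) * B"
      unfolding S(5)[OF g h] by (rule assoc_mult_mat[OF S(1)[OF g] S(1)[OF h] B(1), symmetric])
    finally show ?thesis by simp
  qed
  have one: "?t \<one>\<^bsub>G\<^esub> = 1\<^sub>m m" using S(4) B by simp
  have adj: "mat_adjoint (?t g) = ?t (inv\<^bsub>G\<^esub> g)" if g: "g \<in> carrier G" for g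
  proof -
    have "mat_adjoint (?t g) = mat_adjoint (\<sigma> g * B) * mat_adjoint (mat_adjoint B)"
      by (rule mat_adjoint_mult[OF Ba SB[OF g]])
    also have "\<dots> = (mat_adjoint B * mat_adjoint (\<sigma> g)) * B"
      by (simp only: mat_adjoint_adjoint mat_adjoint_mult[OF S(1)[OF g] B(1)])
    also have "\<dots> = mat_adjoint B * (mat_adjoint (\<sigma> g) * B)"
      by (rule assoc_mult_mat[OF Ba mat_adjoint_carrier[OF S(1)[OF g]] B(1)])
    finally show ?thesis by (simp only: unitary_rep_inv[OF G \<sigma> g])
  qed
  have "?t g * mat_adjoint (?t g) = 1\<^sub>m m" "mat_adjoint (?t g) * ?t g = 1\<^sub>m m" if g: "g \<in> carrier G" for g
    unfolding adj[OF g] using mult[OF g inv_closed[OF g]] mult[OF inv_closed[OF g] g] one g by simp_all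
  thus ?thesis using t one mult unfolding unitary_rep_def by blast
qed

text \<open>An invariant subspace and its orthogonal complement give isometries \<open>B\<close> and
  \<open>B'\<close> with B B* + B' B'* = 1. Inserting this sum into the trace of \<sigma>(g) splits
  it into the traces of the two compressions.\<close>

lemma unitary_rep_split:
  assumes G: "group G" and \<sigma>: "unitary_rep G n \<sigma>" and n: "0 < n" and red: "\<not> irreducible_unitary_rep G n \<sigma>"
  shows "\<exists>m m' \<tau> \<tau>'. m < n \<and> m' < n \<and> unitary_rep G m \<tau> \<and> unitary_rep G m' \<tau>' \<and>
    (\<forall>g\<in>carrier G. mtr (\<sigma> g) = mtr (\<tau> g) + mtr (\<tau>' g))"
proof -
  interpret group G by (rule G)
  note S = unitary_repD[OF \<sigma>]
  have "\<exists>W. VectorSpace.subspace class_ring W (module_vec TYPE(complex) n) \<and>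
      (\<forall>g\<in>carrier G. \<forall>v\<in>W. \<sigma> g *\<^sub>v v \<in> W) \<and> W \<noteq> {0\<^sub>v n} \<and> W \<noteq> carrier_vec n"
    using red \<sigma> n unfolding irreducible_unitary_rep_def by (simp only: simp_thms not_all not_imp de_Morgan_disj)
  then obtain W where W0: "VectorSpace.subspace class_ring W (module_vec TYPE(complex) n) \<and>
      (\<forall>g\<in>carrier G. \<forall>v\<in>W. \<sigma> g *\<^sub>v v \<in> W) \<and> W \<noteq> {0\<^sub>v n} \<and> W \<noteq> carrier_vec n" ..
  hence W: "VectorSpace.subspace class_ring W (module_vec TYPE(complex) n)"
      "\<And>g v. g \<in> carrier G \<Longrightarrow> v \<in> W \<Longrightarrow> \<sigma> g *\<^sub>v v \<in> W" "W \<noteq> {0\<^sub>v n}" "W \<noteq> carrier_vec n"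
    by simp_all
  have lW: "lin_closed n W" using W(1) unfolding vec_subspace_iff lin_closed_def .
  obtain m B where B: "isometry_into n m B W" and Bid: "\<And>v. v \<in> W \<Longrightarrow> B *\<^sub>v (mat_adjoint B *\<^sub>v v) = v"
    using isometry_onto[OF lW] by blast
  have Bc: "B \<in> carrier_mat n m" and BB: "mat_adjoint B * B = 1\<^sub>m m" and BW: "\<And>c. c \<in> carrier_vec m \<Longrightarrow> B *\<^sub>v c \<in> W"
    using B by (auto simp: isometry_into_def)
  note Ba = mat_adjoint_carrier[OF Bc]
  define W' where "W' = {v \<in> carrier_vec n. mat_adjoint B *\<^sub>v v = 0\<^sub>v m}"
  have lW': "lin_closed n W'"
    unfolding lin_closed_def
  proof (intro conjI ballI allI)
    show "W' \<subseteq> carrier_vec n" by (auto simp: W'_def)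
    have "mat_adjoint B *\<^sub>v 0\<^sub>v n = 0\<^sub>v m" using Ba by (intro eq_vecI) (auto simp: scalar_prod_def)
    thus "0\<^sub>v n \<in> W'" by (simp add: W'_def)
    show "v + w \<in> W'" if "v \<in> W'" "w \<in> W'" for v w
      using that mult_add_distrib_mat_vec[OF Ba, of v w] by (simp add: W'_def)
    show "c \<cdot>\<^sub>v v \<in> W'" if "v \<in> W'" for c v
    proof -
      have "c \<cdot>\<^sub>v 0\<^sub>v m = (0\<^sub>v m :: complex vec)" by (rule eq_vecI) auto
      thus ?thesis using that mult_mat_vec[OF Ba, of v c] by (simp add: W'_def)
    qed
  qed
  obtain m' B' where B': "isometry_into n m' B' W'" and Bid': "\<And>v. v \<in> W' \<Longrightarrow> B' *\<^sub>v (mat_adjoint B' *\<^sub>v v) = v"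
    using isometry_onto[OF lW'] by blast
  have Bc': "B' \<in> carrier_mat n m'" and BB': "mat_adjoint B' * B' = 1\<^sub>m m'" and BW': "\<And>c. c \<in> carrier_vec m' \<Longrightarrow> B' *\<^sub>v c \<in> W'"
    using B' by (auto simp: isometry_into_def)
  note Ba' = mat_adjoint_carrier[OF Bc']
  have SB: "\<sigma> g * B \<in> carrier_mat n m" if "g \<in> carrier G" for g by (rule mult_carrier_mat[OF S(1)[OF that] Bc])
  have SB': "\<sigma> g * B' \<in> carrier_mat n m'" if "g \<in> carrier G" for g by (rule mult_carrier_mat[OF S(1)[OF that] Bc'])
  have inv: "B * (mat_adjoint B * (\<sigma> g * B)) = \<sigma> g * B" if g: "g \<in> carrier G" for g
  proof (rule mat_eq_mult_vecI)
    fix c :: "complex vec" assume c: "c \<in> carrier_vec m"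
    have v: "\<sigma> g *\<^sub>v (B *\<^sub>v c) \<in> W" by (rule W(2)[OF g BW[OF c]])
    have "(B * (mat_adjoint B * (\<sigma> g * B))) *\<^sub>v c = B *\<^sub>v (mat_adjoint B *\<^sub>v (\<sigma> g *\<^sub>v (B *\<^sub>v c)))"
      using assoc_mult_mat_vec[OF Bc mult_carrier_mat[OF Ba SB[OF g]] c] assoc_mult_mat_vec[OF Ba SB[OF g] c]
        assoc_mult_mat_vec[OF S(1)[OF g] Bc c] by simp
    also have "\<dots> = \<sigma> g *\<^sub>v (B *\<^sub>v c)" by (rule Bid[OF v])
    also have "\<dots> = (\<sigma> g * B) *\<^sub>v c" by (rule assoc_mult_mat_vec[OF S(1)[OF g] Bc c, symmetric])
    finally show "(B * (mat_adjoint B * (\<sigma> g * B))) *\<^sub>v c = (\<sigma> g * B) *\<^sub>v c" .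
  qed (rule mult_carrier_mat[OF Bc mult_carrier_mat[OF Ba SB[OF g]]], rule SB[OF g])
  \<comment> \<open>By unitarity \<sigma>(g) is the adjoint of \<sigma>(g^-1), so the invariance of
    the subspace under g^-1, read through adjoints, is the invariance of the orthogonal complement
    under g.\<close>
  have W'inv: "\<sigma> g *\<^sub>v v \<in> W'" if g: "g \<in> carrier G" and v: "v \<in> W'" for g v
  proof -
    have vc: "v \<in> carrier_vec n" and v0: "mat_adjoint B *\<^sub>v v = 0\<^sub>v m" using v by (auto simp: W'_def)
    let ?C = "mat_adjoint B * (\<sigma> (inv\<^bsub>G\<^esub> g) * B)"
    have gi: "inv\<^bsub>G\<^esub> g \<in> carrier G" using g by simp
    have C: "?C \<in> carrier_mat m m" by (rule mult_carrier_mat[OF Ba SB[OF gi]])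
    have "\<sigma> g = mat_adjoint (\<sigma> (inv\<^bsub>G\<^esub> g))" using unitary_rep_inv[OF G \<sigma> gi] g by simp
    hence "mat_adjoint B * \<sigma> g = mat_adjoint (\<sigma> (inv\<^bsub>G\<^esub> g) * B)" by (simp only: mat_adjoint_mult[OF S(1)[OF gi] Bc])
    also have "\<dots> = mat_adjoint (B * ?C)" by (simp only: inv[OF gi])
    also have "\<dots> = mat_adjoint ?C * mat_adjoint B" by (rule mat_adjoint_mult[OF Bc C])
    finally have e: "mat_adjoint B * \<sigma> g = mat_adjoint ?C * mat_adjoint B" .
    have "mat_adjoint B *\<^sub>v (\<sigma> g *\<^sub>v v) = (mat_adjoint ?C * mat_adjoint B) *\<^sub>v v"
      unfolding e[symmetric] by (rule assoc_mult_mat_vec[OF Ba S(1)[OF g] vc, symmetric])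
    also have "\<dots> = mat_adjoint ?C *\<^sub>v 0\<^sub>v m"
      using assoc_mult_mat_vec[OF mat_adjoint_carrier[OF C] Ba vc] v0 by simp
    also have "\<dots> = 0\<^sub>v m" using mat_adjoint_carrier[OF C] by (intro eq_vecI) (auto simp: scalar_prod_def)
    finally show ?thesis using mult_mat_vec_carrier[OF S(1)[OF g] vc] by (simp add: W'_def)
  qed
  have inv': "B' * (mat_adjoint B' * (\<sigma> g * B')) = \<sigma> g * B'" if g: "g \<in> carrier G" for g
  proof (rule mat_eq_mult_vecI)
    fix c :: "complex vec" assume c: "c \<in> carrier_vec m'"
    have v: "\<sigma> g *\<^sub>v (B' *\<^sub>v c) \<in> W'" by (rule W'inv[OF g BW'[OF c]])
    have "(B' * (mat_adjoint B' * (\<sigma> g * B'))) *\<^sub>v c = B' *\<^sub>v (mat_adjoint B' *\<^sub>v (\<sigma> g *\<^sub>v (B' *\<^sub>v c)))"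
      using assoc_mult_mat_vec[OF Bc' mult_carrier_mat[OF Ba' SB'[OF g]] c] assoc_mult_mat_vec[OF Ba' SB'[OF g] c]
        assoc_mult_mat_vec[OF S(1)[OF g] Bc' c] by simp
    also have "\<dots> = \<sigma> g *\<^sub>v (B' *\<^sub>v c)" by (rule Bid'[OF v])
    also have "\<dots> = (\<sigma> g * B') *\<^sub>v c" by (rule assoc_mult_mat_vec[OF S(1)[OF g] Bc' c, symmetric])
    finally show "(B' * (mat_adjoint B' * (\<sigma> g * B'))) *\<^sub>v c = (\<sigma> g * B') *\<^sub>v c" .
  qed (rule mult_carrier_mat[OF Bc' mult_carrier_mat[OF Ba' SB'[OF g]]], rule SB'[OF g])
  let ?P = "B * mat_adjoint B" and ?P' = "B' * mat_adjoint B'"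
  have P: "?P \<in> carrier_mat n n" and P': "?P' \<in> carrier_mat n n"
    by (rule mult_carrier_mat[OF Bc Ba], rule mult_carrier_mat[OF Bc' Ba'])
  have zero_mult: "0\<^sub>m a b *\<^sub>v x = 0\<^sub>v a" if "x \<in> carrier_vec b" for a b and x :: "complex vec"
    using that by (intro eq_vecI) (auto simp: scalar_prod_def)
  have add_diff: "y + (x - y) = x" if "x \<in> carrier_vec n" "y \<in> carrier_vec n" for x y :: "complex vec"
    using that by (intro eq_vecI) auto
  have B'B: "mat_adjoint B' *\<^sub>v (B *\<^sub>v c) = 0\<^sub>v m'" if c: "c \<in> carrier_vec m" for c
  proof -
    have "mat_adjoint B * B' = 0\<^sub>m m m'"
    proof (rule mat_eq_mult_vecI)
      fix x :: "complex vec" assume x: "x \<in> carrier_vec m'"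
      have "mat_adjoint B *\<^sub>v (B' *\<^sub>v x) = 0\<^sub>v m" using BW'[OF x] by (simp add: W'_def)
      moreover have "0\<^sub>m m m' *\<^sub>v x = 0\<^sub>v m" by (rule zero_mult[OF x])
      ultimately show "(mat_adjoint B * B') *\<^sub>v x = 0\<^sub>m m m' *\<^sub>v x" using assoc_mult_mat_vec[OF Ba Bc' x] x by simp
    qed (rule mult_carrier_mat[OF Ba Bc'], rule zero_carrier_mat)
    hence "mat_adjoint (mat_adjoint B * B') = mat_adjoint (0\<^sub>m m m')" by simp
    hence "mat_adjoint B' * B = mat_adjoint (0\<^sub>m m m')" by (simp only: mat_adjoint_mult[OF Ba Bc'] mat_adjoint_adjoint)
    also have "mat_adjoint (0\<^sub>m m m' :: complex mat) = 0\<^sub>m m' m" by (rule eq_matI) (auto simp: mat_adjoint_index)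
    finally have "(mat_adjoint B' * B) *\<^sub>v c = 0\<^sub>v m'" by (simp only: zero_mult[OF c])
    thus ?thesis using assoc_mult_mat_vec[OF Ba' Bc c] by simp
  qed
  have sum1: "?P + ?P' = 1\<^sub>m n"
  proof (rule mat_eq_mult_vecI)
    fix v :: "complex vec" assume v: "v \<in> carrier_vec n"
    let ?w = "B *\<^sub>v (mat_adjoint B *\<^sub>v v)"
    have c: "mat_adjoint B *\<^sub>v v \<in> carrier_vec m" by (rule mult_mat_vec_carrier[OF Ba v])
    have w: "?w \<in> carrier_vec n" by (rule mult_mat_vec_carrier[OF Bc c])
    have "mat_adjoint B *\<^sub>v ?w = mat_adjoint B *\<^sub>v v"
      using assoc_mult_mat_vec[OF Ba Bc c] c by (simp add: BB)
    hence rW: "v - ?w \<in> W'"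
      using mult_minus_distrib_mat_vec[OF Ba v w] v w c by (simp add: W'_def)
    have c': "mat_adjoint B' *\<^sub>v v \<in> carrier_vec m'" by (rule mult_mat_vec_carrier[OF Ba' v])
    have "mat_adjoint B' *\<^sub>v (v - ?w) = mat_adjoint B' *\<^sub>v v"
      using mult_minus_distrib_mat_vec[OF Ba' v w] B'B[OF c] c' by simp
    hence "B' *\<^sub>v (mat_adjoint B' *\<^sub>v v) = v - ?w" using Bid'[OF rW] by simp
    hence "?w + B' *\<^sub>v (mat_adjoint B' *\<^sub>v v) = v" by (simp only: add_diff[OF v w])
    thus "(?P + ?P') *\<^sub>v v = 1\<^sub>m n *\<^sub>v v"
      using add_mult_distrib_mat_vec[OF P P' v] assoc_mult_mat_vec[OF Bc Ba v] assoc_mult_mat_vec[OF Bc' Ba' v] v by simp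
  qed (rule add_carrier_mat[OF P'], rule one_carrier_mat)
  have dims: "m + m' = n"
  proof -
    have "mtr ?P = of_nat m" using mtr_comm[OF Bc Ba] BB by simp
    moreover have "mtr ?P' = of_nat m'" using mtr_comm[OF Bc' Ba'] BB' by simp
    ultimately have "complex_of_nat (m + m') = of_nat n" using mtr_add[OF P P'] sum1 by simp
    thus ?thesis by (simp only: of_nat_eq_iff)
  qed
  have "m \<noteq> 0"
  proof
    assume m0: "m = 0"
    have "v = 0\<^sub>v n" if v: "v \<in> W" for v
    proof -
      have "v \<in> carrier_vec n" using v lW by (auto simp: lin_closed_def)
      hence c: "mat_adjoint B *\<^sub>v v \<in> carrier_vec m" by (rule mult_mat_vec_carrier[OF Ba])
      have "B *\<^sub>v (mat_adjoint B *\<^sub>v v) = 0\<^sub>v n"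
      proof (rule eq_vecI)
        fix a assume "a < dim_vec (0\<^sub>v n :: complex vec)"
        hence a: "a < n" by simp
        show "vec_index (B *\<^sub>v (mat_adjoint B *\<^sub>v v)) a = vec_index (0\<^sub>v n) a"
          using mult_vec_index_sum[OF Bc c a] m0 a by simp
      qed (use Bc in simp)
      thus ?thesis using Bid[OF v] by simp
    qed
    moreover have "0\<^sub>v n \<in> W" using lW by (simp add: lin_closed_def)
    ultimately have "W = {0\<^sub>v n}" by blast
    thus False using W(3) by simp
  qed
  moreover have "m' \<noteq> 0"
  proof
    assume m0: "m' = 0"
    have "v \<in> W" if v: "v \<in> carrier_vec n" for v
    proof -
      have c: "mat_adjoint B' *\<^sub>v v \<in> carrier_vec m'" by (rule mult_mat_vec_carrier[OF Ba' v])
      have "?P' *\<^sub>v v = 0\<^sub>v n"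
      proof (rule eq_vecI)
        fix a assume "a < dim_vec (0\<^sub>v n :: complex vec)"
        hence a: "a < n" by simp
        show "vec_index (?P' *\<^sub>v v) a = vec_index (0\<^sub>v n) a"
          unfolding assoc_mult_mat_vec[OF Bc' Ba' v] using mult_vec_index_sum[OF Bc' c a] m0 a by simp
      qed (use Bc' in simp)
      hence "?P *\<^sub>v v = v"
        using add_mult_distrib_mat_vec[OF P P' v] sum1 v mult_mat_vec_carrier[OF P v] by simp
      thus ?thesis
        using BW[OF mult_mat_vec_carrier[OF Ba v]] assoc_mult_mat_vec[OF Bc Ba v] by simp
    qed
    moreover have "W \<subseteq> carrier_vec n" using lW by (simp add: lin_closed_def)
    ultimately have "W = carrier_vec n" by blast
    thus False using W(4) by simp
  qed
  ultimately have lt: "m < n" "m' < n" using dims by auto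
  let ?t = "\<lambda>g. mat_adjoint B * (\<sigma> g * B)" and ?t' = "\<lambda>g. mat_adjoint B' * (\<sigma> g * B')"
  have "mtr (\<sigma> g) = mtr (?t g) + mtr (?t' g)" if g: "g \<in> carrier G" for g
  proof -
    note s = S(1)[OF g]
    have "mtr (?t g) = mtr (\<sigma> g * ?P)"
      unfolding mtr_comm[OF Ba SB[OF g]] assoc_mult_mat[OF s Bc Ba] ..
    moreover have "mtr (?t' g) = mtr (\<sigma> g * ?P')"
      unfolding mtr_comm[OF Ba' SB'[OF g]] assoc_mult_mat[OF s Bc' Ba'] ..
    moreover have "mtr (\<sigma> g * ?P) + mtr (\<sigma> g * ?P') = mtr (\<sigma> g * (?P + ?P'))"
      unfolding mult_add_distrib_mat[OF s P P'] by (rule mtr_add[OF mult_carrier_mat[OF s P] mult_carrier_mat[OF s P'], symmetric])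
    ultimately show ?thesis unfolding sum1 using s by simp
  qed
  thus ?thesis
    using lt compress_unitary_rep[OF G \<sigma> Bc BB inv] compress_unitary_rep[OF G \<sigma> Bc' BB' inv']
    by (intro exI[of _ m] exI[of _ m'] exI[of _ ?t] exI[of _ ?t'] conjI ballI)
qed

text \<open>Induction on the degree through \<open>unitary_rep_split\<close>. A list records the
  multiplicities of the constituents; degree 0 gives the empty list.\<close>

lemma unitary_rep_character_decomposition:
  assumes G: "group G"
  shows "unitary_rep G n \<sigma> \<Longrightarrow>
    \<exists>cs. set cs \<subseteq> irr_characters G \<and> (\<forall>g\<in>carrier G. mtr (\<sigma> g) = (\<Sum>\<chi>\<leftarrow>cs. \<chi> g))"
proof (induction n arbitrary: \<sigma> rule: less_induct)
  case (less n)
  consider "n = 0" | "0 < n" "irreducible_unitary_rep G n \<sigma>" | "0 < n" "\<not> irreducible_unitary_rep G n \<sigma>" by blast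
  thus ?case
  proof cases
    case 1
    have "mtr (\<sigma> g) = (\<Sum>\<chi>\<leftarrow>[]. \<chi> g)" if "g \<in> carrier G" for g
      using unitary_repD(1)[OF less.prems that] 1 by (simp add: mtr_def)
    thus ?thesis by (intro exI[of _ "[]"]) auto
  next
    case 2
    have "mtr (\<sigma> g) = (\<Sum>\<chi>\<leftarrow>[rep_character G n \<sigma>]. \<chi> g)" if "g \<in> carrier G" for g
      using unitary_repD(1)[OF less.prems that] that by (simp add: mtr_def rep_character_def)
    moreover have "rep_character G n \<sigma> \<in> irr_characters G" using 2 by (auto simp: irr_characters_def)
    ultimately show ?thesis by (intro exI[of _ "[rep_character G n \<sigma>]"]) auto
  next
    case 3
    obtain m m' \<tau> \<tau>' where s: "m < n" "m' < n" "unitary_rep G m \<tau>" "unitary_rep G m' \<tau>'"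
      "\<And>g. g \<in> carrier G \<Longrightarrow> mtr (\<sigma> g) = mtr (\<tau> g) + mtr (\<tau>' g)"
      using unitary_rep_split[OF G less.prems 3] by blast
    obtain cs where cs: "set cs \<subseteq> irr_characters G" "\<forall>g\<in>carrier G. mtr (\<tau> g) = (\<Sum>\<chi>\<leftarrow>cs. \<chi> g)"
      using less.IH[OF s(1,3)] by blast
    obtain cs' where cs': "set cs' \<subseteq> irr_characters G" "\<forall>g\<in>carrier G. mtr (\<tau>' g) = (\<Sum>\<chi>\<leftarrow>cs'. \<chi> g)"
      using less.IH[OF s(2,4)] by blast
    have "mtr (\<sigma> g) = (\<Sum>\<chi>\<leftarrow>cs @ cs'. \<chi> g)" if "g \<in> carrier G" for g
      using s(5)[OF that] cs(2) cs'(2) that by simp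
    thus ?thesis using cs(1) cs'(1) by (intro exI[of _ "cs @ cs'"]) auto
  qed
qed

text \<open>The permutation matrices of left multiplication, after numbering the group. The trace
  counts the fixed points of a left multiplication, which exist only for the unit element.\<close>

lemma regular_rep:
  assumes G: "group G" and fin: "finite (carrier G)"
  obtains \<sigma> where "unitary_rep G (card (carrier G)) \<sigma>"
    "\<And>g. g \<in> carrier G \<Longrightarrow> mtr (\<sigma> g) = (if g = \<one>\<^bsub>G\<^esub> then of_nat (card (carrier G)) else 0)"
proof -
  interpret group G by (rule G)
  let ?N = "card (carrier G)"
  obtain e where e: "bij_betw e {..<?N} (carrier G)"
    using ex_bij_betw_nat_finite[OF fin] by (auto simp: lessThan_atLeast0)
  have eG: "e i \<in> carrier G" if "i < ?N" for i using e that by (auto simp: bij_betw_def)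
  have inj: "e i = e j \<longleftrightarrow> i = j" if "i < ?N" "j < ?N" for i j
    using e that by (auto simp: bij_betw_def inj_on_def)
  define \<sigma> where "\<sigma> g = mat ?N ?N (\<lambda>(i, j). if e i = g \<otimes>\<^bsub>G\<^esub> e j then 1 else (0::complex))" for g
  have s: "\<sigma> g \<in> carrier_mat ?N ?N" for g by (simp add: \<sigma>_def)
  have dims: "dim_row (\<sigma> g) = ?N" "dim_col (\<sigma> g) = ?N" for g by (simp_all add: \<sigma>_def)
  have mat_adjoint_dims: "dim_row (mat_adjoint (\<sigma> g)) = ?N" "dim_col (mat_adjoint (\<sigma> g)) = ?N" for g
    using carrier_matD[OF mat_adjoint_carrier[OF s[of g]]] by simp_all
  have ix: "\<sigma> g $$ (i, j) = (if e i = g \<otimes>\<^bsub>G\<^esub> e j then 1 else 0)" if "i < ?N" "j < ?N" for g i j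
    using that by (simp add: \<sigma>_def)
  have one: "\<sigma> \<one>\<^bsub>G\<^esub> = 1\<^sub>m ?N"
    by (rule eq_matI) (auto simp: \<sigma>_def eG inj)
  have mult: "\<sigma> (g \<otimes>\<^bsub>G\<^esub> h) = \<sigma> g * \<sigma> h" if g: "g \<in> carrier G" and h: "h \<in> carrier G" for g h
  proof (rule eq_matI)
    fix i j assume "i < dim_row (\<sigma> g * \<sigma> h)" "j < dim_col (\<sigma> g * \<sigma> h)"
    hence ij: "i < ?N" "j < ?N" using carrier_matD[OF s] by simp_all
    have "h \<otimes>\<^bsub>G\<^esub> e j \<in> carrier G" using h eG[OF ij(2)] by simp
    hence "h \<otimes>\<^bsub>G\<^esub> e j \<in> e ` {..<?N}" by (simp only: bij_betw_imp_surj_on[OF e])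
    then obtain b where "h \<otimes>\<^bsub>G\<^esub> e j = e b" "b \<in> {..<?N}" by (rule imageE)
    hence b: "b < ?N" "e b = h \<otimes>\<^bsub>G\<^esub> e j" by simp_all
    have "(\<sigma> g * \<sigma> h) $$ (i, j) = (\<Sum>a<?N. \<sigma> g $$ (i, a) * \<sigma> h $$ (a, j))" by (rule mult_index_sum[OF s s ij])
    also have "\<dots> = (\<Sum>a<?N. if a = b then \<sigma> g $$ (i, b) else 0)"
    proof (intro sum.cong refl)
      fix a assume "a \<in> {..<?N}"
      hence a: "a < ?N" by simp
      have "e a = h \<otimes>\<^bsub>G\<^esub> e j \<longleftrightarrow> a = b" using inj[OF a b(1)] unfolding b(2) .
      hence "\<sigma> h $$ (a, j) = (if a = b then 1 else 0)" by (simp only: ix[OF a ij(2)])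
      thus "\<sigma> g $$ (i, a) * \<sigma> h $$ (a, j) = (if a = b then \<sigma> g $$ (i, b) else 0)" by simp
    qed
    also have "\<dots> = \<sigma> g $$ (i, b)" using b by simp
    also have "\<dots> = \<sigma> (g \<otimes>\<^bsub>G\<^esub> h) $$ (i, j)" using ij b g h eG[OF ij(2)] by (simp add: ix m_assoc)
    finally show "\<sigma> (g \<otimes>\<^bsub>G\<^esub> h) $$ (i, j) = (\<sigma> g * \<sigma> h) $$ (i, j)" by simp
  qed (simp_all add: dims mat_adjoint_dims)
  have adj: "mat_adjoint (\<sigma> g) = \<sigma> (inv\<^bsub>G\<^esub> g)" if g: "g \<in> carrier G" for g
  proof (rule eq_matI)
    fix i j assume "i < dim_row (\<sigma> (inv\<^bsub>G\<^esub> g))" "j < dim_col (\<sigma> (inv\<^bsub>G\<^esub> g))"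
    hence ij: "i < ?N" "j < ?N" using carrier_matD[OF s] by simp_all
    have "e j = g \<otimes>\<^bsub>G\<^esub> e i \<longleftrightarrow> e i = inv\<^bsub>G\<^esub> g \<otimes>\<^bsub>G\<^esub> e j"
      using g eG[OF ij(1)] eG[OF ij(2)] by (metis inv_closed inv_solve_left m_closed r_inv l_inv l_one m_assoc)
    thus "mat_adjoint (\<sigma> g) $$ (i, j) = \<sigma> (inv\<^bsub>G\<^esub> g) $$ (i, j)"
      by (simp add: mat_adjoint_index dims ix ij)
  qed (simp_all add: dims mat_adjoint_dims)
  have "unitary_rep G ?N \<sigma>"
    unfolding unitary_rep_def
  proof (intro conjI ballI s one mult)
    fix g assume g: "g \<in> carrier G"
    show "\<sigma> g * mat_adjoint (\<sigma> g) = 1\<^sub>m ?N" "mat_adjoint (\<sigma> g) * \<sigma> g = 1\<^sub>m ?N"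
      unfolding adj[OF g] using mult[OF g inv_closed[OF g]] mult[OF inv_closed[OF g] g] one g by simp_all
  qed
  moreover have "mtr (\<sigma> g) = (if g = \<one>\<^bsub>G\<^esub> then of_nat ?N else 0)" if g: "g \<in> carrier G" for g
  proof -
    have "mtr (\<sigma> g) = (\<Sum>i<?N. \<sigma> g $$ (i, i))" by (simp add: mtr_def dims)
    also have "\<dots> = (\<Sum>i<?N. if g = \<one>\<^bsub>G\<^esub> then 1 else 0)"
    proof (intro sum.cong refl)
      fix i assume "i \<in> {..<?N}"
      hence i: "i < ?N" by simp
      have "e i = g \<otimes>\<^bsub>G\<^esub> e i \<longleftrightarrow> g = \<one>\<^bsub>G\<^esub>" using r_cancel_one[OF eG[OF i] g] by metis
      thus "\<sigma> g $$ (i, i) = (if g = \<one>\<^bsub>G\<^esub> then 1 else 0)" using i by (simp add: ix)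
    qed
    finally show ?thesis by simp
  qed
  ultimately show ?thesis by (rule that)
qed

lemma sum_count_list:
  fixes f :: "'a \<Rightarrow> complex"
  assumes "finite A" and "set xs \<subseteq> A"
  shows "(\<Sum>x\<in>A. of_nat (count_list xs x) * f x) = (\<Sum>x\<leftarrow>xs. f x)"
  using assms(2)
proof (induction xs)
  case (Cons y xs)
  have "(\<Sum>x\<in>A. of_nat (count_list (y # xs) x) * f x) =
      (\<Sum>x\<in>A. (if y = x then f x else 0) + of_nat (count_list xs x) * f x)"
    by (intro sum.cong refl) (simp add: distrib_right)
  also have "\<dots> = f y + (\<Sum>x\<in>A. of_nat (count_list xs x) * f x)"
    using Cons.prems assms(1) by (simp add: sum.distrib)
  finally show ?case using Cons by simp
qed simp

text \<open>The regular character is the sum of a finite list \<open>cs\<close> of irreducible ones.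
  Pairing it with an irreducible \<psi> gives |G| times the multiplicity of \<psi> in
  \<open>cs\<close> by orthogonality, and |G| times the degree of \<psi> by direct evaluation. Since
  degrees are positive, every irreducible character occurs in the list, whence finiteness.\<close>

theorem irreducible_characters_complete:
  assumes G: "group G" and fin: "finite (carrier G)"
  shows "finite (irr_characters G)"
    and "\<And>g. g \<in> carrier G \<Longrightarrow> (\<Sum>\<chi>\<in>irr_characters G. of_nat (character_dim G \<chi>) * \<chi> g) =
      (if g = \<one>\<^bsub>G\<^esub> then of_nat (card (carrier G)) else 0)"
proof -
  interpret group G by (rule G)
  let ?N = "card (carrier G)"
  have N0: "(of_nat ?N :: complex) \<noteq> 0" using fin one_closed by auto
  obtain \<sigma> where \<sigma>: "unitary_rep G ?N \<sigma>"
    "\<And>g. g \<in> carrier G \<Longrightarrow> mtr (\<sigma> g) = (if g = \<one>\<^bsub>G\<^esub> then of_nat ?N else 0)"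
    by (rule regular_rep[OF G fin], rule that; assumption)
  obtain cs where cs: "set cs \<subseteq> irr_characters G" "\<forall>g\<in>carrier G. mtr (\<sigma> g) = (\<Sum>\<chi>\<leftarrow>cs. \<chi> g)"
    using unitary_rep_character_decomposition[OF G \<sigma>(1)] by blast
  have ev: "(\<Sum>\<chi>\<leftarrow>cs. \<chi> g) = (if g = \<one>\<^bsub>G\<^esub> then of_nat ?N else 0)" if "g \<in> carrier G" for g
    using cs(2) \<sigma>(2)[OF that] that by simp
  have cnt: "count_list cs \<psi> = character_dim G \<psi>" if \<psi>: "\<psi> \<in> irr_characters G" for \<psi>
  proof -
    have "(\<Sum>g\<in>carrier G. (\<Sum>\<chi>\<leftarrow>cs. \<chi> g) * cnj (\<psi> g)) = (\<Sum>g\<in>carrier G. if g = \<one>\<^bsub>G\<^esub> then of_nat ?N * cnj (\<psi> g) else 0)"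
      by (intro sum.cong refl) (simp add: ev)
    also have "\<dots> = of_nat ?N * cnj (\<psi> \<one>\<^bsub>G\<^esub>)" using fin by simp
    also have "\<psi> \<one>\<^bsub>G\<^esub> = of_nat (character_dim G \<psi>)"
    proof -
      obtain \<rho> where \<rho>: "irreducible_unitary_rep G (character_dim G \<psi>) \<rho>" "\<psi> = rep_character G (character_dim G \<psi>) \<rho>"
        by (rule irr_characterE[OF G \<psi>])
      show ?thesis by (subst \<rho>(2), rule rep_character_one[OF G \<rho>(1)])
    qed
    finally have 1: "(\<Sum>g\<in>carrier G. (\<Sum>\<chi>\<leftarrow>cs. \<chi> g) * cnj (\<psi> g)) = of_nat ?N * of_nat (character_dim G \<psi>)" by simp
    have 2: "(\<Sum>g\<in>carrier G. (\<Sum>\<chi>\<leftarrow>xs. \<chi> g) * cnj (\<psi> g)) = of_nat ?N * of_nat (count_list xs \<psi>)"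
      if "set xs \<subseteq> irr_characters G" for xs
      using that
    proof (induction xs)
      case (Cons x xs)
      have "(\<Sum>g\<in>carrier G. (\<Sum>\<chi>\<leftarrow>x # xs. \<chi> g) * cnj (\<psi> g)) =
          (\<Sum>g\<in>carrier G. x g * cnj (\<psi> g)) + (\<Sum>g\<in>carrier G. (\<Sum>\<chi>\<leftarrow>xs. \<chi> g) * cnj (\<psi> g))"
        by (simp add: distrib_right sum.distrib)
      also have "(\<Sum>g\<in>carrier G. x g * cnj (\<psi> g)) = (if x = \<psi> then of_nat ?N else 0)"
        by (rule character_orthogonality[OF G fin _ \<psi>]) (use Cons.prems in simp)
      finally show ?case using Cons by (auto simp: distrib_left)
    qed simp
    have "complex_of_nat ?N * of_nat (count_list cs \<psi>) = of_nat ?N * of_nat (character_dim G \<psi>)"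
      by (rule trans[OF 2[OF cs(1), symmetric] 1])
    hence "complex_of_nat (count_list cs \<psi>) = of_nat (character_dim G \<psi>)" by (simp only: mult_left_cancel[OF N0])
    thus ?thesis by (simp only: of_nat_eq_iff)
  qed
  have "\<psi> \<in> set cs" if \<psi>: "\<psi> \<in> irr_characters G" for \<psi>
  proof -
    obtain \<rho> where "irreducible_unitary_rep G (character_dim G \<psi>) \<rho>"
      by (rule irr_characterE[OF G \<psi>])
    hence "0 < character_dim G \<psi>" by (rule irreducible_unitary_repD(2))
    hence "count_list cs \<psi> \<noteq> 0" by (simp only: cnt[OF \<psi>])
    thus ?thesis by (simp only: count_list_0_iff not_not)
  qed
  hence irr: "irr_characters G = set cs" using cs(1) by blast
  show "finite (irr_characters G)" unfolding irr by simp
  show "(\<Sum>\<chi>\<in>irr_characters G. of_nat (character_dim G \<chi>) * \<chi> g) = (if g = \<one>\<^bsub>G\<^esub> then of_nat ?N else 0)"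
    if g: "g \<in> carrier G" for g
  proof -
    have "(\<Sum>\<chi>\<in>irr_characters G. of_nat (character_dim G \<chi>) * \<chi> g) = (\<Sum>\<chi>\<in>set cs. of_nat (count_list cs \<chi>) * \<chi> g)"
      unfolding irr[symmetric] by (intro sum.cong refl) (simp add: cnt)
    also have "\<dots> = (\<Sum>\<chi>\<leftarrow>cs. \<chi> g)" by (rule sum_count_list) simp_all
    finally show ?thesis using ev[OF g] by simp
  qed
qed

section \<open>Biholomorphic maps between disks\<close>

text \<open>A Moebius map moves the image of 0 back to 0. The Schwarz lemma for the resulting map
  and for its inverse forces equality of moduli at the test point 1/2, hence a rotation. So
  \<open>h\<close> is an explicit fraction whose denominator is at least 1 - |a| in modulus.\<close>

lemma unit_disk_automorphism_deriv:
  assumes h: "h holomorphic_on ball 0 1" and k: "k holomorphic_on ball 0 1"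
    and hm: "\<And>z. norm z < 1 \<Longrightarrow> norm (h z) < 1" and km: "\<And>z. norm z < 1 \<Longrightarrow> norm (k z) < 1"
    and kh: "\<And>z. norm z < 1 \<Longrightarrow> k (h z) = z" and hk: "\<And>z. norm z < 1 \<Longrightarrow> h (k z) = z"
  shows "\<exists>L>0. \<forall>z\<in>ball 0 1. norm (deriv h z) \<le> L"
proof -
  define a where "a = h 0"
  have a1: "norm a < 1" unfolding a_def by (rule hm) simp
  let ?M = "Moebius_function 0 a" and ?N = "Moebius_function 0 (- a)"
  have M1: "norm (?M z) < 1" if "norm z < 1" for z by (rule Moebius_function_norm_lt_1[OF a1 that])
  have na1: "norm (- a) < 1" using a1 by simp
  have N1: "norm (?N z) < 1" if "norm z < 1" for z by (rule Moebius_function_norm_lt_1[OF na1 that])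
  have MN: "?M (?N z) = z" if "norm z < 1" for z by (rule Moebius_function_compose[OF _ a1 that]) simp
  have NM: "?N (?M z) = z" if "norm z < 1" for z by (rule Moebius_function_compose[OF _ na1 that]) simp
  define F where "F z = ?M (h z)" for z
  define K where "K z = k (?N z)" for z
  have Fhol: "F holomorphic_on ball 0 1"
    unfolding F_def using holomorphic_on_compose_gen[OF h Moebius_function_holomorphic[OF a1, of 0]] hm
    by (simp add: o_def image_subset_iff)
  have Khol: "K holomorphic_on ball 0 1"
    unfolding K_def using holomorphic_on_compose_gen[OF Moebius_function_holomorphic[OF na1, of 0] k] N1
    by (simp add: o_def image_subset_iff)
  have F0: "F 0 = 0" by (simp add: F_def a_def Moebius_function_eq_zero)
  have Fm: "norm (F z) < 1" if "norm z < 1" for z unfolding F_def by (rule M1[OF hm[OF that]])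
  have Km: "norm (K z) < 1" if "norm z < 1" for z unfolding K_def by (rule km[OF N1[OF that]])
  have KF: "K (F z) = z" if "norm z < 1" for z unfolding F_def K_def NM[OF hm[OF that]] by (rule kh[OF that])
  have K0: "K 0 = 0" using KF[of 0] F0 by simp
  have half: "norm (1/2 :: complex) < 1" by simp
  have "norm (F (1/2)) \<le> norm (1/2 :: complex)" by (rule Schwarz_Lemma(1)[OF Fhol F0 Fm half])
  moreover have "norm (K (F (1/2))) \<le> norm (F (1/2))" by (rule Schwarz_Lemma(1)[OF Khol K0 Km Fm[OF half]])
  ultimately have "norm (F (1/2)) = norm (1/2 :: complex)" unfolding KF[OF half] by simp
  hence "\<exists>z. norm z < 1 \<and> z \<noteq> 0 \<and> norm (F z) = norm z" using half by (intro exI[of _ "1/2"]) simp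
  hence "(\<exists>z. norm z < 1 \<and> z \<noteq> 0 \<and> norm (F z) = norm z) \<or> norm (deriv F 0) = 1" ..
  with Schwarz_Lemma(3)[OF Fhol F0 Fm half]
  obtain \<alpha> where \<alpha>: "\<forall>z. norm z < 1 \<longrightarrow> F z = \<alpha> * z" "norm \<alpha> = 1" by blast
  have heq: "h z = (\<alpha> * z + a) / (1 + cnj a * (\<alpha> * z))" if z: "norm z < 1" for z
  proof -
    have "h z = ?N (F z)" unfolding F_def by (rule NM[OF hm[OF z], symmetric])
    also have "F z = \<alpha> * z" using \<alpha> z by blast
    finally show ?thesis by (simp add: Moebius_function_simple)
  qed
  have low: "1 - norm a \<le> norm (1 + cnj a * (\<alpha> * z))" if z: "norm z < 1" for z
  proof -
    have "norm (cnj a * (\<alpha> * z)) \<le> norm a * 1"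
      unfolding norm_mult complex_mod_cnj \<alpha>(2) using z by (intro mult_left_mono) auto
    moreover have "1 - norm (cnj a * (\<alpha> * z)) \<le> norm (1 + cnj a * (\<alpha> * z))"
      using norm_triangle_ineq2[of 1 "- (cnj a * (\<alpha> * z))"] by simp
    ultimately show ?thesis by simp
  qed
  show ?thesis
  \<comment> \<open>The summand 1 is added only to have a positive constant at no cost.\<close>
  proof (intro exI[of _ "norm (\<alpha> * (1 - a * cnj a)) / (1 - norm a)\<^sup>2 + 1"] conjI ballI)
    show "0 < norm (\<alpha> * (1 - a * cnj a)) / (1 - norm a)\<^sup>2 + 1"
      by (rule add_nonneg_pos) (simp_all only: zero_le_divide_iff norm_ge_zero zero_le_power2 simp_thms zero_less_one)
    fix z :: complex assume "z \<in> ball 0 1"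
    hence z: "norm z < 1" by simp
    let ?d = "1 + cnj a * (\<alpha> * z)"
    have d0: "?d \<noteq> 0" using low[OF z] a1 by auto
    have "((\<lambda>z. (\<alpha> * z + a) / (1 + cnj a * (\<alpha> * z))) has_field_derivative
        (\<alpha> * ?d - (\<alpha> * z + a) * (cnj a * \<alpha>)) / (?d * ?d)) (at z)"
      using d0 by (auto intro!: derivative_eq_intros)
    moreover have "\<alpha> * ?d - (\<alpha> * z + a) * (cnj a * \<alpha>) = \<alpha> * (1 - a * cnj a)" by (simp add: algebra_simps)
    ultimately have "((\<lambda>z. (\<alpha> * z + a) / (1 + cnj a * (\<alpha> * z))) has_field_derivative
        \<alpha> * (1 - a * cnj a) / (?d * ?d)) (at z)" by simp
    hence "(h has_field_derivative \<alpha> * (1 - a * cnj a) / (?d * ?d)) (at z)"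
      by (rule has_field_derivative_transform_within_open[OF _ open_ball[of 0 1]]) (use z heq in auto)
    hence "norm (deriv h z) = norm (\<alpha> * (1 - a * cnj a)) / (norm ?d)\<^sup>2"
      by (simp add: DERIV_imp_deriv norm_divide norm_mult power2_eq_square)
    also have "\<dots> \<le> norm (\<alpha> * (1 - a * cnj a)) / (1 - norm a)\<^sup>2"
    proof (rule divide_left_mono)
      show "(1 - norm a)\<^sup>2 \<le> (norm ?d)\<^sup>2" using low[OF z] a1 by (intro power_mono) auto
      show "0 < (norm ?d)\<^sup>2 * (1 - norm a)\<^sup>2" using d0 a1 by simp
    qed simp
    finally show "norm (deriv h z) \<le> norm (\<alpha> * (1 - a * cnj a)) / (1 - norm a)\<^sup>2 + 1" by simp
  qed
qed

text \<open>Affine rescaling to the unit disk. The bound is uniform up to the boundary, which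
  general interior estimates would not provide, and it controls the change of variables in
  \<open>pull_bergman\<close>.\<close>

lemma disk_biholomorphism_deriv_bounded:
  fixes g k :: "complex \<Rightarrow> complex"
  assumes r: "0 < r" "0 < r'" and g: "g holomorphic_on ball c r" and k: "k holomorphic_on ball c' r'"
    and gm: "\<And>z. z \<in> ball c r \<Longrightarrow> g z \<in> ball c' r'" and km: "\<And>z. z \<in> ball c' r' \<Longrightarrow> k z \<in> ball c r"
    and kg: "\<And>z. z \<in> ball c r \<Longrightarrow> k (g z) = z" and gk: "\<And>z. z \<in> ball c' r' \<Longrightarrow> g (k z) = z"
  shows "\<exists>L>0. \<forall>z\<in>ball c r. norm (deriv g z) \<le> L"
proof -
  have to: "c + of_real r * z \<in> ball c r" if "0 < r" "norm z < 1" for z c :: complex and r :: real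
    using that by (simp add: dist_norm norm_mult)
  have from1: "norm ((w - c) / of_real r) < 1" if "0 < r" "w \<in> ball c r" for w c :: complex and r :: real
    using that by (simp add: dist_norm norm_divide norm_minus_commute)
  define h where "h z = (g (c + of_real r * z) - c') / of_real r'" for z
  define h' where "h' z = (k (c' + of_real r' * z) - c) / of_real r" for z
  have hol: "h holomorphic_on ball 0 1"
    unfolding h_def
    by (intro holomorphic_intros holomorphic_on_compose_gen[OF _ g, unfolded o_def]) (use r to[OF r(1)] in auto)
  have hol': "h' holomorphic_on ball 0 1"
    unfolding h'_def
    by (intro holomorphic_intros holomorphic_on_compose_gen[OF _ k, unfolded o_def]) (use r to[OF r(2)] in auto)
  have "\<exists>L>0. \<forall>z\<in>ball 0 1. norm (deriv h z) \<le> L"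
  proof (rule unit_disk_automorphism_deriv[OF hol hol'])
    fix z :: complex assume z: "norm z < 1"
    show "norm (h z) < 1" unfolding h_def by (rule from1[OF r(2) gm[OF to[OF r(1) z]]])
    show "norm (h' z) < 1" unfolding h'_def by (rule from1[OF r(1) km[OF to[OF r(2) z]]])
    show "h' (h z) = z" "h (h' z) = z"
      unfolding h_def h'_def using r kg[OF to[OF r(1) z]] gk[OF to[OF r(2) z]] by simp_all
  qed
  then obtain L where L: "0 < L" "\<And>z. norm z < 1 \<Longrightarrow> norm (deriv h z) \<le> L" by auto
  show ?thesis
  proof (intro exI[of _ "r' / r * L"] conjI ballI)
    show "0 < r' / r * L" using r L(1) by simp
    fix w assume w: "w \<in> ball c r"
    let ?z = "(w - c) / of_real r"
    have z: "norm ?z < 1" by (rule from1[OF r(1) w])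
    have gh: "g x = c' + of_real r' * h ((x - c) / of_real r)" for x using r by (simp add: h_def)
    have "(h has_field_derivative deriv h ?z) (at ?z)"
      using hol z by (intro holomorphic_derivI[OF hol]) auto
    hence "((\<lambda>x. h ((x - c) / of_real r)) has_field_derivative deriv h ?z * (1 / of_real r)) (at w)"
      by (rule DERIV_chain2) (use r in \<open>auto intro!: derivative_eq_intros\<close>)
    hence "((\<lambda>x. c' + of_real r' * h ((x - c) / of_real r)) has_field_derivative
        of_real r' * (deriv h ?z * (1 / of_real r))) (at w)"
      by (auto intro!: derivative_eq_intros)
    hence "(g has_field_derivative of_real r' * (deriv h ?z * (1 / of_real r))) (at w)"
      by (simp only: gh[abs_def])
    hence "norm (deriv g w) = r' / r * norm (deriv h ?z)"
      using r by (simp add: DERIV_imp_deriv norm_mult norm_divide)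
    also have "\<dots> \<le> r' / r * L" using L(2)[OF z] r by (intro mult_left_mono) auto
    finally show "norm (deriv g w) \<le> r' / r * L" .
  qed
qed

section \<open>Symmetric iterated function schemes\<close>

locale ifs_symmetry =
  fixes S :: "'i :: finite ifs"
    and G :: "('g, 'm) monoid_scheme" (structure)
    and act :: "'g \<Rightarrow> complex \<Rightarrow> complex"
    and V :: "complex \<Rightarrow> complex"
  assumes ifs: "holomorphic_ifs S"
    and symm: "symmetry_group S G act"
    and V_holo: "V holomorphic_on branch_image S"
    and V_bounded: "bounded (V ` branch_image S)"
    and V_invariant: "invariant_potential S G act V"
begin

abbreviation D where "D \<equiv> region S"
abbreviation B where "B \<equiv> disk S"
abbreviation sa where "sa \<equiv> symbol_act S act"

section \<open>Disks, branches and uniform constants\<close>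

lemma radius_pos: "0 < radius S i"
  using ifs by (simp add: holomorphic_ifs_def)

lemma disk_open: "open (B i)" and disk_connected: "connected (B i)"
  by (simp_all add: disk_def)

lemma centre_mem: "centre S i \<in> B i"
  using radius_pos by (simp add: disk_def)

lemma disk_subset: "B i \<subseteq> D" by (auto simp: region_def)

lemma disk_mem: "u \<in> B i \<Longrightarrow> u \<in> D" by (auto simp: region_def)

lemma region_cases:
  assumes "u \<in> D" obtains i where "u \<in> B i"
  using assms by (auto simp: region_def)

lemma disk_unique:
  assumes "u \<in> B i" "u \<in> B j" shows "i = j"
proof (rule ccontr)
  assume "i \<noteq> j"
  hence "closure (B i) \<inter> closure (B j) = {}" using ifs by (simp add: holomorphic_ifs_def)
  moreover have "u \<in> closure (B i) \<inter> closure (B j)" using assms closure_subset by blast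
  ultimately show False by simp
qed

lemma region_open: "open D" by (simp add: region_def disk_open open_UN)

lemma region_finite_measure: "emeasure lborel D < \<infinity>"
proof -
  have "bounded D" unfolding region_def by (intro bounded_UN) (auto simp: disk_def)
  thus ?thesis by (rule emeasure_bounded_finite)
qed

lemma holomorphic_on_region: "f holomorphic_on D \<longleftrightarrow> (\<forall>i. f holomorphic_on B i)"
proof
  assume "f holomorphic_on D"
  thus "\<forall>i. f holomorphic_on B i" using holomorphic_on_subset[OF _ disk_subset] by blast
next
  assume "\<forall>i. f holomorphic_on B i"
  thus "f holomorphic_on D" unfolding region_def by (intro holomorphic_on_UN_open) (auto simp: disk_open)
qed

lemma adj_branch:
  assumes "adj S i j"
  shows "branch S i j holomorphic_on B i" "compact (closure (branch S i j ` B i))"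
    "closure (branch S i j ` B i) \<subseteq> B j"
  using ifs assms by (simp_all add: holomorphic_ifs_def biholomorphic_on_image_def)

lemma branch_mem: "adj S i j \<Longrightarrow> u \<in> B i \<Longrightarrow> branch S i j u \<in> B j"
  using adj_branch(3)[of i j] closure_subset by blast

lemma branch_image_mem: "adj S i j \<Longrightarrow> u \<in> B i \<Longrightarrow> branch S i j u \<in> branch_image S"
  by (auto simp: branch_image_def)

lemma compact_in_ball:
  fixes c :: complex
  assumes K: "compact K" "K \<subseteq> ball c r" and r: "0 < r"
  shows "\<exists>q. 0 < q \<and> q < 1 \<and> K \<subseteq> cball c (q * r)"
proof (cases "K = {}")
  case True
  thus ?thesis by (intro exI[of _ "1/2"]) simp
next
  case False
  obtain x where x: "x \<in> K" "\<And>y. y \<in> K \<Longrightarrow> dist c y \<le> dist c x"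
    using continuous_attains_sup[OF K(1) False continuous_on_dist[OF continuous_on_const continuous_on_id, of K c]]
    by auto
  have d: "dist c x < r" using x(1) K(2) by auto
  \<comment> \<open>The midpoint between the largest relative distance attained on \<open>K\<close>
    and 1; it is positive even when \<open>K\<close> is just the centre.\<close>
  let ?q = "(dist c x / r + 1) / 2"
  have "0 < (a + 1) / 2 \<and> (a + 1) / 2 < 1 \<and> a \<le> (a + 1) / 2" if "a < 1" "0 \<le> a" for a :: real
    using that by auto
  from this[of "dist c x / r"] have q: "0 < ?q" "?q < 1" "dist c x / r \<le> ?q" using d r by simp_all
  have "dist c x \<le> ?q * r" using q(3) r by (simp only: pos_divide_le_eq)
  hence "K \<subseteq> cball c (?q * r)" using x(2) by fastforce
  thus ?thesis using q(1,2) by (intro exI[of _ ?q] conjI)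
qed

text \<open>A relatively compact image keeps a positive distance from the boundary of the target
  disk, and there are only finitely many branches, so the largest of the individual ratios works for
  all.\<close>

lemma contraction_ratio_exists:
  "\<exists>q. 0 < q \<and> q < 1 \<and> (\<forall>i j. adj S i j \<longrightarrow> branch S i j ` B i \<subseteq> cball (centre S j) (q * radius S j))"
proof -
  have "\<forall>p. \<exists>q. 0 < q \<and> q < 1 \<and> (adj S (fst p) (snd p) \<longrightarrow>
      branch S (fst p) (snd p) ` B (fst p) \<subseteq> cball (centre S (snd p)) (q * radius S (snd p)))"
  proof
    fix p :: "'i \<times> 'i"
    show "\<exists>q. 0 < q \<and> q < 1 \<and> (adj S (fst p) (snd p) \<longrightarrow>
      branch S (fst p) (snd p) ` B (fst p) \<subseteq> cball (centre S (snd p)) (q * radius S (snd p)))"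
    proof (cases "adj S (fst p) (snd p)")
      case True
      obtain q where "0 < q" "q < 1" "closure (branch S (fst p) (snd p) ` B (fst p)) \<subseteq> cball (centre S (snd p)) (q * radius S (snd p))"
        using compact_in_ball[OF adj_branch(2)[OF True] _ radius_pos[of "snd p"], of "centre S (snd p)"]
          adj_branch(3)[OF True] unfolding disk_def by blast
      thus ?thesis using closure_subset by blast
    next
      case False
      thus ?thesis by (intro exI[of _ "1/2"]) simp
    qed
  qed
  then obtain q where q: "\<And>p. 0 < q p" "\<And>p. q p < 1" "\<And>p. adj S (fst p) (snd p) \<Longrightarrow>
      branch S (fst p) (snd p) ` B (fst p) \<subseteq> cball (centre S (snd p)) (q p * radius S (snd p))"
    by (metis (no_types))
  let ?Q = "Max (range q)"
  have Q: "q p \<le> ?Q" for p by (rule Max_ge) auto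
  have "?Q \<in> range q" by (rule Max_in) auto
  then obtain p where p: "?Q = q p" by blast
  have "0 < ?Q" "?Q < 1" unfolding p by (rule q(1), rule q(2))
  moreover have "branch S i j ` B i \<subseteq> cball (centre S j) (?Q * radius S j)" if "adj S i j" for i j
  proof -
    have "branch S i j ` B i \<subseteq> cball (centre S j) (q (i, j) * radius S j)" using q(3)[of "(i, j)"] that by simp
    moreover have "q (i, j) * radius S j \<le> ?Q * radius S j" using Q radius_pos[of j] by (intro mult_right_mono) auto
    ultimately show ?thesis by fastforce
  qed
  ultimately show ?thesis by blast
qed

definition ratio :: real where
  "ratio = (SOME q. 0 < q \<and> q < 1 \<and>
     (\<forall>i j. adj S i j \<longrightarrow> branch S i j ` B i \<subseteq> cball (centre S j) (q * radius S j)))"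

lemma ratio: "0 < ratio" "ratio < 1"
    "\<And>i j u. adj S i j \<Longrightarrow> u \<in> B i \<Longrightarrow> branch S i j u \<in> cball (centre S j) (ratio * radius S j)"
  using someI_ex[OF contraction_ratio_exists] unfolding ratio_def[symmetric] by blast+

definition V_sup :: real where
  "V_sup = (SOME b. 0 < b \<and> (\<forall>u\<in>branch_image S. norm (V u) \<le> b))"

lemma V_sup: "0 < V_sup" "\<And>u. u \<in> branch_image S \<Longrightarrow> norm (V u) \<le> V_sup"
proof -
  have "\<exists>b. 0 < b \<and> (\<forall>u\<in>branch_image S. norm (V u) \<le> b)"
    using V_bounded unfolding bounded_pos by blast
  from someI_ex[OF this] show "0 < V_sup" "\<And>u. u \<in> branch_image S \<Longrightarrow> norm (V u) \<le> V_sup"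
    unfolding V_sup_def[symmetric] by blast+
qed

lemma V_branch_holo: "adj S i j \<Longrightarrow> (\<lambda>u. V (branch S i j u)) holomorphic_on B i"
  using holomorphic_on_compose_gen[OF adj_branch(1) V_holo, of i j] branch_image_mem
  by (simp add: o_def image_subset_iff)

section \<open>The action of the group on disks and symbols\<close>

lemma G_group: "group G" and G_finite: "finite (carrier G)"
  using symm by (simp_all add: symmetry_group_def group_action_def group_hom_def)

sublocale group G by (rule G_group)

lemma act_bij: "g \<in> carrier G \<Longrightarrow> act g \<in> Bij D"
  using symm group_hom.hom_closed[of G "BijGroup D" act g]
  by (simp add: symmetry_group_def group_action_def BijGroup_def)

lemma act_mem: "g \<in> carrier G \<Longrightarrow> u \<in> D \<Longrightarrow> act g u \<in> D"
  using act_bij[of g] by (auto simp: Bij_def bij_betw_def)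

lemma act_mult:
  assumes "g \<in> carrier G" "h \<in> carrier G" "u \<in> D"
  shows "act (g \<otimes> h) u = act g (act h u)"
proof -
  have "group_hom G (BijGroup D) act" using symm by (simp add: symmetry_group_def group_action_def)
  from group_hom.hom_mult[OF this assms(1,2)] show ?thesis
    using act_bij[OF assms(1)] act_bij[OF assms(2)] assms(3) by (simp add: BijGroup_def compose_def)
qed

lemma act_one: "u \<in> D \<Longrightarrow> act \<one> u = u"
proof -
  assume u: "u \<in> D"
  have "group_hom G (BijGroup D) act" using symm by (simp add: symmetry_group_def group_action_def)
  from group_hom.hom_one[OF this] show ?thesis using u by (simp add: BijGroup_def)
qed

lemma act_inv: "g \<in> carrier G \<Longrightarrow> u \<in> D \<Longrightarrow> act (inv g) (act g u) = u"
    "g \<in> carrier G \<Longrightarrow> u \<in> D \<Longrightarrow> act g (act (inv g) u) = u"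
  using act_mult[of "inv g" g u] act_mult[of g "inv g" u] act_one by simp_all

lemma act_holo: "g \<in> carrier G \<Longrightarrow> act g holomorphic_on D"
  using symm by (simp add: symmetry_group_def)

text \<open>The image of a disk is connected, and the disks form a separation of the region into
  open sets.\<close>

lemma act_disk_subset:
  assumes g: "g \<in> carrier G"
  obtains j where "\<And>u. u \<in> B i \<Longrightarrow> act g u \<in> B j"
proof -
  let ?A = "act g ` B i"
  have A: "?A \<subseteq> D" using act_mem[OF g] disk_mem by blast
  have "connected ?A"
    by (rule connected_continuous_image[OF holomorphic_on_imp_continuous_on disk_connected])
      (rule holomorphic_on_subset[OF act_holo[OF g] disk_subset])
  obtain j where j: "act g (centre S i) \<in> B j" using region_cases[OF act_mem[OF g disk_mem[OF centre_mem]]] .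
  let ?R = "\<Union>k\<in>- {j}. B k"
  have "open ?R" by (auto intro: disk_open)
  moreover have "B j \<inter> ?R \<inter> ?A = {}" using disk_unique by blast
  moreover have "?A \<subseteq> B j \<union> ?R" using A by (auto simp: region_def)
  ultimately have "B j \<inter> ?A = {} \<or> ?R \<inter> ?A = {}"
    using connectedD[OF \<open>connected ?A\<close> disk_open] by blast
  moreover have "act g (centre S i) \<in> B j \<inter> ?A" using j centre_mem by blast
  ultimately have "?R \<inter> ?A = {}" by blast
  hence "?A \<subseteq> B j" using \<open>?A \<subseteq> B j \<union> ?R\<close> by blast
  thus ?thesis by (intro that[of j]) auto
qed

text \<open>The image of disk i lies in one disk j, and the inverse sends disk j into one disk,
  which must be i again. This gives equality of sets, and disjointness makes the description in
  \<open>symbol_act\<close> unique.\<close>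

lemma act_disk:
  assumes g: "g \<in> carrier G"
  shows "act g ` B i = B (sa g i)"
proof -
  obtain j where j: "\<And>u. u \<in> B i \<Longrightarrow> act g u \<in> B j" by (rule act_disk_subset[OF g, of i], rule that; assumption)
  obtain k where k: "\<And>u. u \<in> B j \<Longrightarrow> act (inv g) u \<in> B k"
    by (rule act_disk_subset[OF inv_closed[OF g], of j], rule that; assumption)
  have "act (inv g) (act g (centre S i)) \<in> B k" by (rule k[OF j[OF centre_mem]])
  hence "centre S i \<in> B k" by (simp only: act_inv(1)[OF g disk_mem[OF centre_mem]])
  hence ki: "k = i" using disk_unique centre_mem by blast
  have "act g ` B i = B j"
  proof
    show "act g ` B i \<subseteq> B j" using j by blast
    show "B j \<subseteq> act g ` B i"
    proof
      fix u assume u: "u \<in> B j"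
      have "u = act g (act (inv g) u)" by (rule act_inv(2)[OF g disk_mem[OF u], symmetric])
      thus "u \<in> act g ` B i" using k[OF u] unfolding ki by (rule image_eqI)
    qed
  qed
  moreover have "j' = j" if "act g ` B i = B j'" for j'
    using that calculation centre_mem[of j] disk_unique by blast
  ultimately have "sa g i = j" unfolding symbol_act_def by (rule the_equality)
  thus ?thesis using \<open>act g ` B i = B j\<close> by simp
qed

lemma act_disk_mem: "g \<in> carrier G \<Longrightarrow> u \<in> B i \<Longrightarrow> act g u \<in> B (sa g i)"
  using act_disk by blast

lemma symbol_act_eq: "g \<in> carrier G \<Longrightarrow> u \<in> B i \<Longrightarrow> act g u \<in> B j \<Longrightarrow> sa g i = j"
  by (rule disk_unique[OF act_disk_mem])

lemma symbol_act_inv: "g \<in> carrier G \<Longrightarrow> sa (inv g) (sa g i) = i"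
proof -
  assume g: "g \<in> carrier G"
  have "act (inv g) (act g (centre S i)) \<in> B i" using act_inv(1)[OF g disk_mem[OF centre_mem]] centre_mem by simp
  thus ?thesis by (rule symbol_act_eq[OF inv_closed[OF g] act_disk_mem[OF g centre_mem]])
qed

text \<open>Identifies the unnamed pair of symbols in \<open>symmetry_group\<close> as the image of
  (i, j) under the action; testing at the centre of the disk suffices, since disks are
  disjoint.\<close>

lemma branch_equivariant:
  assumes g: "g \<in> carrier G" and ij: "adj S i j"
  shows "adj S (sa g i) (sa g j)"
    and "\<And>u. u \<in> B i \<Longrightarrow> act g (branch S i j u) = branch S (sa g i) (sa g j) (act g u)"
proof -
  obtain k l where kl: "adj S k l"
    "\<And>u. u \<in> B i \<Longrightarrow> act g u \<in> B k" "\<And>u. u \<in> B i \<Longrightarrow> act g (branch S i j u) = branch S k l (act g u)"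
    using symm g ij unfolding symmetry_group_def by blast
  have k: "sa g i = k" by (rule symbol_act_eq[OF g centre_mem kl(2)[OF centre_mem]])
  have "act g (branch S i j (centre S i)) \<in> B l"
    unfolding kl(3)[OF centre_mem] by (rule branch_mem[OF kl(1) kl(2)[OF centre_mem]])
  hence l: "sa g j = l" by (rule symbol_act_eq[OF g branch_mem[OF ij centre_mem]])
  show "adj S (sa g i) (sa g j)" unfolding k l by (rule kl(1))
  show "act g (branch S i j u) = branch S (sa g i) (sa g j) (act g u)" if "u \<in> B i" for u
    unfolding k l by (rule kl(3)[OF that])
qed

lemma V_act:
  assumes "g \<in> carrier G" "adj S i j" "u \<in> B i"
  shows "V (act g (branch S i j u)) = V (branch S i j u)"
  using V_invariant assms(1) branch_image_mem[OF assms(2,3)] by (simp add: invariant_potential_def)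

lemma act_deriv_bounded:
  assumes g: "g \<in> carrier G"
  shows "\<exists>L>0. \<forall>z\<in>D. norm (deriv (act g) z) \<le> L"
proof -
  have "\<exists>L>0. \<forall>z\<in>B i. norm (deriv (act g) z) \<le> L" for i
    unfolding disk_def
  proof (rule disk_biholomorphism_deriv_bounded[OF radius_pos radius_pos])
    let ?j = "sa g i"
    show "act g holomorphic_on ball (centre S i) (radius S i)"
      using holomorphic_on_subset[OF act_holo[OF g] disk_subset] by (simp add: disk_def)
    show "act (inv g) holomorphic_on ball (centre S ?j) (radius S ?j)"
      using holomorphic_on_subset[OF act_holo[OF inv_closed[OF g]] disk_subset] by (simp add: disk_def)
    show "act g z \<in> ball (centre S ?j) (radius S ?j)" "act (inv g) (act g z) = z"
      if "z \<in> ball (centre S i) (radius S i)" for z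
      using act_disk_mem[OF g] act_inv(1)[OF g disk_mem] that unfolding disk_def by blast+
    show "act (inv g) z \<in> ball (centre S i) (radius S i)" "act g (act (inv g) z) = z"
      if "z \<in> ball (centre S ?j) (radius S ?j)" for z
      using act_disk_mem[OF inv_closed[OF g], of z ?j] act_inv(2)[OF g disk_mem, of z ?j] that symbol_act_inv[OF g, of i]
      unfolding disk_def by simp_all
  qed
  then obtain L where L: "\<And>i. 0 < L i" "\<And>i z. z \<in> B i \<Longrightarrow> norm (deriv (act g) z) \<le> L i" by metis
  have le: "L i \<le> (\<Sum>i\<in>UNIV. L i)" for i by (rule member_le_sum) (use L(1) less_imp_le in auto)
  show ?thesis
  proof (intro exI[of _ "\<Sum>i\<in>UNIV. L i"] conjI ballI)
    show "0 < (\<Sum>i\<in>UNIV. L i)" by (intro sum_pos) (use L(1) in auto)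
    fix z assume "z \<in> D"
    then obtain i where "z \<in> B i" by (rule region_cases)
    thus "norm (deriv (act g) z) \<le> (\<Sum>i\<in>UNIV. L i)" using L(2) le order_trans by blast
  qed
qed

section \<open>The transfer operator and the group algebra\<close>

abbreviation L where "L \<equiv> transfer_op S V"
abbreviation pull where "pull \<equiv> function_act S G act"
abbreviation bergman where "bergman \<equiv> bergman_space D"

section \<open>The transfer operator on holomorphic functions\<close>

lemma transfer_disk:
  assumes "u \<in> B i"
  shows "L f u = (\<Sum>j | adj S i j. V (branch S i j u) * f (branch S i j u))"
proof -
  have e: "{(k, j). u \<in> B k \<and> adj S k j} = Pair i ` {j. adj S i j}"
    using assms disk_unique by auto
  show ?thesis unfolding transfer_op_def e
    by (subst sum.reindex) (auto simp: inj_on_def)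
qed

lemma transfer_outside: "u \<notin> D \<Longrightarrow> L f u = 0"
proof -
  assume "u \<notin> D"
  hence e: "{(k, j). u \<in> B k \<and> adj S k j} = {}" using disk_mem by blast
  show ?thesis unfolding transfer_op_def e by simp
qed

lemma transfer_sum: "L (\<lambda>u. \<Sum>x\<in>A. c x * f x u) u = (\<Sum>x\<in>A. c x * L (f x) u)"
proof -
  have "L (\<lambda>u. \<Sum>x\<in>A. c x * f x u) u = (\<Sum>(i, j) \<in> {(i, j). u \<in> disk S i \<and> adj S i j}. \<Sum>x\<in>A. c x * (V (branch S i j u) * f x (branch S i j u)))"
    unfolding transfer_op_def by (intro sum.cong refl) (auto simp: sum_distrib_left algebra_simps)
  also have "\<dots> = (\<Sum>x\<in>A. \<Sum>(i, j) \<in> {(i, j). u \<in> disk S i \<and> adj S i j}. c x * (V (branch S i j u) * f x (branch S i j u)))"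
    unfolding case_prod_unfold by (rule sum.swap)
  also have "\<dots> = (\<Sum>x\<in>A. c x * L (f x) u)"
    unfolding transfer_op_def sum_distrib_left case_prod_unfold ..
  finally show ?thesis .
qed

lemma transfer_holo:
  assumes f: "f holomorphic_on D"
  shows "L f holomorphic_on D"
  unfolding holomorphic_on_region
proof
  fix i
  have "(\<lambda>u. \<Sum>j | adj S i j. V (branch S i j u) * f (branch S i j u)) holomorphic_on B i"
  proof (intro holomorphic_intros)
    fix j assume "j \<in> {j. adj S i j}"
    hence a: "adj S i j" by simp
    show "(\<lambda>u. V (branch S i j u)) holomorphic_on B i" by (rule V_branch_holo[OF a])
    show "(\<lambda>u. f (branch S i j u)) holomorphic_on B i"
      using holomorphic_on_compose_gen[OF adj_branch(1)[OF a] f] disk_mem[OF branch_mem[OF a]]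
      by (simp add: o_def image_subset_iff)
  qed
  thus "L f holomorphic_on B i"
    by (rule holomorphic_transform) (simp add: transfer_disk)
qed

definition L_sup :: real where "L_sup = real CARD('i) * V_sup"

lemma L_sup_pos: "0 < L_sup" using V_sup(1) by (simp add: L_sup_def)

text \<open>The bound on \<open>f\<close> is asked for at branch values only, so that it also
  applies to functions that are unbounded near the boundary of the region.\<close>

lemma transfer_sup:
  assumes "\<And>i j u. adj S i j \<Longrightarrow> u \<in> B i \<Longrightarrow> norm (f (branch S i j u)) \<le> b" and b: "0 \<le> b"
  shows "norm (L f u) \<le> L_sup * b"
proof (cases "u \<in> D")
  case True
  then obtain i where i: "u \<in> B i" by (rule region_cases)
  have "norm (L f u) \<le> (\<Sum>j | adj S i j. V_sup * b)"
    unfolding transfer_disk[OF i]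
  proof (rule sum_norm_le)
    fix j assume "j \<in> {j. adj S i j}"
    hence a: "adj S i j" by simp
    show "norm (V (branch S i j u) * f (branch S i j u)) \<le> V_sup * b"
      unfolding norm_mult
      by (intro mult_mono V_sup(2) branch_image_mem[OF a i] assms(1)[OF a i] norm_ge_zero less_imp_le[OF V_sup(1)])
  qed
  also have "\<dots> \<le> real CARD('i) * (V_sup * b)"
    using V_sup(1) b by (simp add: card_mono mult_right_mono)
  finally show ?thesis by (simp add: L_sup_def mult.assoc)
next
  case False
  thus ?thesis using L_sup_pos b by (simp add: transfer_outside)
qed

text \<open>The operator sees \<open>f\<close> only on a compact union of shrunken disks, where
  holomorphy already makes it bounded; a bounded holomorphic function on a region of finite area is
  square integrable.\<close>

lemma transfer_bergman:
  assumes f: "f holomorphic_on D"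
  shows "L f \<in> bergman"
proof -
  let ?K = "\<Union>j. cball (centre S j) (ratio * radius S j)"
  have sub: "cball (centre S j) (ratio * radius S j) \<subseteq> B j" for j
  proof -
    have "ratio * radius S j < radius S j" using ratio(2) radius_pos[of j] by simp
    thus ?thesis unfolding disk_def by auto
  qed
  have "compact ?K" by (intro compact_UN) auto
  moreover have "?K \<subseteq> D" unfolding region_def using sub by blast
  ultimately have "compact (f ` ?K)"
    by (intro compact_continuous_image continuous_on_subset[OF holomorphic_on_imp_continuous_on[OF f]])
  hence "bounded (f ` ?K)" by (rule compact_imp_bounded)
  then obtain b where b: "0 < b" "\<forall>y\<in>f ` ?K. norm y \<le> b" unfolding bounded_pos by (elim exE conjE)
  have "norm (L f u) \<le> L_sup * b" for u
  proof (rule transfer_sup)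
    fix i j u assume "adj S i j" "u \<in> B i"
    hence "branch S i j u \<in> ?K" by (rule UN_I[of j, OF UNIV_I, OF ratio(3)])
    thus "norm (f (branch S i j u)) \<le> b" by (rule b(2)[rule_format, OF imageI])
  qed (use b(1) in simp)
  thus ?thesis by (intro bounded_bergman(1)[OF region_open region_finite_measure transfer_holo[OF f] transfer_outside])
qed

section \<open>The action on functions and averaging\<close>

lemma pull_region: "u \<in> D \<Longrightarrow> pull g f u = f (act (inv g) u)"
  by (simp add: function_act_def)

lemma pull_outside: "u \<notin> D \<Longrightarrow> pull g f u = 0"
  by (simp add: function_act_def)

lemma pull_mult:
  assumes "g \<in> carrier G" "h \<in> carrier G"
  shows "pull g (pull h f) = pull (g \<otimes> h) f"
proof
  fix u show "pull g (pull h f) u = pull (g \<otimes> h) f u"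
  proof (cases "u \<in> D")
    case True
    thus ?thesis using assms act_mem[of "inv g" u]
      by (simp add: pull_region inv_mult_group act_mult)
  qed (simp add: pull_outside)
qed

lemma pull_holo:
  assumes g: "g \<in> carrier G" and f: "f holomorphic_on D"
  shows "pull g f holomorphic_on D"
proof -
  have "f \<circ> act (inv g) holomorphic_on D"
    by (rule holomorphic_on_compose_gen[OF act_holo[OF inv_closed[OF g]] f]) (use act_mem[OF inv_closed[OF g]] in auto)
  thus ?thesis by (rule holomorphic_transform) (simp add: pull_region)
qed

text \<open>Substitution by the symmetry multiplies area by |g'|^2, which
  \<open>act_deriv_bounded\<close> keeps bounded.\<close>

lemma pull_bergman:
  assumes g: "g \<in> carrier G" and f: "f \<in> bergman"
  shows "pull g f \<in> bergman"
proof -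
  note fD = bergman_spaceD[OF f]
  have hol: "pull g f holomorphic_on D" by (rule pull_holo[OF g fD(1)])
  have meas: "(\<lambda>z. ennreal ((norm (f z))\<^sup>2)) \<in> borel_measurable borel"
  proof -
    have "set_borel_measurable lborel D f"
      by (rule set_borel_measurable_continuous[OF region_open bergman_cont[OF f]])
    moreover have "(\<lambda>z. indicator D z *\<^sub>R f z) = f" using fD(3) by (auto simp: indicator_def)
    ultimately have "f \<in> borel_measurable borel" by (simp add: set_borel_measurable_def)
    thus ?thesis by simp
  qed
  obtain C where C: "0 < C" "\<And>z. z \<in> D \<Longrightarrow> norm (deriv (act g) z) \<le> C" using act_deriv_bounded[OF g] by blast
  have "(\<integral>\<^sup>+z\<in>D. ennreal ((norm (f (act (inv g) z)))\<^sup>2) \<partial>lborel) \<le>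
      ennreal (C\<^sup>2) * (\<integral>\<^sup>+z\<in>D. ennreal ((norm (f z))\<^sup>2) \<partial>lborel)"
    by (rule nn_integral_biholomorphic_le[OF region_open region_open act_holo[OF g] _ C(2,1) _ _ meas])
      (use act_mem act_inv g holomorphic_on_imp_continuous_on[OF act_holo[OF inv_closed[OF g]]] in auto)
  also have "\<dots> < \<infinity>"
  proof -
    have "(\<integral>\<^sup>+z\<in>D. ennreal ((norm (f z))\<^sup>2) \<partial>lborel) < \<infinity>"
    proof -
      have "(\<integral>\<^sup>+z\<in>D. ennreal ((norm (f z))\<^sup>2) \<partial>lborel) =
          (\<integral>\<^sup>+z. ennreal (norm (indicat_real D z *\<^sub>R (norm (f z))\<^sup>2)) \<partial>lborel)"
        by (intro nn_integral_cong) (auto simp: indicator_def)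
      also have "\<dots> < \<infinity>" using fD(2) unfolding set_integrable_def integrable_iff_bounded by (rule conjunct2)
      finally show ?thesis .
    qed
    thus ?thesis by (simp add: ennreal_mult_less_top)
  qed
  finally have fin: "(\<integral>\<^sup>+z\<in>D. ennreal ((norm (f (act (inv g) z)))\<^sup>2) \<partial>lborel) < \<infinity>" .
  have "set_integrable lborel D (\<lambda>u. (norm (pull g f u))\<^sup>2)"
    unfolding set_integrable_def
  proof (rule integrableI_bounded)
    show "(\<lambda>x. indicat_real D x *\<^sub>R (norm (pull g f x))\<^sup>2) \<in> borel_measurable lborel"
      by (rule set_borel_measurable_continuous[OF region_open, unfolded set_borel_measurable_def])
        (intro continuous_intros holomorphic_on_imp_continuous_on hol)
    have "(\<integral>\<^sup>+x. ennreal (norm (indicat_real D x *\<^sub>R (norm (pull g f x))\<^sup>2)) \<partial>lborel) =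
        (\<integral>\<^sup>+z\<in>D. ennreal ((norm (f (act (inv g) z)))\<^sup>2) \<partial>lborel)"
      by (intro nn_integral_cong) (auto simp: indicator_def pull_region)
    thus "(\<integral>\<^sup>+x. ennreal (norm (indicat_real D x *\<^sub>R (norm (pull g f x))\<^sup>2)) \<partial>lborel) < \<infinity>" using fin by simp
  qed
  thus ?thesis using hol pull_outside by (simp add: bergman_space_def)
qed

text \<open>Let h be the inverse of g. It carries the branches leaving disk i bijectively onto those
  leaving disk h i, and the potential takes equal values at corresponding points, so the two sums
  agree term by term.\<close>

lemma transfer_pull:
  assumes g: "g \<in> carrier G"
  shows "L (pull g f) = pull g (L f)"
proof
  fix u show "L (pull g f) u = pull g (L f) u"
  proof (cases "u \<in> D")
    case True
    then obtain i where i: "u \<in> B i" by (rule region_cases)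
    let ?h = "inv g"
    have h: "?h \<in> carrier G" by (rule inv_closed[OF g])
    have bij: "sa ?h ` {j. adj S i j} = {j. adj S (sa ?h i) j}"
    proof
      show "sa ?h ` {j. adj S i j} \<subseteq> {j. adj S (sa ?h i) j}" using branch_equivariant(1)[OF h] by auto
      show "{j. adj S (sa ?h i) j} \<subseteq> sa ?h ` {j. adj S i j}"
      proof
        fix j assume "j \<in> {j. adj S (sa ?h i) j}"
        hence "adj S (sa g (sa ?h i)) (sa g j)" by (intro branch_equivariant(1)[OF g]) simp
        hence "adj S i (sa g j)" using symbol_act_inv[OF h, of i] g by simp
        moreover have "j = sa ?h (sa g j)" by (rule symbol_act_inv[OF g, symmetric])
        ultimately show "j \<in> sa ?h ` {j. adj S i j}" by blast
      qed
    qed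
    have inj: "inj_on (sa ?h) {j. adj S i j}"
      by (rule inj_on_inverseI[of _ "sa g"]) (use symbol_act_inv[OF h] g in simp)
    have "pull g (L f) u = L f (act ?h u)" by (rule pull_region[OF True])
    also have "\<dots> = (\<Sum>j | adj S (sa ?h i) j. V (branch S (sa ?h i) j (act ?h u)) * f (branch S (sa ?h i) j (act ?h u)))"
      by (rule transfer_disk[OF act_disk_mem[OF h i]])
    also have "\<dots> = (\<Sum>j | adj S i j. V (branch S (sa ?h i) (sa ?h j) (act ?h u)) * f (branch S (sa ?h i) (sa ?h j) (act ?h u)))"
      unfolding bij[symmetric] by (simp add: sum.reindex[OF inj])
    also have "\<dots> = (\<Sum>j | adj S i j. V (branch S i j u) * pull g f (branch S i j u))"
    proof (intro sum.cong refl)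
      fix j assume "j \<in> {j. adj S i j}"
      hence a: "adj S i j" by simp
      show "V (branch S (sa ?h i) (sa ?h j) (act ?h u)) * f (branch S (sa ?h i) (sa ?h j) (act ?h u)) =
          V (branch S i j u) * pull g f (branch S i j u)"
        unfolding branch_equivariant(2)[OF h a i, symmetric] V_act[OF h a i] pull_region[OF disk_mem[OF branch_mem[OF a i]]] ..
    qed
    also have "\<dots> = L (pull g f) u" by (rule transfer_disk[OF i, symmetric])
    finally show ?thesis ..
  qed (simp add: transfer_outside pull_outside)
qed

text \<open>The operator of the group algebra element with coefficients \<open>a\<close>; the
  projection P_\<chi> is the case of the normalized conjugate character.\<close>

definition average :: "('g \<Rightarrow> complex) \<Rightarrow> (complex \<Rightarrow> complex) \<Rightarrow> complex \<Rightarrow> complex" where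
  "average a f u = (\<Sum>g\<in>carrier G. a g * pull g f u)"

lemma average_outside: "u \<notin> D \<Longrightarrow> average a f u = 0"
  by (simp add: average_def pull_outside)

lemma bergman_sum:
  assumes "finite A" "\<And>x. x \<in> A \<Longrightarrow> f x \<in> bergman"
  shows "(\<lambda>u. \<Sum>x\<in>A. c x * f x u) \<in> bergman"
  using assms
proof (induction A rule: finite_induct)
  case empty show ?case by (simp add: bergman_space_zero)
next
  case (insert x A)
  have "(\<lambda>u. c x * f x u + (\<Sum>x\<in>A. c x * f x u)) \<in> bergman"
    by (intro bergman_space_add[OF region_open] bergman_space_scale insert.IH) (use insert.prems in auto)
  thus ?case using insert.hyps by simp
qed

lemma average_bergman: "f \<in> bergman \<Longrightarrow> average a f \<in> bergman"
  unfolding average_def[abs_def] by (intro bergman_sum G_finite pull_bergman)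

lemma average_sum: "average a (\<lambda>u. \<Sum>x\<in>A. c x * f x u) u = (\<Sum>x\<in>A. c x * average a (f x) u)"
proof (cases "u \<in> D")
  case True
  have "average a (\<lambda>u. \<Sum>x\<in>A. c x * f x u) u = (\<Sum>g\<in>carrier G. \<Sum>x\<in>A. c x * (a g * f x (act (inv g) u)))"
    unfolding average_def pull_region[OF True] sum_distrib_left by (intro sum.cong refl) (simp add: algebra_simps)
  also have "\<dots> = (\<Sum>x\<in>A. c x * average a (f x) u)"
    unfolding average_def pull_region[OF True] sum_distrib_left by (rule sum.swap)
  finally show ?thesis .
qed (simp add: average_outside)

lemma transfer_average: "L (average a f) = average a (L f)"
  unfolding average_def[abs_def] transfer_sum[abs_def]
  by (rule ext, intro sum.cong refl) (simp add: transfer_pull)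

lemma transfer_power_average: "(L ^^ n) (average a f) = average a ((L ^^ n) f)"
  by (induction n) (simp_all add: transfer_average)

lemma average_sup:
  assumes "\<And>u. u \<in> D \<Longrightarrow> norm (f u) \<le> b" and b: "0 \<le> b"
  shows "norm (average a f u) \<le> (\<Sum>g\<in>carrier G. norm (a g)) * b"
proof (cases "u \<in> D")
  case True
  show ?thesis unfolding average_def sum_distrib_right
  proof (rule sum_norm_le)
    fix g assume g: "g \<in> carrier G"
    show "norm (a g * pull g f u) \<le> norm (a g) * b"
      unfolding norm_mult pull_region[OF True]
      by (intro mult_left_mono assms(1) act_mem inv_closed g True norm_ge_zero)
  qed
next
  case False
  thus ?thesis using b by (simp add: average_outside sum_nonneg)
qed

text \<open>Idempotents of the group algebra: the unit element gives the whole Bergman space, a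
  normalized character an isotypic component.\<close>

definition conv_idempotent :: "('g \<Rightarrow> complex) \<Rightarrow> bool" where
  "conv_idempotent a \<longleftrightarrow> (\<forall>g\<in>carrier G. (\<Sum>h\<in>carrier G. a h * a (inv h \<otimes> g)) = a g)"

lemma average_idem:
  assumes a: "conv_idempotent a"
  shows "average a (average a f) = average a f"
proof
  fix u
  have "average a (average a f) u = (\<Sum>h\<in>carrier G. \<Sum>g\<in>carrier G. a h * a g * pull (h \<otimes> g) f u)"
    unfolding average_def[of a "average a f"]
  proof (intro sum.cong refl)
    fix h assume h: "h \<in> carrier G"
    have "pull h (average a f) u = (\<Sum>g\<in>carrier G. a g * pull h (pull g f) u)"
      by (cases "u \<in> D") (simp_all add: pull_region pull_outside average_def)
    also have "\<dots> = (\<Sum>g\<in>carrier G. a g * pull (h \<otimes> g) f u)" by (intro sum.cong refl) (simp add: pull_mult h)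
    finally show "a h * pull h (average a f) u = (\<Sum>g\<in>carrier G. a h * a g * pull (h \<otimes> g) f u)"
      by (simp add: sum_distrib_left mult.assoc)
  qed
  also have "\<dots> = (\<Sum>h\<in>carrier G. \<Sum>g\<in>carrier G. a h * a (inv h \<otimes> g) * pull g f u)"
  proof (rule sum.cong[OF refl])
    fix h assume h: "h \<in> carrier G"
    have "(\<Sum>g\<in>carrier G. a h * a (inv h \<otimes> g) * pull g f u) =
        (\<Sum>g\<in>carrier G. a h * a (inv h \<otimes> (h \<otimes> g)) * pull (h \<otimes> g) f u)"
      by (rule group_sum_translate[OF G_group h, symmetric])
    also have "\<dots> = (\<Sum>g\<in>carrier G. a h * a g * pull (h \<otimes> g) f u)"
      by (intro sum.cong refl) (use h in \<open>simp add: m_assoc[symmetric]\<close>)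
    finally show "(\<Sum>g\<in>carrier G. a h * a g * pull (h \<otimes> g) f u) =
        (\<Sum>g\<in>carrier G. a h * a (inv h \<otimes> g) * pull g f u)" ..
  qed
  also have "\<dots> = (\<Sum>g\<in>carrier G. (\<Sum>h\<in>carrier G. a h * a (inv h \<otimes> g)) * pull g f u)"
    unfolding sum_distrib_right by (rule sum.swap)
  also have "\<dots> = average a f u"
    unfolding average_def by (intro sum.cong refl) (use a in \<open>simp add: conv_idempotent_def\<close>)
  finally show "average a (average a f) u = average a f u" .
qed

definition component :: "('g \<Rightarrow> complex) \<Rightarrow> (complex \<Rightarrow> complex) set" where
  "component a = average a ` bergman"

lemma component_iff: "conv_idempotent a \<Longrightarrow> f \<in> component a \<longleftrightarrow> f \<in> bergman \<and> average a f = f"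
  unfolding component_def using average_bergman average_idem[of a] by (auto intro: image_eqI[OF HOL.sym])

lemma average_component: "f \<in> bergman \<Longrightarrow> average a f \<in> component a"
  by (simp add: component_def)

text \<open>The range of an idempotent is its fixed space, and the fixed point equation involves
  only finitely many values of the function at a time, so it survives pointwise limits.\<close>

lemma component_hilbert:
  assumes a: "conv_idempotent a"
  shows "function_hilbert (component a) (bergman_inner D)"
proof (rule bergman_subspace_hilbert[OF region_open])
  note it = component_iff[OF a]
  show "component a \<subseteq> bergman" using it by blast
  show "(\<lambda>u. 0) \<in> component a"
    unfolding it using average_sum[of a "\<lambda>_. 0" "\<lambda>_ _. 0" "{}"] by (auto simp: bergman_space_zero)
  show "(\<lambda>u. f u + g u) \<in> component a" if f: "f \<in> component a" and g: "g \<in> component a" for f g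
    unfolding it
  proof
    show "(\<lambda>u. f u + g u) \<in> bergman" using f g it bergman_space_add[OF region_open] by blast
    \<comment> \<open>A sum indexed by the two elements of \<open>bool\<close> derives additivity
      from \<open>average_sum\<close>.\<close>
    have "average a (\<lambda>u. f u + g u) u = average a f u + average a g u" for u
      using average_sum[of a "\<lambda>_. 1" "\<lambda>x. if x then f else g" UNIV u] by (simp add: UNIV_bool add.commute)
    thus "average a (\<lambda>u. f u + g u) = (\<lambda>u. f u + g u)" using f g by (simp add: it fun_eq_iff)
  qed
  show "(\<lambda>u. c * f u) \<in> component a" if f: "f \<in> component a" for f c
    unfolding it
  proof
    show "(\<lambda>u. c * f u) \<in> bergman" using f it bergman_space_scale by blast
    have "average a (\<lambda>u. c * f u) u = c * average a f u" for u
      using average_sum[of a "\<lambda>_. c" "\<lambda>_. f" "{()}" u] by simp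
    thus "average a (\<lambda>u. c * f u) = (\<lambda>u. c * f u)" using f by (simp add: it fun_eq_iff)
  qed
  show "g \<in> component a" if fs: "\<And>n. fs n \<in> component a" and g: "g \<in> bergman" and l: "\<And>z. (\<lambda>n. fs n z) \<longlonglongrightarrow> g z" for fs g
    unfolding it
  proof
    show "g \<in> bergman" by fact
    show "average a g = g"
    proof
      fix u
      have "(\<lambda>n. average a (fs n) u) \<longlonglongrightarrow> average a g u"
        unfolding average_def function_act_def using l by (cases "u \<in> D") (auto intro!: tendsto_intros)
      moreover have "average a (fs n) u = fs n u" for n using fs[of n] by (simp add: it)
      ultimately have "(\<lambda>n. fs n u) \<longlonglongrightarrow> average a g u" by simp
      thus "average a g u = g u" using l[of u] by (rule LIMSEQ_unique)
    qed
  qed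
qed

lemma transfer_component:
  assumes a: "conv_idempotent a" and f: "f \<in> component a"
  shows "L f \<in> component a"
  using f transfer_bergman[OF bergman_spaceD(1), of f] transfer_average[of a f] by (simp add: component_iff[OF a])

end

section \<open>Nuclear expansion of the transfer operator\<close>

text \<open>The expansion of the operator is naturally indexed by source, target and degree, whereas
  the matrix theory uses natural numbers. The geometric bound gives absolute convergence, so any
  enumeration \<open>e\<close> has the same sum.\<close>

lemma enumerated_sum:
  fixes F :: "'i :: finite \<Rightarrow> 'i \<Rightarrow> nat \<Rightarrow> complex"
  assumes b: "\<And>i j m. norm (F i j m) \<le> C * q ^ m" and q: "0 \<le> q" "q < 1"
    and e: "bij_betw e UNIV (UNIV :: ('i \<times> 'i \<times> nat) set)"
  shows "(\<lambda>n. case e n of (i, j, m) \<Rightarrow> F i j m) sums (\<Sum>i\<in>UNIV. \<Sum>j\<in>UNIV. \<Sum>m. F i j m)"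
    and "summable (\<lambda>n. norm (case e n of (i, j, m) \<Rightarrow> F i j m))"
proof -
  let ?f = "\<lambda>p :: ('i \<times> 'i) \<times> nat. F (fst (fst p)) (snd (fst p)) (snd p)"
  let ?r = "\<lambda>p :: 'i \<times> 'i \<times> nat. ((fst p, fst (snd p)), snd (snd p))"
  have sm: "summable (\<lambda>m. norm (F i j m))" for i j
    by (rule summable_comparison_test'[where g = "\<lambda>m. C * q ^ m" and N = 0]) (use b q in \<open>auto intro!: summable_mult summable_geometric\<close>)
  have so: "(\<lambda>m. norm (F i j m)) summable_on UNIV" for i j
    by (rule norm_summable_imp_summable_on[of "\<lambda>m. norm (F i j m)", simplified]) (use sm[of i j] in simp)
  have hs: "(F i j has_sum (\<Sum>m. F i j m)) UNIV" for i j
    by (rule norm_summable_imp_has_sum[OF sm summable_sums[OF summable_norm_cancel[OF sm]]])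
  have hp: "((\<lambda>m. ?f (p, m)) has_sum (\<Sum>m. F (fst p) (snd p) m)) UNIV" for p using hs by simp
  have U: "(UNIV :: (('i \<times> 'i) \<times> nat) set) = Sigma UNIV (\<lambda>_. UNIV)" by simp
  have abs: "(\<lambda>p. norm (?f p)) summable_on UNIV"
    unfolding U
  proof (rule Infinite_Sum.abs_summable_on_Sigma_iff[THEN iffD2], intro conjI ballI)
    show "(\<lambda>m. norm (?f (p, m))) summable_on UNIV" for p using so by simp
    show "(\<lambda>p. norm (infsum (\<lambda>m. norm (?f (p, m))) UNIV)) summable_on UNIV" by (rule summable_on_finite) simp
  qed
  have "(?f has_sum (\<Sum>p\<in>UNIV. \<Sum>m. F (fst p) (snd p) m)) (Sigma UNIV (\<lambda>_. UNIV))"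
  proof (rule has_sum_SigmaI[OF hp])
    show "((\<lambda>p. \<Sum>m. F (fst p) (snd p) m) has_sum (\<Sum>p\<in>UNIV. \<Sum>m. F (fst p) (snd p) m)) UNIV"
      by (rule has_sum_finite) simp
    show "?f summable_on Sigma UNIV (\<lambda>_. UNIV)" using Infinite_Sum.abs_summable_summable[OF abs] by simp
  qed
  hence hf: "(?f has_sum (\<Sum>p\<in>UNIV. \<Sum>m. F (fst p) (snd p) m)) UNIV" by simp
  have r: "bij_betw ?r UNIV UNIV"
    by (rule bij_betw_byWitness[where f' = "\<lambda>p. (fst (fst p), snd (fst p), snd p)"]) auto
  have re: "bij_betw (\<lambda>n. ?r (e n)) UNIV UNIV" using bij_betw_trans[OF e r] by (simp add: o_def)
  have c: "(case e n of (i, j, m) \<Rightarrow> F i j m) = ?f (?r (e n))" for n by (simp add: case_prod_unfold)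
  have "((\<lambda>n. ?f (?r (e n))) has_sum (\<Sum>p\<in>UNIV. \<Sum>m. F (fst p) (snd p) m)) UNIV"
    by (rule has_sum_reindex_bij_betw[OF re, THEN iffD2, OF hf])
  hence "(\<lambda>n. case e n of (i, j, m) \<Rightarrow> F i j m) sums (\<Sum>p\<in>UNIV. \<Sum>m. F (fst p) (snd p) m)"
    unfolding c by (rule has_sum_imp_sums)
  moreover have "(\<Sum>p\<in>UNIV. \<Sum>m. F (fst p) (snd p) m) = (\<Sum>i\<in>UNIV. \<Sum>j\<in>UNIV. \<Sum>m. F i j m)"
    unfolding sum.cartesian_product by (simp add: case_prod_unfold)
  ultimately show "(\<lambda>n. case e n of (i, j, m) \<Rightarrow> F i j m) sums (\<Sum>i\<in>UNIV. \<Sum>j\<in>UNIV. \<Sum>m. F i j m)" by simp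
  have "(\<lambda>n. norm (?f (?r (e n)))) summable_on UNIV"
    by (rule summable_on_reindex_bij_betw[OF re, THEN iffD2, OF abs])
  hence "summable (\<lambda>n. norm (?f (?r (e n))))" by (rule summable_on_imp_summable)
  thus "summable (\<lambda>n. norm (case e n of (i, j, m) \<Rightarrow> F i j m))" unfolding c .
qed

context ifs_symmetry begin

text \<open>The entries of a triple are the source symbol, the target symbol and the Taylor
  degree.\<close>

definition code :: "nat \<Rightarrow> 'i \<times> 'i \<times> nat" where "code = from_nat_into UNIV"

lemma code_bij: "bij_betw code UNIV UNIV"
proof -
  have "infinite (UNIV :: ('i \<times> 'i \<times> nat) set)" by (simp add: finite_prod infinite_UNIV_nat)
  thus ?thesis unfolding code_def by (rule bij_betw_from_nat_into[OF countableI_type])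
qed

text \<open>The contribution of the single branch from i to j to the image of (w - c)^m under the
  transfer operator, where c is the centre of disk j.\<close>

definition monomial :: "'i \<Rightarrow> 'i \<Rightarrow> nat \<Rightarrow> complex \<Rightarrow> complex" where
  "monomial i j m u =
     (if adj S i j \<and> u \<in> B i then V (branch S i j u) * (branch S i j u - centre S j) ^ m else 0)"

text \<open>Evaluating Taylor coefficients on the circle of radius \<open>\<tau> r\<close> costs \<open>(\<tau> r)\<^sup>-\<^sup>m\<close>, while
  the \<open>m\<close>-th monomial decays like \<open>(\<tau>\<^sup>2 r)\<^sup>m\<close>; this leaves a geometric factor \<open>\<tau>\<^sup>m\<close>.\<close>

definition \<tau> :: real where "\<tau> = sqrt ratio"

lemma \<tau>: "0 < \<tau>" "\<tau> < 1" "ratio = \<tau> * \<tau>"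
  using ratio(1,2) by (simp_all add: \<tau>_def)

abbreviation r where "r \<equiv> radius S"
abbreviation coeff where "coeff j m \<equiv> taylor_coeff (centre S j) m"

lemma monomial_sup: "norm (monomial i j m u) \<le> V_sup * (ratio * r j) ^ m"
proof (cases "adj S i j \<and> u \<in> B i")
  case True
  hence a: "adj S i j" "u \<in> B i" by simp_all
  have "norm (branch S i j u - centre S j) \<le> ratio * r j"
    using ratio(3)[OF a] by (simp add: dist_norm norm_minus_commute)
  thus ?thesis using a V_sup(1) unfolding monomial_def
    by (simp add: norm_mult norm_power) (intro mult_mono V_sup(2) branch_image_mem power_mono; simp)
next
  case False
  hence "monomial i j m u = 0" unfolding monomial_def by (rule if_not_P)
  thus ?thesis using V_sup(1) ratio(1) radius_pos[of j] by simp
qed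

lemma monomial_holo: "monomial i j m holomorphic_on D"
  unfolding holomorphic_on_region
proof
  fix k
  show "monomial i j m holomorphic_on B k"
  proof (cases "adj S i j \<and> k = i")
    case True
    hence a: "adj S i j" and k: "k = i" by simp_all
    have "(\<lambda>u. V (branch S i j u) * (branch S i j u - centre S j) ^ m) holomorphic_on B k"
      unfolding k by (intro holomorphic_intros V_branch_holo[OF a] adj_branch(1)[OF a])
    thus ?thesis by (rule holomorphic_transform) (use a k in \<open>simp add: monomial_def\<close>)
  next
    case False
    have "(\<lambda>u. 0) holomorphic_on B k" by simp
    thus ?thesis
    proof (rule holomorphic_transform)
      fix u assume "u \<in> B k"
      thus "0 = monomial i j m u" using False disk_unique[of u k i] by (auto simp: monomial_def)
    qed
  qed
qed

lemma monomial_bergman: "monomial i j m \<in> bergman"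
  by (rule bounded_bergman(1)[OF region_open region_finite_measure monomial_holo _ monomial_sup])
    (auto simp: monomial_def region_def)

lemma coeff_sup:
  assumes f: "f holomorphic_on D" and b: "\<And>u. u \<in> D \<Longrightarrow> norm (f u) \<le> b"
  shows "norm (coeff j m f) \<le> b / (\<tau> * r j) ^ m"
proof (rule taylor_coeff_bound)
  show "f holomorphic_on ball (centre S j) (r j)"
    using holomorphic_on_subset[OF f disk_subset[of j]] by (simp add: disk_def)
  show "0 < \<tau> * r j" "\<tau> * r j < r j" using \<tau> radius_pos[of j] by simp_all
  hence "\<tau> * r j < r j" by simp
  thus "norm (f z) \<le> b" if "dist (centre S j) z = \<tau> * r j" for z
    using that by (intro b disk_mem[of z j]) (simp add: disk_def)
qed

lemma ratio_power: "(ratio * r j) ^ m / (\<tau> * r j) ^ m = \<tau> ^ m"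
proof -
  have "(ratio * r j) ^ m = \<tau> ^ m * (\<tau> * r j) ^ m" by (simp add: \<tau>(3) power_mult_distrib)
  thus ?thesis using \<tau>(1) radius_pos[of j] by simp
qed

text \<open>The circle of radius \<open>\<tau> * r j\<close> keeps the distance
  \<open>(1 - \<tau>) * r j\<close> from the boundary of its disk. The minimal radius serves all
  disks at once, and the half makes the inequality of radii in \<open>bergman_point_bound\<close>
  strict.\<close>

definition point_const :: real where
  "point_const = 1 / sqrt (measure lborel (ball (0::complex) ((1 - \<tau>) * Min (range r) / 2)))"

lemma min_radius: "0 < Min (range r)" "Min (range r) \<le> r j"
proof -
  have "Min (range r) \<in> range r" by (rule Min_in) auto
  thus "0 < Min (range r)" using radius_pos by auto
  show "Min (range r) \<le> r j" by (rule Min_le) auto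
qed

lemma point_const_nonneg: "0 \<le> point_const" by (simp add: point_const_def)

lemma coeff_bergman:
  assumes f: "f \<in> bergman"
  shows "norm (coeff j m f) \<le> point_const / (\<tau> * r j) ^ m * sqrt (square_norm D f)"
proof -
  let ?s = "(1 - \<tau>) * Min (range r) / 2" let ?\<mu> = "measure lborel (ball (0::complex) ?s)"
  have s: "0 < ?s" "?s < (1 - \<tau>) * r j"
  proof -
    show "0 < ?s" using \<tau>(2) min_radius(1) by simp
    have "?s < (1 - \<tau>) * Min (range r)" using \<tau>(2) min_radius(1) by simp
    also have "\<dots> \<le> (1 - \<tau>) * r j" using \<tau>(2) min_radius(2) by (intro mult_left_mono) auto
    finally show "?s < (1 - \<tau>) * r j" .
  qed
  have mp: "0 < ?\<mu>" by (rule measure_ball_pos[OF s(1)])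
  have b: "norm (f z) \<le> point_const * sqrt (square_norm D f)" if z: "dist (centre S j) z = \<tau> * r j" for z
  proof -
    have "ball z ((1 - \<tau>) * r j) \<subseteq> D"
    proof
      fix w assume "w \<in> ball z ((1 - \<tau>) * r j)"
      hence "dist (centre S j) w < \<tau> * r j + (1 - \<tau>) * r j"
        using z dist_triangle[of "centre S j" w z] by simp
      thus "w \<in> D" by (intro disk_mem[of w j]) (simp add: disk_def algebra_simps)
    qed
    from bergman_point_bound[OF region_open f this s]
    have "(norm (f z))\<^sup>2 \<le> square_norm D f / ?\<mu>" using mp by (simp add: pos_le_divide_eq)
    hence "sqrt ((norm (f z))\<^sup>2) \<le> sqrt (square_norm D f / ?\<mu>)" by (rule real_sqrt_le_mono)
    thus ?thesis by (simp add: point_const_def real_sqrt_divide)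
  qed
  have "norm (coeff j m f) \<le> (point_const * sqrt (square_norm D f)) / (\<tau> * r j) ^ m"
  proof (rule taylor_coeff_bound[OF _ _ _ b])
    show "f holomorphic_on ball (centre S j) (r j)"
      using holomorphic_on_subset[OF bergman_spaceD(1)[OF f] disk_subset[of j]] by (simp add: disk_def)
    show "0 < \<tau> * r j" "\<tau> * r j < r j" using \<tau> radius_pos[of j] by simp_all
  qed
  thus ?thesis by simp
qed

text \<open>At a point of disk i only the summands with source i survive, and for every target j the
  sum over m is the Taylor series of \<open>f\<close> at the branch value.\<close>

lemma transfer_series:
  assumes f: "f holomorphic_on D" and u: "u \<in> D"
  shows "L f u = (\<Sum>i\<in>UNIV. \<Sum>j\<in>UNIV. \<Sum>m. coeff j m f * monomial i j m u)"
proof -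
  obtain i where i: "u \<in> B i" by (rule region_cases[OF u])
  have z: "monomial k j m u = 0" if "\<not> (adj S k j \<and> k = i)" for k j m
    using that disk_unique[OF i, of k] by (auto simp: monomial_def)
  have s: "(\<Sum>m. coeff j m f * monomial i j m u) = V (branch S i j u) * f (branch S i j u)" if a: "adj S i j" for j
  proof -
    have "f holomorphic_on ball (centre S j) (r j)" "branch S i j u \<in> ball (centre S j) (r j)"
      using holomorphic_on_subset[OF f disk_subset[of j]] branch_mem[OF a i] by (simp_all add: disk_def)
    from sums_mult[OF taylor_series[OF this], of "V (branch S i j u)"]
    have "(\<lambda>m. V (branch S i j u) * (coeff j m f * (branch S i j u - centre S j) ^ m)) sums
        (V (branch S i j u) * f (branch S i j u))" .
    moreover have "coeff j m f * monomial i j m u = V (branch S i j u) * (coeff j m f * (branch S i j u - centre S j) ^ m)" for m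
      using a i by (simp add: monomial_def)
    ultimately show ?thesis by (simp only: sums_iff)
  qed
  have "(\<Sum>k\<in>UNIV. \<Sum>j\<in>UNIV. \<Sum>m. coeff j m f * monomial k j m u) =
      (\<Sum>k\<in>UNIV. if k = i then (\<Sum>j\<in>UNIV. \<Sum>m. coeff j m f * monomial i j m u) else 0)"
    by (intro sum.cong refl) (simp add: z)
  also have "\<dots> = (\<Sum>j\<in>UNIV. \<Sum>m. coeff j m f * monomial i j m u)" by simp
  also have "\<dots> = (\<Sum>j | adj S i j. \<Sum>m. coeff j m f * monomial i j m u)"
    by (rule sum.mono_neutral_right) (auto simp: z)
  also have "\<dots> = L f u" unfolding transfer_disk[OF i] by (intro sum.cong refl) (simp add: s)
  finally show ?thesis ..
qed

definition coord :: "nat \<Rightarrow> (complex \<Rightarrow> complex) \<Rightarrow> complex" where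
  "coord n f = (case code n of (i, j, m) \<Rightarrow> coeff j m f)"

definition mono_at :: "nat \<Rightarrow> complex \<Rightarrow> complex" where
  "mono_at n = (case code n of (i, j, m) \<Rightarrow> monomial i j m)"

definition \<xi> :: "nat \<Rightarrow> real" where
  "\<xi> n = (case code n of (i, j, m) \<Rightarrow> point_const / (\<tau> * r j) ^ m)"

definition \<eta>\<^sub>0 :: "nat \<Rightarrow> real" where
  "\<eta>\<^sub>0 n = (case code n of (i, j, m) \<Rightarrow> V_sup * (ratio * r j) ^ m)"

lemma \<xi>_nonneg: "0 \<le> \<xi> n"
  using point_const_nonneg \<tau>(1) radius_pos by (auto simp: \<xi>_def less_imp_le split: prod.split)

lemma \<eta>\<^sub>0_nonneg: "0 \<le> \<eta>\<^sub>0 n"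
  using V_sup(1) ratio(1) radius_pos by (auto simp: \<eta>\<^sub>0_def less_imp_le split: prod.split)

lemma \<xi>_\<eta>\<^sub>0: "\<xi> n * \<eta>\<^sub>0 n = (case code n of (i, j, m) \<Rightarrow> point_const * V_sup * \<tau> ^ m)"
proof -
  obtain i j m where c: "code n = (i, j, m)" by (rule prod_cases3)
  have "\<xi> n * \<eta>\<^sub>0 n = point_const * V_sup * ((ratio * r j) ^ m / (\<tau> * r j) ^ m)"
    by (simp add: \<xi>_def \<eta>\<^sub>0_def c)
  thus ?thesis unfolding ratio_power by (simp add: c)
qed

lemma summable_code:
  fixes C q :: real
  assumes "0 \<le> q" "q < 1"
  shows "summable (\<lambda>n. case code n of (i, j, m) \<Rightarrow> C * q ^ m)"
proof -
  have "summable (\<lambda>n. norm (case code n of (i, j, m) \<Rightarrow> complex_of_real (C * q ^ m)))"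
    by (rule enumerated_sum(2)[OF _ assms code_bij, of _ "\<bar>C\<bar>"]) (use assms in \<open>simp add: norm_mult norm_power\<close>)
  hence "summable (\<lambda>n. \<bar>case code n of (i, j, m) \<Rightarrow> C * q ^ m\<bar>)"
    by (simp add: case_prod_unfold abs_mult norm_mult norm_power power_abs)
  thus ?thesis by (rule summable_rabs_cancel)
qed

lemma \<xi>_\<eta>\<^sub>0_summable: "summable (\<lambda>n. \<xi> n * \<eta>\<^sub>0 n)"
  unfolding \<xi>_\<eta>\<^sub>0 by (rule summable_code) (use \<tau> in auto)

lemma \<xi>_\<eta>\<^sub>0_sqrt_summable: "summable (\<lambda>n. sqrt (\<xi> n * \<eta>\<^sub>0 n))"
proof -
  have "sqrt (\<xi> n * \<eta>\<^sub>0 n) = (case code n of (i, j, m) \<Rightarrow> sqrt (point_const * V_sup) * sqrt \<tau> ^ m)" for n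
    unfolding \<xi>_\<eta>\<^sub>0 by (auto simp: real_sqrt_mult real_sqrt_power split: prod.split)
  thus ?thesis using summable_code[of "sqrt \<tau>"] \<tau> by simp
qed

lemma mono_at_bergman: "mono_at n \<in> bergman"
  by (auto simp: mono_at_def monomial_bergman split: prod.split)

lemma mono_at_sup: "norm (mono_at n u) \<le> \<eta>\<^sub>0 n"
  by (auto simp: mono_at_def \<eta>\<^sub>0_def monomial_sup split: prod.split)

lemma coord_bergman: "f \<in> bergman \<Longrightarrow> norm (coord n f) \<le> \<xi> n * sqrt (square_norm D f)"
  using coeff_bergman by (auto simp: coord_def \<xi>_def split: prod.split)

lemma coeff_linear:
  assumes "finite A" "\<And>x. x \<in> A \<Longrightarrow> f x holomorphic_on D"
  shows "coeff j m (\<lambda>u. \<Sum>x\<in>A. c x * f x u) = (\<Sum>x\<in>A. c x * coeff j m (f x))"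
proof -
  have cD: "centre S j \<in> D" by (rule disk_mem[OF centre_mem])
  have "coeff j m (\<lambda>u. \<Sum>x\<in>A. c x * f x u) = (\<Sum>x\<in>A. coeff j m (\<lambda>u. c x * f x u))"
    by (rule taylor_coeff_sum[OF assms(1) _ region_open cD]) (use assms(2) in \<open>auto intro!: holomorphic_intros\<close>)
  also have "\<dots> = (\<Sum>x\<in>A. c x * coeff j m (f x))"
    by (intro sum.cong refl taylor_coeff_scale[OF assms(2) region_open cD])
  finally show ?thesis .
qed

lemma coord_linear:
  assumes "finite A" "\<And>x. x \<in> A \<Longrightarrow> f x holomorphic_on D"
  shows "coord n (\<lambda>u. \<Sum>x\<in>A. c x * f x u) = (\<Sum>x\<in>A. c x * coord n (f x))"
  by (auto simp: coord_def coeff_linear[OF assms] split: prod.split)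

lemma coord_diff:
  assumes f: "f holomorphic_on D" and g: "g holomorphic_on D"
  shows "coord n (\<lambda>u. f u - g u) = coord n f - coord n g"
proof -
  have "coord n (\<lambda>u. \<Sum>x\<in>UNIV. (if x then 1 else -1) * (if x then f else g) u) =
      (\<Sum>x\<in>UNIV. (if x then 1 else -1) * coord n (if x then f else g))"
    by (rule coord_linear) (use f g in auto)
  thus ?thesis by (simp add: UNIV_bool)
qed

lemma transfer_expansion:
  assumes f: "f \<in> bergman" and u: "u \<in> D"
  shows "(\<lambda>n. coord n f * mono_at n u) sums L f u"
proof -
  let ?C = "point_const * sqrt (square_norm D f) * V_sup"
  have "(\<lambda>n. case code n of (i, j, m) \<Rightarrow> coeff j m f * monomial i j m u) sums
      (\<Sum>i\<in>UNIV. \<Sum>j\<in>UNIV. \<Sum>m. coeff j m f * monomial i j m u)"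
  proof (rule enumerated_sum(1)[OF _ _ \<tau>(2) code_bij])
    show "norm (coeff j m f * monomial i j m u) \<le> ?C * \<tau> ^ m" for i j m
    proof -
      have "norm (coeff j m f * monomial i j m u) \<le>
          (point_const / (\<tau> * r j) ^ m * sqrt (square_norm D f)) * (V_sup * (ratio * r j) ^ m)"
        unfolding norm_mult by (intro mult_mono coeff_bergman[OF f] monomial_sup norm_ge_zero mult_nonneg_nonneg divide_nonneg_nonneg)
          (use point_const_nonneg \<tau>(1) radius_pos[of j] square_norm_nonneg in \<open>auto simp: less_imp_le\<close>)
      also have "\<dots> = ?C * ((ratio * r j) ^ m / (\<tau> * r j) ^ m)" by simp
      finally show ?thesis unfolding ratio_power .
    qed
  qed (use \<tau> in auto)
  moreover have "(case code n of (i, j, m) \<Rightarrow> coeff j m f * monomial i j m u) = coord n f * mono_at n u" for n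
    by (simp add: coord_def mono_at_def case_prod_unfold)
  ultimately show ?thesis using transfer_series[OF bergman_spaceD(1)[OF f] u] by simp
qed

end

locale ifs_average = ifs_symmetry S G act V
  for S :: "'i :: finite ifs" and G :: "('g, 'm) monoid_scheme" (structure)
    and act :: "'g \<Rightarrow> complex \<Rightarrow> complex" and V :: "complex \<Rightarrow> complex" +
  fixes a :: "'g \<Rightarrow> complex"
  assumes a_idem: "conv_idempotent a"
begin

abbreviation H where "H \<equiv> component a"

lemma H_iff: "f \<in> H \<longleftrightarrow> f \<in> bergman \<and> average a f = f"
  by (rule component_iff[OF a_idem])

sublocale function_hilbert H "bergman_inner D"
  by (rule component_hilbert[OF a_idem])

lemma nsq_square_norm: "nsq f = square_norm D f"
  by (simp add: nsq_def bergman_inner_self)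

definition vec :: "nat \<Rightarrow> complex \<Rightarrow> complex" where "vec n = average a (mono_at n)"

definition a_norm :: real where "a_norm = (\<Sum>g\<in>carrier G. norm (a g))"

lemma a_norm_nonneg: "0 \<le> a_norm" by (simp add: a_norm_def sum_nonneg)

lemma vec_H: "vec n \<in> H"
  unfolding vec_def by (rule average_component[OF mono_at_bergman])

lemma vec_bergman: "vec n \<in> bergman" using vec_H H_iff by blast

lemma vec_sup: "norm (vec n u) \<le> a_norm * \<eta>\<^sub>0 n"
  unfolding vec_def a_norm_def by (rule average_sup[OF mono_at_sup \<eta>\<^sub>0_nonneg])

definition \<eta> :: "nat \<Rightarrow> real" where "\<eta> n = a_norm * \<eta>\<^sub>0 n * sqrt (measure lborel D)"

lemma \<eta>_nonneg: "0 \<le> \<eta> n" by (simp add: \<eta>_def a_norm_nonneg \<eta>\<^sub>0_nonneg)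

lemma vec_nsq: "nsq (vec n) \<le> (\<eta> n)\<^sup>2"
  using bounded_bergman(2)[OF region_open region_finite_measure bergman_spaceD(1)[OF vec_bergman] bergman_spaceD(3)[OF vec_bergman] vec_sup]
  by (simp add: nsq_square_norm \<eta>_def power_mult_distrib)

lemma coord_functional: "bounded_functional (coord n) (\<xi> n)"
  unfolding bounded_functional_def
proof (intro conjI ballI allI)
  show "0 \<le> \<xi> n" by (rule \<xi>_nonneg)
  have holo: "f holomorphic_on D" if "f \<in> H" for f using that H_iff bergman_spaceD(1) by blast
  show "coord n (\<lambda>u. f u + g u) = coord n f + coord n g" if f: "f \<in> H" and g: "g \<in> H" for f g
  proof -
    have "coord n (\<lambda>u. \<Sum>x\<in>UNIV. 1 * (if x then f else g) u) = (\<Sum>x\<in>UNIV. 1 * coord n (if x then f else g))"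
      by (rule coord_linear) (use holo f g in auto)
    thus ?thesis by (simp add: UNIV_bool add.commute)
  qed
  show "coord n (\<lambda>u. c * f u) = c * coord n f" if f: "f \<in> H" for f c
    using coord_linear[of "{()}" "\<lambda>_. f" n "\<lambda>_. c"] holo[OF f] by simp
  show "norm (coord n f) \<le> \<xi> n * sqrt (nsq f)" if f: "f \<in> H" for f
    unfolding nsq_square_norm by (rule coord_bergman) (use f H_iff in blast)
qed

text \<open>The expansion of L f is averaged. The coefficients are numbers and unaffected, the
  monomials turn into the \<open>vec n\<close>, and L f is fixed because it lies in \<open>H\<close>
  again.\<close>

lemma vec_expansion:
  assumes f: "f \<in> H"
  shows "(\<lambda>n. coord n f * vec n u) sums L f u"
proof (cases "u \<in> D")
  case True
  have fB: "f \<in> bergman" using f H_iff by blast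
  have "(\<lambda>n. \<Sum>g\<in>carrier G. a g * (coord n f * mono_at n (act (inv g) u))) sums
      (\<Sum>g\<in>carrier G. a g * L f (act (inv g) u))"
    by (intro sums_sum sums_mult transfer_expansion[OF fB] act_mem inv_closed True)
  moreover have "(\<Sum>g\<in>carrier G. a g * (coord n f * mono_at n (act (inv g) u))) = coord n f * vec n u" for n
    unfolding vec_def average_def pull_region[OF True] sum_distrib_left by (intro sum.cong refl) simp
  moreover have "(\<Sum>g\<in>carrier G. a g * L f (act (inv g) u)) = average a (L f) u"
    by (simp add: average_def pull_region[OF True])
  moreover have "average a (L f) = L f" using transfer_component[OF a_idem f] H_iff by blast
  ultimately show ?thesis by simp
next
  case False
  thus ?thesis by (simp add: vec_def average_outside transfer_outside)
qed

text \<open>The expansion converges uniformly on the region, with the tails \<open>?T N\<close> of a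
  summable majorant as error; finite area turns this into convergence in norm.\<close>

lemma vec_expansion_nsq:
  assumes f: "f \<in> H"
  shows "(\<lambda>N. nsq (\<lambda>u. L f u - (\<Sum>n<N. coord n f * vec n u))) \<longlonglongrightarrow> 0"
proof -
  have fB: "f \<in> bergman" using f H_iff by blast
  let ?t = "\<lambda>n. sqrt (square_norm D f) * a_norm * (\<xi> n * \<eta>\<^sub>0 n)"
  have ts: "summable ?t" by (intro summable_mult \<xi>_\<eta>\<^sub>0_summable)
  have tb: "norm (coord n f * vec n u) \<le> ?t n" for n u
  proof -
    have "norm (coord n f * vec n u) \<le> (\<xi> n * sqrt (square_norm D f)) * (a_norm * \<eta>\<^sub>0 n)"
      unfolding norm_mult
      by (intro mult_mono coord_bergman[OF fB] vec_sup norm_ge_zero mult_nonneg_nonneg \<xi>_nonneg)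
        (simp add: square_norm_nonneg)
    thus ?thesis by (simp add: algebra_simps)
  qed
  let ?T = "\<lambda>N. \<Sum>n. ?t (n + N)"
  have le: "nsq (\<lambda>u. L f u - (\<Sum>n<N. coord n f * vec n u)) \<le> (?T N)\<^sup>2 * measure lborel D" for N
    unfolding nsq_square_norm
  proof (rule bounded_bergman(2)[OF region_open region_finite_measure])
    show "(\<lambda>u. L f u - (\<Sum>n<N. coord n f * vec n u)) holomorphic_on D"
      by (intro holomorphic_intros transfer_holo bergman_spaceD(1)[OF fB] bergman_spaceD(1)[OF vec_bergman])
    show "L f z - (\<Sum>n<N. coord n f * vec n z) = 0" if "z \<notin> D" for z
      using that by (simp add: vec_def average_outside transfer_outside)
    show "norm (L f z - (\<Sum>n<N. coord n f * vec n z)) \<le> ?T N" for z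
    proof -
      have s: "summable (\<lambda>n. coord n f * vec n z)" and e: "L f z = (\<Sum>n. coord n f * vec n z)"
        using vec_expansion[OF f, of z] by (simp_all add: sums_iff)
      have ns: "summable (\<lambda>n. norm (coord (n + N) f * vec (n + N) z))"
        by (rule summable_comparison_test'[where N = 0, OF summable_ignore_initial_segment[OF ts, of N]]) (use tb in simp)
      have "L f z - (\<Sum>n<N. coord n f * vec n z) = (\<Sum>n. coord (n + N) f * vec (n + N) z)"
        unfolding e by (rule suminf_minus_initial_segment[OF s, symmetric])
      also have "norm \<dots> \<le> (\<Sum>n. norm (coord (n + N) f * vec (n + N) z))" by (rule summable_norm[OF ns])
      also have "\<dots> \<le> ?T N" by (rule suminf_le[OF tb ns summable_ignore_initial_segment[OF ts]])
      finally show ?thesis .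
    qed
  qed
  have lim: "(\<lambda>N. (?T N)\<^sup>2 * measure lborel D) \<longlonglongrightarrow> 0"
    using tendsto_mult_right[OF tendsto_power[OF suminf_exist_split2[OF ts], of 2], of "measure lborel D"] by simp
  show ?thesis
  proof (rule Lim_null_comparison[OF always_eventually lim], rule allI)
    show "norm (nsq (\<lambda>u. L f u - (\<Sum>n<N. coord n f * vec n u))) \<le> (?T N)\<^sup>2 * measure lborel D" for N
      using le[of N] by (simp add: nsq_square_norm square_norm_nonneg)
  qed
qed

definition kernel :: "nat \<Rightarrow> nat \<Rightarrow> complex" where "kernel \<alpha> \<beta> = coord \<alpha> (vec \<beta>)"

lemma \<xi>_\<eta>_summable: "summable (\<lambda>n. \<xi> n * \<eta> n)"
  using summable_mult[OF \<xi>_\<eta>\<^sub>0_summable, of "a_norm * sqrt (measure lborel D)"] by (simp add: \<eta>_def algebra_simps)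

text \<open>The names are exchanged on purpose: rows of \<open>kernel\<close> belong to functionals
  and columns to vectors, so the row bound of \<open>bounded_kernel\<close> is \<open>\<xi>\<close>
  here and the column bound is \<open>\<eta>\<close>.\<close>

sublocale bounded_kernel \<xi> \<eta>
proof
  show "0 \<le> \<xi> n" "0 \<le> \<eta> n" for n by (rule \<xi>_nonneg, rule \<eta>_nonneg)
  have "sqrt (\<xi> n * \<eta> n) = sqrt (a_norm * sqrt (measure lborel D)) * sqrt (\<xi> n * \<eta>\<^sub>0 n)" for n
    unfolding real_sqrt_mult[symmetric] by (simp add: \<eta>_def algebra_simps)
  thus "summable (\<lambda>n. sqrt (\<xi> n * \<eta> n))" using summable_mult[OF \<xi>_\<eta>\<^sub>0_sqrt_summable] by simp
qed

lemma kernel_bounded: "bounded_by kernel"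
  unfolding bounded_by_def kernel_def
proof (intro allI)
  fix \<alpha> \<beta>
  have "norm (coord \<alpha> (vec \<beta>)) \<le> \<xi> \<alpha> * sqrt (nsq (vec \<beta>))"
    unfolding nsq_square_norm by (rule coord_bergman[OF vec_bergman])
  also have "\<dots> \<le> \<xi> \<alpha> * sqrt ((\<eta> \<beta>)\<^sup>2)" by (intro mult_left_mono real_sqrt_le_mono vec_nsq \<xi>_nonneg)
  finally show "norm (coord \<alpha> (vec \<beta>)) \<le> \<xi> \<alpha> * \<eta> \<beta>" using \<eta>_nonneg by simp
qed

lemma fredholm_det_component: "fredholm_det (bergman_inner D) H L z = kernel_det kernel z"
  unfolding kernel_def[abs_def]
  by (rule fredholm_det_nuclear[OF vec_H vec_nsq \<eta>_nonneg coord_functional \<xi>_\<eta>_summable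
    transfer_component[OF a_idem] vec_expansion_nsq])

text \<open>The expansion of L f converges in norm, so a bounded coordinate functional may be
  applied termwise.\<close>

lemma coord_transfer:
  assumes f: "f \<in> H"
  shows "(\<lambda>n. coord \<alpha> (vec n) * coord n f) sums coord \<alpha> (L f)"
proof -
  have fB: "f \<in> bergman" using f H_iff by blast
  let ?d = "\<lambda>N u. L f u - (\<Sum>n<N. coord n f * vec n u)"
  have sH: "(\<lambda>u. \<Sum>n<N. coord n f * vec n u) \<in> H" for N by (intro sum_mem vec_H) simp
  have dH: "?d N \<in> H" for N by (rule diff_mem[OF transfer_component[OF a_idem f] sH])
  have e: "coord \<alpha> (?d N) = coord \<alpha> (L f) - (\<Sum>n<N. coord \<alpha> (vec n) * coord n f)" for N
  proof -
    have "coord \<alpha> (?d N) = coord \<alpha> (L f) - coord \<alpha> (\<lambda>u. \<Sum>n<N. coord n f * vec n u)"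
      by (rule coord_diff) (use transfer_holo bergman_spaceD(1) fB sH H_iff in blast)+
    also have "coord \<alpha> (\<lambda>u. \<Sum>n<N. coord n f * vec n u) = (\<Sum>n<N. coord n f * coord \<alpha> (vec n))"
      by (rule coord_linear) (use bergman_spaceD(1) vec_bergman in auto)
    finally show ?thesis by (simp add: mult.commute)
  qed
  have "(\<lambda>N. coord \<alpha> (?d N)) \<longlonglongrightarrow> 0"
  proof (rule Lim_null_comparison)
    show "\<forall>\<^sub>F N in sequentially. norm (coord \<alpha> (?d N)) \<le> \<xi> \<alpha> * sqrt (nsq (?d N))"
      unfolding nsq_square_norm using dH H_iff coord_bergman by (intro always_eventually allI) blast
    have "(\<lambda>N. \<xi> \<alpha> * sqrt (nsq (?d N))) \<longlonglongrightarrow> \<xi> \<alpha> * sqrt 0"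
      by (intro tendsto_intros vec_expansion_nsq f)
    thus "(\<lambda>N. \<xi> \<alpha> * sqrt (nsq (?d N))) \<longlonglongrightarrow> 0" by simp
  qed
  hence "(\<lambda>N. coord \<alpha> (L f) - coord \<alpha> (?d N)) \<longlonglongrightarrow> coord \<alpha> (L f) - 0" by (intro tendsto_intros)
  thus ?thesis unfolding e sums_def by simp
qed

lemma transfer_power_H: "f \<in> H \<Longrightarrow> (L ^^ n) f \<in> H"
  by (induction n) (simp_all add: transfer_component[OF a_idem])

text \<open>The power of the matrix is n+1 but that of the operator is n: one application of L is
  already used up in the vectors \<open>vec\<close>, which come from its expansion.\<close>

lemma kernel_pow_coord: "kernel_pow kernel n \<alpha> \<beta> = coord \<alpha> ((L ^^ n) (vec \<beta>))"
proof (induction n arbitrary: \<alpha>)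
  case (Suc n)
  have "(\<lambda>c. kernel \<alpha> c * kernel_pow kernel n c \<beta>) sums coord \<alpha> (L ((L ^^ n) (vec \<beta>)))"
    unfolding Suc.IH kernel_def[of \<alpha>] by (rule coord_transfer[OF transfer_power_H[OF vec_H]])
  thus ?case by (simp add: sums_iff)
qed (simp add: kernel_def)

end

context ifs_symmetry begin

text \<open>The trace of \<open>pull g\<close> composed with the power L^(n+1), one factor L being
  contained in the monomials.\<close>

definition twisted_trace :: "nat \<Rightarrow> 'g \<Rightarrow> complex" where
  "twisted_trace n g = (\<Sum>i\<in>UNIV. \<Sum>j\<in>UNIV. \<Sum>m. coeff j m (pull g ((L ^^ n) (monomial i j m))))"

lemma transfer_power_holo: "f holomorphic_on D \<Longrightarrow> (L ^^ n) f holomorphic_on D"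
  by (induction n) (simp_all add: transfer_holo)

lemma transfer_power_sup:
  assumes "\<And>u. u \<in> D \<Longrightarrow> norm (f u) \<le> b" "0 \<le> b" "u \<in> D"
  shows "norm ((L ^^ n) f u) \<le> L_sup ^ n * b"
  using assms(3)
proof (induction n arbitrary: u)
  case (Suc n)
  have "norm (L ((L ^^ n) f) u) \<le> L_sup * (L_sup ^ n * b)"
    by (rule transfer_sup) (use Suc.IH disk_mem[OF branch_mem] L_sup_pos assms(2) in auto)
  thus ?case by (simp add: mult.assoc)
qed (use assms in simp)

text \<open>Suprema are used instead of Bergman norms because \<open>pull g\<close> does not
  increase them and L multiplies them by at most \<open>L_sup\<close>; the decay of the monomials is
  thus preserved.\<close>

lemma coeff_pull_bound:
  assumes g: "g \<in> carrier G"
  shows "norm (coeff j m (pull g ((L ^^ n) (monomial i j m)))) \<le> L_sup ^ n * V_sup * \<tau> ^ m"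
proof -
  have V0: "0 \<le> V_sup * (ratio * r j) ^ m" using V_sup(1) ratio(1) radius_pos[of j] by simp
  have "norm (coeff j m (pull g ((L ^^ n) (monomial i j m)))) \<le> (L_sup ^ n * (V_sup * (ratio * r j) ^ m)) / (\<tau> * r j) ^ m"
  proof (rule coeff_sup[OF pull_holo[OF g transfer_power_holo[OF monomial_holo]]])
    fix u assume u: "u \<in> D"
    show "norm (pull g ((L ^^ n) (monomial i j m)) u) \<le> L_sup ^ n * (V_sup * (ratio * r j) ^ m)"
      unfolding pull_region[OF u] by (rule transfer_power_sup[OF monomial_sup V0 act_mem[OF inv_closed[OF g] u]])
  qed
  also have "\<dots> = L_sup ^ n * V_sup * ((ratio * r j) ^ m / (\<tau> * r j) ^ m)" by simp
  finally show ?thesis unfolding ratio_power .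
qed

end

context ifs_average begin

text \<open>Averaging commutes with the powers of L and can therefore be carried out last, which
  makes every diagonal entry linear in the weights \<open>a\<close>.\<close>

lemma kernel_trace_twisted: "kernel_trace kernel n = (\<Sum>g\<in>carrier G. a g * twisted_trace n g)"
proof -
  let ?F = "\<lambda>i j m. \<Sum>g\<in>carrier G. a g * coeff j m (pull g ((L ^^ n) (monomial i j m)))"
  have d: "kernel_pow kernel n k k = (case code k of (i, j, m) \<Rightarrow> ?F i j m)" for k
  proof -
    obtain i j m where c: "code k = (i, j, m)" by (rule prod_cases3)
    have "kernel_pow kernel n k k = coeff j m (average a ((L ^^ n) (monomial i j m)))"
      by (simp add: kernel_pow_coord vec_def transfer_power_average coord_def mono_at_def c)
    also have "\<dots> = ?F i j m"
      unfolding average_def[abs_def]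
      by (rule coeff_linear[OF G_finite pull_holo[OF _ transfer_power_holo[OF monomial_holo]]])
    finally show ?thesis by (simp add: c)
  qed
  have b: "norm (?F i j m) \<le> (a_norm * (L_sup ^ n * V_sup)) * \<tau> ^ m" for i j m
  proof -
    have "norm (?F i j m) \<le> (\<Sum>g\<in>carrier G. norm (a g) * (L_sup ^ n * V_sup * \<tau> ^ m))"
      by (rule sum_norm_le) (auto simp: norm_mult intro!: mult_left_mono coeff_pull_bound)
    thus ?thesis by (simp add: a_norm_def sum_distrib_right mult.assoc)
  qed
  have "(\<lambda>k. case code k of (i, j, m) \<Rightarrow> ?F i j m) sums (\<Sum>i\<in>UNIV. \<Sum>j\<in>UNIV. \<Sum>m. ?F i j m)"
    by (rule enumerated_sum(1)[OF b less_imp_le[OF \<tau>(1)] \<tau>(2) code_bij])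
  hence "kernel_trace kernel n = (\<Sum>i\<in>UNIV. \<Sum>j\<in>UNIV. \<Sum>m. ?F i j m)"
    unfolding kernel_trace_def d by (rule sums_unique[symmetric])
  also have "\<dots> = (\<Sum>i\<in>UNIV. \<Sum>j\<in>UNIV. \<Sum>g\<in>carrier G. a g * (\<Sum>m. coeff j m (pull g ((L ^^ n) (monomial i j m)))))"
  proof (intro sum.cong refl)
    fix i j
    have sm: "summable (\<lambda>m. coeff j m (pull g ((L ^^ n) (monomial i j m))))" if "g \<in> carrier G" for g
      by (rule summable_comparison_test'[where N = 0 and g = "\<lambda>m. L_sup ^ n * V_sup * \<tau> ^ m"])
        (use coeff_pull_bound[OF that] \<tau> in \<open>auto intro!: summable_mult summable_geometric\<close>)
    have "(\<Sum>m. ?F i j m) = (\<Sum>g\<in>carrier G. \<Sum>m. a g * coeff j m (pull g ((L ^^ n) (monomial i j m))))"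
      by (rule suminf_sum) (intro summable_mult sm)
    also have "\<dots> = (\<Sum>g\<in>carrier G. a g * (\<Sum>m. coeff j m (pull g ((L ^^ n) (monomial i j m)))))"
      by (intro sum.cong refl suminf_mult sm)
    finally show "(\<Sum>m. ?F i j m) = (\<Sum>g\<in>carrier G. a g * (\<Sum>m. coeff j m (pull g ((L ^^ n) (monomial i j m)))))" .
  qed
  also have "\<dots> = (\<Sum>i\<in>UNIV. \<Sum>g\<in>carrier G. \<Sum>j\<in>UNIV. a g * (\<Sum>m. coeff j m (pull g ((L ^^ n) (monomial i j m)))))"
    by (intro sum.cong refl sum.swap)
  also have "\<dots> = (\<Sum>g\<in>carrier G. a g * twisted_trace n g)"
    unfolding twisted_trace_def sum_distrib_left by (rule sum.swap)
  finally show ?thesis .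
qed

end

section \<open>Traces as sums over twisted words\<close>

lemma words_0: "words S 0 = range (\<lambda>i. [i])"
  by (auto simp: words_def length_Suc_conv)

lemma words_length: "w \<in> words S n \<Longrightarrow> length w = Suc n"
  by (simp add: words_def)

lemma words_not_Nil: "w \<in> words S n \<Longrightarrow> w \<noteq> []"
  by (auto simp: words_def)

lemma words_last: "w \<in> words S n \<Longrightarrow> last w = w ! n"
  using words_not_Nil[of w S n] words_length[of w S n] by (simp add: last_conv_nth)

lemma words_finite: "finite (words (S :: ('i :: finite, 'b) ifs_scheme) n)"
  by (rule finite_subset[OF _ finite_lists_length_eq[of UNIV "Suc n"]]) (auto simp: words_def)

lemma words_snoc: "w @ [j] \<in> words S (Suc n) \<longleftrightarrow> w \<in> words S n \<and> adj S (last w) j"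
proof
  assume w: "w @ [j] \<in> words S (Suc n)"
  hence l: "length w = Suc n" by (simp add: words_def)
  have a: "adj S ((w @ [j]) ! k) ((w @ [j]) ! Suc k)" if "k < Suc n" for k using w that by (simp add: words_def)
  have "adj S (w ! k) (w ! Suc k)" if "k < n" for k using a[of k] that l by (simp add: nth_append)
  hence m: "w \<in> words S n" using l by (simp add: words_def)
  have "adj S (w ! n) j" using a[of n] l by (simp add: nth_append)
  thus "w \<in> words S n \<and> adj S (last w) j" using m words_last[OF m] by simp
next
  assume w: "w \<in> words S n \<and> adj S (last w) j"
  hence l: "length w = Suc n" and a: "\<And>k. k < n \<Longrightarrow> adj S (w ! k) (w ! Suc k)" by (simp_all add: words_def)
  have "adj S ((w @ [j]) ! k) ((w @ [j]) ! Suc k)" if "k < Suc n" for k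
  proof (cases "k = n")
    case True
    thus ?thesis using w words_last[of w S n] l by (simp add: nth_append)
  next
    case False
    thus ?thesis using a[of k] that l by (simp add: nth_append)
  qed
  thus "w @ [j] \<in> words S (Suc n)" using l by (simp add: words_def)
qed

lemma words_SucE:
  assumes "w \<in> words S (Suc n)"
  obtains w' j where "w = w' @ [j]" "w' \<in> words S n" "adj S (last w') j"
proof (cases w rule: rev_cases)
  case Nil
  thus ?thesis using words_not_Nil[OF assms] by simp
next
  case (snoc w' j)
  hence "w' \<in> words S n \<and> adj S (last w') j" using assms by (simp only: words_snoc)
  thus ?thesis using snoc by (intro that[of w' j]) simp_all
qed

text \<open>The recursion for \<open>word_map\<close> runs from the front, but iterating the
  transfer operator appends new symbols at the end of a word.\<close>

lemma word_map_snoc: "w \<noteq> [] \<Longrightarrow> word_map S (w @ [j]) = branch S (last w) j \<circ> word_map S w"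
proof (induction w)
  case (Cons i w)
  show ?case
  proof (cases w)
    case (Cons k v)
    have "word_map S ((i # w) @ [j]) = word_map S (w @ [j]) \<circ> branch S i k" by (simp add: Cons)
    also have "word_map S (w @ [j]) = branch S (last w) j \<circ> word_map S w"
      by (rule Cons.IH) (simp add: Cons)
    also have "\<dots> \<circ> branch S i k = branch S (last (i # w)) j \<circ> word_map S (i # w)"
      by (simp add: Cons comp_assoc)
    finally show ?thesis .
  qed simp
qed simp

lemma word_weight_snoc:
  assumes "w \<noteq> []"
  shows "word_weight S V (w @ [j]) u = word_weight S V w u * V (word_map S (w @ [j]) u)"
proof -
  obtain m where m: "length w = Suc m" using assms by (cases w) auto
  have "word_weight S V (w @ [j]) u = (\<Prod>k = 1..Suc m. V (word_map S (take (Suc k) (w @ [j])) u))"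
    by (simp only: word_weight_def length_append m list.size add_0_right add_Suc_right diff_Suc_1)
  also have "\<dots> = (\<Prod>k = 1..m. V (word_map S (take (Suc k) (w @ [j])) u)) * V (word_map S (take (Suc (Suc m)) (w @ [j])) u)"
    by (simp add: mult.commute)
  also have "(\<Prod>k = 1..m. V (word_map S (take (Suc k) (w @ [j])) u)) = word_weight S V w u"
    unfolding word_weight_def m by (rule prod.cong) (auto simp: m)
  finally show ?thesis by (simp add: m)
qed

context ifs_symmetry begin

lemma word_map_holo_mem:
  assumes "w \<in> words S n"
  shows "word_map S w holomorphic_on B (w ! 0) \<and> (\<forall>u\<in>B (w ! 0). word_map S w u \<in> B (last w))"
  using assms
proof (induction n arbitrary: w)
  case 0
  then obtain i where "w = [i]" by (auto simp: words_0)
  thus ?case by (simp add: id_def)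
next
  case (Suc n)
  obtain w' j where w: "w = w' @ [j]" "w' \<in> words S n" "adj S (last w') j" by (rule words_SucE[OF Suc.prems])
  have ne: "w' \<noteq> []" by (rule words_not_Nil[OF w(2)])
  have e: "w ! 0 = w' ! 0" using ne by (simp add: w(1) nth_append)
  note IH = Suc.IH[OF w(2)]
  have m: "word_map S w = branch S (last w') j \<circ> word_map S w'" unfolding w(1) by (rule word_map_snoc[OF ne])
  show ?case unfolding e m
  proof
    show "branch S (last w') j \<circ> word_map S w' holomorphic_on B (w' ! 0)"
      by (rule holomorphic_on_compose_gen[OF _ adj_branch(1)[OF w(3)]]) (use IH in auto)
    show "\<forall>u\<in>B (w' ! 0). (branch S (last w') j \<circ> word_map S w') u \<in> B (last w)"
      using IH branch_mem[OF w(3)] by (simp add: w(1))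
  qed
qed

lemma word_map_holo: "w \<in> words S n \<Longrightarrow> word_map S w holomorphic_on B (w ! 0)"
  and word_map_mem: "w \<in> words S n \<Longrightarrow> u \<in> B (w ! 0) \<Longrightarrow> word_map S w u \<in> B (last w)"
  using word_map_holo_mem by blast+

lemma word_weight_holo: "w \<in> words S n \<Longrightarrow> word_weight S V w holomorphic_on B (w ! 0)"
proof (induction n arbitrary: w)
  case 0
  then obtain i where "w = [i]" by (auto simp: words_0)
  thus ?case by (simp add: word_weight_def[abs_def])
next
  case (Suc n)
  obtain w' j where w: "w = w' @ [j]" "w' \<in> words S n" "adj S (last w') j" by (rule words_SucE[OF Suc.prems])
  have ne: "w' \<noteq> []" by (rule words_not_Nil[OF w(2)])
  have e: "w ! 0 = w' ! 0" using ne by (simp add: w(1) nth_append)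
  have "V \<circ> word_map S w holomorphic_on B (w ! 0)"
  proof (rule holomorphic_on_compose_gen[OF word_map_holo[OF Suc.prems] V_holo])
    show "word_map S w ` B (w ! 0) \<subseteq> branch_image S"
      unfolding e unfolding w(1) word_map_snoc[OF ne]
      using branch_image_mem[OF w(3) word_map_mem[OF w(2)]] by auto
  qed
  hence V: "(\<lambda>u. V (word_map S w u)) holomorphic_on B (w' ! 0)" by (simp add: o_def e)
  have "(\<lambda>u. word_weight S V w' u * V (word_map S w u)) holomorphic_on B (w' ! 0)"
    by (rule holomorphic_on_mult[OF Suc.IH[OF w(2)] V])
  moreover have "word_weight S V w = (\<lambda>u. word_weight S V w' u * V (word_map S w u))"
    unfolding w(1) by (rule ext) (rule word_weight_snoc[OF ne])
  ultimately show ?case unfolding e by simp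
qed

lemma words_from_Suc:
  "{w \<in> words S (Suc n). w ! 0 = i} = (\<lambda>(w, j). w @ [j]) ` (SIGMA w:{w \<in> words S n. w ! 0 = i}. {j. adj S (last w) j})"
proof (intro subset_antisym subsetI)
  fix w assume "w \<in> {w \<in> words S (Suc n). w ! 0 = i}"
  hence w: "w \<in> words S (Suc n)" "w ! 0 = i" by simp_all
  obtain w' j where w': "w = w' @ [j]" "w' \<in> words S n" "adj S (last w') j" by (rule words_SucE[OF w(1)])
  have "w' ! 0 = i" using w(2) words_not_Nil[OF w'(2)] by (simp add: w'(1) nth_append)
  hence "(w', j) \<in> (SIGMA w:{w \<in> words S n. w ! 0 = i}. {j. adj S (last w) j})" using w' by simp
  thus "w \<in> (\<lambda>(w, j). w @ [j]) ` (SIGMA w:{w \<in> words S n. w ! 0 = i}. {j. adj S (last w) j})"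
    by (rule rev_image_eqI) (simp add: w'(1))
next
  fix w assume "w \<in> (\<lambda>(w, j). w @ [j]) ` (SIGMA w:{w \<in> words S n. w ! 0 = i}. {j. adj S (last w) j})"
  then obtain w' j where w': "w = w' @ [j]" "w' \<in> words S n" "w' ! 0 = i" "adj S (last w') j" by auto
  show "w \<in> {w \<in> words S (Suc n). w ! 0 = i}"
    using w' words_snoc[of w' j S n] words_not_Nil[OF w'(2)] by (simp add: nth_append)
qed

lemma transfer_power_words:
  assumes "v \<in> B i"
  shows "(L ^^ n) f v = (\<Sum>w | w \<in> words S n \<and> w ! 0 = i. word_weight S V w v * f (word_map S w v))"
proof (induction n arbitrary: f)
  case 0
  have "{w. w \<in> words S 0 \<and> w ! 0 = i} = {[i]}" by (auto simp: words_0)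
  thus ?case by (simp add: word_weight_def)
next
  case (Suc n)
  let ?W = "{w. w \<in> words S n \<and> w ! 0 = i}"
  have fin: "finite ?W" by (rule finite_subset[OF _ words_finite]) auto
  \<comment> \<open>The innermost application is split off, so that the induction hypothesis for the
    function L f leaves one further branch at the end of each word.\<close>
  have "(L ^^ Suc n) f v = (L ^^ n) (L f) v" by (simp only: funpow_Suc_right o_def)
  also have "\<dots> = (\<Sum>w\<in>?W. word_weight S V w v * L f (word_map S w v))" by (rule Suc.IH)
  also have "\<dots> = (\<Sum>w\<in>?W. \<Sum>j | adj S (last w) j. word_weight S V (w @ [j]) v * f (word_map S (w @ [j]) v))"
  proof (rule sum.cong[OF refl])
    fix w assume "w \<in> ?W"
    hence w: "w \<in> words S n" "w ! 0 = i" by simp_all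
    have ne: "w \<noteq> []" by (rule words_not_Nil[OF w(1)])
    have "word_map S w v \<in> B (last w)" by (rule word_map_mem[OF w(1)]) (simp add: w(2) assms)
    from transfer_disk[OF this, of f]
    show "word_weight S V w v * L f (word_map S w v) =
        (\<Sum>j | adj S (last w) j. word_weight S V (w @ [j]) v * f (word_map S (w @ [j]) v))"
      by (simp add: word_weight_snoc[OF ne] word_map_snoc[OF ne] sum_distrib_left mult.assoc)
  qed
  also have "\<dots> = (\<Sum>(w, j)\<in>(SIGMA w:?W. {j. adj S (last w) j}). word_weight S V (w @ [j]) v * f (word_map S (w @ [j]) v))"
    by (rule sum.Sigma[OF fin]) simp
  also have "\<dots> = (\<Sum>w | w \<in> words S (Suc n) \<and> w ! 0 = i. word_weight S V w v * f (word_map S w v))"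
    unfolding words_from_Suc by (subst sum.reindex) (auto simp: inj_on_def case_prod_unfold)
  finally show ?case .
qed

definition loop_map :: "'i list \<Rightarrow> 'g \<Rightarrow> complex \<Rightarrow> complex" where
  "loop_map w h = word_map S w \<circ> act h"

lemma twisted_wordsD:
  assumes "w \<in> twisted_words S act n h"
  shows "w \<in> words S n" "sa h (last w) = w ! 0"
  using assms words_last[of w S n] by (simp_all add: twisted_words_def)

text \<open>The last branch of the word lands in the concentric disk shrunk by \<open>ratio\<close>.
  This needs at least one branch, hence words of length \<open>Suc n\<close>.\<close>

lemma loop_map_contracting:
  assumes h: "h \<in> carrier G" and w: "w \<in> twisted_words S act (Suc n) h"
  shows "loop_map w h holomorphic_on B (last w)"
    and "\<And>u. u \<in> B (last w) \<Longrightarrow> loop_map w h u \<in> cball (centre S (last w)) (ratio * r (last w))"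
    and "(\<lambda>u. word_weight S V w (act h u)) holomorphic_on B (last w)"
proof -
  note W = twisted_wordsD[OF w]
  have hu: "act h u \<in> B (w ! 0)" if "u \<in> B (last w)" for u
    using act_disk_mem[OF h that] W(2) by simp
  have hh: "act h holomorphic_on B (last w)" by (rule holomorphic_on_subset[OF act_holo[OF h] disk_subset])
  show "loop_map w h holomorphic_on B (last w)"
    unfolding loop_map_def by (rule holomorphic_on_compose_gen[OF hh word_map_holo[OF W(1)]]) (use hu in auto)
  have "word_weight S V w \<circ> act h holomorphic_on B (last w)"
    by (rule holomorphic_on_compose_gen[OF hh word_weight_holo[OF W(1)]]) (use hu in auto)
  thus "(\<lambda>u. word_weight S V w (act h u)) holomorphic_on B (last w)" by (simp add: o_def)
  obtain w' j where w': "w = w' @ [j]" "w' \<in> words S n" "adj S (last w') j" by (rule words_SucE[OF W(1)])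
  have ne: "w' \<noteq> []" by (rule words_not_Nil[OF w'(2)])
  show "loop_map w h u \<in> cball (centre S (last w)) (ratio * r (last w))" if u: "u \<in> B (last w)" for u
  proof -
    have "act h u \<in> B (w' ! 0)" using hu[OF u] ne by (simp add: w'(1) nth_append)
    from ratio(3)[OF w'(3) word_map_mem[OF w'(2) this]] show ?thesis
      by (simp add: loop_map_def w'(1) word_map_snoc[OF ne])
  qed
qed

lemma ratio_radius: "ratio * r j < r j" using ratio(2) radius_pos[of j] by simp

lemma fixed_point:
  assumes h: "h \<in> carrier G" and w: "w \<in> twisted_words S act (Suc n) h"
  defines "u \<equiv> fixed_point S act w h"
  shows "u \<in> B (last w)" "loop_map w h u = u" "norm (deriv (loop_map w h) u) < 1"
proof -
  note c = loop_map_contracting[OF h w]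
  obtain x where x: "x \<in> B (last w)" "loop_map w h x = x" "norm (deriv (loop_map w h) x) < 1"
    "\<And>v. v \<in> B (last w) \<Longrightarrow> loop_map w h v = v \<Longrightarrow> v = x"
    by (rule disk_self_map[OF c(1)[unfolded disk_def] radius_pos ratio_radius c(2)[unfolded disk_def], folded disk_def],
      assumption, rule that; assumption)
  have "u = x"
    unfolding u_def fixed_point_def
  proof (rule the_equality)
    show "x \<in> B (last w) \<and> x = word_map S w (act h x)" using x(1,2) by (simp add: loop_map_def)
    show "v = x" if "v \<in> B (last w) \<and> v = word_map S w (act h v)" for v
      by (rule x(4)) (use that in \<open>simp_all add: loop_map_def\<close>)
  qed
  thus "u \<in> B (last w)" "loop_map w h u = u" "norm (deriv (loop_map w h) u) < 1" using x(1-3) by simp_all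
qed

definition orbit_term :: "'g \<Rightarrow> 'i list \<Rightarrow> complex" where
  "orbit_term h w = word_weight S V w (act h (fixed_point S act w h)) *
     (\<Sum>k. deriv (word_map S w \<circ> act h) (fixed_point S act w h) ^ k)"

lemma orbit_term_sums:
  assumes h: "h \<in> carrier G" and w: "w \<in> twisted_words S act (Suc n) h"
  shows "(\<lambda>m. coeff (last w) m (\<lambda>z. word_weight S V w (act h z) * (loop_map w h z - centre S (last w)) ^ m))
    sums orbit_term h w"
proof -
  note c = loop_map_contracting[OF h w, unfolded disk_def] and u = fixed_point[OF h w]
  have "orbit_term h w = word_weight S V w (act h (fixed_point S act w h)) / (1 - deriv (loop_map w h) (fixed_point S act w h))"
    using suminf_geometric[OF u(3)] by (simp add: orbit_term_def loop_map_def)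
  thus ?thesis
    using weighted_composition_trace[OF c(1) radius_pos ratio_radius c(2,3) u(1)[unfolded disk_def] u(2)] by simp
qed

text \<open>The degree-m coefficient at the centre of disk j meets the power
  \<open>(loop_map - c) ^ m\<close>, so the sum over m is the trace of a weighted composition
  operator on that disk. The action of g^-1 first moves disk j to the disk of the first symbol,
  which is why words twisted by \<open>inv g\<close> appear.\<close>

lemma twisted_trace_words:
  assumes g: "g \<in> carrier G"
  shows "twisted_trace n g = (\<Sum>w\<in>twisted_words S act (Suc n) (inv g). orbit_term (inv g) w)"
proof -
  let ?h = "inv g"
  have h: "?h \<in> carrier G" by (rule inv_closed[OF g])
  define A where "A i j = {w \<in> words S n. w ! 0 = sa ?h j \<and> last w = i \<and> adj S i j}" for i j
  have Afin: "finite (A i j)" for i j unfolding A_def by (rule finite_subset[OF _ words_finite]) auto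
  have tw: "w @ [j] \<in> twisted_words S act (Suc n) ?h" if w: "w \<in> A i j" for w i j
  proof -
    have w': "w \<in> words S n" "w ! 0 = sa ?h j" "adj S (last w) j" using w by (auto simp: A_def)
    show ?thesis using w' words_snoc[of w j S n] words_not_Nil[OF w'(1)] words_length[OF w'(1)]
      by (simp add: twisted_words_def nth_append)
  qed
  have inner: "(\<Sum>m. coeff j m (pull g ((L ^^ n) (monomial i j m)))) = (\<Sum>w\<in>A i j. orbit_term ?h (w @ [j]))" for i j
  proof -
    let ?f = "\<lambda>m w z. word_weight S V (w @ [j]) (act ?h z) * (loop_map (w @ [j]) ?h z - centre S j) ^ m"
    have fh: "?f m w holomorphic_on B j" if "w \<in> A i j" for m w
      using loop_map_contracting(1,3)[OF h tw[OF that]] by (auto intro!: holomorphic_intros)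
    have eq: "pull g ((L ^^ n) (monomial i j m)) z = (\<Sum>w\<in>A i j. ?f m w z)" if z: "z \<in> B j" for m z
    proof -
      have hz: "act ?h z \<in> B (sa ?h j)" by (rule act_disk_mem[OF h z])
      let ?W = "{w. w \<in> words S n \<and> w ! 0 = sa ?h j}"
      have fin: "finite ?W" by (rule finite_subset[OF _ words_finite]) auto
      have "pull g ((L ^^ n) (monomial i j m)) z = (L ^^ n) (monomial i j m) (act ?h z)"
        by (rule pull_region[OF disk_mem[OF z]])
      also have "\<dots> = (\<Sum>w\<in>?W. word_weight S V w (act ?h z) * monomial i j m (word_map S w (act ?h z)))"
        by (rule transfer_power_words[OF hz])
      also have "\<dots> = (\<Sum>w\<in>A i j. word_weight S V w (act ?h z) * monomial i j m (word_map S w (act ?h z)))"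
      proof (rule sum.mono_neutral_right[OF fin])
        show "A i j \<subseteq> ?W" by (auto simp: A_def)
        show "\<forall>w\<in>?W - A i j. word_weight S V w (act ?h z) * monomial i j m (word_map S w (act ?h z)) = 0"
        proof
          fix w assume w: "w \<in> ?W - A i j"
          hence W: "w \<in> words S n" "w ! 0 = sa ?h j" by simp_all
          have n: "\<not> (last w = i \<and> adj S i j)" using w by (auto simp: A_def)
          have "word_map S w (act ?h z) \<in> B (last w)" by (rule word_map_mem[OF W(1)]) (simp add: W(2) hz)
          hence "\<not> (adj S i j \<and> word_map S w (act ?h z) \<in> B i)" using n disk_unique by blast
          thus "word_weight S V w (act ?h z) * monomial i j m (word_map S w (act ?h z)) = 0"
            unfolding monomial_def by (simp only: if_False mult_zero_right)
        qed
      qed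
      also have "\<dots> = (\<Sum>w\<in>A i j. ?f m w z)"
      proof (rule sum.cong[OF refl])
        fix w assume "w \<in> A i j"
        hence w: "w \<in> words S n" "w ! 0 = sa ?h j" "last w = i" "adj S i j" by (auto simp: A_def)
        have ne: "w \<noteq> []" by (rule words_not_Nil[OF w(1)])
        have "word_map S w (act ?h z) \<in> B i" using word_map_mem[OF w(1), of "act ?h z"] hz w(2,3) by simp
        thus "word_weight S V w (act ?h z) * monomial i j m (word_map S w (act ?h z)) = ?f m w z"
          by (simp add: monomial_def w(3,4) word_weight_snoc[OF ne] word_map_snoc[OF ne] loop_map_def mult.assoc)
      qed
      finally show ?thesis .
    qed
    have ph: "pull g ((L ^^ n) (monomial i j m)) holomorphic_on B j" for m
      by (rule holomorphic_on_subset[OF pull_holo[OF g transfer_power_holo[OF monomial_holo]] disk_subset])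
    have "coeff j m (pull g ((L ^^ n) (monomial i j m))) = (\<Sum>w\<in>A i j. coeff j m (?f m w))" for m
    proof -
      have "coeff j m (pull g ((L ^^ n) (monomial i j m))) = coeff j m (\<lambda>z. \<Sum>w\<in>A i j. ?f m w z)"
        by (rule taylor_coeff_cong[OF ph _ disk_open centre_mem eq]) (intro holomorphic_on_sum fh)
      also have "\<dots> = (\<Sum>w\<in>A i j. coeff j m (?f m w))"
        by (rule taylor_coeff_sum[OF Afin fh disk_open centre_mem])
      finally show ?thesis .
    qed
    moreover have "(\<lambda>m. \<Sum>w\<in>A i j. coeff j m (?f m w)) sums (\<Sum>w\<in>A i j. orbit_term ?h (w @ [j]))"
      by (rule sums_sum) (use orbit_term_sums[OF h tw] in simp)
    ultimately show ?thesis by (simp add: sums_iff)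
  qed
  have "twisted_trace n g = (\<Sum>i\<in>UNIV. \<Sum>j\<in>UNIV. \<Sum>w\<in>A i j. orbit_term ?h (w @ [j]))"
    unfolding twisted_trace_def inner ..
  also have "\<dots> = (\<Sum>p\<in>UNIV. \<Sum>w\<in>A (fst p) (snd p). orbit_term ?h (w @ [snd p]))"
    unfolding sum.cartesian_product by (simp add: case_prod_unfold)
  also have "\<dots> = (\<Sum>(p, w)\<in>(SIGMA p:UNIV. A (fst p) (snd p)). orbit_term ?h (w @ [snd p]))"
    by (rule sum.Sigma) (use Afin in auto)
  also have "\<dots> = (\<Sum>q\<in>(SIGMA p:UNIV. A (fst p) (snd p)). orbit_term ?h (snd q @ [snd (fst q)]))"
    by (simp add: case_prod_unfold)
  also have "\<dots> = (\<Sum>w\<in>twisted_words S act (Suc n) ?h. orbit_term ?h w)"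
  proof (rule sum.reindex_bij_betw)
    show "bij_betw (\<lambda>q. snd q @ [snd (fst q)]) (SIGMA p:UNIV. A (fst p) (snd p)) (twisted_words S act (Suc n) ?h)"
      unfolding bij_betw_def
    proof
      show "inj_on (\<lambda>q. snd q @ [snd (fst q)]) (SIGMA p:UNIV. A (fst p) (snd p))"
        by (rule inj_onI) (auto simp: A_def)
      show "(\<lambda>q. snd q @ [snd (fst q)]) ` (SIGMA p:UNIV. A (fst p) (snd p)) = twisted_words S act (Suc n) ?h"
      proof
        show "(\<lambda>q. snd q @ [snd (fst q)]) ` (SIGMA p:UNIV. A (fst p) (snd p)) \<subseteq> twisted_words S act (Suc n) ?h"
          using tw by auto
        show "twisted_words S act (Suc n) ?h \<subseteq> (\<lambda>q. snd q @ [snd (fst q)]) ` (SIGMA p:UNIV. A (fst p) (snd p))"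
        proof
          fix w assume w: "w \<in> twisted_words S act (Suc n) ?h"
          note W = twisted_wordsD[OF w]
          obtain w' j where w': "w = w' @ [j]" "w' \<in> words S n" "adj S (last w') j" by (rule words_SucE[OF W(1)])
          have "w' \<in> A (last w') j" using w' W(2) words_not_Nil[OF w'(2)] by (simp add: A_def nth_append)
          hence "((last w', j), w') \<in> (SIGMA p:UNIV. A (fst p) (snd p))" by simp
          thus "w \<in> (\<lambda>q. snd q @ [snd (fst q)]) ` (SIGMA p:UNIV. A (fst p) (snd p))"
            by (rule rev_image_eqI) (simp add: w'(1))
        qed
      qed
    qed
  qed
  finally show ?thesis .
qed

section \<open>Factorization of the zeta function\<close>

text \<open>\<open>pull g\<close> composes with the action of the inverse of g. The sum is indexed
  by the element that actually moves the points, so the weight is taken at its inverse. The index n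
  belongs to words of length n+1.\<close>

definition weighted_trace :: "('g \<Rightarrow> complex) \<Rightarrow> nat \<Rightarrow> complex" where
  "weighted_trace a n =
     (\<Sum>g\<in>carrier G. a (inv g) * (\<Sum>w\<in>twisted_words S act (Suc n) g. orbit_term g w))"

end

context ifs_average begin

lemma kernel_trace_weighted: "kernel_trace kernel n = weighted_trace a n"
proof -
  have inv_bij: "bij_betw (\<lambda>g. inv g) (carrier G) (carrier G)"
    by (rule bij_betw_byWitness[where f' = "\<lambda>g. inv g"]) auto
  let ?t = "\<lambda>g. a (inv g) * (\<Sum>w\<in>twisted_words S act (Suc n) g. orbit_term g w)"
  have "kernel_trace kernel n = (\<Sum>g\<in>carrier G. ?t (inv g))"
    unfolding kernel_trace_twisted by (intro sum.cong refl) (simp add: twisted_trace_words)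
  also have "\<dots> = (\<Sum>g\<in>carrier G. ?t g)" by (rule sum.reindex_bij_betw[OF inv_bij])
  finally show ?thesis by (simp only: weighted_trace_def)
qed

lemma component_det_entire: "fredholm_det (bergman_inner D) H L holomorphic_on UNIV"
proof -
  have "fredholm_det (bergman_inner D) H L = kernel_det kernel" by (rule ext) (rule fredholm_det_component)
  thus ?thesis using kernel_det_entire[OF kernel_bounded] by simp
qed

lemma component_det_exp:
  "\<forall>\<^sub>F z in nhds 0. \<exists>s. (\<lambda>n. z ^ Suc n / of_nat (Suc n) * weighted_trace a n) sums s \<and>
     fredholm_det (bergman_inner D) H L z = exp (- s)"
proof -
  have "((\<lambda>z :: complex. norm z * diag_sum) \<longlongrightarrow> norm (0::complex) * diag_sum) (nhds 0)"
    by (rule tendsto_mult_right[OF tendsto_norm[OF filterlim_ident]])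
  hence "\<forall>\<^sub>F z :: complex in nhds 0. norm z * diag_sum < 1" by (rule order_tendstoD) simp
  thus ?thesis
  proof (rule eventually_mono)
    fix z :: complex assume "norm z * diag_sum < 1"
    from kernel_det_exp_trace[OF kernel_bounded this]
    show "\<exists>s. (\<lambda>n. z ^ Suc n / of_nat (Suc n) * weighted_trace a n) sums s \<and>
        fredholm_det (bergman_inner D) H L z = exp (- s)"
      unfolding kernel_trace_weighted fredholm_det_component .
  qed
qed

end

context ifs_symmetry begin

section \<open>Weights of the whole space and of the isotypic components\<close>

definition unit_weight :: "'g \<Rightarrow> complex" where "unit_weight g = (if g = \<one> then 1 else 0)"

definition character_weight :: "('g \<Rightarrow> complex) \<Rightarrow> 'g \<Rightarrow> complex" where
  "character_weight \<chi> g = of_nat (character_dim G \<chi>) / of_nat (card (carrier G)) * cnj (\<chi> g)"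

lemma card_G: "(of_nat (card (carrier G)) :: complex) \<noteq> 0"
  using G_finite one_closed by auto

lemma average_intro: "conv_idempotent a \<Longrightarrow> ifs_average S G act V a"
  by (simp add: ifs_average_def ifs_average_axioms_def ifs_symmetry_axioms)

lemma unit_weight_idem: "conv_idempotent unit_weight"
  unfolding conv_idempotent_def
proof
  fix g assume g: "g \<in> carrier G"
  have "(\<Sum>h\<in>carrier G. unit_weight h * unit_weight (inv h \<otimes> g)) = (\<Sum>h\<in>carrier G. if h = \<one> then unit_weight g else 0)"
    by (intro sum.cong refl) (use g in \<open>simp add: unit_weight_def\<close>)
  also have "\<dots> = unit_weight g" using G_finite by simp
  finally show "(\<Sum>h\<in>carrier G. unit_weight h * unit_weight (inv h \<otimes> g)) = unit_weight g" .
qed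

lemma component_unit: "component unit_weight = bergman"
proof -
  have "average unit_weight f = f" if f: "f \<in> bergman" for f
  proof
    fix u
    have "average unit_weight f u = (\<Sum>g\<in>carrier G. if g = \<one> then pull g f u else 0)"
      unfolding average_def by (intro sum.cong refl) (simp add: unit_weight_def)
    also have "\<dots> = pull \<one> f u" using G_finite by simp
    also have "\<dots> = f u"
      using bergman_spaceD(3)[OF f, of u] by (cases "u \<in> D") (simp_all add: pull_region pull_outside act_one)
    finally show "average unit_weight f u = f u" .
  qed
  thus ?thesis by (simp add: component_def)
qed

lemma character_weight_idem:
  assumes \<chi>: "\<chi> \<in> irr_characters G"
  shows "conv_idempotent (character_weight \<chi>)"
  unfolding conv_idempotent_def
proof
  fix g assume g: "g \<in> carrier G"
  let ?d = "of_nat (character_dim G \<chi>) :: complex" and ?N = "of_nat (card (carrier G)) :: complex"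
  obtain \<rho> where "irreducible_unitary_rep G (character_dim G \<chi>) \<rho>"
    by (rule irr_characterE[OF G_group \<chi>])
  hence "0 < character_dim G \<chi>" by (rule irreducible_unitary_repD(2))
  hence d: "?d \<noteq> 0" by simp
  have "(\<Sum>h\<in>carrier G. character_weight \<chi> h * character_weight \<chi> (inv h \<otimes> g)) =
      (?d / ?N)\<^sup>2 * cnj (\<Sum>h\<in>carrier G. \<chi> h * \<chi> (inv h \<otimes> g))"
    unfolding character_weight_def cnj_sum sum_distrib_left
    by (intro sum.cong refl) (simp add: power2_eq_square)
  also have "(\<Sum>h\<in>carrier G. \<chi> h * \<chi> (inv h \<otimes> g)) = ?N / ?d * \<chi> g"
    by (rule character_convolution[OF G_group G_finite \<chi> g])
  also have "(?d / ?N)\<^sup>2 * cnj (?N / ?d * \<chi> g) = character_weight \<chi> g"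
    using d card_G by (simp add: character_weight_def power2_eq_square field_simps)
  finally show "(\<Sum>h\<in>carrier G. character_weight \<chi> h * character_weight \<chi> (inv h \<otimes> g)) = character_weight \<chi> g" .
qed

lemma component_character: "component (character_weight \<chi>) = isotypic_bergman S G act \<chi>"
proof -
  have "average (character_weight \<chi>) = isotypic_projection S G act \<chi>"
    by (intro ext) (simp add: average_def isotypic_projection_def character_weight_def sum_distrib_left mult.assoc)
  thus ?thesis by (simp add: component_def isotypic_bergman_def)
qed

lemma sum_character_weight:
  assumes g: "g \<in> carrier G"
  shows "(\<Sum>\<chi>\<in>irr_characters G. character_weight \<chi> g) = unit_weight g"
proof -
  have "(\<Sum>\<chi>\<in>irr_characters G. character_weight \<chi> g) =
      cnj (\<Sum>\<chi>\<in>irr_characters G. of_nat (character_dim G \<chi>) * \<chi> g) / of_nat (card (carrier G))"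
    by (simp add: character_weight_def sum_divide_distrib)
  also have "\<dots> = unit_weight g"
    unfolding irreducible_characters_complete(2)[OF G_group G_finite g] using card_G by (simp add: unit_weight_def)
  finally show ?thesis .
qed

lemma weighted_trace_sum:
  "(\<Sum>\<chi>\<in>irr_characters G. weighted_trace (character_weight \<chi>) n) = weighted_trace unit_weight n"
proof -
  have "(\<Sum>\<chi>\<in>irr_characters G. weighted_trace (character_weight \<chi>) n) =
      (\<Sum>g\<in>carrier G. (\<Sum>\<chi>\<in>irr_characters G. character_weight \<chi> (inv g)) *
        (\<Sum>w\<in>twisted_words S act (Suc n) g. orbit_term g w))"
    unfolding weighted_trace_def sum_distrib_right by (rule sum.swap)
  also have "\<dots> = weighted_trace unit_weight n"
    unfolding weighted_trace_def by (intro sum.cong refl) (simp add: sum_character_weight)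
  finally show ?thesis .
qed

lemma reduced_zeta_entire: "\<chi> \<in> irr_characters G \<Longrightarrow> reduced_zeta S G act V \<chi> holomorphic_on UNIV"
  using ifs_average.component_det_entire[OF average_intro[OF character_weight_idem]]
  unfolding reduced_zeta_def[abs_def] component_character .

lemma dynamical_zeta_entire: "dynamical_zeta S V holomorphic_on UNIV"
  using ifs_average.component_det_entire[OF average_intro[OF unit_weight_idem]]
  unfolding dynamical_zeta_def[abs_def] component_unit .

lemma reduced_zeta_exp:
  "\<chi> \<in> irr_characters G \<Longrightarrow> \<forall>\<^sub>F z in nhds 0. \<exists>s.
    (\<lambda>n. z ^ Suc n / of_nat (Suc n) * weighted_trace (character_weight \<chi>) n) sums s \<and>
    reduced_zeta S G act V \<chi> z = exp (- s)"
  using ifs_average.component_det_exp[OF average_intro[OF character_weight_idem]]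
  unfolding reduced_zeta_def component_character .

lemma dynamical_zeta_exp:
  "\<forall>\<^sub>F z in nhds 0. \<exists>s. (\<lambda>n. z ^ Suc n / of_nat (Suc n) * weighted_trace unit_weight n) sums s \<and>
    dynamical_zeta S V z = exp (- s)"
  using ifs_average.component_det_exp[OF average_intro[OF unit_weight_idem]]
  unfolding dynamical_zeta_def component_unit .

lemma zeta_factorization: "dynamical_zeta S V z = (\<Prod>\<chi>\<in>irr_characters G. reduced_zeta S G act V \<chi> z)"
proof -
  let ?X = "irr_characters G"
  have X: "finite ?X" by (rule irreducible_characters_complete(1)[OF G_group G_finite])
  have "\<forall>\<^sub>F z in nhds 0. \<forall>\<chi>\<in>?X. \<exists>s.
      (\<lambda>n. z ^ Suc n / of_nat (Suc n) * weighted_trace (character_weight \<chi>) n) sums s \<and>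
      reduced_zeta S G act V \<chi> z = exp (- s)"
    by (rule eventually_ball_finite[OF X]) (blast intro: reduced_zeta_exp)
  with dynamical_zeta_exp
  have "\<forall>\<^sub>F z in nhds 0. dynamical_zeta S V z = (\<Prod>\<chi>\<in>?X. reduced_zeta S G act V \<chi> z)"
  proof (rule eventually_elim2)
    fix z :: complex
    let ?c = "\<lambda>n. z ^ Suc n / of_nat (Suc n)"
    assume "\<exists>s. (\<lambda>n. ?c n * weighted_trace unit_weight n) sums s \<and> dynamical_zeta S V z = exp (- s)"
    then obtain s where s: "(\<lambda>n. ?c n * weighted_trace unit_weight n) sums s" "dynamical_zeta S V z = exp (- s)" by blast
    assume "\<forall>\<chi>\<in>?X. \<exists>s. (\<lambda>n. ?c n * weighted_trace (character_weight \<chi>) n) sums s \<and> reduced_zeta S G act V \<chi> z = exp (- s)"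
    from bchoice[OF this] obtain t where t: "\<forall>\<chi>\<in>?X. (\<lambda>n. ?c n * weighted_trace (character_weight \<chi>) n) sums t \<chi> \<and>
        reduced_zeta S G act V \<chi> z = exp (- t \<chi>)" ..
    have "(\<lambda>n. \<Sum>\<chi>\<in>?X. ?c n * weighted_trace (character_weight \<chi>) n) sums (\<Sum>\<chi>\<in>?X. t \<chi>)"
      by (rule sums_sum) (use t in blast)
    hence "(\<lambda>n. ?c n * weighted_trace unit_weight n) sums (\<Sum>\<chi>\<in>?X. t \<chi>)"
      unfolding sum_distrib_left[symmetric] weighted_trace_sum .
    \<comment> \<open>The exponents themselves are compared, as sums of one and the same series, so
      no ambiguity of the logarithm arises.\<close>
    hence "s = (\<Sum>\<chi>\<in>?X. t \<chi>)" by (rule sums_unique2[OF s(1)])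
    hence "dynamical_zeta S V z = exp (\<Sum>\<chi>\<in>?X. - t \<chi>)" by (simp only: s(2) sum_negf)
    also have "\<dots> = (\<Prod>\<chi>\<in>?X. exp (- t \<chi>))" by (rule exp_sum[OF X])
    also have "\<dots> = (\<Prod>\<chi>\<in>?X. reduced_zeta S G act V \<chi> z)" by (rule prod.cong[OF refl]) (use t in simp)
    finally show "dynamical_zeta S V z = (\<Prod>\<chi>\<in>?X. reduced_zeta S G act V \<chi> z)" .
  qed
  then obtain U where U: "open U" "0 \<in> U" "\<forall>z\<in>U. dynamical_zeta S V z = (\<Prod>\<chi>\<in>?X. reduced_zeta S G act V \<chi> z)"
    unfolding eventually_nhds by blast
  show ?thesis
  proof (rule analytic_continuation_open[OF U(1) open_UNIV _ connected_UNIV subset_UNIV dynamical_zeta_entire])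
    show "(\<lambda>z. \<Prod>\<chi>\<in>?X. reduced_zeta S G act V \<chi> z) holomorphic_on UNIV"
      by (intro holomorphic_on_prod reduced_zeta_entire)
  qed (use U(2,3) in auto)
qed

lemma orbit_derivative_summable:
  assumes "0 < n" "g \<in> carrier G" "w \<in> twisted_words S act n g"
  shows "summable (\<lambda>k. deriv (word_map S w \<circ> act g) (fixed_point S act w g) ^ k)"
proof -
  obtain m where "n = Suc m" using assms(1) by (cases n) auto
  thus ?thesis using fixed_point(3)[OF assms(2), of w m] assms(3)
    by (intro summable_geometric) (simp add: loop_map_def)
qed

text \<open>The conjugation in P_\<chi> and the inverse in \<open>weighted_trace\<close> cancel,
  which is why the formula contains \<chi>(g) itself.\<close>

lemma weighted_trace_character:
  assumes \<chi>: "\<chi> \<in> irr_characters G"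
  shows "weighted_trace (character_weight \<chi>) n =
    of_nat (character_dim G \<chi>) / of_nat (card (carrier G)) *
      (\<Sum>g\<in>carrier G. \<chi> g * (\<Sum>w\<in>twisted_words S act (Suc n) g. orbit_term g w))"
  unfolding weighted_trace_def character_weight_def sum_distrib_left
  by (intro sum.cong refl) (simp add: character_inv[OF G_group \<chi>] mult.assoc sum_distrib_left)

end

theorem theorem4p1:
  fixes S :: "'i :: finite ifs"
    and G :: "('g, 'm) monoid_scheme"
    and act :: "'g \<Rightarrow> complex \<Rightarrow> complex"
    and V :: "complex \<Rightarrow> complex"
  assumes "holomorphic_ifs S"
    and "eventually_contracting S"
    and "symmetry_group S G act"
    and "V holomorphic_on branch_image S"
    and "bounded (V ` branch_image S)"
    and "invariant_potential S G act V"
  shows "(\<forall>z. dynamical_zeta S V z = (\<Prod>\<chi>\<in>irr_characters G. reduced_zeta S G act V \<chi> z)) \<and>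
    (\<forall>\<chi>\<in>irr_characters G.
       (\<forall>n>0. \<forall>g\<in>carrier G. \<forall>w\<in>twisted_words S act n g.
          summable (\<lambda>k. deriv (word_map S w \<circ> act g) (fixed_point S act w g) ^ k)) \<and>
       (\<exists>\<epsilon>>0. \<forall>z. norm z < \<epsilon> \<longrightarrow>
          (\<exists>s. (\<lambda>m. let n = Suc m in
                  z ^ n / of_nat n *
                  (of_nat (character_dim G \<chi>) / of_nat (card (carrier G))) *
                  (\<Sum>g\<in>carrier G. \<chi> g *
                    (\<Sum>w\<in>twisted_words S act n g.
                       word_weight S V w (act g (fixed_point S act w g)) *
                       (\<Sum>k. deriv (word_map S w \<circ> act g) (fixed_point S act w g) ^ k)))) sums s \<and>
             reduced_zeta S G act V \<chi> z = exp (- s))) \<and>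
       reduced_zeta S G act V \<chi> holomorphic_on UNIV)"
proof -
  interpret ifs_symmetry S G act V by unfold_locales fact+
  show ?thesis
  proof (intro conjI ballI allI impI)
    show "dynamical_zeta S V z = (\<Prod>\<chi>\<in>irr_characters G. reduced_zeta S G act V \<chi> z)" for z
      by (rule zeta_factorization)
    fix \<chi> assume \<chi>: "\<chi> \<in> irr_characters G"
    show "summable (\<lambda>k. deriv (word_map S w \<circ> act g) (fixed_point S act w g) ^ k)"
      if "0 < n" "g \<in> carrier G" "w \<in> twisted_words S act n g" for n g w
      by (rule orbit_derivative_summable[OF that])
    show "reduced_zeta S G act V \<chi> holomorphic_on UNIV" by (rule reduced_zeta_entire[OF \<chi>])
    obtain \<epsilon> where \<epsilon>: "0 < \<epsilon>" "\<forall>z. dist z 0 < \<epsilon> \<longrightarrow> (\<exists>s.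
        (\<lambda>n. z ^ Suc n / of_nat (Suc n) * weighted_trace (character_weight \<chi>) n) sums s \<and>
        reduced_zeta S G act V \<chi> z = exp (- s))"
      using reduced_zeta_exp[OF \<chi>] unfolding eventually_nhds_metric by blast
    show "\<exists>\<epsilon>>0. \<forall>z. norm z < \<epsilon> \<longrightarrow>
          (\<exists>s. (\<lambda>m. let n = Suc m in
                  z ^ n / of_nat n *
                  (of_nat (character_dim G \<chi>) / of_nat (card (carrier G))) *
                  (\<Sum>g\<in>carrier G. \<chi> g *
                    (\<Sum>w\<in>twisted_words S act n g.
                       word_weight S V w (act g (fixed_point S act w g)) *
                       (\<Sum>k. deriv (word_map S w \<circ> act g) (fixed_point S act w g) ^ k)))) sums s \<and>
             reduced_zeta S G act V \<chi> z = exp (- s))"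
      \<comment> \<open>Since the trace indexed by m concerns words of length \<open>Suc m\<close>,
        folding the definitions back matches the series term by term.\<close>
      unfolding Let_def orbit_term_def[symmetric] mult.assoc weighted_trace_character[OF \<chi>, symmetric]
      using \<epsilon> by (intro exI[of _ \<epsilon>]) simp
  qed
qed

end
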